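(* Let $(M,\mathcal F)$ be a compact Riemannian manifold with an isoparametric foliation. Assume that the radial spectrum $\mathrm{Spec}(M,\mathcal F)$ is a proper subset of $\mathrm{Spec}_1(M)$. Then every isoparametric tube $\Omega_t$, $t\in(0,D(\mathcal F))$, of $\mathcal F$ fails the Pompeiu property.
   Context: $M$ is a compact connected Riemannian manifold without boundary, and $\Delta=-\mathrm{div}\,\nabla$ is its positive Laplacian. An isoparametric function on $M$ is a smooth function $F:M\to[a,b]$ with $F(M)=[a,b]$, $a<b$, such that $|\nabla F|^2=A\circ F$ and $\Delta F=B\circ F$ for some smooth functions $A,B:[a,b]\to\mathbb R$. The sets $M^+:=F^{-1}(a)$ and $M^-:=F^{-1}(b)$ are smooth closed submanifolds, called the focal sets; $F$ is called proper if both focal sets have codimension at least $2$ in $M$. All isoparametric functions are assumed proper. The isoparametric foliation $\mathcal F$ is the decomposition $M=\bigcup_{t\in[a,b]}F^{-1}(t)$ into level sets of $F$. Let $\rho(x)=\mathrm{dist}(x,M^+)$ and $D(\mathcal F)=\mathrm{dist}(M^+,M^-)$, so that $\rho:M\to[0,D(\mathcal F)]$; the leaves of $\mathcal F$ are also the level sets of $\rho$. For $t\in(0,D(\mathcal F))$ the isoparametric tube is $\Omega_t=\{x\in M:\rho(x)<t\}$. A function $f$ on $M$ is radial if $f=\psi\circ\rho$ for some $\psi:[0,D(\mathcal F)]\to\mathbb R$. $\mathrm{Spec}_1(M)$ is the set of distinct eigenvalues of $\Delta$ on $M$. An eigenvalue $\lambda\in\mathrm{Spec}_1(M)$ is radial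 if there is a (nonzero) radial eigenfunction associated to $\lambda$; $\mathrm{Spec}(M,\mathcal F)\subseteq\mathrm{Spec}_1(M)$ is the set of radial eigenvalues. A bounded domain $\Omega\subseteq M$ has the Pompeiu property if the only continuous function $f:M\to\mathbb R$ with $\int_{h(\Omega)}f=0$ for all isometries $h$ of $M$ (integration with respect to the Riemannian measure) is $f=0$; otherwise $\Omega$ fails the Pompeiu property. *)

theory Defs
  imports "HOL-Analysis.Analysis"
begin

section \<open>Smooth functions\<close>

primrec iter_partial ::
  "'n list \<Rightarrow> (real^'n::finite \<Rightarrow> 'b::real_normed_vector) \<Rightarrow> real^'n \<Rightarrow> 'b" where
  "iter_partial [] f = f"
| "iter_partial (i # js) f =
     (\<lambda>y. frechet_derivative (iter_partial js f) (at y) (axis i 1))"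

text \<open>On an open set this is the class \<open>C\<^sup>\<infinity>\<close>: since every iterated
  partial derivative is differentiable, every one of them is also continuous.\<close>

definition smooth_on ::
  "(real^'n::finite) set \<Rightarrow> (real^'n \<Rightarrow> 'b::real_normed_vector) \<Rightarrow> bool" where
  "smooth_on U f \<longleftrightarrow> (\<forall>js. \<forall>y\<in>U. iter_partial js f differentiable (at y))"

text \<open>Smoothness on a compact interval, with one-sided derivatives at the end points;
  \<open>D k\<close> is the \<open>k\<close>-th derivative.\<close>

definition smooth_on_interval :: "real \<Rightarrow> real \<Rightarrow> (real \<Rightarrow> real) \<Rightarrow> bool" where
  "smooth_on_interval a b f \<longleftrightarrow>
     (\<exists>D. D 0 = f \<and>
        (\<forall>k::nat. \<forall>s\<in>{a..b}. (D k has_real_derivative D (Suc k) s) (at s within {a..b})))"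


section \<open>Riemannian manifolds\<close>

text \<open>The points of the manifold are all the elements of the type \<open>'a\<close>, whose type class
  supplies the topology; the dimension is \<open>CARD('n)\<close>. A chart is a domain together with a
  coordinate map.\<close>

type_synonym ('a, 'n) chart = "'a set \<times> ('a \<Rightarrow> real^'n)"

definition chart_inv :: "('a, 'n::finite) chart \<Rightarrow> real^'n \<Rightarrow> 'a" where
  "chart_inv c = inv_into (fst c) (snd c)"

definition is_chart :: "('a::topological_space, 'n::finite) chart \<Rightarrow> bool" where
  "is_chart c \<longleftrightarrow>
     open (fst c) \<and> open (snd c ` fst c) \<and>
     homeomorphism (fst c) (snd c ` fst c) (snd c) (chart_inv c)"

definition smooth_transition :: "('a, 'n::finite) chart \<Rightarrow> ('a, 'n) chart \<Rightarrow> bool" where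
  "smooth_transition c d \<longleftrightarrow> smooth_on (snd c ` (fst c \<inter> fst d)) (snd d \<circ> chart_inv c)"

definition smooth_atlas :: "('a::topological_space, 'n::finite) chart set \<Rightarrow> bool" where
  "smooth_atlas C \<longleftrightarrow>
     (\<forall>c\<in>C. is_chart c) \<and> (\<Union>c\<in>C. fst c) = UNIV \<and> (\<forall>c\<in>C. \<forall>d\<in>C. smooth_transition c d)"

definition jacobian ::
  "('a, 'n::finite) chart \<Rightarrow> ('b, 'm::finite) chart \<Rightarrow> ('a \<Rightarrow> 'b) \<Rightarrow> 'a \<Rightarrow> real^'n^'m" where
  "jacobian c d h p = matrix (frechet_derivative (snd d \<circ> h \<circ> chart_inv c) (at (snd c p)))"

text \<open>A Riemannian metric is given by its Gram matrices: \<open>gram M c p\<close> is the matrix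
  \<open>g\<^sub>i\<^sub>j(p)\<close> with respect to the coordinate frame of the chart \<open>c\<close>.\<close>

record ('a, 'n) riemannian =
  atlas :: "('a, 'n) chart set"
  gram :: "('a, 'n) chart \<Rightarrow> 'a \<Rightarrow> real^'n^'n"

definition riemannian_manifold ::
  "('a::{t2_space, second_countable_topology}, 'n::finite) riemannian \<Rightarrow> bool" where
  "riemannian_manifold M \<longleftrightarrow>
     smooth_atlas (atlas M) \<and>
     (\<forall>c\<in>atlas M.
        smooth_on (snd c ` fst c) (gram M c \<circ> chart_inv c) \<and>
        (\<forall>p\<in>fst c. transpose (gram M c p) = gram M c p \<and>
                    (\<forall>v. v \<noteq> 0 \<longrightarrow> 0 < v \<bullet> (gram M c p *v v)))) \<and>
     (\<forall>c\<in>atlas M. \<forall>d\<in>atlas M. \<forall>p\<in>fst c \<inter> fst d.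
        gram M c p = transpose (jacobian c d id p) ** gram M d p ** jacobian c d id p)"

definition smooth_fun :: "('a, 'n::finite) riemannian \<Rightarrow> ('a \<Rightarrow> real) \<Rightarrow> bool" where
  "smooth_fun M f \<longleftrightarrow> (\<forall>c\<in>atlas M. smooth_on (snd c ` fst c) (f \<circ> chart_inv c))"

definition smooth_map ::
  "('a::topological_space, 'n::finite) riemannian \<Rightarrow> ('a \<Rightarrow> 'a) \<Rightarrow> bool" where
  "smooth_map M h \<longleftrightarrow>
     continuous_on UNIV h \<and>
     (\<forall>c\<in>atlas M. \<forall>d\<in>atlas M.
        smooth_on (snd c ` (fst c \<inter> h -` fst d)) (snd d \<circ> h \<circ> chart_inv c))"

definition riemannian_isometry ::
  "('a::topological_space, 'n::finite) riemannian \<Rightarrow> ('a \<Rightarrow> 'a) \<Rightarrow> bool" where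
  "riemannian_isometry M h \<longleftrightarrow>
     bij h \<and> smooth_map M h \<and> smooth_map M (inv h) \<and>
     (\<forall>c\<in>atlas M. \<forall>d\<in>atlas M. \<forall>p\<in>fst c \<inter> h -` fst d.
        gram M c p = transpose (jacobian c d h p) ** gram M d (h p) ** jacobian c d h p)"


subsection \<open>Gradient, divergence, Laplacian\<close>

text \<open>In a chart, \<open>(grad f)\<^sup>i = \<Sum>\<^sub>j g\<^sup>i\<^sup>j \<partial>\<^sub>j f\<close> and
  \<open>div X = (det g)\<^sup>-\<^sup>1\<^sup>/\<^sup>2 \<Sum>\<^sub>i \<partial>\<^sub>i ((det g)\<^sup>1\<^sup>/\<^sup>2 X\<^sup>i)\<close>. The resulting scalars do not depend on
  the chart, so they are evaluated at \<open>p\<close> in an arbitrary chart of the atlas around \<open>p\<close>.\<close>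

definition chart_at :: "('a, 'n::finite) riemannian \<Rightarrow> 'a \<Rightarrow> ('a, 'n) chart" where
  "chart_at M p = (SOME c. c \<in> atlas M \<and> p \<in> fst c)"

definition chart_partial ::
  "('a, 'n::finite) chart \<Rightarrow> 'n \<Rightarrow> ('a \<Rightarrow> real) \<Rightarrow> 'a \<Rightarrow> real" where
  "chart_partial c i f p = frechet_derivative (f \<circ> chart_inv c) (at (snd c p)) (axis i 1)"

definition chart_gradient ::
  "('a, 'n::finite) riemannian \<Rightarrow> ('a, 'n) chart \<Rightarrow> ('a \<Rightarrow> real) \<Rightarrow> 'a \<Rightarrow> real^'n" where
  "chart_gradient M c f p = matrix_inv (gram M c p) *v (\<chi> i. chart_partial c i f p)"

definition chart_divergence ::
  "('a, 'n::finite) riemannian \<Rightarrow> ('a, 'n) chart \<Rightarrow> ('a \<Rightarrow> real^'n) \<Rightarrow> 'a \<Rightarrow> real" where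
  "chart_divergence M c X p =
     (\<Sum>i\<in>UNIV. chart_partial c i (\<lambda>q. sqrt (det (gram M c q)) * X q $ i) p)
       / sqrt (det (gram M c p))"

definition grad_norm_sq ::
  "('a, 'n::finite) riemannian \<Rightarrow> ('a \<Rightarrow> real) \<Rightarrow> 'a \<Rightarrow> real" where
  "grad_norm_sq M f p =
     (let c = chart_at M p; v = chart_gradient M c f p in v \<bullet> (gram M c p *v v))"

definition laplacian ::
  "('a, 'n::finite) riemannian \<Rightarrow> ('a \<Rightarrow> real) \<Rightarrow> 'a \<Rightarrow> real" where
  "laplacian M f p =
     (let c = chart_at M p in - chart_divergence M c (chart_gradient M c f) p)"


subsection \<open>Riemannian measure and distance\<close>

definition riemannian_measure ::
  "('a::topological_space, 'n::finite) riemannian \<Rightarrow> 'a measure" where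
  "riemannian_measure M =
     (THE \<mu>. sets \<mu> = sets borel \<and>
        (\<forall>c\<in>atlas M. \<forall>E\<in>sets borel. E \<subseteq> fst c \<longrightarrow>
           emeasure \<mu> E =
             (\<integral>\<^sup>+y\<in>snd c ` E. ennreal (sqrt (det (gram M c (chart_inv c y)))) \<partial>lborel)))"

text \<open>By compactness of \<open>{0..1}\<close>, a curve as below is \<open>C\<^sup>1\<close> off a finite set of
  parameters. The library notion of piecewise \<open>C\<^sup>1\<close> allows the velocity to be unbounded near an
  exceptional parameter; the length is therefore an extended nonnegative integral, which is the
  true (possibly infinite) length of the curve.\<close>

definition piecewise_C1_curve ::
  "('a::topological_space, 'n::finite) riemannian \<Rightarrow> (real \<Rightarrow> 'a) \<Rightarrow> bool" where
  "piecewise_C1_curve M \<gamma> \<longleftrightarrow>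
     path \<gamma> \<and>
     (\<forall>c\<in>atlas M. \<forall>u v. 0 \<le> u \<and> u < v \<and> v \<le> 1 \<and> \<gamma> ` {u..v} \<subseteq> fst c \<longrightarrow>
        (snd c \<circ> \<gamma>) piecewise_C1_differentiable_on {u..v})"

definition speed :: "('a, 'n::finite) riemannian \<Rightarrow> (real \<Rightarrow> 'a) \<Rightarrow> real \<Rightarrow> real" where
  "speed M \<gamma> s =
     (let c = chart_at M (\<gamma> s); v = vector_derivative (snd c \<circ> \<gamma>) (at s)
      in sqrt (v \<bullet> (gram M c (\<gamma> s) *v v)))"

definition curve_length :: "('a, 'n::finite) riemannian \<Rightarrow> (real \<Rightarrow> 'a) \<Rightarrow> ennreal" where
  "curve_length M \<gamma> = (\<integral>\<^sup>+s\<in>{0..1}. ennreal (speed M \<gamma> s) \<partial>lborel)"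

definition riemannian_edist ::
  "('a::topological_space, 'n::finite) riemannian \<Rightarrow> 'a \<Rightarrow> 'a \<Rightarrow> ennreal" where
  "riemannian_edist M p q =
     (INF \<gamma>\<in>{\<gamma>. piecewise_C1_curve M \<gamma> \<and> pathstart \<gamma> = p \<and> pathfinish \<gamma> = q}.
        curve_length M \<gamma>)"

text \<open>The conversion to \<open>real\<close> is harmless for nonempty sets in a connected manifold, where the
  infimum is finite.\<close>

definition riemannian_setdist ::
  "('a::topological_space, 'n::finite) riemannian \<Rightarrow> 'a set \<Rightarrow> 'a set \<Rightarrow> real" where
  "riemannian_setdist M S T = enn2real (INF p\<in>S. INF q\<in>T. riemannian_edist M p q)"


subsection \<open>Submanifolds of codimension at least \<open>k\<close>\<close>

text \<open>Around each of its points, \<open>S\<close> is cut out, in some chart of the maximal atlas, by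
  the vanishing of a set \<open>K\<close> of coordinates; \<open>card K\<close> is the codimension there. Different connected
  components of \<open>S\<close> may have different dimensions.\<close>

definition submanifold_codim_ge ::
  "('a::topological_space, 'n::finite) riemannian \<Rightarrow> nat \<Rightarrow> 'a set \<Rightarrow> bool" where
  "submanifold_codim_ge M k S \<longleftrightarrow>
     closed S \<and>
     (\<forall>p\<in>S. \<exists>c (K::'n set).
        is_chart c \<and> (\<forall>d\<in>atlas M. smooth_transition c d \<and> smooth_transition d c) \<and>
        p \<in> fst c \<and> k \<le> card K \<and>
        snd c ` (fst c \<inter> S) = {y \<in> snd c ` fst c. \<forall>i\<in>K. y $ i = 0})"


section \<open>Isoparametric functions and tubes\<close>

definition isoparametric ::
  "('a, 'n::finite) riemannian \<Rightarrow> real \<Rightarrow> real \<Rightarrow> ('a \<Rightarrow> real) \<Rightarrow> bool" where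
  "isoparametric M a b F \<longleftrightarrow>
     a < b \<and> smooth_fun M F \<and> range F = {a..b} \<and>
     (\<exists>A B. smooth_on_interval a b A \<and> smooth_on_interval a b B \<and>
        (\<forall>p. grad_norm_sq M F p = A (F p)) \<and> (\<forall>p. laplacian M F p = B (F p)))"

definition focal_plus :: "real \<Rightarrow> ('a \<Rightarrow> real) \<Rightarrow> 'a set" where
  "focal_plus a F = F -` {a}"

definition focal_minus :: "real \<Rightarrow> ('a \<Rightarrow> real) \<Rightarrow> 'a set" where
  "focal_minus b F = F -` {b}"

definition proper_isoparametric ::
  "('a::topological_space, 'n::finite) riemannian \<Rightarrow> real \<Rightarrow> real \<Rightarrow> ('a \<Rightarrow> real) \<Rightarrow> bool" where
  "proper_isoparametric M a b F \<longleftrightarrow>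
     isoparametric M a b F \<and>
     submanifold_codim_ge M 2 (focal_plus a F) \<and> submanifold_codim_ge M 2 (focal_minus b F)"

definition focal_rho ::
  "('a::topological_space, 'n::finite) riemannian \<Rightarrow> real \<Rightarrow> ('a \<Rightarrow> real) \<Rightarrow> 'a \<Rightarrow> real" where
  "focal_rho M a F x = riemannian_setdist M {x} (focal_plus a F)"

definition focal_distance ::
  "('a::topological_space, 'n::finite) riemannian \<Rightarrow> real \<Rightarrow> real \<Rightarrow> ('a \<Rightarrow> real) \<Rightarrow> real" where
  "focal_distance M a b F = riemannian_setdist M (focal_plus a F) (focal_minus b F)"

definition isoparametric_tube ::
  "('a::topological_space, 'n::finite) riemannian \<Rightarrow> real \<Rightarrow> ('a \<Rightarrow> real) \<Rightarrow> real \<Rightarrow> 'a set" where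
  "isoparametric_tube M a F t = {x. focal_rho M a F x < t}"


section \<open>Spectra\<close>

definition eigenfunction ::
  "('a, 'n::finite) riemannian \<Rightarrow> real \<Rightarrow> ('a \<Rightarrow> real) \<Rightarrow> bool" where
  "eigenfunction M \<kappa> f \<longleftrightarrow>
     smooth_fun M f \<and> (\<exists>p. f p \<noteq> 0) \<and> (\<forall>p. laplacian M f p = \<kappa> * f p)"

definition spectrum :: "('a, 'n::finite) riemannian \<Rightarrow> real set" where
  "spectrum M = {\<kappa>. \<exists>f. eigenfunction M \<kappa> f}"

text \<open>Only the values of the profile \<open>\<psi>\<close> on the range of the distance function matter.\<close>

definition radial_fun ::
  "('a::topological_space, 'n::finite) riemannian \<Rightarrow> real \<Rightarrow> ('a \<Rightarrow> real) \<Rightarrow> ('a \<Rightarrow> real) \<Rightarrow> bool" where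
  "radial_fun M a F f \<longleftrightarrow> (\<exists>\<psi>. f = \<psi> \<circ> focal_rho M a F)"

definition radial_spectrum ::
  "('a::topological_space, 'n::finite) riemannian \<Rightarrow> real \<Rightarrow> ('a \<Rightarrow> real) \<Rightarrow> real set" where
  "radial_spectrum M a F = {\<kappa>\<in>spectrum M. \<exists>f. eigenfunction M \<kappa> f \<and> radial_fun M a F f}"


section \<open>The Pompeiu property\<close>

definition pompeiu ::
  "('a::topological_space, 'n::finite) riemannian \<Rightarrow> 'a set \<Rightarrow> bool" where
  "pompeiu M \<Omega> \<longleftrightarrow>
     (\<forall>f::'a \<Rightarrow> real.
        continuous_on UNIV f \<and>
        (\<forall>h. riemannian_isometry M h \<longrightarrow> (LINT x:h ` \<Omega>|riemannian_measure M. f x) = 0)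
        \<longrightarrow> (\<forall>x. f x = 0))"

end

theory Submission
  imports Defs
begin

text \<open>Let \<open>f\<close> be an eigenfunction whose eigenvalue \<open>\<kappa>\<close> is not radial. Then \<open>f\<close> itself violates the
  Pompeiu property of every tube. Fix an isometry \<open>h\<close> and let \<open>G = F \<circ> h\<^sup>-\<^sup>1\<close>, so that
  \<open>|\<nabla>G|\<^sup>2 = A \<circ> G\<close> and \<open>\<Delta>G = B \<circ> G\<close> as for \<open>F\<close>. For \<open>\<psi>\<close> smooth on \<open>[a, b]\<close> one has
  \<open>\<Delta>(\<psi> \<circ> G) = (B \<psi>' - A \<psi>'') \<circ> G\<close>, and the symmetry of \<open>\<Delta>\<close> gives
  \<open>\<integral> (A \<psi>'' - B \<psi>' + \<kappa> \<psi>)(G) f = 0\<close>. So the image of the signed measure \<open>f d vol\<close> under \<open>G\<close>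
  annihilates the range of the ordinary differential operator \<open>L \<psi> = A \<psi>'' - B \<psi>' + \<kappa> \<psi>\<close>
  (\<open>integral_solvable_zero\<close>).

  The operator degenerates only at the end points, where \<open>A\<close> has simple zeros and \<open>B a < 0 < B b\<close>.
  These are regular singular points, and near each of them \<open>L \<psi> = \<eta>\<close> has a smooth solution with any
  prescribed value at the end point. Matching the solutions from both ends at the midpoint is a linear
  \<open>2 \<times> 2\<close> system, whence the alternative of \<open>singular_boundary_problem\<close>: either \<open>L u = 0\<close> has a
  nonzero smooth solution, or \<open>L \<psi> = \<eta>\<close> is solvable for every smooth \<open>\<eta>\<close>. In the first case
  \<open>u \<circ> F\<close> is a radial eigenfunction for \<open>\<kappa>\<close> (\<open>radial_eigenvalue\<close>), which is excluded. In the second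
  case \<open>\<integral> \<eta>(G) f = 0\<close> for all smooth \<open>\<eta>\<close>, hence for all continuous \<open>\<eta>\<close> by Weierstrass'
  approximation theorem, and finally for the indicator functions of initial segments of \<open>[a, b]\<close>.

  These indicator functions describe the tubes, because the distance from the focal set is
  \<open>\<rho> = R \<circ> F\<close> with the strictly increasing function \<open>R(s) = \<integral>\<^sub>a\<^sup>s A\<^sup>-\<^sup>1\<^sup>/\<^sup>2\<close>
  (\<open>focal_rho_eq\<close>). The function \<open>R \<circ> F\<close> has a gradient of norm one, so it is a lower bound for the
  distance; that the bound is attained follows by minimising \<open>R \<circ> F + c dist(x, -)\<close> with \<open>c < 1\<close>,
  without geodesics. The same lower bound for lengths shows that \<open>A\<close> has no double zero: otherwise
  \<open>\<integral> A\<^sup>-\<^sup>1\<^sup>/\<^sup>2\<close> would diverge logarithmically, although points of a connected manifold have finite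
  distance. The signs of \<open>B\<close> at the end points come from Green's formula with a test function
  supported near one of the focal sets.

  The geometric foundations are elementary. The Riemannian measure exists and is invariant under
  isometries by the change of variables formula; Green's formula follows from the translation
  invariance of Lebesgue measure in coordinates and a partition of unity by \<open>C\<^sup>1\<close> bump functions.\<close>

section \<open>Differentiability classes on a compact interval\<close>

text \<open>The derivative is quantified over because at the end points it is only one-sided, which \<open>deriv\<close>
  does not see.\<close>

primrec Ck :: "nat \<Rightarrow> real \<Rightarrow> real \<Rightarrow> (real \<Rightarrow> real) \<Rightarrow> bool" where
  "Ck 0 a b f \<longleftrightarrow> continuous_on {a..b} f"
| "Ck (Suc n) a b f \<longleftrightarrow>
     (\<exists>f'. (\<forall>x\<in>{a..b}. (f has_real_derivative f' x) (at x within {a..b})) \<and> Ck n a b f')"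

lemma Ck_SucI:
  assumes "\<And>x. x \<in> {a..b} \<Longrightarrow> (f has_real_derivative f' x) (at x within {a..b})" "Ck n a b f'"
  shows "Ck (Suc n) a b f"
  using assms unfolding Ck.simps by blast

lemma Ck_SucE:
  assumes "Ck (Suc n) a b f"
  obtains f' where "\<And>x. x \<in> {a..b} \<Longrightarrow> (f has_real_derivative f' x) (at x within {a..b})" "Ck n a b f'"
  using assms unfolding Ck.simps by blast

lemma deriv_within_cong:
  assumes "\<And>x. x \<in> S \<Longrightarrow> f x = g x" "x \<in> S" "(f has_real_derivative D) (at x within S)"
  shows "(g has_real_derivative D) (at x within S)"
  using assms has_field_derivative_transform_within[of f D x S 1 g] by force

lemma deriv_within_unique:
  assumes "a < b" "x \<in> {a..b}" "(f has_real_derivative D) (at x within {a..b})"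
    "(f has_real_derivative D') (at x within {a..b})"
  shows "D = D'"
  using vector_derivative_unique_within_closed_interval[of a b x f D D'] assms
  by (simp add: has_real_derivative_iff_has_vector_derivative)

lemma Ck_cong:
  assumes "\<And>x. x \<in> {a..b} \<Longrightarrow> f x = g x" "Ck n a b f"
  shows "Ck n a b g"
proof (cases n)
  case 0
  then show ?thesis using assms continuous_on_cong[of "{a..b}" "{a..b}" f g] by simp
next
  case (Suc m)
  obtain f' where f': "\<And>x. x \<in> {a..b} \<Longrightarrow> (f has_real_derivative f' x) (at x within {a..b})" "Ck m a b f'"
    using assms(2) unfolding Suc Ck.simps by blast
  show ?thesis
    unfolding Suc by (rule Ck_SucI[OF deriv_within_cong[OF assms(1) _ f'(1)] f'(2)])
qed

lemma Ck_imp_continuous_on: "Ck n a b f \<Longrightarrow> continuous_on {a..b} f"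
  by (cases n) (auto elim!: Ck_SucE simp del: Ck.simps(2) intro: DERIV_continuous_on)

lemma Ck_SucD: "Ck (Suc n) a b f \<Longrightarrow> Ck n a b f"
proof (induction n arbitrary: f)
  case 0
  then show ?case using Ck_imp_continuous_on unfolding Ck.simps(1) by blast
next
  case (Suc n)
  obtain f' where f': "\<And>x. x \<in> {a..b} \<Longrightarrow> (f has_real_derivative f' x) (at x within {a..b})" "Ck (Suc n) a b f'"
    using Suc.prems unfolding Ck.simps(2)[of "Suc n"] by blast
  show ?case by (rule Ck_SucI[OF f'(1) Suc.IH[OF f'(2)]])
qed

lemma Ck_derivD:
  assumes "Ck (Suc n) a b f" "a < b"
    "\<And>x. x \<in> {a..b} \<Longrightarrow> (f has_real_derivative f' x) (at x within {a..b})"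
  shows "Ck n a b f'"
proof -
  obtain g where g: "\<And>x. x \<in> {a..b} \<Longrightarrow> (f has_real_derivative g x) (at x within {a..b})" "Ck n a b g"
    using assms(1) by (metis Ck_SucE)
  show ?thesis
    by (rule Ck_cong[OF _ g(2)]) (use g(1) assms(2,3) deriv_within_unique in blast)
qed

lemma Ck_const [simp, intro]: "Ck n a b (\<lambda>x. k)"
proof (induction n arbitrary: k)
  case (Suc n)
  show ?case by (rule Ck_SucI[where f' = "\<lambda>x. 0"]) (auto intro: Suc)
qed auto

lemma Ck_ident [simp, intro]: "Ck n a b (\<lambda>x. x)"
proof (cases n)
  case (Suc n)
  show ?thesis unfolding Suc by (rule Ck_SucI[where f' = "\<lambda>x. 1"]) auto
qed (auto intro!: continuous_intros)

lemma Ck_add: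
  assumes "Ck n a b f" "Ck n a b g" shows "Ck n a b (\<lambda>x. f x + g x)"
  using assms
proof (induction n arbitrary: f g)
  case (Suc n)
  obtain f' where f': "\<And>x. x \<in> {a..b} \<Longrightarrow> (f has_real_derivative f' x) (at x within {a..b})" "Ck n a b f'"
    using Suc.prems(1) by (metis Ck_SucE)
  obtain g' where g': "\<And>x. x \<in> {a..b} \<Longrightarrow> (g has_real_derivative g' x) (at x within {a..b})" "Ck n a b g'"
    using Suc.prems(2) by (metis Ck_SucE)
  show ?case
    by (rule Ck_SucI[OF _ Suc.IH[OF f'(2) g'(2)]]) (rule DERIV_add[OF f'(1) g'(1)])
qed (auto intro!: continuous_intros)

lemma Ck_mult:
  assumes "Ck n a b f" "Ck n a b g" shows "Ck n a b (\<lambda>x. f x * g x)"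
  using assms
proof (induction n arbitrary: f g)
  case (Suc n)
  obtain f' where f': "\<And>x. x \<in> {a..b} \<Longrightarrow> (f has_real_derivative f' x) (at x within {a..b})" "Ck n a b f'"
    using Suc.prems(1) by (metis Ck_SucE)
  obtain g' where g': "\<And>x. x \<in> {a..b} \<Longrightarrow> (g has_real_derivative g' x) (at x within {a..b})" "Ck n a b g'"
    using Suc.prems(2) by (metis Ck_SucE)
  have "Ck n a b (\<lambda>x. f' x * g x + f x * g' x)"
    by (intro Ck_add Suc.IH f' g' Suc.prems[THEN Ck_SucD])
  then show ?case
    by (rule Ck_SucI[rotated]) (auto intro!: derivative_eq_intros f' g')
qed (auto intro!: continuous_intros)

lemma Ck_minus: "Ck n a b f \<Longrightarrow> Ck n a b (\<lambda>x. - f x)"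
  using Ck_mult[OF Ck_const[of n a b "-1"], of f] by simp

lemma Ck_diff: "Ck n a b f \<Longrightarrow> Ck n a b g \<Longrightarrow> Ck n a b (\<lambda>x. f x - g x)"
  using Ck_add[of n a b f "\<lambda>x. - g x"] Ck_minus[of n a b g] by simp

lemma Ck_inverse:
  assumes "Ck n a b f" "\<And>x. x \<in> {a..b} \<Longrightarrow> f x \<noteq> 0" shows "Ck n a b (\<lambda>x. inverse (f x))"
  using assms
proof (induction n arbitrary: f)
  case (Suc n)
  obtain f' where f': "\<And>x. x \<in> {a..b} \<Longrightarrow> (f has_real_derivative f' x) (at x within {a..b})" "Ck n a b f'"
    using Suc.prems by (metis Ck_SucE)
  have "Ck n a b (\<lambda>x. inverse (f x))" by (rule Suc.IH[OF Ck_SucD[OF Suc.prems(1)] Suc.prems(2)])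
  then have "Ck n a b (\<lambda>x. - (inverse (f x) * f' x * inverse (f x)))"
    by (intro Ck_mult Ck_minus f')
  then show ?case
    by (rule Ck_SucI[rotated]) (auto intro!: derivative_eq_intros f' Suc.prems)
qed (auto intro!: continuous_intros)

lemma Ck_divide:
  assumes "Ck n a b f" "Ck n a b g" "\<And>x. x \<in> {a..b} \<Longrightarrow> g x \<noteq> 0"
  shows "Ck n a b (\<lambda>x. f x / g x)"
  using Ck_mult[OF assms(1) Ck_inverse[OF assms(2,3)]] by (simp add: divide_inverse)

lemma Ck_exp:
  assumes "Ck n a b f" shows "Ck n a b (\<lambda>x. exp (f x))"
  using assms
proof (induction n arbitrary: f)
  case (Suc n)
  obtain f' where f': "\<And>x. x \<in> {a..b} \<Longrightarrow> (f has_real_derivative f' x) (at x within {a..b})" "Ck n a b f'"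
    using Suc.prems by (metis Ck_SucE)
  have "Ck n a b (\<lambda>x. exp (f x) * f' x)"
    by (intro Ck_mult f' Suc.IH[OF Ck_SucD[OF Suc.prems]])
  then show ?case
    by (rule Ck_SucI[rotated]) (auto intro!: derivative_eq_intros f' Suc.prems)
qed (auto intro!: continuous_intros)

lemma Ck_integral:
  assumes "Ck n a b f" shows "Ck (Suc n) a b (\<lambda>x. integral {a..x} f)"
  by (rule Ck_SucI[OF _ assms]) (intro integral_has_real_derivative Ck_imp_continuous_on[OF assms])

lemma Ck_subset:
  assumes "Ck n a b f" "{c..d} \<subseteq> {a..b}" shows "Ck n c d f"
  using assms
proof (induction n arbitrary: f)
  case (Suc n)
  obtain f' where f': "\<And>x. x \<in> {a..b} \<Longrightarrow> (f has_real_derivative f' x) (at x within {a..b})" "Ck n a b f'"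
    using Suc.prems by (metis Ck_SucE)
  then show ?case using Suc
    by (intro Ck_SucI[where f' = f']) (blast intro: has_field_derivative_subset)+
qed (auto intro: continuous_on_subset)

lemma Ck_affine:
  assumes "Ck n a b f" "\<And>x. x \<in> {c..d} \<Longrightarrow> k * x + l \<in> {a..b}"
  shows "Ck n c d (\<lambda>x. f (k * x + l))"
  using assms
proof (induction n arbitrary: f)
  case 0
  then show ?case
    by (auto intro!: continuous_intros continuous_on_compose2[of "{a..b}" f])
next
  case (Suc n)
  obtain f' where f': "\<And>x. x \<in> {a..b} \<Longrightarrow> (f has_real_derivative f' x) (at x within {a..b})" "Ck n a b f'"
    using Suc.prems by (metis Ck_SucE)
  have "((\<lambda>x. f (k * x + l)) has_real_derivative f' (k * x + l) * k) (at x within {c..d})"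
    if "x \<in> {c..d}" for x
  proof -
    have "((\<lambda>x. k * x + l) has_real_derivative k) (at x within {c..d})"
      by (auto intro!: derivative_eq_intros)
    moreover have "(f has_real_derivative f' (k * x + l)) (at (k * x + l) within (\<lambda>x. k * x + l) ` {c..d})"
      by (rule has_field_derivative_subset[OF f'(1)]) (use that Suc.prems(2) in auto)
    ultimately show ?thesis by (rule DERIV_image_chain[of f _ "\<lambda>x. k * x + l", unfolded o_def, rotated])
  qed
  then show ?case
    by (rule Ck_SucI[OF _ Ck_mult[OF Suc.IH[OF f'(2) Suc.prems(2)] Ck_const]])
qed

text \<open>Weighted averages of the dilates of \<open>g\<close>. With \<open>w = 1\<close> and \<open>k \<sigma> = \<sigma>\<close> this is
  Hadamard's quotient; with \<open>k \<sigma> = \<sigma>\<^sup>1\<^sup>/\<^sup>\<beta>\<close> it inverts the singular operator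
  \<open>v \<mapsto> x v' + \<beta> v\<close>. Differentiation only changes the weight, so smoothness at the singular
  point \<open>0\<close> is preserved.\<close>

lemma Ck_dilation_average:
  fixes w k :: "real \<Rightarrow> real"
  assumes "Ck n 0 c g" "0 < c" "continuous_on {0..1} w" "continuous_on {0..1} k" "k ` {0..1} \<subseteq> {0..1}"
  shows "Ck n 0 c (\<lambda>x. integral {0..1} (\<lambda>\<sigma>. w \<sigma> * g (x * k \<sigma>)))"
    and "\<And>x g'. \<lbrakk>\<And>x. x \<in> {0..c} \<Longrightarrow> (g has_real_derivative g' x) (at x within {0..c});
                  continuous_on {0..c} g'; x \<in> {0..c}\<rbrakk> \<Longrightarrow>
       ((\<lambda>x. integral {0..1} (\<lambda>\<sigma>. w \<sigma> * g (x * k \<sigma>))) has_real_derivative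
         integral {0..1} (\<lambda>\<sigma>. (w \<sigma> * k \<sigma>) * g' (x * k \<sigma>))) (at x within {0..c})"
proof -
  have mem: "x * k \<sigma> \<in> {0..c}" if "x \<in> {0..c}" "\<sigma> \<in> {0..1}" for x \<sigma>
  proof -
    have "k \<sigma> \<in> {0..1}" using that assms(5) by blast
    then show ?thesis using that mult_mono[of x c "k \<sigma>" 1] by auto
  qed
  have cont: "continuous_on ({0..c} \<times> {0..1}) (\<lambda>z. w (snd z) * g (fst z * k (snd z)))"
    if "continuous_on {0..1} w" "continuous_on {0..c} g" for w g :: "real \<Rightarrow> real"
  proof (rule continuous_on_mult)
    show "continuous_on ({0..c} \<times> {0..1}) (\<lambda>z. w (snd z))"
      by (rule continuous_on_compose2[OF that(1)]) (auto intro!: continuous_intros)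
    have "continuous_on ({0..c} \<times> {0..1}) (\<lambda>z::real \<times> real. k (snd z))"
      by (rule continuous_on_compose2[OF assms(4)]) (auto intro!: continuous_intros)
    then have "continuous_on ({0..c} \<times> {0..1}) (\<lambda>z. fst z * k (snd z))"
      by (intro continuous_on_mult continuous_on_fst continuous_on_id)
    then show "continuous_on ({0..c} \<times> {0..1}) (\<lambda>z. g (fst z * k (snd z)))"
      by (rule continuous_on_compose2[OF that(2)]) (use mem in auto)
  qed
  have cont1: "continuous_on {0..1} (\<lambda>\<sigma>. w \<sigma> * g (x * k \<sigma>))"
    if "continuous_on {0..1} w" "continuous_on {0..c} g" "x \<in> {0..c}" for w g :: "real \<Rightarrow> real" and x
    by (rule continuous_on_compose2[OF cont[OF that(1,2)], of _ "\<lambda>\<sigma>. (x, \<sigma>)", simplified])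
       (use that(3) in \<open>auto intro!: continuous_intros\<close>)
  have deriv: "((\<lambda>x. integral {0..1} (\<lambda>\<sigma>. w \<sigma> * g (x * k \<sigma>))) has_real_derivative
         integral {0..1} (\<lambda>\<sigma>. (w \<sigma> * k \<sigma>) * g' (x * k \<sigma>))) (at x within {0..c})"
    if "continuous_on {0..1} w" and gd: "\<And>x. x \<in> {0..c} \<Longrightarrow> (g has_real_derivative g' x) (at x within {0..c})"
      and cg: "continuous_on {0..c} g'" and x: "x \<in> {0..c}" for w g g' :: "real \<Rightarrow> real" and x
  proof -
    have cg0: "continuous_on {0..c} g" using gd by (rule DERIV_continuous_on)
    have "((\<lambda>x. integral (cbox 0 1) (\<lambda>\<sigma>. w \<sigma> * g (x * k \<sigma>))) has_field_derivative
         integral (cbox 0 1) (\<lambda>\<sigma>. (w \<sigma> * k \<sigma>) * g' (x * k \<sigma>))) (at x within {0..c})"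
    proof (rule leibniz_rule_field_derivative)
      fix x \<sigma> :: real assume x: "x \<in> {0..c}" and s: "\<sigma> \<in> cbox 0 1"
      have "((\<lambda>x. g (x * k \<sigma>)) has_real_derivative g' (x * k \<sigma>) * k \<sigma>) (at x within {0..c})"
      proof -
        have "((\<lambda>x. x * k \<sigma>) has_real_derivative k \<sigma>) (at x within {0..c})"
          by (auto intro!: derivative_eq_intros)
        moreover have "(g has_real_derivative g' (x * k \<sigma>)) (at (x * k \<sigma>) within (\<lambda>x. x * k \<sigma>) ` {0..c})"
          by (rule has_field_derivative_subset[OF gd]) (use mem x s in auto)
        ultimately show ?thesis by (rule DERIV_image_chain[of g _ "\<lambda>x. x * k \<sigma>", unfolded o_def, rotated])
      qed
      from DERIV_cmult[OF this, of "w \<sigma>"]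
      show "((\<lambda>x. w \<sigma> * g (x * k \<sigma>)) has_field_derivative (w \<sigma> * k \<sigma>) * g' (x * k \<sigma>)) (at x within {0..c})"
        by (simp add: mult_ac)
    next
      fix x :: real assume "x \<in> {0..c}"
      then show "(\<lambda>\<sigma>. w \<sigma> * g (x * k \<sigma>)) integrable_on cbox 0 1"
        using cont1[OF that(1) cg0] by (simp add: integrable_continuous_real)
    next
      show "continuous_on ({0..c} \<times> cbox 0 1) (\<lambda>(x, \<sigma>). (w \<sigma> * k \<sigma>) * g' (x * k \<sigma>))"
        using cont[of "\<lambda>\<sigma>. w \<sigma> * k \<sigma>" g'] that(1) cg assms(4) by (simp add: split_beta continuous_intros)
    qed (use x in auto)
    then show ?thesis by simp
  qed
  show "((\<lambda>x. integral {0..1} (\<lambda>\<sigma>. w \<sigma> * g (x * k \<sigma>))) has_real_derivative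
         integral {0..1} (\<lambda>\<sigma>. (w \<sigma> * k \<sigma>) * g' (x * k \<sigma>))) (at x within {0..c})"
    if "\<And>x. x \<in> {0..c} \<Longrightarrow> (g has_real_derivative g' x) (at x within {0..c})"
      "continuous_on {0..c} g'" "x \<in> {0..c}" for x g'
    by (rule deriv[OF assms(3) that])
  show "Ck n 0 c (\<lambda>x. integral {0..1} (\<lambda>\<sigma>. w \<sigma> * g (x * k \<sigma>)))"
    using assms(1,3)
  proof (induction n arbitrary: g w)
    case 0
    have "continuous_on {0..c} (\<lambda>x. integral (cbox 0 1) (\<lambda>\<sigma>. w \<sigma> * g (x * k \<sigma>)))"
      by (rule integral_continuous_on_param) (use cont[of w g] 0 in \<open>simp add: split_beta\<close>)
    then show ?case by simp
  next
    case (Suc n)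
    obtain g' where g': "\<And>x. x \<in> {0..c} \<Longrightarrow> (g has_real_derivative g' x) (at x within {0..c})" "Ck n 0 c g'"
      using Suc.prems by (metis Ck_SucE)
    have "Ck n 0 c (\<lambda>x. integral {0..1} (\<lambda>\<sigma>. (w \<sigma> * k \<sigma>) * g' (x * k \<sigma>)))"
      by (rule Suc.IH[OF g'(2)]) (intro continuous_intros Suc.prems assms)
    then show ?case
      by (rule Ck_SucI[rotated]) (intro deriv Suc.prems g'(1) Ck_imp_continuous_on[OF g'(2)])
  qed
qed

text \<open>Integrating \<open>d/d\<sigma> f(x \<sigma>) = x f'(x \<sigma>)\<close> over \<open>[0, 1]\<close> exhibits the difference quotient at \<open>0\<close> as an
  average of dilates of \<open>f'\<close>.\<close>

lemma Ck_Hadamard_quotient: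
  assumes f: "\<And>n. Ck n 0 c f" and c: "0 < c"
  obtains f1 where "\<And>n. Ck n 0 c f1" "\<And>x. x \<in> {0..c} \<Longrightarrow> f x = f 0 + x * f1 x"
    "(f has_real_derivative f1 0) (at 0 within {0..c})"
proof -
  obtain f' where f': "\<And>x. x \<in> {0..c} \<Longrightarrow> (f has_real_derivative f' x) (at x within {0..c})"
    using f[of "Suc 0"] by (metis Ck_SucE)
  have Cf': "Ck n 0 c f'" for n by (rule Ck_derivD[OF f c f'])
  define f1 where "f1 x = integral {0..1} (\<lambda>\<sigma>. 1 * f' (x * \<sigma>))" for x
  have "Ck n 0 c f1" for n unfolding f1_def
    by (rule Ck_dilation_average(1)[OF Cf' c]) auto
  moreover have "f x = f 0 + x * f1 x" if x: "x \<in> {0..c}" for x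
  proof -
    have "((\<lambda>\<sigma>. x * f' (x * \<sigma>)) has_integral (f (x * 1) - f (x * 0))) {0..1}"
    proof (rule fundamental_theorem_of_calculus)
      fix \<sigma> :: real assume s: "\<sigma> \<in> {0..1}"
      have m: "(*) x ` {0..1} \<subseteq> {0..c}"
      proof clarsimp
        fix s :: real assume "0 \<le> s" "s \<le> 1"
        then show "0 \<le> x * s \<and> x * s \<le> c" using x mult_mono[of x c s 1] by auto
      qed
      have "((\<lambda>\<sigma>. f (x * \<sigma>)) has_real_derivative f' (x * \<sigma>) * x) (at \<sigma> within {0..1})"
      proof (rule DERIV_image_chain[of f _ "\<lambda>\<sigma>. x * \<sigma>", unfolded o_def])
        show "(f has_real_derivative f' (x * \<sigma>)) (at (x * \<sigma>) within (*) x ` {0..1})"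
          by (rule has_field_derivative_subset[OF f' m]) (use m s in blast)
      qed (auto intro!: derivative_eq_intros)
      then show "((\<lambda>\<sigma>. f (x * \<sigma>)) has_vector_derivative x * f' (x * \<sigma>)) (at \<sigma> within {0..1})"
        by (simp add: has_real_derivative_iff_has_vector_derivative mult.commute)
    qed simp
    then have "integral {0..1} (\<lambda>\<sigma>. x * f' (x * \<sigma>)) = f (x * 1) - f (x * 0)" by (rule integral_unique)
    then show ?thesis by (simp add: f1_def)
  qed
  moreover have "f1 0 = f' 0" by (simp add: f1_def)
  then have "(f has_real_derivative f1 0) (at 0 within {0..c})" using f'[of 0] c by auto
  ultimately show ?thesis using that by blast
qed

lemma deriv_glue:
  assumes "(f has_real_derivative D) (at m within {a..m})" "(g has_real_derivative D) (at m within {m..b})"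
    "a \<le> m" "m \<le> b" "f m = g m"
  shows "((\<lambda>x. if x \<le> m then f x else g x) has_real_derivative D) (at m within {a..b})"
proof -
  let ?h = "\<lambda>x. if x \<le> m then f x else g x"
  have "(?h has_real_derivative D) (at m within {a..m})"
    by (rule deriv_within_cong[OF _ _ assms(1)]) (use assms in auto)
  moreover have "(?h has_real_derivative D) (at m within {m..b})"
    by (rule deriv_within_cong[OF _ _ assms(2)]) (use assms in auto)
  moreover have "{a..b} = {a..m} \<union> {m..b}" using assms by auto
  ultimately show ?thesis
    unfolding has_field_derivative_iff by (simp only: Lim_within_Un)
qed

lemma at_within_interval_left:
  assumes "x < (q::real)" "q \<le> b" shows "at x within {a..q} = at x within {a..b}"
  by (rule at_within_nhd[of x "{..<q}"]) (use assms in auto)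

lemma at_within_interval_right:
  assumes "(p::real) < x" "a \<le> p" shows "at x within {p..b} = at x within {a..b}"
  by (rule at_within_nhd[of x "{p<..}"]) (use assms in auto)

text \<open>On the overlap of two intervals the derivative is determined by the function, so the derivatives
  on both sides patch together.\<close>

lemma Ck_union_overlap:
  assumes "Ck n a q f" "Ck n p b f" "a \<le> p" "p < q" "q \<le> b"
  shows "Ck n a b f"
  using assms(1,2)
proof (induction n arbitrary: f)
  case 0
  have "{a..b} = {a..q} \<union> {p..b}" using assms by auto
  then show ?case using 0 by (simp add: continuous_on_closed_Un)
next
  case (Suc n)
  obtain f1 where f1: "\<And>x. x \<in> {a..q} \<Longrightarrow> (f has_real_derivative f1 x) (at x within {a..q})" "Ck n a q f1"
    using Suc.prems(1) by (metis Ck_SucE)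
  obtain f2 where f2: "\<And>x. x \<in> {p..b} \<Longrightarrow> (f has_real_derivative f2 x) (at x within {p..b})" "Ck n p b f2"
    using Suc.prems(2) by (metis Ck_SucE)
  have eq: "f1 x = f2 x" if "x \<in> {p..q}" for x
    by (rule deriv_within_unique[of p q x f])
       (use that assms in \<open>auto intro: has_field_derivative_subset[OF f1(1)] has_field_derivative_subset[OF f2(1)]\<close>)
  define h where "h x = (if x < q then f1 x else f2 x)" for x
  have "Ck n a b h"
  proof (rule Suc.IH)
    show "Ck n a q h" by (rule Ck_cong[OF _ f1(2)]) (use assms eq in \<open>auto simp: h_def\<close>)
    show "Ck n p b h" by (rule Ck_cong[OF _ f2(2)]) (use assms eq in \<open>auto simp: h_def\<close>)
  qed
  moreover have "(f has_real_derivative h x) (at x within {a..b})" if "x \<in> {a..b}" for x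
  proof (cases "x < q")
    case True
    then show ?thesis using f1(1)[of x] that assms at_within_interval_left[OF True, of b a] by (simp add: h_def)
  next
    case False
    then show ?thesis using f2(1)[of x] that assms at_within_interval_right[of p x a b] by (simp add: h_def)
  qed
  ultimately show ?case by (intro Ck_SucI)
qed

lemma smooth_on_interval_imp_Ck:
  assumes "smooth_on_interval a b f" shows "Ck n a b f"
proof -
  obtain D where D: "D 0 = f"
    "\<And>k s. s \<in> {a..b} \<Longrightarrow> (D k has_real_derivative D (Suc k) s) (at s within {a..b})"
    using assms unfolding smooth_on_interval_def by blast
  have "Ck n a b (D k)" for k
  proof (induction n arbitrary: k)
    case 0
    show ?case unfolding Ck.simps(1) by (rule DERIV_continuous_on[OF D(2)])
  next
    case (Suc n)
    show ?case by (rule Ck_SucI[OF D(2) Suc])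
  qed
  then show ?thesis using D(1) by metis
qed

text \<open>The derivatives are chosen one after the other. On a nondegenerate interval each of them is unique
  and therefore again of every class.\<close>

lemma smooth_on_intervalI:
  assumes "\<And>n. Ck n a b f" "a < b" shows "smooth_on_interval a b f"
proof -
  define d where "d h = (SOME g. \<forall>x\<in>{a..b}. (h has_real_derivative g x) (at x within {a..b}))"
    for h :: "real \<Rightarrow> real"
  have d: "\<forall>x\<in>{a..b}. (h has_real_derivative d h x) (at x within {a..b})" if h: "\<forall>n. Ck n a b h" for h
  proof -
    have "Ck (Suc 0) a b h" using h by blast
    then have "\<exists>g. \<forall>x\<in>{a..b}. (h has_real_derivative g x) (at x within {a..b})"
      unfolding Ck.simps(2) by blast
    then show ?thesis unfolding d_def by (rule someI_ex)
  qed
  define D where "D k = (d ^^ k) f" for k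
  have DS: "D (Suc k) = d (D k)" for k by (simp add: D_def)
  have C: "\<forall>n. Ck n a b (D k)" for k
  proof (induction k)
    case 0 then show ?case using assms by (simp add: D_def)
  next
    case (Suc k)
    have "Ck n a b (d (D k))" for n
      using Ck_derivD[OF Suc[rule_format] assms(2), of "d (D k)"] d[OF Suc] by blast
    then show ?case unfolding DS by blast
  qed
  show ?thesis unfolding smooth_on_interval_def
  proof (intro exI[of _ D] conjI allI)
    show "D 0 = f" by (simp add: D_def)
    show "\<forall>s\<in>{a..b}. (D k has_real_derivative D (Suc k) s) (at s within {a..b})" for k
      unfolding DS by (rule d[OF C])
  qed
qed

section \<open>Regular singular points of linear differential equations\<close>

text \<open>The bound on \<open>T\<close> improves the order of vanishing at \<open>0\<close> by one, so the \<open>n\<close>-th iterate is at most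
  \<open>M (K x)\<^sup>n / n!\<close> and the Neumann series \<open>\<Sum>n. T\<^sup>n start\<close> converges uniformly.\<close>

lemma Volterra_fixed_point:
  fixes T :: "(real \<Rightarrow> real) \<Rightarrow> real \<Rightarrow> real"
  assumes c: "0 \<le> c" and K: "0 \<le> K"
    and cont: "\<And>g. continuous_on {0..c} g \<Longrightarrow> continuous_on {0..c} (T g)"
    and add: "\<And>g h x. continuous_on {0..c} g \<Longrightarrow> continuous_on {0..c} h \<Longrightarrow> x \<in> {0..c} \<Longrightarrow>
                T (\<lambda>y. g y + h y) x = T g x + T h x"
    and bound: "\<And>g M n x. continuous_on {0..c} g \<Longrightarrow> 0 \<le> M \<Longrightarrow> (\<And>y. y \<in> {0..c} \<Longrightarrow> \<bar>g y\<bar> \<le> M * y ^ n) \<Longrightarrow>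
                x \<in> {0..c} \<Longrightarrow> \<bar>T g x\<bar> \<le> K * M * x ^ Suc n / Suc n"
    and start: "continuous_on {0..c} start"
  obtains \<psi> where "continuous_on {0..c} \<psi>" "\<And>x. x \<in> {0..c} \<Longrightarrow> \<psi> x = start x + T \<psi> x"
proof -
  define h where "h = rec_nat start (\<lambda>_. T)"
  have h0: "h 0 = start" and hS: "h (Suc n) = T (h n)" for n by (simp_all add: h_def)
  have ch: "continuous_on {0..c} (h n)" for n
    by (induction n) (auto simp: h0 hS start cont)
  obtain M where M: "0 \<le> M" "\<And>x. x \<in> {0..c} \<Longrightarrow> \<bar>start x\<bar> \<le> M"
  proof -
    have "bounded (start ` {0..c})"
      by (intro compact_imp_bounded compact_continuous_image start) auto
    then obtain M where "0 < M" "\<forall>x\<in>{0..c}. \<bar>start x\<bar> \<le> M" by (auto simp: bounded_pos)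
    then show ?thesis using that[of M] by auto
  qed
  have hb: "\<forall>x\<in>{0..c}. \<bar>h n x\<bar> \<le> (M * K ^ n / fact n) * x ^ n" for n
  proof (induction n)
    case 0 then show ?case using M by (simp add: h0)
  next
    case (Suc n)
    show ?case
    proof
      fix x assume x: "x \<in> {0..c}"
      have "\<bar>T (h n) x\<bar> \<le> K * (M * K ^ n / fact n) * x ^ Suc n / Suc n"
        by (rule bound[OF ch]) (use M K Suc x in auto)
      also have "\<dots> = (M * K ^ Suc n / fact (Suc n)) * x ^ Suc n"
        by (simp add: field_simps)
      finally show "\<bar>h (Suc n) x\<bar> \<le> (M * K ^ Suc n / fact (Suc n)) * x ^ Suc n" by (simp only: hS)
    qed
  qed
  define \<psi> where "\<psi> x = (\<Sum>n. h n x)" for x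
  define f where "f n x = (\<Sum>k<n. h k x)" for n x
  have ul: "uniform_limit {0..c} f \<psi> sequentially"
    unfolding f_def[abs_def] \<psi>_def[abs_def]
  proof (rule Weierstrass_m_test)
    show "norm (h n x) \<le> M * ((K * c) ^ n / fact n)" if "x \<in> {0..c}" for n x
    proof -
      have "\<bar>h n x\<bar> \<le> (M * K ^ n / fact n) * x ^ n" using hb that by blast
      also have "\<dots> \<le> (M * K ^ n / fact n) * c ^ n"
        using that M K by (intro mult_left_mono power_mono) auto
      finally show ?thesis by (simp add: power_mult_distrib)
    qed
    show "summable (\<lambda>n. M * ((K * c) ^ n / fact n))"
      using summable_exp[of "K * c"] by (intro summable_mult) (simp add: field_simps)
  qed
  have cf: "continuous_on {0..c} (f n)" for n
    unfolding f_def[abs_def] by (intro continuous_intros ch)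
  have c\<psi>: "continuous_on {0..c} \<psi>"
    by (rule uniform_limit_theorem[OF _ ul]) (auto simp: cf)
  have T0: "T (\<lambda>y. 0) x = 0" if "x \<in> {0..c}" for x
    using bound[of "\<lambda>y. 0" 0 0 x] that by auto
  have Tf: "start x + T (f n) x = f (Suc n) x" if x: "x \<in> {0..c}" for n x
  proof (induction n)
    case 0
    then show ?case using T0[OF x] by (simp add: f_def[abs_def] h0)
  next
    case (Suc n)
    have "T (f (Suc n)) x = T (\<lambda>y. f n y + h n y) x" by (simp add: f_def[abs_def])
    also have "\<dots> = T (f n) x + h (Suc n) x" using add[OF cf ch x] by (simp add: hS)
    finally have "T (f (Suc n)) x = T (f n) x + h (Suc n) x" .
    moreover have "f (Suc (Suc n)) x = f (Suc n) x + h (Suc n) x" by (simp only: f_def sum.lessThan_Suc)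
    ultimately show ?case using Suc by linarith
  qed
  have "\<psi> x = start x + T \<psi> x" if x: "x \<in> {0..c}" for x
  proof -
    have "(\<lambda>n. T (f n) x) \<longlonglongrightarrow> T \<psi> x"
    proof (rule LIMSEQ_I)
      fix r :: real assume r: "0 < r"
      define e where "e = r / (2 * (K * c + 1))"
      have e: "0 < e" using r K c by (simp add: e_def add_nonneg_pos)
      have "K * e * c \<le> r / 2"
      proof -
        have "K * e * c = (r / 2) * (K * c / (K * c + 1))" by (simp add: e_def field_simps)
        also have "\<dots> \<le> (r / 2) * 1" using r K c by (intro mult_left_mono) (auto simp: divide_simps add_nonneg_pos)
        finally show ?thesis by simp
      qed
      then have ke: "K * e * c < r" using r by linarith
      obtain N where N: "\<And>n y. n \<ge> N \<Longrightarrow> y \<in> {0..c} \<Longrightarrow> dist (f n y) (\<psi> y) < e"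
        using ul e unfolding uniform_limit_sequentially_iff by metis
      have "norm (T (f n) x - T \<psi> x) < r" if n: "n \<ge> N" for n
      proof -
        let ?d = "\<lambda>y. f n y - \<psi> y"
        have "T (f n) x = T (\<lambda>y. ?d y + \<psi> y) x" by simp
        also have "\<dots> = T ?d x + T \<psi> x" by (rule add) (intro continuous_intros cf c\<psi> x)+
        finally have "T (f n) x - T \<psi> x = T ?d x" by simp
        moreover have "\<bar>T ?d x\<bar> \<le> K * e * x ^ Suc 0 / Suc 0"
          by (rule bound) (use N[OF n] e x cf c\<psi> in \<open>auto intro!: continuous_intros simp: dist_real_def less_imp_le\<close>)
        moreover have "K * e * x \<le> K * e * c" using x K e by (intro mult_left_mono) auto
        ultimately show ?thesis using ke by simp
      qed
      then show "\<exists>N. \<forall>n\<ge>N. norm (T (f n) x - T \<psi> x) < r" by blast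
    qed
    then have "(\<lambda>n. start x + T (f n) x) \<longlonglongrightarrow> start x + T \<psi> x" by (intro tendsto_intros)
    moreover have "(\<lambda>n. f (Suc n) x) \<longlonglongrightarrow> \<psi> x"
      using tendsto_uniform_limitI[OF ul x] LIMSEQ_Suc by blast
    ultimately show ?thesis using Tf[OF x] LIMSEQ_unique by auto
  qed
  then show ?thesis using that c\<psi> by blast
qed

text \<open>The functions \<open>p\<close> and \<open>q\<close> are the first and second derivative of \<open>\<psi>\<close>. If \<open>|\<nabla>F|\<^sup>2 = A \<circ> F\<close> and
  \<open>\<Delta>F = B \<circ> F\<close>, the equation says that \<open>(\<kappa> - \<Delta>) (\<psi> \<circ> F) = \<eta> \<circ> F\<close>.\<close>

definition solves ::
  "real \<Rightarrow> real \<Rightarrow> (real \<Rightarrow> real) \<Rightarrow> (real \<Rightarrow> real) \<Rightarrow> real \<Rightarrow> (real \<Rightarrow> real) \<Rightarrow> (real \<Rightarrow> real) \<Rightarrow> (real \<Rightarrow> real) \<Rightarrow> (real \<Rightarrow> real) \<Rightarrow> bool"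
where
  "solves a b A B \<kappa> \<eta> \<psi> p q \<longleftrightarrow>
     (\<forall>x\<in>{a..b}. (\<psi> has_real_derivative p x) (at x within {a..b}) \<and>
        (p has_real_derivative q x) (at x within {a..b}) \<and>
        A x * q x - B x * p x + \<kappa> * \<psi> x = \<eta> x)"

text \<open>Euler's operator \<open>v \<mapsto> x v' + \<beta> v\<close> with \<open>\<beta> > 0\<close> is inverted by a dilation average, because the
  two integrands add up to the derivative of \<open>\<sigma> \<mapsto> \<sigma> g(x \<sigma>\<^sup>1\<^sup>/\<^sup>\<beta>)\<close>.\<close>

lemma Euler_operator_inverse:
  assumes \<beta>: "0 < \<beta>" and c: "0 < c"
    and g: "\<And>x. x \<in> {0..c} \<Longrightarrow> (g has_real_derivative g' x) (at x within {0..c})" "continuous_on {0..c} g'"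
    and x: "x \<in> {0..c}"
  shows "x * integral {0..1} (\<lambda>\<sigma>. (1 / \<beta> * \<sigma> powr (1 / \<beta>)) * g' (x * \<sigma> powr (1 / \<beta>)))
           + \<beta> * integral {0..1} (\<lambda>\<sigma>. 1 / \<beta> * g (x * \<sigma> powr (1 / \<beta>))) = g x"
proof -
  define k where "k \<sigma> = \<sigma> powr (1 / \<beta>)" for \<sigma> :: real
  have ck: "continuous_on {0..1} k" unfolding k_def using \<beta> by (intro continuous_on_powr' continuous_on_id continuous_on_const) auto
  have mem: "x * k \<sigma> \<in> {0..c}" if "\<sigma> \<in> {0..1}" for \<sigma>
  proof -
    have "0 \<le> k \<sigma>" "k \<sigma> \<le> 1" using that \<beta> by (auto simp: k_def powr_le1)
    then show ?thesis using x mult_mono[of x c "k \<sigma>" 1] by auto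
  qed
  have cg: "continuous_on {0..c} g" using g(1) by (rule DERIV_continuous_on)
  have c1: "continuous_on {0..1} (\<lambda>\<sigma>. x * k \<sigma>)" by (intro continuous_intros ck)
  have cg1: "continuous_on {0..1} (\<lambda>\<sigma>. g (x * k \<sigma>))"
    by (rule continuous_on_compose2[OF cg c1]) (use mem in auto)
  have cg2: "continuous_on {0..1} (\<lambda>\<sigma>. (1 / \<beta> * k \<sigma>) * g' (x * k \<sigma>))"
    by (intro continuous_on_mult ck continuous_on_const continuous_on_compose2[OF g(2) c1]) (use mem in auto)
  have "((\<lambda>\<sigma>. g (x * k \<sigma>) + x * ((1 / \<beta> * k \<sigma>) * g' (x * k \<sigma>))) has_integral
          (1 * g (x * k 1) - 0 * g (x * k 0))) {0..1}"
  proof (rule fundamental_theorem_of_calculus_interior)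
    fix \<sigma> :: real assume s: "\<sigma> \<in> {0<..<1}"
    have k': "(k has_real_derivative (1 / \<beta>) * \<sigma> powr (1 / \<beta> - 1)) (at \<sigma>)"
      unfolding k_def using s by (intro has_real_derivative_powr) auto
    have "((\<lambda>\<sigma>. g (x * k \<sigma>)) has_real_derivative g' (x * k \<sigma>) * (x * ((1 / \<beta>) * \<sigma> powr (1 / \<beta> - 1)))) (at \<sigma> within {0<..<1})"
    proof (rule DERIV_image_chain[of g _ "\<lambda>\<sigma>. x * k \<sigma>", unfolded o_def])
      show "(g has_real_derivative g' (x * k \<sigma>)) (at (x * k \<sigma>) within (\<lambda>\<sigma>. x * k \<sigma>) ` {0<..<1})"
        by (rule has_field_derivative_subset[OF g(1)]) (use mem s in auto)
      show "((\<lambda>\<sigma>. x * k \<sigma>) has_real_derivative x * (1 / \<beta> * \<sigma> powr (1 / \<beta> - 1))) (at \<sigma> within {0<..<1})"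
        by (rule DERIV_cmult[OF has_field_derivative_at_within[OF k']])
    qed
    then have "((\<lambda>\<sigma>. g (x * k \<sigma>)) has_real_derivative g' (x * k \<sigma>) * (x * ((1 / \<beta>) * \<sigma> powr (1 / \<beta> - 1)))) (at \<sigma>)"
      using at_within_open[OF s] by simp
    from DERIV_mult[OF DERIV_ident this]
    have "((\<lambda>\<sigma>. \<sigma> * g (x * k \<sigma>)) has_real_derivative
           1 * g (x * k \<sigma>) + g' (x * k \<sigma>) * (x * ((1 / \<beta>) * \<sigma> powr (1 / \<beta> - 1))) * \<sigma>) (at \<sigma>)" .
    moreover have "\<sigma> powr (1 / \<beta> - 1) * \<sigma> = k \<sigma>"
      using s by (simp add: k_def powr_diff)
    moreover have "d * (x * (m * e)) * \<sigma> = x * ((m * (e * \<sigma>)) * d)" for d m e :: real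
      by (simp add: mult_ac)
    ultimately show "((\<lambda>\<sigma>. \<sigma> * g (x * k \<sigma>)) has_vector_derivative g (x * k \<sigma>) + x * ((1 / \<beta> * k \<sigma>) * g' (x * k \<sigma>))) (at \<sigma>)"
      unfolding has_real_derivative_iff_has_vector_derivative by (simp only: mult_1)
  qed (simp, intro continuous_on_mult continuous_on_id cg1)
  from integral_unique[OF this]
  have "integral {0..1} (\<lambda>\<sigma>. g (x * k \<sigma>) + x * ((1 / \<beta> * k \<sigma>) * g' (x * k \<sigma>))) = g x"
    by (simp add: k_def)
  moreover have "integral {0..1} (\<lambda>\<sigma>. g (x * k \<sigma>) + x * ((1 / \<beta> * k \<sigma>) * g' (x * k \<sigma>)))
     = integral {0..1} (\<lambda>\<sigma>. g (x * k \<sigma>)) + integral {0..1} (\<lambda>\<sigma>. x * ((1 / \<beta> * k \<sigma>) * g' (x * k \<sigma>)))"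
    by (intro integral_add integrable_continuous_real cg1 continuous_on_mult_left cg2)
  moreover have "integral {0..1} (\<lambda>\<sigma>. x * ((1 / \<beta> * k \<sigma>) * g' (x * k \<sigma>)))
     = x * integral {0..1} (\<lambda>\<sigma>. (1 / \<beta> * k \<sigma>) * g' (x * k \<sigma>))"
    by (rule integral_mult_right)
  moreover have "\<beta> * integral {0..1} (\<lambda>\<sigma>. 1 / \<beta> * g (x * k \<sigma>)) = integral {0..1} (\<lambda>\<sigma>. g (x * k \<sigma>))"
    using \<beta> by (subst integral_mult_right) simp
  ultimately show ?thesis unfolding k_def by linarith
qed

text \<open>Write \<open>A = x A1\<close> and \<open>- B = b A1\<close> with \<open>b 0 > 0\<close>. In terms of \<open>p = \<psi>'\<close> the equation becomes
  \<open>x p' + b p = (\<eta> - \<kappa> \<psi>) / A1\<close>, and an integrating factor reduces its left-hand side to Euler's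
  operator. Hence \<open>p = V (\<eta> - \<kappa> \<psi>)\<close> for an operator \<open>V\<close> that preserves every class \<open>C\<^sup>n\<close>, and
  \<open>\<psi> = \<psi>0 + \<integral> V (\<eta> - \<kappa> \<psi>)\<close> is a Volterra equation. Its solution is smooth, since the
  integration gains one derivative at a time.\<close>

theorem regular_singular_solution:
  fixes A B \<eta> :: "real \<Rightarrow> real"
  assumes c: "0 < c" and sm: "\<And>n. Ck n 0 c A" "\<And>n. Ck n 0 c B" "\<And>n. Ck n 0 c \<eta>"
    and A0: "A 0 = 0" and A'0: "(A has_real_derivative \<alpha>) (at 0 within {0..c})" "0 < \<alpha>"
    and Apos: "\<And>x. x \<in> {0<..c} \<Longrightarrow> 0 < A x" and B0: "B 0 < 0"
  obtains \<psi> p q where "\<And>n. Ck n 0 c \<psi>" "\<psi> 0 = \<psi>0" "solves 0 c A B \<kappa> \<eta> \<psi> p q"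
proof -
  obtain A1 where A1: "\<And>n. Ck n 0 c A1" "\<And>x. x \<in> {0..c} \<Longrightarrow> A x = A 0 + x * A1 x"
      "(A has_real_derivative A1 0) (at 0 within {0..c})"
    using Ck_Hadamard_quotient[OF sm(1) c] by blast
  have "A1 0 = \<alpha>" using deriv_within_unique[OF c _ A1(3) A'0(1)] c by simp
  then have A1pos: "0 < A1 x" if "x \<in> {0..c}" for x
    using A1(2)[OF that] Apos[of x] A0 A'0(2) that by (cases "x = 0") (auto simp: zero_less_mult_iff)
  define b where "b x = - B x / A1 x" for x
  have Cb: "Ck n 0 c b" for n unfolding b_def
    using A1pos by (intro Ck_divide Ck_minus A1 sm) force
  define \<beta> where "\<beta> = b 0"
  have \<beta>: "0 < \<beta>" using B0 A1pos[of 0] c by (simp add: \<beta>_def b_def divide_neg_pos)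
  obtain b1 where b1: "\<And>n. Ck n 0 c b1" "\<And>x. x \<in> {0..c} \<Longrightarrow> b x = b 0 + x * b1 x"
      "(b has_real_derivative b1 0) (at 0 within {0..c})"
    using Ck_Hadamard_quotient[OF Cb c] by blast
  \<comment> \<open>With \<open>b = \<beta> + x b1\<close> and \<open>v = E p\<close> one gets \<open>x v' + \<beta> v = E (x p' + b p)\<close>.\<close>
  define E where "E x = exp (integral {0..x} b1)" for x
  have CE: "Ck n 0 c E" for n unfolding E_def by (intro Ck_exp Ck_SucD[OF Ck_integral[OF b1(1)]])
  have E': "(E has_real_derivative b1 x * E x) (at x within {0..c})" if "x \<in> {0..c}" for x
    unfolding E_def
    by (rule derivative_eq_intros integral_has_real_derivative[OF Ck_imp_continuous_on[OF b1(1)] that])+ simp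
  have Epos: "0 < E x" for x by (simp add: E_def)
  define k where "k \<sigma> = \<sigma> powr (1 / \<beta>)" for \<sigma> :: real
  have ck: "continuous_on {0..1} k" unfolding k_def using \<beta> by (intro continuous_on_powr' continuous_on_id continuous_on_const) auto
  have k01: "k ` {0..1} \<subseteq> {0..1}" using \<beta> by (auto simp: k_def powr_le1)
  \<comment> \<open>\<open>S\<close> inverts Euler's operator, and \<open>V g\<close> is the solution \<open>p\<close> of \<open>x p' + b p = g / A1\<close>.\<close>
  define Q where "Q g x = E x * g x / A1 x" for g x
  have CQ: "Ck n 0 c (Q g)" if "Ck n 0 c g" for n g
    unfolding Q_def using A1pos by (intro Ck_divide Ck_mult CE that A1) force
  define S where "S g x = integral {0..1} (\<lambda>\<sigma>. 1 / \<beta> * g (x * k \<sigma>))" for g x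
  have CS: "Ck n 0 c (S g)" if "Ck n 0 c g" for n g
    unfolding S_def by (rule Ck_dilation_average(1)[OF that c _ ck k01]) auto
  define V where "V g x = S (Q g) x / E x" for g x
  have CV: "Ck n 0 c (V g)" if "Ck n 0 c g" for n g
    unfolding V_def using Epos by (intro Ck_divide CS CQ that CE) (metis less_irrefl)
  define T where "T g x = integral {0..x} (V g)" for g x
  have CT: "Ck (Suc n) 0 c (T g)" if "Ck n 0 c g" for n g
    unfolding T_def by (rule Ck_integral[OF CV[OF that]])
  have T': "(T g has_real_derivative V g x) (at x within {0..c})" if "continuous_on {0..c} g" "x \<in> {0..c}" for g x
    unfolding T_def
    using integral_has_real_derivative[OF Ck_imp_continuous_on[OF CV[of 0 g]]] that by simp
  have mem: "x * k \<sigma> \<in> {0..x}" if "\<sigma> \<in> {0..1}" "0 \<le> x" for \<sigma> x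
    using k01 that mult_left_mono[of "k \<sigma>" 1 x] by (auto simp: image_subset_iff)
  have cS: "continuous_on {0..1} (\<lambda>\<sigma>. 1 / \<beta> * Q g (x * k \<sigma>))"
    if g: "continuous_on {0..c} g" and x: "x \<in> {0..c}" for g x
  proof -
    have "continuous_on {0..c} (Q g)" using Ck_imp_continuous_on[OF CQ[of 0 g]] g by simp
    then have "continuous_on {0..1} (\<lambda>\<sigma>. Q g (x * k \<sigma>))"
    proof (rule continuous_on_compose2)
      show "(\<lambda>\<sigma>. x * k \<sigma>) ` {0..1} \<subseteq> {0..c}" using mem x by force
    qed (intro continuous_intros ck)
    then show ?thesis by (intro continuous_intros)
  qed
  have Vadd: "V (\<lambda>y. g y + h y) x = V g x + V h x"
    if "continuous_on {0..c} g" "continuous_on {0..c} h" "x \<in> {0..c}" for g h x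
  proof -
    have "S (Q (\<lambda>y. g y + h y)) x = integral {0..1} (\<lambda>\<sigma>. 1 / \<beta> * Q g (x * k \<sigma>) + 1 / \<beta> * Q h (x * k \<sigma>))"
      unfolding S_def by (rule integral_cong) (simp add: Q_def add_divide_distrib distrib_left)
    also have "\<dots> = S (Q g) x + S (Q h) x"
      unfolding S_def by (rule integral_add) (intro integrable_continuous_real cS that)+
    finally show ?thesis by (simp add: V_def add_divide_distrib)
  qed
  have Tadd: "T (\<lambda>y. g y + h y) x = T g x + T h x"
    if g: "continuous_on {0..c} g" and h: "continuous_on {0..c} h" and x: "x \<in> {0..c}" for g h x
  proof -
    have "T (\<lambda>y. g y + h y) x = integral {0..x} (\<lambda>y. V g y + V h y)"
      unfolding T_def by (rule integral_cong) (use Vadd[OF g h] x in auto)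
    also have "\<dots> = T g x + T h x" unfolding T_def
    proof (rule integral_add; rule integrable_continuous_real)
      show "continuous_on {0..x} (V g)"
        by (rule continuous_on_subset[OF Ck_imp_continuous_on[OF CV[of 0 g]]]) (use g x in auto)
      show "continuous_on {0..x} (V h)"
        by (rule continuous_on_subset[OF Ck_imp_continuous_on[OF CV[of 0 h]]]) (use h x in auto)
    qed
    finally show ?thesis .
  qed
  obtain K1 where K1: "0 < K1" "\<And>x. x \<in> {0..c} \<Longrightarrow> \<bar>E x / A1 x\<bar> \<le> K1"
  proof -
    have "continuous_on {0..c} (\<lambda>x. E x / A1 x)"
      using A1pos by (intro Ck_imp_continuous_on[of 0] Ck_divide CE A1) force
    then have "bounded ((\<lambda>x. E x / A1 x) ` {0..c})"
      by (intro compact_imp_bounded compact_continuous_image) auto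
    then show ?thesis using that by (auto simp: bounded_pos)
  qed
  obtain K2 where K2: "0 < K2" "\<And>x. x \<in> {0..c} \<Longrightarrow> \<bar>1 / E x\<bar> \<le> K2"
  proof -
    have "continuous_on {0..c} (\<lambda>x. 1 / E x)"
      by (intro Ck_imp_continuous_on[of 0] Ck_divide CE Ck_const) (metis Epos less_irrefl)
    then have "bounded ((\<lambda>x. 1 / E x) ` {0..c})"
      by (intro compact_imp_bounded compact_continuous_image) auto
    then show ?thesis using that by (auto simp: bounded_pos)
  qed
  define K where "K = K1 * K2 / \<beta>"
  have K0: "0 \<le> K" using K1 K2 \<beta> by (simp add: K_def)
  have Vb: "\<bar>V g y\<bar> \<le> K * M * y ^ n"
    if g: "continuous_on {0..c} g" and M: "0 \<le> M" and gb: "\<And>y. y \<in> {0..c} \<Longrightarrow> \<bar>g y\<bar> \<le> M * y ^ n"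
      and y: "y \<in> {0..c}" for g M n y
  proof -
    have "norm (S (Q g) y) \<le> integral {0..1::real} (\<lambda>_. K1 / \<beta> * M * y ^ n)"
      unfolding S_def
    proof (rule integral_norm_bound_integral[OF integrable_continuous_real[OF cS[OF g y]]])
      fix \<sigma> :: real assume "\<sigma> \<in> {0..1}"
      then have z: "y * k \<sigma> \<in> {0..y}" using mem y by auto
      have "norm (1 / \<beta> * Q g (y * k \<sigma>)) = 1 / \<beta> * (\<bar>E (y * k \<sigma>) / A1 (y * k \<sigma>)\<bar> * \<bar>g (y * k \<sigma>)\<bar>)"
        using \<beta> by (simp add: Q_def abs_mult)
      also have "\<dots> \<le> 1 / \<beta> * (K1 * (M * y ^ n))"
      proof (intro mult_left_mono mult_mono)
        have "\<bar>g (y * k \<sigma>)\<bar> \<le> M * (y * k \<sigma>) ^ n" using gb[of "y * k \<sigma>"] z y by auto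
        also have "\<dots> \<le> M * y ^ n" using z M by (intro mult_left_mono power_mono) auto
        finally show "\<bar>g (y * k \<sigma>)\<bar> \<le> M * y ^ n" .
      qed (use K1 z y \<beta> in auto)
      finally show "norm (1 / \<beta> * Q g (y * k \<sigma>)) \<le> K1 / \<beta> * M * y ^ n" by (simp add: mult_ac)
    qed auto
    then have "\<bar>S (Q g) y\<bar> * \<bar>1 / E y\<bar> \<le> (K1 / \<beta> * M * y ^ n) * K2"
      using K2 y K1 \<beta> M by (intro mult_mono) auto
    then show ?thesis by (simp add: V_def K_def abs_mult mult_ac)
  qed
  have Tb: "\<bar>T g x\<bar> \<le> K * M * x ^ Suc n / Suc n"
    if g: "continuous_on {0..c} g" and M: "0 \<le> M" and gb: "\<And>y. y \<in> {0..c} \<Longrightarrow> \<bar>g y\<bar> \<le> M * y ^ n"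
      and x: "x \<in> {0..c}" for g M n x
  proof -
    have i: "((\<lambda>y. K * M * y ^ n) has_integral (K * M * x ^ Suc n / Suc n - K * M * 0 ^ Suc n / Suc n)) {0..x}"
    proof (rule fundamental_theorem_of_calculus)
      fix y :: real
      have "((\<lambda>y. (K * M / Suc n) * y ^ Suc n) has_real_derivative (K * M / Suc n) * (real (Suc n) * y ^ (Suc n - Suc 0))) (at y within {0..x})"
        by (intro DERIV_cmult DERIV_pow)
      then show "((\<lambda>y. K * M * y ^ Suc n / Suc n) has_vector_derivative K * M * y ^ n) (at y within {0..x})"
        by (simp add: has_real_derivative_iff_has_vector_derivative mult.assoc del: of_nat_Suc)
    qed (use x in auto)
    have "norm (integral {0..x} (V g)) \<le> integral {0..x} (\<lambda>y. K * M * y ^ n)"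
    proof (rule integral_norm_bound_integral)
      show "V g integrable_on {0..x}"
        by (intro integrable_continuous_real continuous_on_subset[OF Ck_imp_continuous_on[OF CV[of 0 g]]]) (use g x in auto)
      show "(\<lambda>y. K * M * y ^ n) integrable_on {0..x}" using i by blast
      show "norm (V g y) \<le> K * M * y ^ n" if "y \<in> {0..x}" for y
        using Vb[OF g M gb] that x by simp
    qed
    then show ?thesis using integral_unique[OF i] by (simp add: T_def)
  qed
  define g0 where "g0 x = \<psi>0 + T \<eta> x" for x
  obtain \<psi> where \<psi>: "continuous_on {0..c} \<psi>" "\<And>x. x \<in> {0..c} \<Longrightarrow> \<psi> x = g0 x + T (\<lambda>y. - \<kappa> * \<psi> y) x"
  proof (rule Volterra_fixed_point[where c = c and K = "K * \<bar>\<kappa>\<bar>" and T = "\<lambda>g. T (\<lambda>y. - \<kappa> * g y)" and start = g0])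
    fix g :: "real \<Rightarrow> real" assume g: "continuous_on {0..c} g"
    then have cg: "continuous_on {0..c} (\<lambda>y. - \<kappa> * g y)" by (intro continuous_intros)
    then show "continuous_on {0..c} (T (\<lambda>y. - \<kappa> * g y))"
      using Ck_imp_continuous_on[OF CT[of 0 "\<lambda>y. - \<kappa> * g y"]] by simp
    show "T (\<lambda>y. - \<kappa> * (g y + h y)) x = T (\<lambda>y. - \<kappa> * g y) x + T (\<lambda>y. - \<kappa> * h y) x"
      if h: "continuous_on {0..c} h" and x: "x \<in> {0..c}" for h x
    proof -
      have "(\<lambda>y. - \<kappa> * (g y + h y)) = (\<lambda>y. (- \<kappa> * g y) + (- \<kappa> * h y))" by (simp add: distrib_left)
      then show ?thesis using Tadd[OF cg _ x, of "\<lambda>y. - \<kappa> * h y"] h continuous_on_mult_left[of "{0..c}" h "- \<kappa>"] by simp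
    qed
    show "\<bar>T (\<lambda>y. - \<kappa> * g y) x\<bar> \<le> K * \<bar>\<kappa>\<bar> * M * x ^ Suc n / Suc n"
      if "0 \<le> M" "\<And>y. y \<in> {0..c} \<Longrightarrow> \<bar>g y\<bar> \<le> M * y ^ n" "x \<in> {0..c}" for M n x
    proof -
      have "\<bar>T (\<lambda>y. - \<kappa> * g y) x\<bar> \<le> K * (\<bar>\<kappa>\<bar> * M) * x ^ Suc n / Suc n"
        by (rule Tb[OF cg]) (use that mult_left_mono[OF that(2), of _ "\<bar>\<kappa>\<bar>"] in \<open>auto simp: abs_mult mult.assoc\<close>)
      then show ?thesis by (simp add: mult.assoc)
    qed
  next
    show "continuous_on {0..c} g0"
      unfolding g0_def using Ck_imp_continuous_on[OF CT[OF sm(3)[of 0]]] by (intro continuous_intros)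
  qed (use c K0 in auto)
  define g where "g y = \<eta> y - \<kappa> * \<psi> y" for y
  have \<psi>eq: "\<psi> x = \<psi>0 + T g x" if "x \<in> {0..c}" for x
  proof -
    have "T g x = T (\<lambda>y. \<eta> y + - \<kappa> * \<psi> y) x" by (simp add: g_def[abs_def])
    also have "\<dots> = T \<eta> x + T (\<lambda>y. - \<kappa> * \<psi> y) x"
      by (rule Tadd[OF Ck_imp_continuous_on[OF sm(3)[of 0]] _ that]) (intro continuous_intros \<psi>)
    finally show ?thesis using \<psi>(2)[OF that] by (simp add: g0_def)
  qed
  have Cg: "Ck n 0 c g" if "Ck n 0 c \<psi>" for n
    unfolding g_def by (intro Ck_diff Ck_mult Ck_const sm that)
  \<comment> \<open>If \<open>\<psi>\<close> is of class \<open>C\<^sup>n\<close>, then so is \<open>V g\<close>, and \<open>\<psi> = \<psi>0 + \<integral> V g\<close> is one class better.\<close>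
  have C\<psi>: "Ck n 0 c \<psi>" for n
  proof (induction n)
    case (Suc n)
    have "Ck (Suc n) 0 c (\<lambda>x. \<psi>0 + T g x)" by (intro Ck_add Ck_const CT Cg Suc)
    then show ?case by (rule Ck_cong[rotated]) (simp add: \<psi>eq)
  qed (use \<psi> in simp)
  have cg: "continuous_on {0..c} g" using Ck_imp_continuous_on[OF Cg[OF C\<psi>[of 0]]] .
  have \<psi>': "(\<psi> has_real_derivative V g x) (at x within {0..c})" if "x \<in> {0..c}" for x
    by (rule deriv_within_cong[of _ "\<lambda>x. \<psi>0 + T g x"])
       (use that \<psi>eq T'[OF cg that] in \<open>auto intro!: derivative_eq_intros\<close>)
  obtain Q' where Q': "\<And>x. x \<in> {0..c} \<Longrightarrow> (Q g has_real_derivative Q' x) (at x within {0..c})" "Ck 0 0 c Q'"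
    using CQ[OF Cg[OF C\<psi>], of "Suc 0"] by (metis Ck_SucE)
  define S' where "S' x = integral {0..1} (\<lambda>\<sigma>. (1 / \<beta> * k \<sigma>) * Q' (x * k \<sigma>))" for x
  have S': "(S (Q g) has_real_derivative S' x) (at x within {0..c})" if "x \<in> {0..c}" for x
    unfolding S_def S'_def
    by (rule Ck_dilation_average(2)[OF CQ[OF Cg[OF C\<psi>[of 0]]] c _ ck k01 Q'(1) _ that]) (use Q'(2) in auto)
  define V' where "V' x = (S' x * E x - S (Q g) x * (b1 x * E x)) / (E x * E x)" for x
  have V': "(V g has_real_derivative V' x) (at x within {0..c})" if "x \<in> {0..c}" for x
    unfolding V_def V'_def using Epos[of x]
    by (intro DERIV_divide S' E' that) simp
  have ode: "A x * V' x - B x * V g x + \<kappa> * \<psi> x = \<eta> x" if x: "x \<in> {0..c}" for x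
  proof -
    have eu: "x * S' x + \<beta> * S (Q g) x = Q g x"
      unfolding S'_def S_def k_def by (rule Euler_operator_inverse[OF \<beta> c Q'(1) _ x]) (use Q'(2) in auto)
    have EV: "S (Q g) x = E x * V g x" using Epos[of x] by (simp add: V_def)
    have "e * ((s * e - r * (d * e)) / (e * e)) = s - r * d" if "e \<noteq> 0" for s e r d :: real
      using that by (simp add: field_simps)
    from this[of "E x"] have "S' x = E x * V' x + b1 x * E x * V g x"
      using Epos[of x] EV by (simp add: V'_def)
    with eu EV have "E x * (x * V' x + (\<beta> + x * b1 x) * V g x) = E x * (g x / A1 x)"
      by (simp add: Q_def algebra_simps)
    then have "x * V' x + b x * V g x = g x / A1 x"
      using Epos[of x] unfolding mult_cancel_left b1(2)[OF x] \<beta>_def by simp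
    then have "A1 x * (x * V' x + b x * V g x) = g x" using A1pos[OF x] by simp
    then show ?thesis using A1(2)[OF x] A0 A1pos[OF x] by (simp add: b_def g_def algebra_simps)
  qed
  show ?thesis
  proof (rule that[OF C\<psi>])
    show "\<psi> 0 = \<psi>0" using \<psi>eq[of 0] c by (simp add: T_def)
    show "solves 0 c A B \<kappa> \<eta> \<psi> (V g) V'" using \<psi>' V' ode by (simp add: solves_def)
  qed
qed

section \<open>A boundary value problem with two singular end points\<close>

lemma solvesD:
  assumes "solves a b A B \<kappa> \<eta> \<psi> p q" "x \<in> {a..b}"
  shows "(\<psi> has_real_derivative p x) (at x within {a..b})"
    "(p has_real_derivative q x) (at x within {a..b})"
    "A x * q x - B x * p x + \<kappa> * \<psi> x = \<eta> x"
  using assms unfolding solves_def by blast+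

lemma solves_subset:
  assumes "solves a b A B \<kappa> \<eta> \<psi> p q" "{c..d} \<subseteq> {a..b}"
  shows "solves c d A B \<kappa> \<eta> \<psi> p q"
  unfolding solves_def
proof (intro ballI conjI)
  fix x assume "x \<in> {c..d}"
  then have x: "x \<in> {a..b}" using assms(2) by blast
  note s = solvesD[OF assms(1) x]
  show "(\<psi> has_real_derivative p x) (at x within {c..d})" "(p has_real_derivative q x) (at x within {c..d})"
    "A x * q x - B x * p x + \<kappa> * \<psi> x = \<eta> x"
    using s assms(2) by (auto intro: has_field_derivative_subset)
qed

text \<open>For \<open>k = -1\<close> this carries the right end point to the left one: the reflection changes the sign of
  first derivatives only, hence replaces \<open>B\<close> by \<open>- B\<close>.\<close>

lemma solves_affine:
  assumes s: "solves c d (\<lambda>x. A (k * x + l)) (\<lambda>x. k * B (k * x + l)) \<kappa> (\<lambda>x. \<eta> (k * x + l)) \<psi> p q"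
    and k: "k = 1 \<or> k = -1" and m: "\<And>y. y \<in> {a..b} \<Longrightarrow> k * (y - l) \<in> {c..d}"
  shows "solves a b A B \<kappa> \<eta> (\<lambda>y. \<psi> (k * (y - l))) (\<lambda>y. k * p (k * (y - l))) (\<lambda>y. q (k * (y - l)))"
  unfolding solves_def
proof (intro ballI conjI)
  fix y assume y: "y \<in> {a..b}"
  have d: "((\<lambda>y. k * (y - l)) has_real_derivative k) (at y within {a..b})"
    by (auto intro!: derivative_eq_intros)
  have ch: "((\<lambda>y. f (k * (y - l))) has_real_derivative f' (k * (y - l)) * k) (at y within {a..b})"
    if "\<And>x. x \<in> {c..d} \<Longrightarrow> (f has_real_derivative f' x) (at x within {c..d})" for f f'
    by (rule DERIV_image_chain[of f _ "\<lambda>y. k * (y - l)", unfolded o_def, OF _ d])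
       (rule has_field_derivative_subset[OF that[OF m[OF y]]], use m in auto)
  show "((\<lambda>y. \<psi> (k * (y - l))) has_real_derivative k * p (k * (y - l))) (at y within {a..b})"
    using ch[of \<psi> p] solvesD(1)[OF s] by (simp add: mult.commute)
  have "((\<lambda>y. p (k * (y - l))) has_real_derivative q (k * (y - l)) * k) (at y within {a..b})"
    using ch[of p q] solvesD(2)[OF s] by simp
  from DERIV_cmult[OF this, of k]
  show "((\<lambda>y. k * p (k * (y - l))) has_real_derivative q (k * (y - l))) (at y within {a..b})"
    using k by auto
  have "k * (k * (y - l)) + l = y" using k by auto
  then show "A y * q (k * (y - l)) - B y * (k * p (k * (y - l))) + \<kappa> * \<psi> (k * (y - l)) = \<eta> y"
    using solvesD(3)[OF s m[OF y]] by (simp add: mult_ac)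
qed

lemma solves_add_scaled:
  assumes "solves a b A B \<kappa> \<eta> \<psi> p q" "solves a b A B \<kappa> (\<lambda>_. 0) u p' q'"
  shows "solves a b A B \<kappa> \<eta> (\<lambda>x. \<psi> x + r * u x) (\<lambda>x. p x + r * p' x) (\<lambda>x. q x + r * q' x)"
  unfolding solves_def
proof (intro ballI conjI)
  fix x assume x: "x \<in> {a..b}"
  note s = solvesD[OF assms(1) x] and t = solvesD[OF assms(2) x]
  show "((\<lambda>x. \<psi> x + r * u x) has_real_derivative p x + r * p' x) (at x within {a..b})"
    "((\<lambda>x. p x + r * p' x) has_real_derivative q x + r * q' x) (at x within {a..b})"
    by (intro DERIV_add DERIV_cmult s t)+
  have "A x * (q x + r * q' x) - B x * (p x + r * p' x) + \<kappa> * (\<psi> x + r * u x)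
     = (A x * q x - B x * p x + \<kappa> * \<psi> x) + r * (A x * q' x - B x * p' x + \<kappa> * u x)"
    by (simp add: algebra_simps)
  then show "A x * (q x + r * q' x) - B x * (p x + r * p' x) + \<kappa> * (\<psi> x + r * u x) = \<eta> x"
    using s(3) t(3) by simp
qed

lemma solves_scaled:
  assumes "solves a b A B \<kappa> (\<lambda>_. 0) u p q"
  shows "solves a b A B \<kappa> (\<lambda>_. 0) (\<lambda>x. r * u x) (\<lambda>x. r * p x) (\<lambda>x. r * q x)"
proof -
  have "solves a b A B \<kappa> (\<lambda>_. 0) (\<lambda>_. 0) (\<lambda>_. 0) (\<lambda>_. 0)" by (simp add: solves_def)
  from solves_add_scaled[OF this assms] show ?thesis by simp
qed

lemma deriv_glue_on:
  assumes f: "\<And>x. x \<in> {a..m} \<Longrightarrow> (f has_real_derivative f' x) (at x within {a..m})"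
    and g: "\<And>x. x \<in> {m..b} \<Longrightarrow> (g has_real_derivative g' x) (at x within {m..b})"
    and m: "a < m" "m < b" and eq: "f m = g m" "f' m = g' m" and x: "x \<in> {a..b}"
  shows "((\<lambda>x. if x \<le> m then f x else g x) has_real_derivative (if x \<le> m then f' x else g' x)) (at x within {a..b})"
proof -
  let ?h = "\<lambda>x. if x \<le> m then f x else g x"
  consider "x < m" | "x = m" | "m < x" by linarith
  then show ?thesis
  proof cases
    case 1
    have "(?h has_real_derivative f' x) (at x within {a..m})"
      by (rule deriv_within_cong[OF _ _ f]) (use 1 x in auto)
    then show ?thesis using 1 m at_within_interval_left[OF 1, of b a] by simp
  next
    case 2
    have "(?h has_real_derivative f' m) (at m within {a..b})"
      by (rule deriv_glue) (use f[of m] g[of m] m eq in auto)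
    then show ?thesis using 2 by simp
  next
    case 3
    have "(?h has_real_derivative g' x) (at x within {m..b})"
      by (rule deriv_within_cong[OF _ _ g]) (use 3 x eq in auto)
    then show ?thesis using 3 m at_within_interval_right[OF 3, of a b] by simp
  qed
qed

text \<open>Where \<open>A\<close> does not vanish, the equation determines the second derivative from the value and the
  first derivative, so only these have to match.\<close>

lemma solves_glue:
  assumes s: "solves a m A B \<kappa> \<eta> \<psi>1 p1 q1" and t: "solves m b A B \<kappa> \<eta> \<psi>2 p2 q2"
    and m: "a < m" "m < b" and eq: "\<psi>1 m = \<psi>2 m" "p1 m = p2 m" and A: "A m \<noteq> 0"
  shows "solves a b A B \<kappa> \<eta> (\<lambda>x. if x \<le> m then \<psi>1 x else \<psi>2 x)
     (\<lambda>x. if x \<le> m then p1 x else p2 x) (\<lambda>x. if x \<le> m then q1 x else q2 x)"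
proof -
  have "A m * q1 m - B m * p1 m + \<kappa> * \<psi>1 m = A m * q2 m - B m * p2 m + \<kappa> * \<psi>2 m"
    using solvesD(3)[OF s, of m] solvesD(3)[OF t, of m] m by simp
  then have "A m * q1 m = A m * q2 m" using eq by simp
  then have q: "q1 m = q2 m" using A by simp
  show ?thesis unfolding solves_def
  proof (intro ballI conjI)
    fix x assume x: "x \<in> {a..b}"
    show "((\<lambda>x. if x \<le> m then \<psi>1 x else \<psi>2 x) has_real_derivative (if x \<le> m then p1 x else p2 x)) (at x within {a..b})"
      by (rule deriv_glue_on[OF solvesD(1)[OF s] solvesD(1)[OF t] m eq x])
    show "((\<lambda>x. if x \<le> m then p1 x else p2 x) has_real_derivative (if x \<le> m then q1 x else q2 x)) (at x within {a..b})"
      by (rule deriv_glue_on[OF solvesD(2)[OF s] solvesD(2)[OF t] m eq(2) q x])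
    show "A x * (if x \<le> m then q1 x else q2 x) - B x * (if x \<le> m then p1 x else p2 x)
        + \<kappa> * (if x \<le> m then \<psi>1 x else \<psi>2 x) = \<eta> x"
      using solvesD(3)[OF s, of x] solvesD(3)[OF t, of x] x by auto
  qed
qed

text \<open>Where \<open>A\<close> does not vanish, the second derivative is a smooth expression in \<open>u\<close> and \<open>u'\<close>, which
  raises the class of \<open>u\<close> step by step.\<close>

lemma solves_regular_smooth:
  assumes s: "solves a b A B \<kappa> \<eta> u p q"
    and sm: "\<And>n. Ck n a b A" "\<And>n. Ck n a b B" "\<And>n. Ck n a b \<eta>" and A: "\<And>x. x \<in> {a..b} \<Longrightarrow> A x \<noteq> 0"
  shows "Ck n a b u"
proof -
  have "Ck n a b u \<and> Ck n a b p" for n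
  proof (induction n)
    case 0
    show ?case unfolding Ck.simps(1)
      by (rule conjI[OF DERIV_continuous_on[OF solvesD(1)[OF s]] DERIV_continuous_on[OF solvesD(2)[OF s]]])
  next
    case (Suc n)
    have "Ck n a b (\<lambda>x. (\<eta> x + B x * p x - \<kappa> * u x) / A x)"
      using Suc by (intro Ck_divide Ck_diff Ck_add Ck_mult Ck_const sm A) auto
    then have "Ck n a b q"
    proof (rule Ck_cong[rotated])
      fix x assume x: "x \<in> {a..b}"
      have "A x * q x = \<eta> x + B x * p x - \<kappa> * u x" using solvesD(3)[OF s x] by linarith
      then show "(\<eta> x + B x * p x - \<kappa> * u x) / A x = q x" using A[OF x] by (simp add: field_simps)
    qed
    from Ck_SucI[OF solvesD(2)[OF s] this] have "Ck (Suc n) a b p" .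
    moreover have "Ck (Suc n) a b u" by (rule Ck_SucI[OF solvesD(1)[OF s]]) (use Suc in auto)
    ultimately show ?case by blast
  qed
  then show ?thesis by blast
qed

text \<open>Around \<open>m\<close> the glued function is smooth because it solves a regular equation there; this
  neighbourhood overlaps the two halves, where smoothness is assumed.\<close>

lemma glue_smooth:
  assumes s: "solves a m A B \<kappa> \<eta> \<psi>1 p1 q1" and t: "solves m b A B \<kappa> \<eta> \<psi>2 p2 q2"
    and m: "a < m" "m < b" and eq: "\<psi>1 m = \<psi>2 m" "p1 m = p2 m" and A: "\<And>x. x \<in> {a<..<b} \<Longrightarrow> A x \<noteq> 0"
    and sm: "\<And>n. Ck n a b A" "\<And>n. Ck n a b B" "\<And>n. Ck n a b \<eta>"
    and C: "\<And>n. Ck n a m \<psi>1" "\<And>n. Ck n m b \<psi>2"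
  shows "Ck n a b (\<lambda>x. if x \<le> m then \<psi>1 x else \<psi>2 x)" (is "Ck n a b ?h")
proof -
  let ?l = "(a + m) / 2" and ?r = "(m + b) / 2"
  have sub: "{?l..?r} \<subseteq> {a..b}" using m by auto
  have g: "solves a b A B \<kappa> \<eta> ?h (\<lambda>x. if x \<le> m then p1 x else p2 x) (\<lambda>x. if x \<le> m then q1 x else q2 x)"
    by (rule solves_glue[OF s t m eq]) (use A m in auto)
  have mid: "Ck n ?l ?r ?h" for n
    by (rule solves_regular_smooth[OF solves_subset[OF g sub] sm(1)[THEN Ck_subset] sm(2)[THEN Ck_subset] sm(3)[THEN Ck_subset]])
       (use sub A m in auto)
  have "Ck n a m ?h" for n by (rule Ck_cong[OF _ C(1)]) simp
  then have "Ck n a ?r ?h" for n by (rule Ck_union_overlap[OF _ mid]) (use m in auto)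
  moreover have "Ck n m b ?h" for n by (rule Ck_cong[OF _ C(2)]) (use eq in auto)
  ultimately show ?thesis by (rule Ck_union_overlap) (use m in auto)
qed

text \<open>A Fredholm alternative. The left half of the interval carries the smooth solutions
  \<open>\<psi>1 + x u1\<close>, the right half the smooth solutions \<open>\<psi>2 + y u2\<close>, where \<open>u1\<close> and \<open>u2\<close> solve the
  homogeneous equation. Matching values and derivatives at the midpoint \<open>m\<close> is a linear system for \<open>x\<close> and \<open>y\<close>
  whose determinant is, up to sign, the Wronskian \<open>W\<close> of \<open>u1\<close> and \<open>u2\<close> at \<open>m\<close>. If \<open>W\<close> vanished,
  multiples of \<open>u1\<close> and \<open>u2\<close> would fit together to a nonzero smooth solution of the homogeneous
  equation on all of \<open>[a, b]\<close>.\<close>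

theorem singular_boundary_problem:
  fixes A B \<eta> :: "real \<Rightarrow> real"
  assumes ab: "a < b" and sm: "\<And>n. Ck n a b A" "\<And>n. Ck n a b B" "\<And>n. Ck n a b \<eta>"
    and A0: "A a = 0" "A b = 0" and Apos: "\<And>x. x \<in> {a<..<b} \<Longrightarrow> 0 < A x"
    and Aa: "(A has_real_derivative \<alpha>) (at a within {a..b})" "0 < \<alpha>"
    and Ab: "(A has_real_derivative \<beta>) (at b within {a..b})" "\<beta> < 0"
    and B0: "B a < 0" "0 < B b"
    and ker: "\<And>u p q. \<lbrakk>\<forall>n. Ck n a b u; solves a b A B \<kappa> (\<lambda>_. 0) u p q\<rbrakk> \<Longrightarrow> \<forall>x\<in>{a..b}. u x = 0"
  obtains \<psi> p q where "\<And>n. Ck n a b \<psi>" "solves a b A B \<kappa> \<eta> \<psi> p q"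
proof -
  define m where "m = (a + b) / 2"
  have m: "a < m" "m < b" using ab by (auto simp: m_def)
  \<comment> \<open>The values \<open>k = 1\<close>, \<open>l = a\<close> belong to the left half; \<open>k = -1\<close>, \<open>l = b\<close> belong to the right half,
    which is reflected so that the singular point becomes \<open>0\<close>.\<close>
  have half: "\<exists>\<psi> p q. (\<forall>n. Ck n x y \<psi>) \<and> \<psi> l = \<psi>0 \<and> solves x y A B \<kappa> \<eta> \<psi> p q"
    if side: "k = 1 \<and> l = a \<and> x = a \<and> y = m \<or> k = -1 \<and> l = b \<and> x = m \<and> y = b"
      and smh: "\<And>n. Ck n a b \<eta>"
    for k l x y \<psi>0 :: real and \<eta> :: "real \<Rightarrow> real"
  proof -
    define c where "c = m - a"
    have c: "0 < c" "c = b - m" using m by (auto simp: c_def m_def field_simps)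
    have k: "k = 1 \<or> k = -1" using side by blast
    have mem: "k * z + l \<in> {a..b}" if "z \<in> {0..c}" for z using side that m c by (auto simp: c_def)
    have sh: "Ck n 0 c (\<lambda>z. f (k * z + l))" if "Ck n a b f" for n f
      by (rule Ck_affine[OF that mem])
    have Ad: "\<exists>\<gamma>>0. ((\<lambda>z. A (k * z + l)) has_real_derivative \<gamma>) (at 0 within {0..c})"
    proof -
      have ch: "((\<lambda>z. A (k * z + l)) has_real_derivative D * k) (at 0 within {0..c})"
        if "(A has_real_derivative D) (at l within {a..b})" for D
        by (rule DERIV_image_chain[of A _ "\<lambda>z. k * z + l", unfolded o_def])
           (use mem in \<open>auto intro!: derivative_eq_intros has_field_derivative_subset[OF that]\<close>)
      from side show ?thesis
      proof (elim disjE conjE)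
        assume "k = 1" "l = a" then show ?thesis using ch[of \<alpha>] Aa by auto
      next
        assume "k = -1" "l = b" then show ?thesis using ch[of \<beta>] Ab by (intro exI[of _ "-\<beta>"]) auto
      qed
    qed
    then obtain \<gamma> where \<gamma>: "0 < \<gamma>" "((\<lambda>z. A (k * z + l)) has_real_derivative \<gamma>) (at 0 within {0..c})" by blast
    obtain \<psi> p q where s: "\<And>n. Ck n 0 c \<psi>" "\<psi> 0 = \<psi>0"
      "solves 0 c (\<lambda>z. A (k * z + l)) (\<lambda>z. k * B (k * z + l)) \<kappa> (\<lambda>z. \<eta> (k * z + l)) \<psi> p q"
    proof (rule regular_singular_solution[where c = c and A = "\<lambda>z. A (k * z + l)" and B = "\<lambda>z. k * B (k * z + l)"
          and \<eta> = "\<lambda>z. \<eta> (k * z + l)" and \<alpha> = \<gamma> and \<kappa> = \<kappa> and ?\<psi>0.0 = \<psi>0])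
      show "A (k * 0 + l) = 0" using side A0 by auto
      show "0 < A (k * z + l)" if "z \<in> {0<..c}" for z using that side m c by (intro Apos) (auto simp: c_def)
      show "k * B (k * 0 + l) < 0" using side B0 by auto
    qed (use c(1) \<gamma> in \<open>auto intro!: sh sm smh Ck_mult\<close>)
    have mem': "k * (z - l) \<in> {0..c}" if "z \<in> {x..y}" for z using side that c by (auto simp: c_def)
    have "Ck n x y (\<lambda>z. \<psi> (k * z + (- k * l)))" for n
      by (rule Ck_affine[OF s(1)]) (use mem' in \<open>auto simp: algebra_simps\<close>)
    then have "\<forall>n. Ck n x y (\<lambda>z. \<psi> (k * (z - l)))" by (simp add: right_diff_distrib)
    moreover have "solves x y A B \<kappa> \<eta> (\<lambda>z. \<psi> (k * (z - l))) (\<lambda>z. k * p (k * (z - l))) (\<lambda>z. q (k * (z - l)))"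
      by (rule solves_affine[OF s(3) k mem'])
    moreover have "\<psi> (k * (l - l)) = \<psi>0" using s(2) by simp
    ultimately show ?thesis by (intro exI conjI)
  qed
  obtain \<psi>1 p1 q1 where s1: "\<And>n. Ck n a m \<psi>1" "solves a m A B \<kappa> \<eta> \<psi>1 p1 q1"
    using half[of 1 a a m \<eta> 0, OF _ sm(3)] by auto
  obtain \<psi>2 p2 q2 where s2: "\<And>n. Ck n m b \<psi>2" "solves m b A B \<kappa> \<eta> \<psi>2 p2 q2"
    using half[of "-1" b m b \<eta> 0, OF _ sm(3)] by auto
  obtain u1 d1 e1 where u1: "\<And>n. Ck n a m u1" "u1 a = 1" "solves a m A B \<kappa> (\<lambda>_. 0) u1 d1 e1"
    using half[of 1 a a m "\<lambda>_. 0" 1] by auto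
  obtain u2 d2 e2 where u2: "\<And>n. Ck n m b u2" "u2 b = 1" "solves m b A B \<kappa> (\<lambda>_. 0) u2 d2 e2"
    using half[of "-1" b m b "\<lambda>_. 0" 1] by auto
  have An: "\<And>x. x \<in> {a<..<b} \<Longrightarrow> A x \<noteq> 0" using Apos by force
  define W where "W = u1 m * d2 m - u2 m * d1 m"
  have W: "W \<noteq> 0"
  proof
    assume W0: "W = 0"
    \<comment> \<open>The Cauchy data of \<open>u1\<close> and \<open>u2\<close> at \<open>m\<close> are linearly dependent.\<close>
    obtain r s where rs: "r \<noteq> 0 \<or> s \<noteq> 0" "r * u1 m = s * u2 m" "r * d1 m = s * d2 m"
    proof -
      consider "u1 m \<noteq> 0 \<or> u2 m \<noteq> 0" | "d1 m \<noteq> 0 \<or> d2 m \<noteq> 0" | "u1 m = 0" "u2 m = 0" "d1 m = 0" "d2 m = 0" by blast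
      then show ?thesis
      proof cases
        case 1 show ?thesis by (rule that[of "u2 m" "u1 m"]) (use 1 W0 in \<open>auto simp: W_def\<close>)
      next
        case 2 show ?thesis by (rule that[of "d2 m" "d1 m"]) (use 2 W0 in \<open>auto simp: W_def mult.commute\<close>)
      next
        case 3 show ?thesis by (rule that[of 1 1]) (use 3 in auto)
      qed
    qed
    let ?u = "\<lambda>x. if x \<le> m then r * u1 x else s * u2 x"
    have "\<forall>n. Ck n a b ?u"
      by (intro allI glue_smooth[OF solves_scaled[OF u1(3), of r] solves_scaled[OF u2(3), of s] m rs(2,3) An sm(1,2) Ck_const]
           Ck_mult Ck_const u1 u2)
    from ker[OF this solves_glue[OF solves_scaled[OF u1(3), of r] solves_scaled[OF u2(3), of s] m rs(2,3) An]]
    have "\<forall>x\<in>{a..b}. ?u x = 0" using m by simp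
    then have "?u a = 0" "?u b = 0" using ab by auto
    then show False using rs(1) u1(2) u2(2) m by (auto split: if_splits)
  qed
  define r1 where "r1 = \<psi>2 m - \<psi>1 m"
  define r2 where "r2 = p2 m - p1 m"
  \<comment> \<open>Cramer's rule.\<close>
  define x where "x = (r1 * d2 m - r2 * u2 m) / W"
  define y where "y = (d1 m * r1 - u1 m * r2) / W"
  have e1: "x * u1 m - y * u2 m = r1"
  proof -
    have "x * u1 m - y * u2 m = r1 * W / W"
      by (simp add: x_def y_def W_def diff_divide_distrib algebra_simps)
    then show ?thesis using W by simp
  qed
  have e2: "x * d1 m - y * d2 m = r2"
  proof -
    have "x * d1 m - y * d2 m = r2 * W / W"
      by (simp add: x_def y_def W_def diff_divide_distrib algebra_simps)
    then show ?thesis using W by simp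
  qed
  note g1 = solves_add_scaled[OF s1(2) u1(3), of x] and g2 = solves_add_scaled[OF s2(2) u2(3), of y]
  have eq: "\<psi>1 m + x * u1 m = \<psi>2 m + y * u2 m" "p1 m + x * d1 m = p2 m + y * d2 m"
    using e1 e2 by (auto simp: r1_def r2_def)
  show ?thesis
  proof (rule that)
    show "Ck n a b (\<lambda>z. if z \<le> m then \<psi>1 z + x * u1 z else \<psi>2 z + y * u2 z)" for n
      by (intro glue_smooth[OF g1 g2 m eq An sm] Ck_add Ck_mult Ck_const s1 s2 u1 u2)
    show "solves a b A B \<kappa> \<eta> (\<lambda>z. if z \<le> m then \<psi>1 z + x * u1 z else \<psi>2 z + y * u2 z)
      (\<lambda>z. if z \<le> m then p1 z + x * d1 z else p2 z + y * d2 z)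
      (\<lambda>z. if z \<le> m then q1 z + x * e1 z else q2 z + y * e2 z)"
      by (rule solves_glue[OF g1 g2 m eq An]) (use m in auto)
  qed
qed

section \<open>Change of variables for nonnegative integrals\<close>

text \<open>For absolutely integrable functions the two integrals have the same finite values; for nonnegative
  functions one of them is therefore infinite exactly if the other one is.\<close>

lemma nn_integral_change_of_variables_wellorder:
  fixes g :: "real^'m::{finite,wellorder} \<Rightarrow> real^'m::_" and f :: "real^'m::_ \<Rightarrow> real"
  assumes S: "S \<in> sets borel"
    and der: "\<And>x. x \<in> S \<Longrightarrow> (g has_derivative g' x) (at x within S)"
    and inj: "inj_on g S"
    and f: "(\<lambda>y. f y * indicat_real (g ` S) y) \<in> borel_measurable borel" "\<And>y. 0 \<le> f y"
    and m: "(\<lambda>x. \<bar>det (matrix (g' x))\<bar> * f (g x) * indicat_real S x) \<in> borel_measurable borel"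
  shows "(\<integral>\<^sup>+y. ennreal (f y * indicat_real (g ` S) y) \<partial>lborel)
       = (\<integral>\<^sup>+x. ennreal (\<bar>det (matrix (g' x))\<bar> * f (g x) * indicat_real S x) \<partial>lborel)"
proof -
  let ?h = "\<lambda>x. \<bar>det (matrix (g' x))\<bar> * f (g x)"
  let ?F = "\<lambda>y. f y * indicat_real (g ` S) y" and ?H = "\<lambda>x. ?h x * indicat_real S x"
  have SL: "S \<in> sets lebesgue" using S by simp
  have hi: "((\<lambda>x. u x * indicat_real T x) has_integral r) UNIV \<longleftrightarrow> (u has_integral r) T" for u :: "real^'m::_ \<Rightarrow> real" and T r
  proof -
    have "(\<lambda>x. u x * indicat_real T x) = (\<lambda>x. if x \<in> T then u x else 0)" by (auto simp: indicator_def)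
    then show ?thesis using has_integral_restrict_UNIV[of T u r] by simp
  qed
  have eq: "(?h has_integral r) S \<longleftrightarrow> (f has_integral r) (g ` S)" for r
  proof -
    have a: "u absolutely_integrable_on T \<and> (u has_integral r) T \<longleftrightarrow> (u has_integral r) T"
      if "\<And>x. x \<in> T \<Longrightarrow> 0 \<le> u x" for u :: "real^'m::_ \<Rightarrow> real" and T
      using absolutely_integrable_on_iff_nonneg[of T u] that by (auto simp: has_integral_iff)
    have "(?h absolutely_integrable_on S \<and> (?h has_integral r) S)
       \<longleftrightarrow> (f absolutely_integrable_on (g ` S) \<and> (f has_integral r) (g ` S))"
      using has_absolute_integral_change_of_variables[OF SL der inj, of "\<lambda>x. vec (f x) :: real^1" "vec r"]
      unfolding integrable_on_1_iff integral_on_1_eq absolutely_integrable_on_1_iff absolutely_integrable_drop absolutely_integrable_on_def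
      by (auto simp: o_def has_integral_iff)
    then show ?thesis using a[of S ?h] a[of "g ` S" f] f(2) by auto
  qed
  have b: "(u has_integral r) UNIV \<longleftrightarrow> integral\<^sup>N lborel (\<lambda>x. ennreal (u x)) = ennreal r"
    if "\<And>x. 0 \<le> u x" "0 \<le> r" "u \<in> borel_measurable borel" for u :: "real^'m::_ \<Rightarrow> real" and r
    unfolding has_integral_iff_nn_integral_lebesgue[OF that(1)]
    using that by (auto simp: nn_integral_completion measurable_completion)
  have c: "integral\<^sup>N lborel (\<lambda>x. ennreal (?F x)) = ennreal r \<longleftrightarrow> integral\<^sup>N lborel (\<lambda>x. ennreal (?H x)) = ennreal r"
    if "0 \<le> r" for r
    using b[of ?F r] b[of ?H r] f m that hi[of f "g ` S" r] hi[of ?h S r] eq[of r] by auto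
  show ?thesis
  proof (cases "integral\<^sup>N lborel (\<lambda>x. ennreal (?F x)) = \<infinity>")
    case True
    then show ?thesis using c by (cases "integral\<^sup>N lborel (\<lambda>x. ennreal (?H x))") auto
  next
    case False
    then obtain r where r: "0 \<le> r" "integral\<^sup>N lborel (\<lambda>x. ennreal (?F x)) = ennreal r"
      by (cases "integral\<^sup>N lborel (\<lambda>x. ennreal (?F x))") auto
    then show ?thesis using c[OF r(1)] by metis
  qed
qed

text \<open>Coordinates are now allowed to be indexed by an arbitrary finite type. The copy \<open>'a wo\<close> of
  such a type carries the well-order of an injection into the natural numbers, and renaming the
  coordinates changes neither Lebesgue measure nor determinants.\<close>

typedef 'a wo = "UNIV :: 'a set" by simp

lemma range_Abs_wo: "range Abs_wo = UNIV"
  by (rule surjI[of _ Rep_wo]) (rule Rep_wo_inverse)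

instance wo :: (finite) finite
  by standard (metis finite finite_imageI range_Abs_wo)

instantiation wo :: (finite) wellorder
begin

definition wo_index :: "'a wo \<Rightarrow> nat" where
  "wo_index = (SOME h. inj h)"

lemma inj_wo_index: "inj (wo_index :: 'a wo \<Rightarrow> nat)"
proof -
  have "\<exists>h :: 'a wo \<Rightarrow> nat. inj h"
    using finite_imp_inj_to_nat_seg[OF finite[of "UNIV :: 'a wo set"]] by (elim exE conjE) (rule exI)
  from someI_ex[OF this] show ?thesis unfolding wo_index_def .
qed

definition less_eq_wo :: "'a wo \<Rightarrow> 'a wo \<Rightarrow> bool" where
  "less_eq_wo x y \<longleftrightarrow> wo_index x \<le> wo_index y"

definition less_wo :: "'a wo \<Rightarrow> 'a wo \<Rightarrow> bool" where
  "less_wo x y \<longleftrightarrow> wo_index x < wo_index y"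

instance
proof
  fix x y z :: "'a wo" and P :: "'a wo \<Rightarrow> bool"
  show "x = y" if "x \<le> y" "y \<le> x"
    using that inj_wo_index by (auto simp: less_eq_wo_def inj_def)
  show "P x" if "\<And>x. (\<And>y. y < x \<Longrightarrow> P y) \<Longrightarrow> P x"
    by (rule measure_induct_rule[of wo_index]) (rule that, simp add: less_wo_def)
qed (auto simp: less_eq_wo_def less_wo_def)

end

definition to_wo :: "real^'n \<Rightarrow> real^('n wo)" where "to_wo v = (\<chi> i. v $ Rep_wo i)"
definition of_wo :: "real^('n wo) \<Rightarrow> real^'n" where "of_wo w = (\<chi> i. w $ Abs_wo i)"

lemma of_to_wo [simp]: "of_wo (to_wo v) = v" "to_wo (of_wo w) = w"
  by (simp_all add: of_wo_def to_wo_def vec_eq_iff Abs_wo_inverse Rep_wo_inverse)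

lemma linear_to_wo: "linear (to_wo :: real^'n::finite \<Rightarrow> _)"
  by (rule linearI) (simp_all add: to_wo_def vec_eq_iff)

lemma linear_of_wo: "linear (of_wo :: real^('n::finite wo) \<Rightarrow> _)"
  by (rule linearI) (simp_all add: of_wo_def vec_eq_iff)

lemma bounded_linear_wo: "bounded_linear (to_wo :: real^'n::finite \<Rightarrow> _)" "bounded_linear (of_wo :: real^('n wo) \<Rightarrow> _)"
  using linear_to_wo linear_of_wo by (auto intro: linear_conv_bounded_linear[THEN iffD1])

lemma bij_Rep_wo: "bij Rep_wo"
proof (rule bijI)
  show "inj Rep_wo" by (rule injI) (simp add: Rep_wo_inject)
  show "surj Rep_wo" by (rule surjI[of _ Abs_wo]) (simp add: Abs_wo_inverse)
qed

lemma to_wo_measurable [measurable]: "(to_wo :: real^'n::finite \<Rightarrow> _) \<in> borel_measurable borel"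
  "(of_wo :: real^('n::finite wo) \<Rightarrow> _) \<in> borel_measurable borel"
  using bounded_linear_wo by (auto intro!: borel_measurable_continuous_onI linear_continuous_on)

lemma emeasure_lborel_box_cart:
  "emeasure lborel (box l (u :: real^'n::finite)) = (if \<forall>i. l $ i \<le> u $ i then \<Prod>i\<in>UNIV. u $ i - l $ i else 0)"
  by (simp add: emeasure_lborel_box_eq Basis_vec_def cart_eq_inner_axis axis_eq_axis prod.UNION_disjoint inner_diff_left)

lemma lborel_distr_to_wo: "distr lborel borel (to_wo :: real^'n::finite \<Rightarrow> _) = lborel"
proof (rule lborel_eqI[symmetric])
  fix l u :: "real^('n wo)" assume lu: "\<And>b. b \<in> Basis \<Longrightarrow> l \<bullet> b \<le> u \<bullet> b"
  have lu': "l $ i \<le> u $ i" for i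
    using lu[of "axis i 1"] by (simp add: cart_eq_inner_axis)
  have "to_wo -` box l u = box (of_wo l) (of_wo u)"
  proof -
    have "(\<forall>i. l $ i < v $ Rep_wo i \<and> v $ Rep_wo i < u $ i) \<longleftrightarrow>
          (\<forall>i. l $ Abs_wo i < v $ i \<and> v $ i < u $ Abs_wo i)" for v :: "real^'n"
    proof -
      have "(\<forall>i::'n wo. P i) \<longleftrightarrow> (\<forall>j. P (Abs_wo j))" for P
        by (metis Rep_wo_inverse)
      then show ?thesis by (simp add: Abs_wo_inverse)
    qed
    then show ?thesis by (auto simp: mem_box_cart to_wo_def of_wo_def)
  qed
  then have "emeasure (distr lborel borel to_wo) (box l u) = emeasure lborel (box (of_wo l) (of_wo u))"
    by (subst emeasure_distr) auto
  also have "\<dots> = (\<Prod>i\<in>UNIV. u $ Abs_wo i - l $ Abs_wo i)"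
    using lu' by (simp add: emeasure_lborel_box_cart of_wo_def)
  also have "(\<Prod>i\<in>UNIV. u $ Abs_wo i - l $ Abs_wo i) = (\<Prod>i\<in>UNIV. u $ i - l $ i)"
    by (rule prod.reindex_bij_witness[of _ Rep_wo Abs_wo]) (auto simp: Abs_wo_inverse Rep_wo_inverse)
  also have "ennreal \<dots> = emeasure lborel (box l u)"
    using lu' by (simp add: emeasure_lborel_box_cart)
  also have "\<dots> = (\<Prod>b\<in>Basis. (u - l) \<bullet> b)" using lu by (rule emeasure_lborel_box)
  finally show "emeasure (distr lborel borel to_wo) (box l u) = (\<Prod>b\<in>Basis. (u - l) \<bullet> b)" .
qed simp

text \<open>Renaming rows and columns simultaneously conjugates the permutations in the Leibniz formula, and
  conjugate permutations have the same sign.\<close>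

lemma det_matrix_wo:
  fixes L :: "real^'n::finite \<Rightarrow> real^'n"
  shows "det (matrix (to_wo \<circ> L \<circ> of_wo)) = det (matrix L)"
proof -
  have ax: "of_wo (axis j 1) = axis (Rep_wo j) (1::real)" for j :: "'n wo"
    by (auto simp: of_wo_def vec_eq_iff axis_def Abs_wo_inverse Rep_wo_inverse)
  have ent: "matrix (to_wo \<circ> L \<circ> of_wo) $ i $ j = matrix L $ Rep_wo i $ Rep_wo j" for i j
    by (simp add: matrix_def ax to_wo_def)
  have inj: "inj (Rep_wo :: 'n wo \<Rightarrow> 'n)" using bij_Rep_wo by (rule bij_is_inj)
  have inj': "inj (Abs_wo :: 'n \<Rightarrow> 'n wo)" by (metis Abs_wo_inverse UNIV_I injI)
  have bijA: "bij (Abs_wo :: 'n \<Rightarrow> 'n wo)" using inj' range_Abs_wo by (simp add: bij_def)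
  have mp: "map_permutation UNIV Rep_wo p = Rep_wo \<circ> p \<circ> Abs_wo" for p :: "'n wo \<Rightarrow> 'n wo"
  proof -
    have "inv Rep_wo = (Abs_wo :: 'n \<Rightarrow> 'n wo)" by (rule inv_equality) (auto simp: Abs_wo_inverse Rep_wo_inverse)
    moreover have "surj (Rep_wo :: 'n wo \<Rightarrow> 'n)" using bij_Rep_wo by (rule bij_is_surj)
    ultimately show ?thesis by (simp add: map_permutation_def restrict_id_def fun_eq_iff)
  qed
  show ?thesis unfolding det_def ent
  proof (rule sum.reindex_bij_witness[where i = "\<lambda>q. Abs_wo \<circ> q \<circ> Rep_wo" and j = "\<lambda>p. Rep_wo \<circ> p \<circ> Abs_wo"])
    fix p :: "'n wo \<Rightarrow> 'n wo" assume p: "p \<in> {p. p permutes UNIV}"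
    show "Abs_wo \<circ> (Rep_wo \<circ> p \<circ> Abs_wo) \<circ> Rep_wo = p" by (simp add: fun_eq_iff Rep_wo_inverse)
    show "Rep_wo \<circ> p \<circ> Abs_wo \<in> {p. p permutes UNIV}"
      using bij_comp[OF bij_comp[OF bijA permutes_bij] bij_Rep_wo] p by (auto intro!: bij_imp_permutes simp: comp_assoc)
    have "sign (Rep_wo \<circ> p \<circ> Abs_wo) = sign p"
      using sign_map_permutation[OF inj, of p] p by (simp add: mp)
    moreover have "(\<Prod>i\<in>UNIV. matrix L $ i $ (Rep_wo \<circ> p \<circ> Abs_wo) i) = (\<Prod>i\<in>UNIV. matrix L $ Rep_wo i $ Rep_wo (p i))"
      by (rule prod.reindex_bij_witness[of _ Rep_wo Abs_wo]) (auto simp: Abs_wo_inverse Rep_wo_inverse)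
    ultimately show "of_int (sign (Rep_wo \<circ> p \<circ> Abs_wo)) * (\<Prod>i\<in>UNIV. matrix L $ i $ (Rep_wo \<circ> p \<circ> Abs_wo) i)
      = of_int (sign p) * (\<Prod>i\<in>UNIV. matrix L $ Rep_wo i $ Rep_wo (p i))" by simp
  next
    fix q :: "'n \<Rightarrow> 'n" assume q: "q \<in> {p. p permutes UNIV}"
    show "Rep_wo \<circ> (Abs_wo \<circ> q \<circ> Rep_wo) \<circ> Abs_wo = q" by (simp add: fun_eq_iff Abs_wo_inverse)
    show "Abs_wo \<circ> q \<circ> Rep_wo \<in> {p. p permutes UNIV}"
      using bij_comp[OF bij_comp[OF bij_Rep_wo permutes_bij] bijA] q by (auto intro!: bij_imp_permutes simp: comp_assoc)
  qed
qed

theorem nn_integral_change_of_variables: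
  fixes g :: "real^'n::finite \<Rightarrow> real^'n" and f :: "real^'n \<Rightarrow> real"
  assumes S: "S \<in> sets borel"
    and der: "\<And>x. x \<in> S \<Longrightarrow> (g has_derivative g' x) (at x within S)"
    and inj: "inj_on g S"
    and f: "(\<lambda>y. f y * indicat_real (g ` S) y) \<in> borel_measurable borel" "\<And>y. 0 \<le> f y"
    and m: "(\<lambda>x. \<bar>det (matrix (g' x))\<bar> * f (g x) * indicat_real S x) \<in> borel_measurable borel"
  shows "(\<integral>\<^sup>+y. ennreal (f y * indicat_real (g ` S) y) \<partial>lborel)
       = (\<integral>\<^sup>+x. ennreal (\<bar>det (matrix (g' x))\<bar> * f (g x) * indicat_real S x) \<partial>lborel)"
proof -
  let ?g = "to_wo \<circ> g \<circ> of_wo" and ?g' = "\<lambda>x. to_wo \<circ> g' (of_wo x) \<circ> of_wo" and ?f = "f \<circ> of_wo" and ?S = "of_wo -` S"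
  have gS: "?g ` ?S = of_wo -` (g ` S)"
  proof (intro set_eqI iffI)
    fix w assume "w \<in> of_wo -` (g ` S)"
    then obtain x where "x \<in> S" "of_wo w = g x" by auto
    then have "w = ?g (to_wo x)" "to_wo x \<in> ?S"
      using of_to_wo(2)[of w] by simp_all
    then show "w \<in> ?g ` ?S" by blast
  qed auto
  let ?F = "\<lambda>y. f y * indicat_real (g ` S) y"
  let ?H = "\<lambda>x. \<bar>det (matrix (g' x))\<bar> * f (g x) * indicat_real S x"
  have 1: "?f y * indicat_real (?g ` ?S) y = ?F (of_wo y)" for y
    unfolding gS by (auto simp: indicator_def)
  have 2: "\<bar>det (matrix (?g' x))\<bar> * ?f (?g x) * indicat_real ?S x = ?H (of_wo x)" for x
    by (auto simp: indicator_def det_matrix_wo)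
  have "(\<integral>\<^sup>+y. ennreal (?f y * indicat_real (?g ` ?S) y) \<partial>lborel)
      = (\<integral>\<^sup>+x. ennreal (\<bar>det (matrix (?g' x))\<bar> * ?f (?g x) * indicat_real ?S x) \<partial>lborel)"
  proof (rule nn_integral_change_of_variables_wellorder)
    show "?S \<in> sets borel" using measurable_sets[OF to_wo_measurable(2) S] by simp
    show "inj_on ?g ?S"
    proof (rule inj_onI)
      fix x y assume xy: "x \<in> ?S" "y \<in> ?S" "?g x = ?g y"
      then have "of_wo (?g x) = of_wo (?g y)" by simp
      then have "of_wo x = of_wo y" using inj xy(1,2) by (simp add: inj_on_def)
      then have "to_wo (of_wo x) = to_wo (of_wo y)" by simp
      then show "x = y" by simp
    qed
    show "(?g has_derivative ?g' x) (at x within ?S)" if "x \<in> ?S" for x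
    proof -
      have "((\<lambda>x. g (of_wo x)) has_derivative (\<lambda>h. g' (of_wo x) (of_wo h))) (at x within ?S)"
      proof (rule has_derivative_in_compose[OF bounded_linear_imp_has_derivative[OF bounded_linear_wo(2)]])
        show "(g has_derivative g' (of_wo x)) (at (of_wo x) within of_wo ` ?S)"
          by (rule has_derivative_subset[OF der]) (use that in auto)
      qed
      from bounded_linear.has_derivative[OF bounded_linear_wo(1) this]
      show ?thesis by (simp add: o_def)
    qed
    show "(\<lambda>y. ?f y * indicat_real (?g ` ?S) y) \<in> borel_measurable borel"
      unfolding 1 by (rule measurable_compose[OF to_wo_measurable(2) f(1)])
    show "(\<lambda>x. \<bar>det (matrix (?g' x))\<bar> * ?f (?g x) * indicat_real ?S x) \<in> borel_measurable borel"
      unfolding 2 by (rule measurable_compose[OF to_wo_measurable(2) m])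
  qed (use f(2) in auto)
  then have "(\<integral>\<^sup>+y. ennreal (?F (of_wo y)) \<partial>lborel) = (\<integral>\<^sup>+x. ennreal (?H (of_wo x)) \<partial>lborel)"
    unfolding 1 2 .
  moreover have tr: "(\<integral>\<^sup>+y. ennreal (h (of_wo y)) \<partial>lborel) = (\<integral>\<^sup>+y. ennreal (h y) \<partial>lborel)"
    if h: "h \<in> borel_measurable borel" for h :: "real^'n \<Rightarrow> real"
  proof -
    have hw: "(\<lambda>y. ennreal (h (of_wo y))) \<in> borel_measurable borel"
      by (intro measurable_compose[OF measurable_compose[OF to_wo_measurable(2) h]] measurable_ennreal)
    have "(\<integral>\<^sup>+y. ennreal (h (of_wo y)) \<partial>lborel) = (\<integral>\<^sup>+y. ennreal (h (of_wo y)) \<partial>(distr lborel borel to_wo))"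
      by (simp only: lborel_distr_to_wo)
    also have "\<dots> = (\<integral>\<^sup>+y. ennreal (h (of_wo (to_wo y))) \<partial>lborel)"
      by (rule nn_integral_distr) (use hw to_wo_measurable in auto)
    finally show ?thesis by simp
  qed
  ultimately show ?thesis using tr[OF f(1)] tr[OF m] by (simp only:)
qed

section \<open>Positive definite matrices\<close>

definition posdef :: "real^'n^'n::finite \<Rightarrow> bool" where
  "posdef G \<longleftrightarrow> transpose G = G \<and> (\<forall>v. v \<noteq> 0 \<longrightarrow> 0 < v \<bullet> (G *v v))"

lemma posdef_nonneg: "posdef G \<Longrightarrow> 0 \<le> v \<bullet> (G *v v)"
  by (cases "v = 0") (auto simp: posdef_def less_imp_le)

lemma posdef_sym: "posdef G \<Longrightarrow> v \<bullet> (G *v w) = w \<bullet> (G *v v)"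
  by (metis posdef_def dot_lmul_matrix inner_commute vector_transpose_matrix)

lemma pos_imp_invertible:
  assumes "\<And>v. v \<noteq> 0 \<Longrightarrow> 0 < v \<bullet> (G *v v)" shows "invertible (G :: real^'n^'n::finite)"
proof -
  have "\<forall>x. G *v x = 0 \<longrightarrow> x = 0"
    using assms by (metis inner_zero_right less_irrefl)
  then show ?thesis unfolding invertible_left_inverse matrix_left_invertible_ker .
qed

text \<open>Along the segment from the identity to \<open>G\<close> all matrices are positive definite, hence invertible, so
  the determinant does not change its sign.\<close>

lemma posdef_det_pos:
  assumes G: "posdef (G :: real^'n^'n::finite)" shows "0 < det G"
proof (rule ccontr)
  assume "\<not> 0 < det G"
  then have neg: "det G \<le> 0" by simp
  let ?P = "\<lambda>t::real. (1 - t) *\<^sub>R mat 1 + t *\<^sub>R G"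
  have "continuous_on {0..1} (\<lambda>t. det (?P t))"
    unfolding det_def by (intro continuous_intros)
  moreover have "det (?P 1) \<le> 0" "0 \<le> det (?P 0)" using neg by simp_all
  ultimately obtain t where t: "0 \<le> t" "t \<le> 1" "det (?P t) = 0"
    using IVT2'[of "\<lambda>t. det (?P t)" 1 0 0] by auto
  have "invertible (?P t)"
  proof (rule pos_imp_invertible)
    fix v :: "real^'n" assume v: "v \<noteq> 0"
    have e: "v \<bullet> (?P t *v v) = (1 - t) * (v \<bullet> v) + t * (v \<bullet> (G *v v))"
      by (simp add: matrix_vector_mult_add_rdistrib scaleR_matrix_vector_assoc[symmetric] inner_add_right)
    have "0 < v \<bullet> v" "0 < v \<bullet> (G *v v)" using v G by (auto simp: posdef_def)
    then show "0 < v \<bullet> (?P t *v v)"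
      unfolding e using t by (cases "t = 0") (auto intro: add_nonneg_pos)
  qed
  then show False using t(3) by (simp add: invertible_det_nz)
qed

lemma posdef_inverse:
  assumes "posdef (G :: real^'n^'n::finite)"
  shows "matrix_inv G *v (G *v v) = v" "G *v (matrix_inv G *v v) = v"
proof -
  have "invertible G" using assms by (intro pos_imp_invertible) (auto simp: posdef_def)
  then have "\<exists>A'. G ** A' = mat 1 \<and> A' ** G = mat 1" by (simp add: invertible_def)
  from someI_ex[OF this] have "matrix_inv G ** G = mat 1" "G ** matrix_inv G = mat 1"
    unfolding matrix_inv_def by auto
  then show "matrix_inv G *v (G *v v) = v" "G *v (matrix_inv G *v v) = v"
    by (simp_all add: matrix_vector_mul_assoc)
qed

lemma posdef_inverse_unique:
  assumes "posdef (G :: real^'n^'n::finite)" "G *v v = w" shows "matrix_inv G *v w = v"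
  using posdef_inverse(1)[OF assms(1), of v] assms(2) by simp

text \<open>By Cramer's rule the inverse depends on the entries through determinants, hence as regularly as
  the entries themselves.\<close>

lemma posdef_inverse_Cramer:
  assumes "posdef (G :: real^'n^'n::finite)"
  shows "(matrix_inv G *v v) $ k = det (\<chi> i j. if j = k then v $ i else G $ i $ j) / det G"
proof -
  have "det G \<noteq> 0" using posdef_det_pos[OF assms] by simp
  then have "matrix_inv G *v v = (\<chi> k. det (\<chi> i j. if j = k then v $ i else G $ i $ j) / det G)"
    using cramer[of G "matrix_inv G *v v" v] posdef_inverse(2)[OF assms] by blast
  then show ?thesis by simp
qed

lemma posdef_Cauchy_Schwarz:
  assumes G: "posdef G" shows "(v \<bullet> (G *v w))\<^sup>2 \<le> (v \<bullet> (G *v v)) * (w \<bullet> (G *v w))"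
proof (cases "w = 0")
  case True then show ?thesis by simp
next
  case False
  define c where "c = w \<bullet> (G *v w)"
  define b where "b = v \<bullet> (G *v w)"
  have c: "0 < c" using G False by (auto simp: c_def posdef_def)
  let ?u = "v - (b / c) *\<^sub>R w"
  have "0 \<le> ?u \<bullet> (G *v ?u)" by (rule posdef_nonneg[OF G])
  also have "?u \<bullet> (G *v ?u) = v \<bullet> (G *v v) - 2 * (b / c) * b + (b / c)\<^sup>2 * c"
    using posdef_sym[OF G, of w v]
    by (simp add: matrix_vector_mult_diff_distrib matrix_vector_mult_scaleR inner_diff_left inner_diff_right
        b_def[symmetric] c_def[symmetric] power2_eq_square algebra_simps)
  also have "\<dots> = v \<bullet> (G *v v) - b\<^sup>2 / c" using c by (simp add: power2_eq_square field_simps)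
  finally have "b\<^sup>2 / c \<le> v \<bullet> (G *v v)" by simp
  then show ?thesis using c by (simp add: b_def c_def[symmetric] divide_le_eq)
qed

section \<open>Continuously differentiable maps\<close>

text \<open>Continuity of the derivative is meant in the operator norm, as in the chain rule below.\<close>

definition C1_on :: "'a::euclidean_space set \<Rightarrow> ('a \<Rightarrow> 'b::real_normed_vector) \<Rightarrow> bool" where
  "C1_on U f \<longleftrightarrow> (\<forall>x\<in>U. f differentiable (at x)) \<and>
     continuous_on U (\<lambda>x. Blinfun (frechet_derivative f (at x)))"

lemma C1_onI:
  assumes "\<And>x. x \<in> U \<Longrightarrow> (f has_derivative blinfun_apply (f' x)) (at x)" "continuous_on U f'"
  shows "C1_on U f"
  unfolding C1_on_def
proof
  have "Blinfun (frechet_derivative f (at x)) = f' x" if "x \<in> U" for x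
    unfolding frechet_derivative_at[OF assms(1)[OF that], symmetric] by (rule blinfun_apply_inverse)
  then show "continuous_on U (\<lambda>x. Blinfun (frechet_derivative f (at x)))"
    by (intro continuous_on_eq[OF assms(2)]) simp
  show "\<forall>x\<in>U. f differentiable (at x)" using assms(1) by (auto simp: differentiable_def)
qed

lemma C1_onE:
  assumes "C1_on U f"
  obtains f' where "\<And>x. x \<in> U \<Longrightarrow> (f has_derivative blinfun_apply (f' x)) (at x)" "continuous_on U f'"
proof (rule that)
  show "(f has_derivative blinfun_apply (Blinfun (frechet_derivative f (at x)))) (at x)" if "x \<in> U" for x
  proof -
    have d: "(f has_derivative frechet_derivative f (at x)) (at x)"
      using assms that by (simp add: C1_on_def frechet_derivative_works[symmetric])
    then show ?thesis by (simp add: bounded_linear_Blinfun_apply has_derivative_bounded_linear)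
  qed
  show "continuous_on U (\<lambda>x. Blinfun (frechet_derivative f (at x)))" using assms by (simp add: C1_on_def)
qed

lemma C1_on_differentiable: "C1_on U f \<Longrightarrow> x \<in> U \<Longrightarrow> f differentiable (at x)"
  by (simp add: C1_on_def)

lemma C1_on_continuous: "C1_on U f \<Longrightarrow> continuous_on U f"
  using C1_on_differentiable[of U f] differentiable_imp_continuous_within[of f _ UNIV]
  by (intro continuous_at_imp_continuous_on) blast

lemma C1_on_partial_continuous:
  assumes "C1_on U f" shows "continuous_on U (\<lambda>x. frechet_derivative f (at x) v)"
proof -
  obtain f' where f': "\<And>x. x \<in> U \<Longrightarrow> (f has_derivative blinfun_apply (f' x)) (at x)" "continuous_on U f'"
    using C1_onE[OF assms] by metis
  have "continuous_on U (\<lambda>x. blinfun_apply (f' x) v)" by (intro continuous_intros f')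
  then show ?thesis
    by (rule continuous_on_eq) (use frechet_derivative_at[OF f'(1)] in simp)
qed

lemma C1_on_cong:
  assumes "C1_on U f" "open U" "\<And>x. x \<in> U \<Longrightarrow> f x = g x" shows "C1_on U g"
proof -
  obtain f' where f': "\<And>x. x \<in> U \<Longrightarrow> (f has_derivative blinfun_apply (f' x)) (at x)" "continuous_on U f'"
    using C1_onE[OF assms(1)] by metis
  show ?thesis
    by (rule C1_onI[OF _ f'(2)]) (rule has_derivative_transform_within_open[OF f'(1) assms(2)], use assms(3) in auto)
qed

lemma C1_on_local:
  assumes "\<And>x. x \<in> U \<Longrightarrow> \<exists>W. open W \<and> x \<in> W \<and> C1_on W f" shows "C1_on U f"
  unfolding C1_on_def
proof
  show "\<forall>x\<in>U. f differentiable (at x)" using assms by (auto simp: C1_on_def)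
  show "continuous_on U (\<lambda>x. Blinfun (frechet_derivative f (at x)))"
  proof (rule continuous_at_imp_continuous_on, rule ballI)
    fix x assume "x \<in> U"
    then obtain W where "open W" "x \<in> W" "C1_on W f" using assms by blast
    then show "isCont (\<lambda>x. Blinfun (frechet_derivative f (at x))) x"
      by (simp add: C1_on_def continuous_on_eq_continuous_at)
  qed
qed

lemma C1_on_const [intro]: "C1_on U (\<lambda>x. c)"
  by (rule C1_onI[where f' = "\<lambda>_. 0"]) (auto simp: zero_blinfun.rep_eq)

lemma C1_on_add:
  assumes "C1_on U f" "C1_on U g" shows "C1_on U (\<lambda>x. f x + g x)"
proof -
  obtain f' where f': "\<And>x. x \<in> U \<Longrightarrow> (f has_derivative blinfun_apply (f' x)) (at x)" "continuous_on U f'"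
    using C1_onE[OF assms(1)] by metis
  obtain g' where g': "\<And>x. x \<in> U \<Longrightarrow> (g has_derivative blinfun_apply (g' x)) (at x)" "continuous_on U g'"
    using C1_onE[OF assms(2)] by metis
  show ?thesis
  proof (rule C1_onI[where f' = "\<lambda>x. f' x + g' x"])
    show "((\<lambda>x. f x + g x) has_derivative blinfun_apply (f' x + g' x)) (at x)" if "x \<in> U" for x
      by (rule has_derivative_eq_rhs[OF has_derivative_add[OF f'(1)[OF that] g'(1)[OF that]]])
         (simp add: fun_eq_iff blinfun.add_left)
    show "continuous_on U (\<lambda>x. f' x + g' x)" by (intro continuous_on_add f' g')
  qed
qed

lemma C1_on_mult:
  fixes f g :: "_ \<Rightarrow> real"
  assumes "C1_on U f" "C1_on U g" shows "C1_on U (\<lambda>x. f x * g x)"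
proof -
  obtain f' where f': "\<And>x. x \<in> U \<Longrightarrow> (f has_derivative blinfun_apply (f' x)) (at x)" "continuous_on U f'"
    using C1_onE[OF assms(1)] by metis
  obtain g' where g': "\<And>x. x \<in> U \<Longrightarrow> (g has_derivative blinfun_apply (g' x)) (at x)" "continuous_on U g'"
    using C1_onE[OF assms(2)] by metis
  show ?thesis
  proof (rule C1_onI[where f' = "\<lambda>x. f x *\<^sub>R g' x + g x *\<^sub>R f' x"])
    show "((\<lambda>x. f x * g x) has_derivative blinfun_apply (f x *\<^sub>R g' x + g x *\<^sub>R f' x)) (at x)" if "x \<in> U" for x
      by (rule has_derivative_eq_rhs[OF has_derivative_mult[OF f'(1) g'(1)]])
         (auto simp: that fun_eq_iff blinfun.add_left blinfun.scaleR_left)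
    show "continuous_on U (\<lambda>x. f x *\<^sub>R g' x + g x *\<^sub>R f' x)"
      by (intro continuous_on_add continuous_on_scaleR f' g' C1_on_continuous assms)
  qed
qed

lemma C1_on_minus: "C1_on U f \<Longrightarrow> C1_on U (\<lambda>x. - f x :: real)"
  using C1_on_mult[of U "\<lambda>_. -1" f] by (simp add: C1_on_const)

lemma C1_on_sum:
  assumes "\<And>i. i \<in> I \<Longrightarrow> C1_on U (f i)" shows "C1_on U (\<lambda>x. \<Sum>i\<in>I. f i x)"
  using assms by (induction I rule: infinite_finite_induct) (auto intro: C1_on_add)

lemma C1_on_prod:
  fixes f :: "_ \<Rightarrow> _ \<Rightarrow> real"
  assumes "\<And>i. i \<in> I \<Longrightarrow> C1_on U (f i)" shows "C1_on U (\<lambda>x. \<Prod>i\<in>I. f i x)"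
  using assms by (induction I rule: infinite_finite_induct) (auto intro: C1_on_mult)

lemma C1_on_bounded_linear:
  assumes "bounded_linear L" "C1_on U f" shows "C1_on U (\<lambda>x. L (f x))"
proof -
  obtain f' where f': "\<And>x. x \<in> U \<Longrightarrow> (f has_derivative blinfun_apply (f' x)) (at x)" "continuous_on U f'"
    using C1_onE[OF assms(2)] by metis
  show ?thesis
  proof (rule C1_onI[where f' = "\<lambda>x. Blinfun L o\<^sub>L f' x"])
    show "((\<lambda>x. L (f x)) has_derivative blinfun_apply (Blinfun L o\<^sub>L f' x)) (at x)" if "x \<in> U" for x
      by (rule has_derivative_eq_rhs[OF bounded_linear.has_derivative[OF assms(1) f'(1)[OF that]]])
         (simp add: fun_eq_iff bounded_linear_Blinfun_apply[OF assms(1)])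
    show "continuous_on U (\<lambda>x. Blinfun L o\<^sub>L f' x)" by (intro continuous_intros f')
  qed
qed

lemma C1_on_nth: "C1_on U f \<Longrightarrow> C1_on U (\<lambda>x. f x $ i)"
  by (rule C1_on_bounded_linear[OF bounded_linear_vec_nth])

lemma C1_on_compose:
  assumes "C1_on U f" "C1_on W g" "f ` U \<subseteq> W" shows "C1_on U (\<lambda>x. g (f x))"
proof -
  obtain f' where f': "\<And>x. x \<in> U \<Longrightarrow> (f has_derivative blinfun_apply (f' x)) (at x)" "continuous_on U f'"
    using C1_onE[OF assms(1)] by metis
  obtain g' where g': "\<And>x. x \<in> W \<Longrightarrow> (g has_derivative blinfun_apply (g' x)) (at x)" "continuous_on W g'"
    using C1_onE[OF assms(2)] by metis
  show ?thesis
  proof (rule C1_onI[where f' = "\<lambda>x. g' (f x) o\<^sub>L f' x"])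
    show "((\<lambda>x. g (f x)) has_derivative blinfun_apply (g' (f x) o\<^sub>L f' x)) (at x)" if "x \<in> U" for x
      by (rule has_derivative_eq_rhs[OF has_derivative_compose[OF f'(1)[OF that] g'(1)]])
         (use that assms(3) in \<open>auto simp: fun_eq_iff\<close>)
    show "continuous_on U (\<lambda>x. g' (f x) o\<^sub>L f' x)"
      by (intro continuous_intros f' continuous_on_compose2[OF g'(2) C1_on_continuous[OF assms(1)] assms(3)])
  qed
qed

lemma C1_on_real_compose:
  fixes f :: "_ \<Rightarrow> real"
  assumes f: "C1_on U f" and S: "f ` U \<subseteq> S" "open U" and h: "\<And>s. s \<in> S \<Longrightarrow> (h has_real_derivative h' s) (at s within S)"
    and h': "continuous_on S h'"
  shows "C1_on U (\<lambda>x. h (f x))"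
    and "x \<in> U \<Longrightarrow> frechet_derivative (\<lambda>x. h (f x)) (at x) v = h' (f x) * frechet_derivative f (at x) v"
proof -
  obtain f' where f': "\<And>x. x \<in> U \<Longrightarrow> (f has_derivative blinfun_apply (f' x)) (at x)" "continuous_on U f'"
    using C1_onE[OF f] by metis
  have d: "((\<lambda>x. h (f x)) has_derivative blinfun_apply (h' (f x) *\<^sub>R f' x)) (at x)" if x: "x \<in> U" for x
  proof -
    have "(f has_derivative blinfun_apply (f' x)) (at x within U)"
      using f'(1)[OF x] by (rule has_derivative_at_withinI)
    moreover have "(h has_derivative (*) (h' (f x))) (at (f x) within f ` U)"
      using h[of "f x"] S x by (auto simp: has_field_derivative_def intro: has_derivative_subset)
    ultimately have "((\<lambda>x. h (f x)) has_derivative (\<lambda>v. h' (f x) * blinfun_apply (f' x) v)) (at x within U)"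
      using has_derivative_in_compose by fastforce
    then show ?thesis using at_within_open[OF x S(2)] by (simp add: blinfun.scaleR_left[abs_def])
  qed
  show "C1_on U (\<lambda>x. h (f x))"
  proof (rule C1_onI[OF d])
    have "continuous_on U (\<lambda>x. h' (f x))" by (rule continuous_on_compose2[OF h' C1_on_continuous[OF f] S(1)])
    then show "continuous_on U (\<lambda>x. h' (f x) *\<^sub>R f' x)" by (intro continuous_on_scaleR f')
  qed
  show "frechet_derivative (\<lambda>x. h (f x)) (at x) v = h' (f x) * frechet_derivative f (at x) v" if x: "x \<in> U"
    using frechet_derivative_at[OF d[OF x]] frechet_derivative_at[OF f'(1)[OF x]]
    by (simp add: fun_eq_iff blinfun.scaleR_left)
qed

lemma C1_on_inverse:
  fixes f :: "_ \<Rightarrow> real"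
  assumes "C1_on U f" "open U" "\<And>x. x \<in> U \<Longrightarrow> 0 < f x" shows "C1_on U (\<lambda>x. inverse (f x))"
proof (rule C1_on_real_compose(1)[OF assms(1), of "{0<..}" inverse "\<lambda>s. - (inverse s ^ Suc (Suc 0))"])
  show "(inverse has_real_derivative - (inverse s ^ Suc (Suc 0))) (at s within {0<..})" if "s \<in> {0<..}" for s :: real
    using that by (intro DERIV_inverse) auto
  have "continuous_on {0<..} (\<lambda>s::real. inverse s)" by (intro continuous_on_inverse continuous_on_id) auto
  then show "continuous_on {0<..} (\<lambda>s::real. - (inverse s ^ Suc (Suc 0)))"
    by (intro continuous_on_minus continuous_on_power)
qed (use assms in auto)

lemma C1_on_sqrt:
  fixes f :: "_ \<Rightarrow> real"
  assumes "C1_on U f" "open U" "\<And>x. x \<in> U \<Longrightarrow> 0 < f x" shows "C1_on U (\<lambda>x. sqrt (f x))"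
proof (rule C1_on_real_compose(1)[OF assms(1), of "{0<..}" sqrt "\<lambda>s. inverse (sqrt s) / 2"])
  show "(sqrt has_real_derivative inverse (sqrt s) / 2) (at s within {0<..})" if "s \<in> {0<..}" for s :: real
    using that by (intro has_field_derivative_at_within[OF DERIV_real_sqrt]) auto
  show "continuous_on {0<..} (\<lambda>s::real. inverse (sqrt s) / 2)"
    by (intro continuous_on_divide continuous_on_inverse continuous_on_real_sqrt continuous_on_id continuous_on_const) auto
qed (use assms in auto)

lemma C1_on_det:
  fixes A :: "_ \<Rightarrow> real^'n^'n::finite"
  assumes "\<And>i j. C1_on U (\<lambda>x. A x $ i $ j)" shows "C1_on U (\<lambda>x. det (A x))"
  unfolding det_def by (intro C1_on_sum C1_on_mult C1_on_const C1_on_prod assms)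

lemma C1_on_posdef_inverse:
  fixes G :: "_ \<Rightarrow> real^'n^'n::finite"
  assumes G: "\<And>i j. C1_on U (\<lambda>x. G x $ i $ j)" and w: "\<And>i. C1_on U (\<lambda>x. w x $ i)"
    and U: "open U" and pd: "\<And>x. x \<in> U \<Longrightarrow> posdef (G x)"
  shows "C1_on U (\<lambda>x. (matrix_inv (G x) *v w x) $ k)"
proof -
  have "C1_on U (\<lambda>x. det (\<chi> i j. if j = k then w x $ i else G x $ i $ j) * inverse (det (G x)))"
  proof (intro C1_on_mult C1_on_det C1_on_inverse U G posdef_det_pos pd)
    show "C1_on U (\<lambda>x. (\<chi> i j. if j = k then w x $ i else G x $ i $ j) $ i $ j)" for i j
      using G w by (cases "j = k") simp_all
  qed
  then show ?thesis
    by (rule C1_on_cong[OF _ U]) (simp add: posdef_inverse_Cramer[OF pd] divide_inverse)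
qed

lemma frechet_derivative_axis_sum:
  fixes f :: "real^'n::finite \<Rightarrow> 'b::real_normed_vector"
  assumes "f differentiable (at x)"
  shows "frechet_derivative f (at x) v = (\<Sum>i\<in>UNIV. v $ i *\<^sub>R frechet_derivative f (at x) (axis i 1))"
proof -
  have l: "linear (frechet_derivative f (at x))" using assms by (rule linear_frechet_derivative)
  have "frechet_derivative f (at x) v = frechet_derivative f (at x) (\<Sum>i\<in>UNIV. v $ i *\<^sub>R axis i 1)"
    using basis_expansion[of v] by (simp add: scalar_mult_eq_scaleR)
  then show ?thesis by (simp add: linear_sum[OF l] linear_scale[OF l] o_def)
qed

lemma smooth_on_partial:
  assumes "smooth_on U f" shows "smooth_on U (\<lambda>y. frechet_derivative f (at y) (axis i 1))"
proof -
  have "iter_partial js (\<lambda>y. frechet_derivative f (at y) (axis i 1)) = iter_partial (js @ [i]) f" for js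
    by (induction js) simp_all
  then show ?thesis using assms by (simp add: smooth_on_def)
qed

lemma smooth_on_differentiable: "smooth_on U f \<Longrightarrow> y \<in> U \<Longrightarrow> f differentiable (at y)"
  unfolding smooth_on_def by (drule spec[of _ "[]"]) simp

text \<open>Every partial derivative is differentiable, hence continuous; in finite dimension this makes the
  total derivative continuous.\<close>

lemma smooth_on_C1:
  fixes f :: "real^'n::finite \<Rightarrow> 'b::real_normed_vector"
  assumes "smooth_on U f" shows "C1_on U f"
  unfolding C1_on_def
proof
  show "\<forall>x\<in>U. f differentiable (at x)" using smooth_on_differentiable[OF assms] by blast
  show "continuous_on U (\<lambda>x. Blinfun (frechet_derivative f (at x)))"
  proof (rule continuous_on_blinfun_componentwise)
    fix b :: "real^'n" assume "b \<in> Basis"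
    then obtain i where b: "b = axis i 1" by (auto simp: Basis_vec_def)
    have "continuous_on U (\<lambda>y. frechet_derivative f (at y) (axis i 1))"
      using smooth_on_differentiable[OF smooth_on_partial[OF assms, of i]] differentiable_imp_continuous_within[of _ _ UNIV]
      by (intro continuous_at_imp_continuous_on) blast
    then show "continuous_on U (\<lambda>x. blinfun_apply (Blinfun (frechet_derivative f (at x))) b)"
    proof (rule continuous_on_eq)
      fix x assume x: "x \<in> U"
      have "bounded_linear (frechet_derivative f (at x))"
        using smooth_on_differentiable[OF assms x] by (simp add: frechet_derivative_works has_derivative_bounded_linear)
      then show "frechet_derivative f (at x) (axis i 1) = blinfun_apply (Blinfun (frechet_derivative f (at x))) b"
        by (simp add: bounded_linear_Blinfun_apply b)
    qed
  qed
qed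

section \<open>Charts and isometries\<close>

text \<open>The transformation rule \<open>Gc = J\<^sup>T Gd J\<close> of Gram matrices makes the inner product of two gradients
  independent of the chart, and gives the Jacobian factor between the two volume densities.\<close>

lemma congruent_pairing:
  fixes Gc Gd J :: "real^'n^'n::finite"
  assumes c: "posdef Gc" and d: "posdef Gd" and J: "Gc = transpose J ** Gd ** J"
  shows "(transpose J *v a) \<bullet> (matrix_inv Gc *v (transpose J *v b)) = a \<bullet> (matrix_inv Gd *v b)"
    and "sqrt (det Gc) = \<bar>det J\<bar> * sqrt (det Gd)" and "det J \<noteq> 0"
proof -
  have det: "det Gc = (det J)\<^sup>2 * det Gd"
    unfolding J by (simp add: det_mul det_transpose power2_eq_square)
  then show "sqrt (det Gc) = \<bar>det J\<bar> * sqrt (det Gd)" by (simp add: real_sqrt_mult)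
  show nz: "det J \<noteq> 0" using det posdef_det_pos[OF c] by auto
  define v where "v = matrix_inv Gc *v (transpose J *v b)"
  have "transpose J *v (Gd *v (J *v v)) = Gc *v v"
    unfolding J by (simp only: matrix_vector_mul_assoc matrix_mul_assoc)
  also have "\<dots> = transpose J *v b" unfolding v_def by (rule posdef_inverse(2)[OF c])
  finally have "transpose J *v (Gd *v (J *v v)) = transpose J *v b" .
  moreover have "invertible (transpose J)" using nz by (simp add: invertible_det_nz det_transpose)
  ultimately have "Gd *v (J *v v) = b" using injD[OF inj_matrix_vector_mult, of "transpose J"] by blast
  then have "matrix_inv Gd *v b = J *v v" by (rule posdef_inverse_unique[OF d])
  then show "(transpose J *v a) \<bullet> (matrix_inv Gc *v (transpose J *v b)) = a \<bullet> (matrix_inv Gd *v b)"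
    unfolding v_def[symmetric] by (simp only: transpose_matrix_vector dot_lmul_matrix)
qed

definition partials :: "('a, 'n::finite) chart \<Rightarrow> ('a \<Rightarrow> real) \<Rightarrow> real^'n \<Rightarrow> real^'n" where
  "partials c f y = (\<chi> i. frechet_derivative (f \<circ> chart_inv c) (at y) (axis i 1))"

text \<open>The inner product of the gradients of \<open>f\<close> and \<open>g\<close> in the coordinates of \<open>c\<close>: the differentials are
  paired by the inverse Gram matrix.\<close>

definition grad_pairing :: "('a, 'n::finite) riemannian \<Rightarrow> ('a, 'n) chart \<Rightarrow> ('a \<Rightarrow> real) \<Rightarrow> ('a \<Rightarrow> real) \<Rightarrow> 'a \<Rightarrow> real" where
  "grad_pairing M c f g p = partials c f (snd c p) \<bullet> (matrix_inv (gram M c p) *v partials c g (snd c p))"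

definition density_at :: "('a, 'n::finite) riemannian \<Rightarrow> ('a, 'n) chart \<Rightarrow> real^'n \<Rightarrow> real" where
  "density_at M c y = sqrt (det (gram M c (chart_inv c y)))"

lemma matrix_frechet_mult:
  fixes \<tau> :: "real^'n::finite \<Rightarrow> real^'m::finite"
  assumes "\<tau> differentiable (at y)"
  shows "matrix (frechet_derivative \<tau> (at y)) *v v = frechet_derivative \<tau> (at y) v"
  by (rule fun_cong[OF matrix_vector_mul(2)[OF linear_frechet_derivative[OF assms]]])

lemma frechet_derivative_cong_open:
  assumes "open W" "y \<in> W" "\<And>x. x \<in> W \<Longrightarrow> f x = g x"
  shows "frechet_derivative f (at y) = frechet_derivative g (at y)"
proof -
  have "(f has_derivative D) (at y) \<longleftrightarrow> (g has_derivative D) (at y)" for D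
  proof
    show "(g has_derivative D) (at y)" if "(f has_derivative D) (at y)"
      by (rule has_derivative_transform_within_open[OF that assms(1,2)]) (rule assms(3))
    show "(f has_derivative D) (at y)" if "(g has_derivative D) (at y)"
      by (rule has_derivative_transform_within_open[OF that assms(1,2)]) (rule assms(3)[symmetric])
  qed
  then show ?thesis unfolding frechet_derivative_def by simp
qed

lemma partials_chain:
  fixes c :: "('a, 'n::finite) chart" and d :: "('b, 'n) chart"
  assumes W: "open W" "y \<in> W" and eq: "\<And>x. x \<in> W \<Longrightarrow> f (h (chart_inv c x)) = (f \<circ> chart_inv d) (\<tau> x)"
    and \<tau>: "\<tau> differentiable (at y)" and f: "(f \<circ> chart_inv d) differentiable (at (\<tau> y))"
  shows "partials c (f \<circ> h) y = transpose (matrix (frechet_derivative \<tau> (at y))) *v partials d f (\<tau> y)"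
proof -
  let ?\<tau>' = "frechet_derivative \<tau> (at y)" and ?f' = "frechet_derivative (f \<circ> chart_inv d) (at (\<tau> y))"
  have "((f \<circ> chart_inv d) \<circ> \<tau> has_derivative ?f' \<circ> ?\<tau>') (at y)"
    by (rule diff_chain_at) (use \<tau> f in \<open>simp_all add: frechet_derivative_works[symmetric]\<close>)
  then have "frechet_derivative ((f \<circ> chart_inv d) \<circ> \<tau>) (at y) = ?f' \<circ> ?\<tau>'"
    by (rule frechet_derivative_at[symmetric])
  moreover have "frechet_derivative ((f \<circ> h) \<circ> chart_inv c) (at y) = frechet_derivative ((f \<circ> chart_inv d) \<circ> \<tau>) (at y)"
    by (rule frechet_derivative_cong_open[OF W]) (use eq in auto)
  ultimately have "partials c (f \<circ> h) y $ i = ?f' (?\<tau>' (axis i 1))" for i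
    by (simp add: partials_def)
  also have "?f' (?\<tau>' (axis i 1)) = (\<Sum>j\<in>UNIV. ?\<tau>' (axis i 1) $ j * partials d f (\<tau> y) $ j)" for i
    using frechet_derivative_axis_sum[OF f, of "?\<tau>' (axis i 1)"] by (simp add: partials_def)
  finally show ?thesis
    by (simp add: vec_eq_iff matrix_vector_mult_def transpose_def matrix_def)
qed

locale rmanifold =
  fixes M :: "('a::{t2_space, second_countable_topology}, 'n::finite) riemannian"
  assumes M: "riemannian_manifold M"
begin

lemma chart: assumes "c \<in> atlas M"
  shows "open (fst c)" "open (snd c ` fst c)" "continuous_on (fst c) (snd c)"
    "continuous_on (snd c ` fst c) (chart_inv c)"
    and "p \<in> fst c \<Longrightarrow> chart_inv c (snd c p) = p"
    and "y \<in> snd c ` fst c \<Longrightarrow> chart_inv c y \<in> fst c \<and> snd c (chart_inv c y) = y"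
proof -
  have c: "is_chart c" using M assms unfolding riemannian_manifold_def smooth_atlas_def by blast
  then have hm: "homeomorphism (fst c) (snd c ` fst c) (snd c) (chart_inv c)" by (simp add: is_chart_def)
  show "open (fst c)" "open (snd c ` fst c)" using c by (simp_all add: is_chart_def)
  show "continuous_on (fst c) (snd c)" "continuous_on (snd c ` fst c) (chart_inv c)"
    using hm by (simp_all add: homeomorphism_def)
  show "chart_inv c (snd c p) = p" if "p \<in> fst c"
    using hm that by (simp add: homeomorphism_def)
  show "chart_inv c y \<in> fst c \<and> snd c (chart_inv c y) = y" if "y \<in> snd c ` fst c"
    using hm that by (auto simp: homeomorphism_def)
qed

lemma chart_inj: "c \<in> atlas M \<Longrightarrow> inj_on (snd c) (fst c)"
  by (rule inj_on_inverseI[of _ "chart_inv c"]) (rule chart(5))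

lemma chart_cover: "\<exists>c\<in>atlas M. p \<in> fst c"
  using M unfolding riemannian_manifold_def smooth_atlas_def by blast

lemma chart_at: "chart_at M p \<in> atlas M" "p \<in> fst (chart_at M p)"
proof -
  have "\<exists>c. c \<in> atlas M \<and> p \<in> fst c" using chart_cover by blast
  from someI_ex[OF this] show "chart_at M p \<in> atlas M" "p \<in> fst (chart_at M p)"
    unfolding chart_at_def by auto
qed

lemma chart_image_open:
  assumes c: "c \<in> atlas M" and U: "open U" "U \<subseteq> fst c" shows "open (snd c ` U)"
proof -
  have "snd c ` U = snd c ` fst c \<inter> chart_inv c -` U"
    using U chart(5)[OF c] chart(6)[OF c] by force
  then show ?thesis using continuous_open_preimage[OF chart(4)[OF c] chart(2)[OF c] U(1)] by simp
qed

lemma chart_inv_image_open: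
  assumes c: "c \<in> atlas M" and W: "open W" "W \<subseteq> snd c ` fst c" shows "open (chart_inv c ` W)"
proof -
  have "chart_inv c ` W = fst c \<inter> snd c -` W"
    using W chart(5)[OF c] chart(6)[OF c] by force
  then show ?thesis using continuous_open_preimage[OF chart(3)[OF c] chart(1)[OF c] W(1)] by simp
qed

lemma gram_posdef: "c \<in> atlas M \<Longrightarrow> p \<in> fst c \<Longrightarrow> posdef (gram M c p)"
  using M unfolding riemannian_manifold_def posdef_def by blast

lemma gram_C1: "c \<in> atlas M \<Longrightarrow> C1_on (snd c ` fst c) (\<lambda>y. gram M c (chart_inv c y) $ i $ j)"
proof (intro C1_on_nth)
  assume "c \<in> atlas M"
  then have "smooth_on (snd c ` fst c) (gram M c \<circ> chart_inv c)"
    using M unfolding riemannian_manifold_def by blast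
  then show "C1_on (snd c ` fst c) (\<lambda>y. gram M c (chart_inv c y))"
    using smooth_on_C1 by (simp add: o_def)
qed

lemma posdef_chart_inv: "c \<in> atlas M \<Longrightarrow> y \<in> snd c ` fst c \<Longrightarrow> posdef (gram M c (chart_inv c y))"
  using chart(6) gram_posdef by blast

lemma density_C1: "c \<in> atlas M \<Longrightarrow> C1_on (snd c ` fst c) (density_at M c)"
  unfolding density_at_def[abs_def]
  by (intro C1_on_sqrt C1_on_det gram_C1 chart(2) posdef_det_pos posdef_chart_inv)

lemma density_pos: "c \<in> atlas M \<Longrightarrow> y \<in> snd c ` fst c \<Longrightarrow> 0 < density_at M c y"
  by (simp add: density_at_def posdef_det_pos posdef_chart_inv)

definition C1_fun :: "('a \<Rightarrow> real) \<Rightarrow> bool" where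
  "C1_fun f \<longleftrightarrow> (\<forall>c\<in>atlas M. C1_on (snd c ` fst c) (f \<circ> chart_inv c))"

lemma smooth_fun_C1: "smooth_fun M f \<Longrightarrow> C1_fun f"
  unfolding smooth_fun_def C1_fun_def using smooth_on_C1 by blast

lemma C1_funD:
  assumes "C1_fun f" "c \<in> atlas M"
  shows "C1_on (snd c ` fst c) (f \<circ> chart_inv c)"
    "p \<in> fst c \<Longrightarrow> (f \<circ> chart_inv c) differentiable (at (snd c p))"
proof -
  show c: "C1_on (snd c ` fst c) (f \<circ> chart_inv c)" using assms unfolding C1_fun_def by blast
  show "(f \<circ> chart_inv c) differentiable (at (snd c p))" if "p \<in> fst c"
    by (rule C1_on_differentiable[OF c]) (use that in blast)
qed

lemma C1_fun_mult: "C1_fun f \<Longrightarrow> C1_fun g \<Longrightarrow> C1_fun (\<lambda>p. f p * g p)"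
  unfolding C1_fun_def o_def by (intro ballI C1_on_mult) blast+

lemma C1_fun_sum: "(\<And>i. i \<in> I \<Longrightarrow> C1_fun (f i)) \<Longrightarrow> C1_fun (\<lambda>p. \<Sum>i\<in>I. f i p)"
  unfolding C1_fun_def o_def by (intro ballI C1_on_sum) blast

lemma C1_fun_inverse: "C1_fun f \<Longrightarrow> (\<And>p. 0 < f p) \<Longrightarrow> C1_fun (\<lambda>p. inverse (f p))"
  unfolding C1_fun_def o_def by (intro ballI C1_on_inverse chart(2)) auto

lemma continuous_on_charts:
  assumes "\<And>c. c \<in> atlas M \<Longrightarrow> continuous_on (snd c ` fst c) (f \<circ> chart_inv c)" shows "continuous_on UNIV f"
proof (rule continuous_at_imp_continuous_on, rule ballI)
  fix p
  obtain c where c: "c \<in> atlas M" "p \<in> fst c" using chart_cover by blast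
  have "continuous_on (fst c) ((f \<circ> chart_inv c) \<circ> snd c)"
    by (rule continuous_on_compose[OF chart(3)[OF c(1)] assms[OF c(1)]])
  then have "continuous_on (fst c) f" by (rule continuous_on_eq) (simp add: chart(5)[OF c(1)])
  then show "isCont f p" using c chart(1) by (simp add: continuous_on_eq_continuous_at)
qed

lemma C1_fun_continuous: "C1_fun f \<Longrightarrow> continuous_on UNIV f"
  by (rule continuous_on_charts, rule C1_on_continuous, rule C1_funD(1))

lemma isometry_id: "riemannian_isometry M id"
proof -
  have t: "smooth_transition c d" if "c \<in> atlas M" "d \<in> atlas M" for c d
    using M that unfolding riemannian_manifold_def smooth_atlas_def by blast
  have sm: "smooth_map M id" unfolding smooth_map_def
  proof (intro conjI ballI)
    fix c d assume "c \<in> atlas M" "d \<in> atlas M"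
    from t[OF this] show "smooth_on (snd c ` (fst c \<inter> id -` fst d)) (snd d \<circ> id \<circ> chart_inv c)"
      by (simp add: smooth_transition_def)
  qed (rule continuous_on_id')
  have gr: "gram M c p = transpose (jacobian c d id p) ** gram M d p ** jacobian c d id p"
    if "c \<in> atlas M" "d \<in> atlas M" "p \<in> fst c \<inter> fst d" for c d p
    using M that unfolding riemannian_manifold_def by blast
  show ?thesis unfolding riemannian_isometry_def
  proof (intro conjI ballI)
    show "smooth_map M (inv id)" using sm by simp
    show "gram M c p = transpose (jacobian c d id p) ** gram M d (id p) ** jacobian c d id p"
      if "c \<in> atlas M" "d \<in> atlas M" "p \<in> fst c \<inter> id -` fst d" for c d p
      using gr[OF that(1,2), of p] that(3) by simp
  qed (simp_all add: sm)
qed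

lemma isometry_homeo: "riemannian_isometry M h \<Longrightarrow> bij h \<and> continuous_on UNIV h \<and> continuous_on UNIV (inv h)"
  by (simp add: riemannian_isometry_def smooth_map_def)

text \<open>The identity is an isometry, and its coordinate expressions are the transition maps. So the
  invariance under isometries below contains the independence of the chart.\<close>

lemma isometry_coordinates:
  assumes h: "riemannian_isometry M h" and c: "c \<in> atlas M" and d: "d \<in> atlas M"
  defines "W \<equiv> snd c ` (fst c \<inter> h -` fst d)" and "\<tau> \<equiv> snd d \<circ> h \<circ> chart_inv c"
  shows "open W" "C1_on W \<tau>" "inj_on \<tau> W"
    and "\<And>y. y \<in> W \<Longrightarrow> \<tau> y \<in> snd d ` fst d \<and> chart_inv d (\<tau> y) = h (chart_inv c y)"
    and "\<And>y. y \<in> W \<Longrightarrow> gram M c (chart_inv c y) =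
      transpose (matrix (frechet_derivative \<tau> (at y))) ** gram M d (h (chart_inv c y)) ** matrix (frechet_derivative \<tau> (at y))"
proof -
  have W: "W \<subseteq> snd c ` fst c" by (auto simp: W_def)
  have "open (fst c \<inter> h -` fst d)"
    using chart(1)[OF c] chart(1)[OF d] isometry_homeo[OF h] by (auto intro: open_Int open_vimage)
  then show "open W" unfolding W_def by (rule chart_image_open[OF c]) auto
  have "smooth_on W \<tau>" using h c d unfolding riemannian_isometry_def smooth_map_def W_def \<tau>_def by blast
  then show "C1_on W \<tau>" by (rule smooth_on_C1)
  show t: "\<tau> y \<in> snd d ` fst d \<and> chart_inv d (\<tau> y) = h (chart_inv c y)" if "y \<in> W" for y
    using that chart(5)[OF c] chart(5)[OF d] by (auto simp: W_def \<tau>_def)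
  have "bij h" using isometry_homeo[OF h] by blast
  show "inj_on \<tau> W"
  proof (rule inj_onI)
    fix x y assume xy: "x \<in> W" "y \<in> W" "\<tau> x = \<tau> y"
    then have "h (chart_inv c x) = h (chart_inv c y)" using t[OF xy(1)] t[OF xy(2)] by simp
    then have "chart_inv c x = chart_inv c y" using bij_is_inj[OF \<open>bij h\<close>] by (simp add: inj_eq)
    then have "snd c (chart_inv c x) = snd c (chart_inv c y)" by simp
    then show "x = y" using chart(6)[OF c, of x] chart(6)[OF c, of y] W xy by auto
  qed
  show "gram M c (chart_inv c y) =
      transpose (matrix (frechet_derivative \<tau> (at y))) ** gram M d (h (chart_inv c y)) ** matrix (frechet_derivative \<tau> (at y))"
    if y: "y \<in> W" for y
  proof -
    obtain p where p: "p \<in> fst c \<inter> h -` fst d" "y = snd c p" using y unfolding W_def by blast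
    have "gram M c p = transpose (jacobian c d h p) ** gram M d (h p) ** jacobian c d h p"
      using h c d p(1) unfolding riemannian_isometry_def by blast
    then show ?thesis using p chart(5)[OF c] by (simp add: jacobian_def \<tau>_def)
  qed
qed

lemma isometry_pairing:
  assumes h: "riemannian_isometry M h" and c: "c \<in> atlas M" and d: "d \<in> atlas M"
    and p: "p \<in> fst c" "h p \<in> fst d" and f: "C1_fun f" and g: "C1_fun g"
  shows "grad_pairing M c (f \<circ> h) (g \<circ> h) p = grad_pairing M d f g (h p)"
proof -
  let ?\<tau> = "snd d \<circ> h \<circ> chart_inv c" and ?W = "snd c ` (fst c \<inter> h -` fst d)"
  let ?J = "matrix (frechet_derivative ?\<tau> (at (snd c p)))"
  note i = isometry_coordinates[OF h c d]
  have y: "snd c p \<in> ?W" using p by auto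
  have \<tau>y: "?\<tau> (snd c p) = snd d (h p)" using p chart(5)[OF c] by simp
  have pc: "partials c (k \<circ> h) (snd c p) = transpose ?J *v partials d k (snd d (h p))" if k: "C1_fun k" for k
    unfolding \<tau>y[symmetric]
  proof (rule partials_chain[OF i(1) y])
    show "k (h (chart_inv c x)) = (k \<circ> chart_inv d) (?\<tau> x)" if "x \<in> ?W" for x using i(4)[OF that] by simp
    show "?\<tau> differentiable at (snd c p)" by (rule C1_on_differentiable[OF i(2) y])
    show "(k \<circ> chart_inv d) differentiable at (?\<tau> (snd c p))"
      unfolding \<tau>y by (rule C1_funD(2)[OF k d p(2)])
  qed
  have G: "gram M c p = transpose ?J ** gram M d (h p) ** ?J"
    using i(5)[OF y] chart(5)[OF c p(1)] by simp
  show ?thesis unfolding grad_pairing_def pc[OF f] pc[OF g]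
    by (rule congruent_pairing(1)[OF gram_posdef[OF c p(1)] gram_posdef[OF d p(2)] G])
qed

lemma C1_fun_smooth_map:
  assumes h: "smooth_map M h" and f: "C1_fun f" shows "C1_fun (f \<circ> h)"
  unfolding C1_fun_def
proof
  fix c assume c: "c \<in> atlas M"
  show "C1_on (snd c ` fst c) (f \<circ> h \<circ> chart_inv c)"
  proof (rule C1_on_local)
    fix y assume y: "y \<in> snd c ` fst c"
    obtain d where d: "d \<in> atlas M" "h (chart_inv c y) \<in> fst d" using chart_cover by blast
    let ?\<tau> = "snd d \<circ> h \<circ> chart_inv c" and ?W = "snd c ` (fst c \<inter> h -` fst d)"
    have "continuous_on UNIV h" using h by (simp add: smooth_map_def)
    then have "open (fst c \<inter> h -` fst d)"
      using chart(1)[OF c] chart(1)[OF d(1)] by (auto intro: open_Int open_vimage)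
    then have oW: "open ?W" by (rule chart_image_open[OF c]) auto
    have \<tau>: "C1_on ?W ?\<tau>" using h c d by (intro smooth_on_C1) (simp add: smooth_map_def)
    have t: "?\<tau> y \<in> snd d ` fst d \<and> chart_inv d (?\<tau> y) = h (chart_inv c y)" if "y \<in> ?W" for y
      using that chart(5)[OF c] chart(5)[OF d(1)] by auto
    have "C1_on ?W (\<lambda>x. (f \<circ> chart_inv d) (?\<tau> x))"
      by (rule C1_on_compose[OF \<tau> C1_funD(1)[OF f d(1)]]) (use t in blast)
    then have "C1_on ?W (f \<circ> h \<circ> chart_inv c)"
      by (rule C1_on_cong[OF _ oW]) (use t in auto)
    moreover have "y \<in> ?W" using y d(2) chart(5)[OF c] by auto
    ultimately show "\<exists>W. open W \<and> y \<in> W \<and> C1_on W (f \<circ> h \<circ> chart_inv c)" using oW by blast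
  qed
qed

lemma pairing_chart_indep:
  assumes "c \<in> atlas M" "d \<in> atlas M" "p \<in> fst c" "p \<in> fst d" "C1_fun f" "C1_fun g"
  shows "grad_pairing M c f g p = grad_pairing M d f g p"
  using isometry_pairing[OF isometry_id assms(1,2) _ _ assms(5,6), of p] assms(3,4) by simp

definition pairing :: "('a \<Rightarrow> real) \<Rightarrow> ('a \<Rightarrow> real) \<Rightarrow> 'a \<Rightarrow> real" where
  "pairing f g p = grad_pairing M (chart_at M p) f g p"

lemma pairing_eq:
  assumes "c \<in> atlas M" "p \<in> fst c" "C1_fun f" "C1_fun g"
  shows "pairing f g p = grad_pairing M c f g p"
  unfolding pairing_def by (rule pairing_chart_indep[OF chart_at(1) assms(1) chart_at(2) assms(2-4)])

lemma pairing_isometry: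
  assumes "riemannian_isometry M h" "C1_fun f" "C1_fun g"
  shows "pairing (f \<circ> h) (g \<circ> h) p = pairing f g (h p)"
  unfolding pairing_def by (rule isometry_pairing[OF assms(1) chart_at(1) chart_at(1) chart_at(2) chart_at(2) assms(2,3)])

lemma grad_norm_sq_pairing: "grad_norm_sq M f p = pairing f f p"
proof -
  let ?c = "chart_at M p" and ?G = "gram M (chart_at M p) p"
  have pd: "posdef ?G" by (rule gram_posdef[OF chart_at])
  have "chart_gradient M ?c f p = matrix_inv ?G *v partials ?c f (snd ?c p)"
    by (simp add: chart_gradient_def partials_def chart_partial_def[abs_def])
  then show ?thesis
    by (simp add: grad_norm_sq_def pairing_def grad_pairing_def Let_def posdef_inverse(2)[OF pd] inner_commute)
qed

lemma pairing_sym: "pairing f g p = pairing g f p"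
proof -
  let ?c = "chart_at M p" and ?G = "gram M (chart_at M p) p"
  have pd: "posdef ?G" by (rule gram_posdef[OF chart_at])
  have "(?G *v (matrix_inv ?G *v v)) \<bullet> (matrix_inv ?G *v w) = (?G *v (matrix_inv ?G *v w)) \<bullet> (matrix_inv ?G *v v)" for v w
    using posdef_sym[OF pd, of "matrix_inv ?G *v w" "matrix_inv ?G *v v"] by (simp add: inner_commute)
  then show ?thesis by (simp add: pairing_def grad_pairing_def posdef_inverse(2)[OF pd])
qed

lemma partials_mult:
  assumes "C1_fun f" "C1_fun g" "c \<in> atlas M" "p \<in> fst c"
  shows "partials c (\<lambda>q. f q * g q) (snd c p) = f p *\<^sub>R partials c g (snd c p) + g p *\<^sub>R partials c f (snd c p)"
proof -
  have df: "((f \<circ> chart_inv c) has_derivative frechet_derivative (f \<circ> chart_inv c) (at (snd c p))) (at (snd c p))"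
    using C1_funD(2)[OF assms(1,3,4)] by (simp add: frechet_derivative_works)
  have dg: "((g \<circ> chart_inv c) has_derivative frechet_derivative (g \<circ> chart_inv c) (at (snd c p))) (at (snd c p))"
    using C1_funD(2)[OF assms(2,3,4)] by (simp add: frechet_derivative_works)
  show ?thesis
    using frechet_derivative_at[OF has_derivative_mult[OF df dg], symmetric] chart(5)[OF assms(3,4)]
    by (simp add: partials_def vec_eq_iff o_def)
qed

lemma pairing_mult:
  assumes "C1_fun f" "C1_fun g"
  shows "pairing (\<lambda>q. f q * g q) k p = f p * pairing g k p + g p * pairing f k p"
  unfolding pairing_def grad_pairing_def partials_mult[OF assms chart_at] by (simp add: inner_add_left)

text \<open>The outer function is differentiated relative to a set that contains the range of \<open>f\<close>, which allows
  one-sided derivatives at the extreme values of \<open>f\<close>.\<close>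

lemma C1_fun_compose:
  assumes f: "C1_fun f" and S: "range f \<subseteq> S" and h: "\<And>s. s \<in> S \<Longrightarrow> (h has_real_derivative h' s) (at s within S)"
    and h': "continuous_on S h'"
  shows "C1_fun (\<lambda>q. h (f q))" "pairing (\<lambda>q. h (f q)) k p = h' (f p) * pairing f k p"
proof -
  have a: "C1_on (snd c ` fst c) (\<lambda>y. h ((f \<circ> chart_inv c) y))"
    "y \<in> snd c ` fst c \<Longrightarrow> frechet_derivative (\<lambda>y. h ((f \<circ> chart_inv c) y)) (at y) v = h' (f (chart_inv c y)) * frechet_derivative (f \<circ> chart_inv c) (at y) v"
    if c: "c \<in> atlas M" for c y v
  proof -
    have s: "(f \<circ> chart_inv c) ` snd c ` fst c \<subseteq> S" using S by auto
    show "C1_on (snd c ` fst c) (\<lambda>y. h ((f \<circ> chart_inv c) y))"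
      by (rule C1_on_real_compose(1)[OF C1_funD(1)[OF f c] s chart(2)[OF c] h h'])
    show "frechet_derivative (\<lambda>y. h ((f \<circ> chart_inv c) y)) (at y) v = h' (f (chart_inv c y)) * frechet_derivative (f \<circ> chart_inv c) (at y) v"
      if "y \<in> snd c ` fst c"
      using C1_on_real_compose(2)[OF C1_funD(1)[OF f c] s chart(2)[OF c] h h' that] by simp
  qed
  then show "C1_fun (\<lambda>q. h (f q))" by (simp add: C1_fun_def o_def)
  let ?c = "chart_at M p"
  have "partials ?c (\<lambda>q. h (f q)) (snd ?c p) = h' (f p) *\<^sub>R partials ?c f (snd ?c p)"
  proof -
    have "frechet_derivative (\<lambda>y. h ((f \<circ> chart_inv ?c) y)) (at (snd ?c p)) v = h' (f p) * frechet_derivative (f \<circ> chart_inv ?c) (at (snd ?c p)) v" for v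
      using a(2)[OF chart_at(1)[of p], of "snd ?c p" v] chart_at(2)[of p] chart(5)[OF chart_at[of p]] by simp
    then show ?thesis by (simp add: partials_def vec_eq_iff o_def)
  qed
  then show "pairing (\<lambda>q. h (f q)) k p = h' (f p) * pairing f k p"
    by (simp add: pairing_def grad_pairing_def)
qed

lemma pairing_continuous:
  assumes f: "C1_fun f" and g: "C1_fun g" shows "continuous_on UNIV (pairing f g)"
proof (rule continuous_on_charts)
  fix c assume c: "c \<in> atlas M"
  have pc: "continuous_on (snd c ` fst c) (partials c k)" if "C1_fun k" for k
    unfolding partials_def[abs_def]
    by (intro continuous_on_vec_lambda C1_on_partial_continuous C1_funD(1)[OF that c])
  have cof: "continuous_on (snd c ` fst c) (\<lambda>y. det (\<chi> i j. if j = k then partials c g y $ i else gram M c (chart_inv c y) $ i $ j) / det (gram M c (chart_inv c y)))" for k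
  proof (rule continuous_on_divide)
    have e: "continuous_on (snd c ` fst c) (\<lambda>y. (if j = k then partials c g y $ i else gram M c (chart_inv c y) $ i $ j))" for i j
      by (cases "j = k") (auto intro: continuous_on_component pc g C1_on_continuous[OF gram_C1[OF c]])
    show "continuous_on (snd c ` fst c) (\<lambda>y. det (\<chi> i j. if j = k then partials c g y $ i else gram M c (chart_inv c y) $ i $ j))"
      unfolding det_def by (intro continuous_on_sum continuous_on_mult continuous_on_const continuous_on_prod) (simp add: e)
    show "continuous_on (snd c ` fst c) (\<lambda>y. det (gram M c (chart_inv c y)))"
      by (intro C1_on_continuous C1_on_det gram_C1 c)
    show "\<forall>y\<in>snd c ` fst c. det (gram M c (chart_inv c y)) \<noteq> 0"
    proof
      fix y assume "y \<in> snd c ` fst c"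
      then show "det (gram M c (chart_inv c y)) \<noteq> 0" using posdef_det_pos[OF posdef_chart_inv[OF c]] by fastforce
    qed
  qed
  have "continuous_on (snd c ` fst c) (\<lambda>y. \<Sum>k\<in>UNIV. partials c f y $ k * (det (\<chi> i j. if j = k then partials c g y $ i else gram M c (chart_inv c y) $ i $ j) / det (gram M c (chart_inv c y))))"
    by (intro continuous_on_sum continuous_on_mult cof continuous_on_component pc f)
  then show "continuous_on (snd c ` fst c) (pairing f g \<circ> chart_inv c)"
  proof (rule continuous_on_eq)
    fix y assume y: "y \<in> snd c ` fst c"
    show "(\<Sum>k\<in>UNIV. partials c f y $ k * (det (\<chi> i j. if j = k then partials c g y $ i else gram M c (chart_inv c y) $ i $ j) / det (gram M c (chart_inv c y)))) = (pairing f g \<circ> chart_inv c) y"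
      using pairing_eq[OF c _ f g, of "chart_inv c y"] chart(6)[OF c y]
      by (simp add: grad_pairing_def inner_vec_def posdef_inverse_Cramer[OF posdef_chart_inv[OF c y]])
  qed
qed

end

section \<open>The Riemannian measure\<close>

lemma borel_Int_vimage_open:
  assumes "open V" "continuous_on V f" "E \<in> sets borel" shows "V \<inter> f -` E \<in> sets borel"
proof -
  have "f \<in> borel_measurable (restrict_space borel V)"
    by (rule borel_measurable_continuous_on_restrict[OF assms(2)])
  from measurable_sets[OF this assms(3)] have "f -` E \<inter> V \<in> sets (restrict_space borel V)"
    by (simp add: space_restrict_space)
  then show ?thesis using assms(1) by (auto simp: sets_restrict_space Int_commute)
qed

context rmanifold
begin

lemma chart_image_borel:
  assumes c: "c \<in> atlas M" and E: "E \<in> sets borel" "E \<subseteq> fst c" shows "snd c ` E \<in> sets borel"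
proof -
  have "snd c ` E = snd c ` fst c \<inter> chart_inv c -` E"
    using E chart(5)[OF c] chart(6)[OF c] by force
  then show ?thesis using borel_Int_vimage_open[OF chart(2,4)[OF c] E(1)] by simp
qed

lemma isometry_image_borel:
  assumes h: "riemannian_isometry M h" and X: "X \<in> sets borel" shows "h ` X \<in> sets borel"
proof -
  have bij: "bij h" and cont: "continuous_on UNIV (inv h)" using isometry_homeo[OF h] by auto
  have "h ` X = inv h -` X" using bij by (simp add: bij_vimage_eq_inv_image bij_imp_bij_inv inv_inv_eq)
  then show ?thesis using measurable_sets[OF borel_measurable_continuous_onI[OF cont(1)], of X] X by simp
qed

definition chart_measure :: "('a, 'n) chart \<Rightarrow> 'a set \<Rightarrow> ennreal" where
  "chart_measure c E = (\<integral>\<^sup>+y\<in>snd c ` E. ennreal (sqrt (det (gram M c (chart_inv c y)))) \<partial>lborel)"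

definition chart_lborel :: "('a, 'n) chart \<Rightarrow> (real^'n) measure" where
  "chart_lborel c = density lborel (\<lambda>y. ennreal (indicat_real (snd c ` fst c) y * density_at M c y))"

lemma density_measurable:
  assumes "c \<in> atlas M" shows "(\<lambda>y. indicat_real (snd c ` fst c) y * density_at M c y) \<in> borel_measurable borel"
  using borel_measurable_continuous_on_indicator[OF _ C1_on_continuous[OF density_C1[OF assms]]] chart(2)[OF assms]
  by simp

lemma chart_measure_eq:
  assumes c: "c \<in> atlas M" and E: "E \<in> sets borel" "E \<subseteq> fst c"
  shows "chart_measure c E = emeasure (chart_lborel c) (snd c ` E)"
proof -
  have "emeasure (chart_lborel c) (snd c ` E) =
      (\<integral>\<^sup>+y. ennreal (indicat_real (snd c ` fst c) y * density_at M c y) * indicator (snd c ` E) y \<partial>lborel)"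
    unfolding chart_lborel_def using density_measurable[OF c] chart_image_borel[OF c E]
    by (intro emeasure_density) auto
  also have "\<dots> = chart_measure c E" unfolding chart_measure_def
    using E(2) by (intro nn_integral_cong) (auto simp: indicator_def density_at_def)
  finally show ?thesis ..
qed

text \<open>The change of variables formula for the coordinate expression of \<open>h\<close>: the determinant of its
  derivative cancels against the quotient of the two volume densities.\<close>

lemma isometry_chart_measure:
  assumes h: "riemannian_isometry M h" and c: "c \<in> atlas M" and d: "d \<in> atlas M"
    and E: "E \<in> sets borel" "E \<subseteq> fst c" "h ` E \<subseteq> fst d"
  shows "chart_measure c E = chart_measure d (h ` E)"
proof -
  let ?\<tau> = "snd d \<circ> h \<circ> chart_inv c" and ?W = "snd c ` (fst c \<inter> h -` fst d)"
  note i = isometry_coordinates[OF h c d]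
  let ?S = "snd c ` E" and ?D = "\<lambda>y. frechet_derivative ?\<tau> (at y)"
  have "E \<subseteq> fst c \<inter> h -` fst d" using E by blast
  then have SW: "?S \<subseteq> ?W" by (rule image_mono)
  have S: "?S \<in> sets borel" by (rule chart_image_borel[OF c E(1,2)])
  have \<tau>S: "?\<tau> ` ?S = snd d ` h ` E"
    unfolding image_image by (rule image_cong[OF refl]) (use chart(5)[OF c] E(2) in auto)
  have hE: "h ` E \<in> sets borel"
    by (rule isometry_image_borel[OF h E(1)])
  have dS: "snd d ` h ` E \<in> sets borel" by (rule chart_image_borel[OF d hE E(3)])
  let ?f = "\<lambda>y. indicat_real (snd d ` fst d) y * density_at M d y"
  have f0: "0 \<le> ?f y" for y using density_pos[OF d, of y] by (auto simp: indicator_def)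
  have eq: "\<bar>det (matrix (?D y))\<bar> * ?f (?\<tau> y) = density_at M c y" if "y \<in> ?W" for y
  proof -
    have yV: "y \<in> snd c ` fst c" using that by auto
    have "sqrt (det (gram M c (chart_inv c y))) = \<bar>det (matrix (?D y))\<bar> * sqrt (det (gram M d (h (chart_inv c y))))"
      by (rule congruent_pairing(2)[OF posdef_chart_inv[OF c yV] _ i(5)[OF that]])
         (use that chart(5)[OF c] in \<open>auto intro!: gram_posdef[OF d]\<close>)
    then show ?thesis using i(4)[OF that] by (simp add: density_at_def)
  qed
  have meq: "\<bar>det (matrix (?D y))\<bar> * ?f (?\<tau> y) * indicat_real ?S y = indicat_real (snd c ` fst c) y * density_at M c y * indicat_real ?S y" for y
  proof (cases "y \<in> ?S")
    case True
    moreover have "y \<in> snd c ` fst c" using True E(2) by blast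
    ultimately show ?thesis using eq[of y] SW by (simp add: subset_iff)
  qed simp
  have der: "(?\<tau> has_derivative ?D y) (at y within ?S)" if "y \<in> ?S" for y
  proof -
    have "?\<tau> differentiable at y" by (rule C1_on_differentiable[OF i(2)]) (use SW that in blast)
    then show ?thesis unfolding frechet_derivative_works by (rule has_derivative_at_withinI)
  qed
  have inj: "inj_on ?\<tau> ?S" by (rule inj_on_subset[OF i(3) SW])
  have m1: "(\<lambda>y. ?f y * indicat_real (?\<tau> ` ?S) y) \<in> borel_measurable borel"
    unfolding \<tau>S by (intro borel_measurable_times density_measurable[OF d] borel_measurable_indicator dS)
  have m2: "(\<lambda>y. \<bar>det (matrix (?D y))\<bar> * ?f (?\<tau> y) * indicat_real ?S y) \<in> borel_measurable borel"
    unfolding meq by (intro borel_measurable_times density_measurable[OF c] borel_measurable_indicator S)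
  note e1 = nn_integral_change_of_variables[of ?S ?\<tau> ?D ?f, OF S der inj m1 f0 m2]
  have e2: "(\<integral>\<^sup>+y. ennreal (?f y * indicat_real (?\<tau> ` ?S) y) \<partial>lborel) = chart_measure d (h ` E)"
    unfolding \<tau>S chart_measure_def
  proof (rule nn_integral_cong)
    fix y show "ennreal (?f y * indicat_real (snd d ` h ` E) y) = ennreal (sqrt (det (gram M d (chart_inv d y)))) * indicator (snd d ` h ` E) y"
    proof (cases "y \<in> snd d ` h ` E")
      case True
      moreover have "y \<in> snd d ` fst d" using True E(3) by blast
      ultimately show ?thesis by (simp add: density_at_def)
    qed simp
  qed
  have e3: "(\<integral>\<^sup>+y. ennreal (\<bar>det (matrix (?D y))\<bar> * ?f (?\<tau> y) * indicat_real ?S y) \<partial>lborel) = chart_measure c E"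
    unfolding meq chart_measure_def
  proof (rule nn_integral_cong)
    fix y show "ennreal (indicat_real (snd c ` fst c) y * density_at M c y * indicat_real ?S y) = ennreal (sqrt (det (gram M c (chart_inv c y)))) * indicator ?S y"
    proof (cases "y \<in> ?S")
      case True
      moreover have "y \<in> snd c ` fst c" using True E(2) by blast
      ultimately show ?thesis by (simp add: density_at_def)
    qed simp
  qed
  show ?thesis using e1 unfolding e2 e3 by (rule sym)
qed

lemma chart_measure_indep:
  assumes "c \<in> atlas M" "d \<in> atlas M" "E \<in> sets borel" "E \<subseteq> fst c" "E \<subseteq> fst d"
  shows "chart_measure c E = chart_measure d E"
  using isometry_chart_measure[OF isometry_id assms(1-4)] assms(5) by simp

lemma chart_measure_suminf:
  assumes c: "c \<in> atlas M" and A: "range A \<subseteq> sets borel" "disjoint_family A" "\<And>k. A k \<subseteq> fst c"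
  shows "(\<Sum>k. chart_measure c (A k)) = chart_measure c (\<Union>k. A k)"
proof -
  have "(\<Sum>k. chart_measure c (A k)) = (\<Sum>k. emeasure (chart_lborel c) (snd c ` A k))"
    using A by (intro suminf_cong chart_measure_eq[OF c]) auto
  also have "\<dots> = emeasure (chart_lborel c) (\<Union>k. snd c ` A k)"
  proof (rule suminf_emeasure)
    show "range (\<lambda>k. snd c ` A k) \<subseteq> sets (chart_lborel c)"
      using chart_image_borel[OF c] A by (auto simp: chart_lborel_def)
    show "disjoint_family (\<lambda>k. snd c ` A k)"
      unfolding disjoint_family_on_def
    proof (intro ballI impI)
      fix m n :: nat assume "m \<noteq> n"
      then have "A m \<inter> A n = {}" using A(2) by (auto simp: disjoint_family_on_def)
      then show "snd c ` A m \<inter> snd c ` A n = {}"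
        using inj_on_image_Int[OF chart_inj[OF c] A(3) A(3), of m n] by simp
    qed
  qed
  also have "(\<Union>k. snd c ` A k) = snd c ` (\<Union>k. A k)" by blast
  also have "emeasure (chart_lborel c) \<dots> = chart_measure c (\<Union>k. A k)"
    using A by (intro chart_measure_eq[OF c, symmetric]) auto
  finally show ?thesis .
qed

end

lemma borel_partition_sum:
  fixes n :: nat
  assumes s: "sets \<mu> = sets borel" and D: "\<And>i. i < n \<Longrightarrow> D i \<in> sets borel" "(\<Union>i<n. D i) = UNIV" "disjoint_family_on D {..<n}"
    and E: "E \<in> sets borel"
  shows "emeasure \<mu> E = (\<Sum>i<n. emeasure \<mu> (E \<inter> D i))"
proof -
  have "(\<Sum>i<n. emeasure \<mu> (E \<inter> D i)) = emeasure \<mu> (\<Union>i\<in>{..<n}. E \<inter> D i)"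
  proof (rule sum_emeasure)
    show "(\<lambda>i. E \<inter> D i) ` {..<n} \<subseteq> sets \<mu>" using D(1) E s by auto
    show "disjoint_family_on (\<lambda>i. E \<inter> D i) {..<n}" using D(3) unfolding disjoint_family_on_def by blast
  qed (rule finite_lessThan)
  also have "(\<Union>i\<in>{..<n}. E \<inter> D i) = E" using D(2) by blast
  finally show ?thesis ..
qed

locale compact_rmanifold = rmanifold M for M :: "('a::{t2_space, second_countable_topology}, 'n::finite) riemannian" +
  assumes compact_M: "compact (UNIV :: 'a set)"
begin

definition chart_partition :: "nat \<Rightarrow> (nat \<Rightarrow> ('a, 'n) chart) \<Rightarrow> (nat \<Rightarrow> 'a set) \<Rightarrow> bool" where
  "chart_partition n C D \<longleftrightarrow> (\<forall>i<n. C i \<in> atlas M \<and> D i \<subseteq> fst (C i) \<and> D i \<in> sets borel) \<and>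
     (\<Union>i<n. D i) = UNIV \<and> disjoint_family_on D {..<n}"

lemma chart_partitionD:
  assumes "chart_partition n C D"
  shows "i < n \<Longrightarrow> C i \<in> atlas M" "i < n \<Longrightarrow> D i \<subseteq> fst (C i)" "i < n \<Longrightarrow> D i \<in> sets borel"
    "(\<Union>i<n. D i) = UNIV" "disjoint_family_on D {..<n}"
  using assms unfolding chart_partition_def by blast+

lemma chart_partition_exists: "\<exists>n C D. chart_partition n C D"
proof -
  have "\<forall>U\<in>fst ` atlas M. open U" "UNIV \<subseteq> \<Union>(fst ` atlas M)"
    using chart(1) chart_cover by auto
  then obtain T where T: "T \<subseteq> fst ` atlas M" "finite T" "UNIV \<subseteq> \<Union>T"
    using compactE[OF compact_M] by metis
  obtain U and n :: nat where U: "T = U ` {i. i < n}" using finite_imp_nat_seg_image_inj_on[OF T(2)] by metis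
  define C where "C i = (SOME c. c \<in> atlas M \<and> fst c = U i)" for i
  have C: "C i \<in> atlas M \<and> fst (C i) = U i" if "i < n" for i
  proof -
    have "U i \<in> fst ` atlas M" using T(1) U that by auto
    then have "\<exists>c. c \<in> atlas M \<and> fst c = U i" by auto
    from someI_ex[OF this] show ?thesis unfolding C_def .
  qed
  define D where "D i = U i - (\<Union>j<i. U j)" for i
  have oU: "open (U i)" if "i < n" for i using C[OF that] chart(1) by metis
  have "chart_partition n C D" unfolding chart_partition_def
  proof (intro conjI allI impI)
    show "C i \<in> atlas M" "D i \<subseteq> fst (C i)" if "i < n" for i using C[OF that] by (auto simp: D_def)
    show "D i \<in> sets borel" if "i < n" for i
      unfolding D_def using oU that by (intro sets.Diff borel_open open_UN) auto
    show "disjoint_family_on D {..<n}"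
      unfolding disjoint_family_on_def D_def
    proof (intro ballI impI)
      fix i j :: nat assume "i \<noteq> j"
      then consider "i < j" | "j < i" by linarith
      then show "(U i - (\<Union>k<i. U k)) \<inter> (U j - (\<Union>k<j. U k)) = {}" by cases auto
    qed
    show "(\<Union>i<n. D i) = UNIV"
    proof -
      have "\<exists>i<n. x \<in> D i" for x
      proof -
        have ex: "\<exists>i. i < n \<and> x \<in> U i" using T(3) U by auto
        define i where "i = (LEAST i. i < n \<and> x \<in> U i)"
        have i: "i < n \<and> x \<in> U i" unfolding i_def by (rule LeastI_ex[OF ex])
        have "x \<notin> U j" if "j < i" for j using not_less_Least[of j "\<lambda>i. i < n \<and> x \<in> U i"] that i unfolding i_def by auto
        then show ?thesis using i by (auto simp: D_def)
      qed
      then show ?thesis by blast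
    qed
  qed
  then show ?thesis by blast
qed

definition is_riemannian_measure :: "'a measure \<Rightarrow> bool" where
  "is_riemannian_measure \<mu> \<longleftrightarrow> sets \<mu> = sets borel \<and>
        (\<forall>c\<in>atlas M. \<forall>E\<in>sets borel. E \<subseteq> fst c \<longrightarrow> emeasure \<mu> E = chart_measure c E)"

lemma riemannian_measure_unique:
  assumes "is_riemannian_measure \<mu>" "is_riemannian_measure \<nu>" shows "\<mu> = \<nu>"
proof (rule measure_eqI)
  note s = assms[unfolded is_riemannian_measure_def]
  show "sets \<mu> = sets \<nu>" using s by simp
  fix E assume E: "E \<in> sets \<mu>"
  obtain n C D where "chart_partition n C D" using chart_partition_exists by blast
  note CD = chart_partitionD[OF this]
  have "emeasure \<rho> E = (\<Sum>i<n. chart_measure (C i) (E \<inter> D i))" if "is_riemannian_measure \<rho>" for \<rho>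
  proof -
    have "emeasure \<rho> E = (\<Sum>i<n. emeasure \<rho> (E \<inter> D i))"
      using that s E by (intro borel_partition_sum CD) (auto simp: is_riemannian_measure_def)
    also have "\<dots> = (\<Sum>i<n. chart_measure (C i) (E \<inter> D i))"
    proof (rule sum.cong[OF refl])
      fix i assume "i \<in> {..<n}"
      then have i: "i < n" by simp
      have "E \<inter> D i \<in> sets borel" "E \<inter> D i \<subseteq> fst (C i)" using CD(2,3)[OF i] E s by auto
      then show "emeasure \<rho> (E \<inter> D i) = chart_measure (C i) (E \<inter> D i)"
        using that CD(1)[OF i] unfolding is_riemannian_measure_def by blast
    qed
    finally show ?thesis .
  qed
  then show "emeasure \<mu> E = emeasure \<nu> E" using assms by simp
qed

text \<open>The measure is the sum of the chart measures over the pieces of a partition; the comparison of two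
  charts shows that it agrees with every chart measure.\<close>

lemma riemannian_measure_exists: "\<exists>\<mu>. is_riemannian_measure \<mu>"
proof -
  obtain n C D where "chart_partition n C D" using chart_partition_exists by blast
  note CD = chart_partitionD[OF this]
  define m where "m E = (\<Sum>i<n. chart_measure (C i) (E \<inter> D i))" for E
  define \<mu> where "\<mu> = measure_of UNIV (sets borel) m"
  have sb: "sigma_sets UNIV (sets borel) = (sets borel :: 'a set set)"
    using sets.sigma_sets_eq[of "borel :: 'a measure"] by simp
  have s: "sets \<mu> = sets borel" unfolding \<mu>_def by (simp add: sb)
  have pos: "positive (sets borel) m" by (simp add: positive_def m_def chart_measure_def)
  have add: "countably_additive (sets borel) m"
  proof (rule countably_additiveI)
    fix A :: "nat \<Rightarrow> 'a set" assume A: "range A \<subseteq> sets borel" "disjoint_family A"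
    have "(\<Sum>k. m (A k)) = (\<Sum>i<n. \<Sum>k. chart_measure (C i) (A k \<inter> D i))"
      unfolding m_def by (rule suminf_sum) simp
    also have "\<dots> = (\<Sum>i<n. chart_measure (C i) (\<Union>k. A k \<inter> D i))"
    proof (intro sum.cong refl chart_measure_suminf)
      fix i assume "i \<in> {..<n}"
      then have i: "i < n" by simp
      show "C i \<in> atlas M" by (rule CD(1)[OF i])
      show "range (\<lambda>k. A k \<inter> D i) \<subseteq> sets borel" using A(1) CD(3)[OF i] by auto
      show "disjoint_family (\<lambda>k. A k \<inter> D i)" using A(2) unfolding disjoint_family_on_def by blast
      show "A k \<inter> D i \<subseteq> fst (C i)" for k using CD(2)[OF i] by blast
    qed
    also have "\<dots> = m (\<Union>k. A k)"
      unfolding m_def by (intro sum.cong refl arg_cong[where f = "chart_measure _"]) blast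
    finally show "(\<Sum>k. m (A k)) = m (\<Union>k. A k)" .
  qed
  have em: "emeasure \<mu> E = m E" if "E \<in> sets borel" for E
    unfolding \<mu>_def
    by (rule emeasure_measure_of_sigma[OF _ pos add that]) (use sets.sigma_algebra_axioms[of "borel :: 'a measure"] in simp)
  have "emeasure \<mu> E = chart_measure c E" if c: "c \<in> atlas M" and E: "E \<in> sets borel" "E \<subseteq> fst c" for c E
  proof -
    let ?A = "\<lambda>k. if k < n then E \<inter> D k else {}"
    have A: "range ?A \<subseteq> sets borel" "disjoint_family ?A" "?A k \<subseteq> fst c" "(\<Union>k. ?A k) = E" for k
    proof -
      show "range ?A \<subseteq> sets borel" using E(1) CD(3) by auto
      show "disjoint_family ?A" using CD(5) unfolding disjoint_family_on_def by auto
      show "?A k \<subseteq> fst c" using E(2) by auto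
      show "(\<Union>k. ?A k) = E" using CD(4) by (auto split: if_splits)
    qed
    have "m E = (\<Sum>k<n. chart_measure c (?A k))" unfolding m_def
    proof (rule sum.cong[OF refl])
      fix i assume "i \<in> {..<n}"
      then have i: "i < n" by simp
      show "chart_measure (C i) (E \<inter> D i) = chart_measure c (?A i)"
        using chart_measure_indep[OF CD(1)[OF i] c, of "E \<inter> D i"] CD(2,3)[OF i] E i by auto
    qed
    also have "\<dots> = (\<Sum>k. chart_measure c (?A k))"
      by (rule suminf_finite[symmetric]) (auto simp: chart_measure_def)
    also have "\<dots> = chart_measure c E" using chart_measure_suminf[OF c A(1,2,3)] A(4) by simp
    finally show ?thesis using em[OF E(1)] by simp
  qed
  then have "is_riemannian_measure \<mu>" unfolding is_riemannian_measure_def using s by blast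
  then show ?thesis ..
qed

abbreviation vol :: "'a measure" where "vol \<equiv> riemannian_measure M"

lemma is_riemannian_measure_vol: "is_riemannian_measure vol"
proof -
  have eq: "riemannian_measure M = (THE \<mu>. is_riemannian_measure \<mu>)"
    unfolding riemannian_measure_def is_riemannian_measure_def chart_measure_def ..
  have "\<exists>!\<mu>. is_riemannian_measure \<mu>"
    using riemannian_measure_exists riemannian_measure_unique by blast
  from theI'[OF this] show ?thesis unfolding eq .
qed

lemma sets_vol [simp, measurable_cong]: "sets vol = sets borel"
  using is_riemannian_measure_vol by (simp add: is_riemannian_measure_def)

lemma space_vol [simp]: "space vol = UNIV"
  using sets_eq_imp_space_eq[OF sets_vol] by simp

lemma emeasure_vol_chart: "c \<in> atlas M \<Longrightarrow> E \<in> sets borel \<Longrightarrow> E \<subseteq> fst c \<Longrightarrow> emeasure vol E = chart_measure c E"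
  using is_riemannian_measure_vol by (simp add: is_riemannian_measure_def)

lemma distr_isometry:
  assumes h: "riemannian_isometry M h" shows "distr vol borel h = vol"
proof (rule measure_eqI)
  show "sets (distr vol borel h) = sets vol" by simp
  fix E assume "E \<in> sets (distr vol borel h)"
  then have E: "E \<in> sets borel" by simp
  have bij: "bij h" and cont: "continuous_on UNIV h" "continuous_on UNIV (inv h)" using isometry_homeo[OF h] by auto
  have hm: "h \<in> borel_measurable borel" by (rule borel_measurable_continuous_onI[OF cont(1)])
  have him: "h ` X \<in> sets borel" if "X \<in> sets borel" for X
    by (rule isometry_image_borel[OF h that])
  have vE: "h -` E \<in> sets borel" using measurable_sets[OF hm E] by simp
  obtain n C D where "chart_partition n C D" using chart_partition_exists by blast
  note CD = chart_partitionD[OF this]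
  \<comment> \<open>Both sides are additive, so it suffices to compare sets that are mapped from one chart into another.\<close>
  have loc: "emeasure vol X = emeasure vol (h ` X)" if X: "X \<in> sets borel" "X \<subseteq> fst (C i)" "h ` X \<subseteq> fst (C j)" "i < n" "j < n" for X i j
    using isometry_chart_measure[OF h CD(1)[OF X(4)] CD(1)[OF X(5)] X(1-3)]
      emeasure_vol_chart[OF CD(1)[OF X(4)] X(1,2)] emeasure_vol_chart[OF CD(1)[OF X(5)] him[OF X(1)] X(3)] by simp
  have "emeasure vol (h -` E) = (\<Sum>i<n. emeasure vol (h -` E \<inter> D i))"
    by (rule borel_partition_sum) (use CD vE in auto)
  also have "\<dots> = (\<Sum>i<n. \<Sum>j<n. emeasure vol (h -` E \<inter> D i \<inter> h -` D j))"
  proof (rule sum.cong[OF refl])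
    fix i assume i: "i \<in> {..<n}"
    show "emeasure vol (h -` E \<inter> D i) = (\<Sum>j<n. emeasure vol (h -` E \<inter> D i \<inter> h -` D j))"
    proof (rule borel_partition_sum)
      show "h -` D j \<in> sets borel" if "j < n" for j using measurable_sets[OF hm CD(3)[OF that]] by simp
      show "(\<Union>j<n. h -` D j) = UNIV" using CD(4) by (auto simp: vimage_UN[symmetric])
      show "disjoint_family_on (\<lambda>j. h -` D j) {..<n}" using CD(5) unfolding disjoint_family_on_def by blast
      show "h -` E \<inter> D i \<in> sets borel" using vE CD(3) i by auto
    qed simp
  qed
  also have "\<dots> = (\<Sum>i<n. \<Sum>j<n. emeasure vol (E \<inter> D j \<inter> h ` D i))"
  proof (intro sum.cong refl)
    fix i j assume ij: "i \<in> {..<n}" "j \<in> {..<n}"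
    let ?X = "h -` E \<inter> D i \<inter> h -` D j"
    have "h ` ?X = E \<inter> D j \<inter> h ` D i" using bij_is_surj[OF bij] by auto
    moreover have "?X \<in> sets borel"
      using vE CD(3) ij measurable_sets[OF hm CD(3)[of j]] by auto
    then have "emeasure vol ?X = emeasure vol (h ` ?X)"
      using CD(2)[of i] CD(2)[of j] ij by (intro loc[of _ i j]) auto
    ultimately show "emeasure vol ?X = emeasure vol (E \<inter> D j \<inter> h ` D i)" by simp
  qed
  also have "\<dots> = (\<Sum>j<n. \<Sum>i<n. emeasure vol (E \<inter> D j \<inter> h ` D i))" by (rule sum.swap)
  also have "\<dots> = (\<Sum>j<n. emeasure vol (E \<inter> D j))"
  proof (rule sum.cong[OF refl])
    fix j assume j: "j \<in> {..<n}"
    show "(\<Sum>i<n. emeasure vol (E \<inter> D j \<inter> h ` D i)) = emeasure vol (E \<inter> D j)"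
    proof (rule borel_partition_sum[symmetric])
      show "h ` D i \<in> sets borel" if "i < n" for i by (rule him[OF CD(3)[OF that]])
      have "(\<Union>i<n. h ` D i) = h ` (\<Union>i<n. D i)" by blast
      then show "(\<Union>i<n. h ` D i) = UNIV" using CD(4) bij_is_surj[OF bij] by simp
      show "disjoint_family_on (\<lambda>i. h ` D i) {..<n}"
        unfolding disjoint_family_on_def
      proof (intro ballI impI)
        fix i k assume ik: "i \<in> {..<n}" "k \<in> {..<n}" "i \<noteq> k"
        then have "D i \<inter> D k = {}" using CD(5) by (simp add: disjoint_family_on_def)
        then show "h ` D i \<inter> h ` D k = {}" using image_Int[OF bij_is_inj[OF bij], of "D i" "D k"] by simp
      qed
      show "E \<inter> D j \<in> sets borel" using E CD(3) j by auto
    qed simp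
  qed
  also have "\<dots> = emeasure vol E"
    by (rule borel_partition_sum[symmetric]) (use CD E in auto)
  finally show "emeasure (distr vol borel h) E = emeasure vol E"
    using E hm by (subst emeasure_distr) (auto simp: measurable_cong_sets[OF sets_vol refl])
qed

text \<open>The measure is locally finite, and the manifold is compact.\<close>

lemma finite_vol: "finite_measure vol"
proof
  have loc: "\<exists>U. open U \<and> p \<in> U \<and> emeasure vol U < \<infinity>" for p
  proof -
    obtain c where c: "c \<in> atlas M" "p \<in> fst c" using chart_cover by blast
    obtain r where r: "0 < r" "cball (snd c p) r \<subseteq> snd c ` fst c"
      using chart(2)[OF c(1)] c(2) by (meson open_contains_cball imageI)
    have "continuous_on (cball (snd c p) r) (density_at M c)"
      by (rule continuous_on_subset[OF C1_on_continuous[OF density_C1[OF c(1)]] r(2)])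
    then have "bounded (density_at M c ` cball (snd c p) r)"
      by (intro compact_imp_bounded compact_continuous_image) auto
    then obtain K where K: "\<forall>y\<in>cball (snd c p) r. \<bar>density_at M c y\<bar> \<le> K"
      by (auto simp: bounded_iff)
    let ?U = "chart_inv c ` ball (snd c p) r"
    have bs: "ball (snd c p) r \<subseteq> snd c ` fst c" using r(2) ball_subset_cball by blast
    have oU: "open ?U" by (rule chart_inv_image_open[OF c(1) open_ball bs])
    have pU: "p \<in> ?U" using chart(5)[OF c] r(1) by (metis centre_in_ball image_eqI)
    have Uc: "?U \<subseteq> fst c" using bs chart(6)[OF c(1)] by blast
    have im: "snd c ` ?U = ball (snd c p) r" using bs chart(6)[OF c(1)] by (force simp: image_image)
    have "emeasure vol ?U = chart_measure c ?U" by (rule emeasure_vol_chart[OF c(1) borel_open[OF oU] Uc])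
    also have "\<dots> \<le> (\<integral>\<^sup>+y. ennreal K * indicator (ball (snd c p) r) y \<partial>lborel)"
      unfolding chart_measure_def im
    proof (rule nn_integral_mono)
      fix y :: "real^'n"
      show "ennreal (sqrt (det (gram M c (chart_inv c y)))) * indicator (ball (snd c p) r) y \<le> ennreal K * indicator (ball (snd c p) r) y"
      proof (cases "y \<in> ball (snd c p) r")
        case True
        then have "\<bar>density_at M c y\<bar> \<le> K" using K by auto
        then show ?thesis using True by (auto simp: density_at_def intro!: ennreal_leI)
      qed simp
    qed
    also have "\<dots> = ennreal K * emeasure lborel (ball (snd c p) r)" by (simp add: nn_integral_cmult_indicator)
    also have "\<dots> < \<infinity>" using emeasure_lborel_ball_finite[of "snd c p" r] by (simp add: ennreal_mult_less_top)
    finally show ?thesis using oU pU by blast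
  qed
  then obtain U where U: "\<And>p. open (U p)" "\<And>p. p \<in> U p" "\<And>p. emeasure vol (U p) < \<infinity>" by metis
  have "\<forall>B\<in>range U. open B" "UNIV \<subseteq> \<Union>(range U)" using U by auto
  then obtain T where T: "T \<subseteq> range U" "finite T" "UNIV \<subseteq> \<Union>T" using compactE[OF compact_M] by metis
  have "(\<Union>B\<in>T. B) = UNIV" using T(3) by blast
  then have "emeasure vol UNIV = emeasure vol (\<Union>B\<in>T. B)" by simp
  also have "\<dots> \<le> (\<Sum>B\<in>T. emeasure vol B)"
    by (rule emeasure_subadditive_finite[OF T(2)]) (use T(1) U(1) in auto)
  also have "\<dots> < \<infinity>"
  proof -
    have "\<forall>B\<in>T. emeasure vol B < top" using T(1) U(3) by auto
    then show ?thesis using ennreal_sum_less_top[OF T(2)] by simp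
  qed
  finally show "emeasure vol (space vol) \<noteq> \<infinity>" by simp
qed

lemma continuous_integrable: "continuous_on UNIV (f :: 'a \<Rightarrow> real) \<Longrightarrow> integrable vol f"
proof -
  assume f: "continuous_on UNIV f"
  interpret finite_measure vol by (rule finite_vol)
  have "bounded (range f)" by (intro compact_imp_bounded compact_continuous_image f compact_M)
  then obtain K where "\<And>x. \<bar>f x\<bar> \<le> K" by (auto simp: bounded_iff)
  moreover have "f \<in> borel_measurable vol"
    using borel_measurable_continuous_onI[OF f] by (simp add: measurable_cong_sets[OF sets_vol refl])
  ultimately show "integrable vol f" by (intro integrable_const_bound[of f K]) auto
qed

text \<open>The volume density is positive, and nonempty open sets in coordinates are not negligible.\<close>

lemma vol_open_pos:
  assumes U: "open U" "U \<noteq> {}" shows "0 < emeasure vol U"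
proof -
  obtain p where p: "p \<in> U" using U by blast
  obtain c where c: "c \<in> atlas M" "p \<in> fst c" using chart_cover by blast
  let ?E = "U \<inter> fst c"
  have oE: "open ?E" using U chart(1)[OF c(1)] by blast
  let ?S = "snd c ` ?E"
  have oS: "open ?S" by (rule chart_image_open[OF c(1) oE]) auto
  have neg: "\<not> negligible ?S" using open_not_negligible[OF oS] p c by auto
  have "chart_measure c ?E \<noteq> 0"
  proof
    assume "chart_measure c ?E = 0"
    then have "emeasure (chart_lborel c) ?S = 0" using chart_measure_eq[OF c(1) borel_open[OF oE]] by simp
    moreover have "emeasure (chart_lborel c) ?S = (\<integral>\<^sup>+y. ennreal (indicat_real (snd c ` fst c) y * density_at M c y) * indicator ?S y \<partial>lborel)"
      unfolding chart_lborel_def using density_measurable[OF c(1)] oS by (intro emeasure_density) auto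
    ultimately have "(\<integral>\<^sup>+y. ennreal (indicat_real (snd c ` fst c) y * density_at M c y) * indicator ?S y \<partial>lborel) = 0"
      by simp
    then have "AE y in lborel. ennreal (indicat_real (snd c ` fst c) y * density_at M c y) * indicator ?S y = 0"
      using density_measurable[OF c(1)] oS by (subst (asm) nn_integral_0_iff_AE) auto
    then have "AE y in lborel. y \<notin> ?S"
    proof (rule eventually_mono)
      fix y assume "ennreal (indicat_real (snd c ` fst c) y * density_at M c y) * indicator ?S y = 0"
      then show "y \<notin> ?S" using density_pos[OF c(1), of y] by (auto simp: indicator_def split: if_splits)
    qed
    then have "?S \<in> null_sets lborel" using oS by (subst AE_iff_null_sets) auto
    then have "negligible ?S" by (simp add: negligible_iff_null_sets null_sets_completionI)
    then show False using neg by simp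
  qed
  then have "0 < emeasure vol ?E"
    using emeasure_vol_chart[OF c(1) borel_open[OF oE]] by (simp add: zero_less_iff_neq_zero)
  also have "\<dots> \<le> emeasure vol U" using U by (intro emeasure_mono) auto
  finally show ?thesis .
qed

text \<open>The set where the function differs from \<open>0\<close> is open and a null set, hence empty.\<close>

lemma continuous_integral_zero:
  assumes f: "continuous_on UNIV (f :: 'a \<Rightarrow> real)" "\<And>x. 0 \<le> f x" and z: "(LINT x|vol. f x) = 0"
  shows "f x = 0"
proof (rule ccontr)
  assume nz: "f x \<noteq> 0"
  let ?U = "f -` (- {0})"
  have oU: "open ?U" using f(1) by (intro open_vimage) auto
  have "AE x in vol. f x = 0"
    using z integral_nonneg_eq_0_iff_AE[OF continuous_integrable[OF f(1)]] f(2) by simp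
  then have "AE x in vol. x \<notin> ?U" by simp
  then have "emeasure vol ?U = 0" using oU AE_iff_null_sets[of ?U vol] by auto
  moreover have "?U \<noteq> {}" using nz by auto
  ultimately show False using vol_open_pos[OF oU] by simp
qed

end

section \<open>Green's formula\<close>

text \<open>Translation invariance of Lebesgue measure gives the divergence theorem for compactly supported
  vector fields, one coordinate at a time: the integral of a difference quotient vanishes.\<close>

lemma integral_directional_derivative_zero:
  fixes X :: "real^'n::finite \<Rightarrow> real"
  assumes X: "C1_on UNIV X" and K: "compact K" "\<And>y. y \<notin> K \<Longrightarrow> X y = 0"
  shows "integrable lborel (\<lambda>y. frechet_derivative X (at y) v)"
    and "(LINT y|lborel. frechet_derivative X (at y) v) = 0"
proof -
  let ?D = "\<lambda>y. frechet_derivative X (at y) v"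
  have cD: "continuous_on UNIV ?D" by (rule C1_on_partial_continuous[OF X])
  have cX: "continuous_on UNIV X" by (rule C1_on_continuous[OF X])
  obtain R where R: "0 < R" "\<And>y. y \<in> K \<Longrightarrow> norm y \<le> R"
    using compact_imp_bounded[OF K(1)] by (auto simp: bounded_pos)
  let ?B = "cball (0 :: real^'n) (R + norm v)"
  have der: "((\<lambda>t. X (y + t *\<^sub>R v)) has_real_derivative ?D (y + t *\<^sub>R v)) (at t)" for y t
  proof -
    have X': "(X has_derivative frechet_derivative X (at (y + t *\<^sub>R v))) (at (y + t *\<^sub>R v))"
      using C1_on_differentiable[OF X] by (simp add: frechet_derivative_works[symmetric])
    have l: "((\<lambda>t. y + t *\<^sub>R v) has_derivative (\<lambda>h. h *\<^sub>R v)) (at t)"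
      by (auto intro!: derivative_eq_intros)
    have "((\<lambda>t. X (y + t *\<^sub>R v)) has_derivative (\<lambda>h. frechet_derivative X (at (y + t *\<^sub>R v)) (h *\<^sub>R v))) (at t)"
      by (rule has_derivative_compose[OF l X'])
    moreover have "frechet_derivative X (at (y + t *\<^sub>R v)) (h *\<^sub>R v) = ?D (y + t *\<^sub>R v) * h" for h
      using linear_scale[OF linear_frechet_derivative[of X "at (y + t *\<^sub>R v)"]] C1_on_differentiable[OF X] by simp
    ultimately show ?thesis by (simp add: has_field_derivative_def)
  qed
  have "bounded (?D ` ?B)"
    by (intro compact_imp_bounded compact_continuous_image continuous_on_subset[OF cD]) auto
  then obtain C where "\<forall>y\<in>?B. \<bar>?D y\<bar> \<le> C" by (auto simp: bounded_iff)
  then have C: "\<bar>?D y\<bar> \<le> C" if "y \<in> ?B" for y using that by blast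
  have Dz: "?D y = 0" if "norm y > R" for y
  proof -
    have "frechet_derivative X (at y) = frechet_derivative (\<lambda>_. 0) (at y)"
    proof (rule frechet_derivative_cong_open[of "- cball 0 R"])
      show "X x = 0" if "x \<in> - cball 0 R" for x using that K(2) R(2) by force
    qed (use that in auto)
    then show ?thesis by simp
  qed
  have C0: "0 \<le> C" using C[of 0] R(1) by (meson abs_ge_zero add_nonneg_nonneg centre_in_cball less_imp_le norm_ge_zero order_trans)
  have Dall: "\<bar>?D y\<bar> \<le> C" for y
  proof (cases "norm y \<le> R")
    case True then show ?thesis using C[of y] by (simp add: add_increasing2)
  next
    case False then show ?thesis using Dz[of y] C0 by simp
  qed
  let ?q = "\<lambda>n y. (X (y + (1 / Suc n) *\<^sub>R v) - X y) * Suc n"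
  have lip: "\<bar>?q n y\<bar> \<le> C * indicat_real (cball 0 (R + norm v)) y" for n y
  proof -
    let ?t = "1 / real (Suc n)"
    have t: "0 < ?t" "?t \<le> 1" by auto
    obtain z where z: "X (y + ?t *\<^sub>R v) - X (y + 0 *\<^sub>R v) = (?t - 0) * ?D (y + z *\<^sub>R v)"
      using MVT2[of 0 ?t "\<lambda>t. X (y + t *\<^sub>R v)" "\<lambda>t. ?D (y + t *\<^sub>R v)"] der t(1) by blast
    then have q: "?q n y = ?D (y + z *\<^sub>R v)" by simp
    show ?thesis
    proof (cases "y \<in> cball 0 (R + norm v)")
      case True then show ?thesis using q Dall by simp
    next
      case False
      then have ny: "norm y > R + norm v" by simp
      have "norm y \<le> norm (y + ?t *\<^sub>R v) + norm (?t *\<^sub>R v)" using norm_triangle_ineq4[of "y + ?t *\<^sub>R v" "?t *\<^sub>R v"] by simp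
      moreover have "norm (?t *\<^sub>R v) \<le> norm v" using t mult_right_mono[of ?t 1 "norm v"] by simp
      ultimately have "norm (y + ?t *\<^sub>R v) > R" using ny by linarith
      then have "X (y + ?t *\<^sub>R v) = 0" using K(2) R(2) by (meson not_le)
      moreover have "norm y > R" using ny norm_ge_zero[of v] by linarith
      then have "X y = 0" using K(2) R(2) by (meson not_le)
      ultimately show ?thesis using False by simp
    qed
  qed
  have Xm: "X \<in> borel_measurable borel" by (rule borel_measurable_continuous_onI[OF cX])
  have qm: "?q n \<in> borel_measurable lborel" for n
    using measurable_compose[OF _ Xm, of "\<lambda>y. y + (1 / Suc n) *\<^sub>R v" lborel] Xm by simp
  have lim: "(\<lambda>n. ?q n y) \<longlonglongrightarrow> ?D y" for y
  proof -
    have "(\<lambda>h. (X (y + (0 + h) *\<^sub>R v) - X (y + 0 *\<^sub>R v)) / h) \<midarrow>0\<rightarrow> ?D (y + 0 *\<^sub>R v)"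
      using der[of y 0] unfolding DERIV_def .
    moreover have "filterlim (\<lambda>n. 1 / real (Suc n)) (at 0) sequentially"
    proof (rule filterlim_atI)
      show "(\<lambda>n. 1 / real (Suc n)) \<longlonglongrightarrow> 0" by (rule LIMSEQ_inverse_real_of_nat[unfolded inverse_eq_divide])
    qed simp
    ultimately have "(\<lambda>n. (X (y + (0 + 1 / real (Suc n)) *\<^sub>R v) - X (y + 0 *\<^sub>R v)) / (1 / real (Suc n))) \<longlonglongrightarrow> ?D (y + 0 *\<^sub>R v)"
      by (rule filterlim_compose)
    then show ?thesis by simp
  qed
  have bi: "integrable lborel (\<lambda>y. C * indicat_real (cball (0 :: real^'n) (R + norm v)) y)"
    using emeasure_lborel_cball_finite[of "0 :: real^'n" "R + norm v"]
    by (intro integrable_mult_right integrable_real_indicator) auto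
  show int: "integrable lborel ?D"
    by (rule integrable_dominated_convergence[of _ _ ?q, OF _ qm bi]) (use lim lip cD in \<open>auto intro: borel_measurable_continuous_onI\<close>)
  have "(\<lambda>n. LINT y|lborel. ?q n y) \<longlonglongrightarrow> (LINT y|lborel. ?D y)"
    by (rule integral_dominated_convergence[of _ _ ?q, OF _ qm bi]) (use lim lip cD in \<open>auto intro: borel_measurable_continuous_onI\<close>)
  moreover have "(LINT y|lborel. ?q n y) = 0" for n
  proof -
    let ?w = "(1 / Suc n) *\<^sub>R v"
    have "integrable lborel (\<lambda>y. indicator K y *\<^sub>R X y)"
      by (rule borel_integrable_compact[OF K(1) continuous_on_subset[OF cX]]) simp
    moreover have "(\<lambda>y. indicator K y *\<^sub>R X y) = X"
    proof
      show "indicator K y *\<^sub>R X y = X y" for y using K(2) by (cases "y \<in> K") auto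
    qed
    ultimately have Xi: "integrable lborel X" by (simp only:)
    have "integrable (distr lborel borel ((+) ?w)) X" using Xi by (simp only: lborel_distr_plus)
    then have Xt: "integrable lborel (\<lambda>y. X (y + ?w))" by (subst (asm) integrable_distr_eq) (auto simp: Xm add.commute)
    have "(LINT y|distr lborel borel ((+) ?w). X y) = (LINT y|lborel. X (?w + y))"
      by (rule integral_distr) (auto simp: Xm)
    then have "(LINT y|lborel. X (y + ?w)) = (LINT y|lborel. X y)" by (simp only: lborel_distr_plus add.commute)
    then show ?thesis using Xi Xt by (simp add: Bochner_Integration.integral_diff)
  qed
  ultimately show "(LINT y|lborel. ?D y) = 0" by (simp add: LIMSEQ_const_iff)
qed

lemma squared_hinge_deriv:
  "((\<lambda>s. (max 0 s)\<^sup>2) has_real_derivative 2 * max 0 s) (at s within S)" for s :: real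
proof -
  consider "s < 0" | "s = 0" | "0 < s" by linarith
  then have "((\<lambda>s. (max 0 s)\<^sup>2) has_real_derivative 2 * max 0 s) (at s)"
  proof cases
    case 1
    have "((\<lambda>s. 0) has_real_derivative 0) (at s)" by simp
    then have "((\<lambda>s. (max 0 s)\<^sup>2) has_real_derivative 0) (at s)"
      by (rule has_field_derivative_transform_within_open[where S = "{..<0}"]) (use 1 in auto)
    then show ?thesis using 1 by simp
  next
    case 2
    have "((\<lambda>h. ((max 0 (0 + h))\<^sup>2 - (max 0 0)\<^sup>2) / h) \<longlongrightarrow> (0::real)) (at 0)"
    proof (rule Lim_null_comparison[where g = "\<lambda>h::real. \<bar>h\<bar>"])
      show "\<forall>\<^sub>F h::real in at 0. norm (((max 0 (0 + h))\<^sup>2 - (max 0 0)\<^sup>2) / h) \<le> \<bar>h\<bar>"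
        by (intro always_eventually allI) (auto simp: max_def power2_eq_square)
      show "((\<lambda>h::real. \<bar>h\<bar>) \<longlongrightarrow> 0) (at 0)" using tendsto_rabs[OF tendsto_ident_at[of 0 UNIV]] by simp
    qed
    then show ?thesis using 2 by (simp add: DERIV_def)
  next
    case 3
    have "((\<lambda>s. s\<^sup>2) has_real_derivative 2 * s) (at s)" by (auto intro!: derivative_eq_intros)
    then have "((\<lambda>s. (max 0 s)\<^sup>2) has_real_derivative 2 * s) (at s)"
      by (rule has_field_derivative_transform_within_open[where S = "{0<..}"]) (use 3 in auto)
    then show ?thesis using 3 by simp
  qed
  then show ?thesis by (rule has_field_derivative_at_within)
qed

lemma C1_on_ball_bump: "C1_on UNIV (\<lambda>y :: real^'n::finite. (max 0 (r\<^sup>2 - (y - z) \<bullet> (y - z)))\<^sup>2)"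
proof (rule C1_on_real_compose(1)[where h = "\<lambda>s. (max 0 s)\<^sup>2" and h' = "\<lambda>s. 2 * max 0 s" and S = UNIV])
  have "C1_on UNIV (\<lambda>y :: real^'n. y)"
    by (rule C1_onI[where f' = "\<lambda>_. id_blinfun"]) auto
  then have b: "C1_on UNIV (\<lambda>y :: real^'n. y $ i + - (z $ i))" for i by (intro C1_on_add C1_on_nth C1_on_const)
  then have "C1_on UNIV (\<lambda>y :: real^'n. r\<^sup>2 + - (\<Sum>i\<in>UNIV. (y $ i + - (z $ i)) * (y $ i + - (z $ i))))"
    by (intro C1_on_add[OF C1_on_const C1_on_minus] C1_on_sum C1_on_mult b)
  then show "C1_on UNIV (\<lambda>y :: real^'n. r\<^sup>2 - (y - z) \<bullet> (y - z))" by (simp add: inner_vec_def)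
  show "((\<lambda>s. (max 0 s)\<^sup>2) has_real_derivative 2 * max 0 s) (at s within UNIV)" for s :: real
    by (rule squared_hinge_deriv)
  show "continuous_on UNIV (\<lambda>s::real. 2 * max 0 s)" by (intro continuous_intros)
qed auto

context rmanifold
begin

text \<open>The bump function of a small coordinate ball, extended by \<open>0\<close>: its support is compact, hence closed
  in the manifold, so the extension is \<open>C\<^sup>1\<close> also outside of the chart.\<close>

lemma C1_fun_bump:
  assumes c: "c \<in> atlas M" "p \<in> fst c" and U: "open U" "p \<in> U"
  shows "\<exists>\<phi> K. C1_fun \<phi> \<and> (\<forall>q. 0 \<le> \<phi> q) \<and> 0 < \<phi> p \<and> compact K \<and> K \<subseteq> snd c ` (fst c \<inter> U) \<and>
    (\<forall>q. q \<notin> chart_inv c ` K \<longrightarrow> \<phi> q = 0)"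
proof -
  let ?z = "snd c p" and ?V = "snd c ` (fst c \<inter> U)"
  have "open ?V" by (rule chart_image_open[OF c(1) open_Int[OF chart(1)[OF c(1)] U(1)]]) auto
  moreover have "?z \<in> ?V" using c U by auto
  ultimately obtain r where r: "0 < r" "cball ?z r \<subseteq> ?V" using open_contains_cball by blast
  define b where "b y = (max 0 (r\<^sup>2 - (y - ?z) \<bullet> (y - ?z)))\<^sup>2" for y
  define \<phi> where "\<phi> q = (if q \<in> fst c then b (snd c q) else 0)" for q
  have cb: "C1_on UNIV b" unfolding b_def[abs_def] by (rule C1_on_ball_bump)
  have b0: "b y = 0" if "y \<notin> cball ?z r" for y
  proof -
    have "r < norm (y - ?z)" using that by (simp add: dist_norm norm_minus_commute)
    then have "r\<^sup>2 \<le> (norm (y - ?z))\<^sup>2" using r(1) by (intro power_mono) auto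
    then show ?thesis by (simp add: b_def power2_norm_eq_inner)
  qed
  let ?K = "cball ?z r"
  have KV: "?K \<subseteq> snd c ` fst c" using r(2) by auto
  have z: "\<phi> q = 0" if "q \<notin> chart_inv c ` ?K" for q
  proof (cases "q \<in> fst c")
    case True
    have "snd c q \<notin> ?K"
    proof
      assume "snd c q \<in> ?K"
      then have "chart_inv c (snd c q) \<in> chart_inv c ` ?K" by (rule imageI)
      then show False using that chart(5)[OF c(1) True] by simp
    qed
    then show ?thesis using b0 by (simp add: \<phi>_def)
  qed (simp add: \<phi>_def)
  have clK: "closed (chart_inv c ` ?K)"
    by (intro compact_imp_closed compact_continuous_image continuous_on_subset[OF chart(4)[OF c(1)] KV]) simp
  have C1: "C1_fun \<phi>" unfolding C1_fun_def
  proof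
    fix d assume d: "d \<in> atlas M"
    show "C1_on (snd d ` fst d) (\<phi> \<circ> chart_inv d)"
    proof (rule C1_on_local)
      fix y assume y: "y \<in> snd d ` fst d"
      show "\<exists>W. open W \<and> y \<in> W \<and> C1_on W (\<phi> \<circ> chart_inv d)"
      proof (cases "chart_inv d y \<in> fst c")
        case True
        let ?W = "snd d ` (fst d \<inter> id -` fst c)"
        note i = isometry_coordinates[OF isometry_id d c(1)]
        have "C1_on ?W (\<lambda>x. b ((snd c \<circ> id \<circ> chart_inv d) x))"
          by (rule C1_on_compose[OF i(2) cb]) auto
        then have "C1_on ?W (\<phi> \<circ> chart_inv d)"
        proof (rule C1_on_cong[OF _ i(1)])
          fix x assume "x \<in> ?W"
          then have "chart_inv d x \<in> fst c" using chart(5)[OF d] by auto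
          then show "b ((snd c \<circ> id \<circ> chart_inv d) x) = (\<phi> \<circ> chart_inv d) x" by (simp add: \<phi>_def)
        qed
        moreover have "y \<in> ?W"
          using chart(6)[OF d y] True by (intro image_eqI[of _ _ "chart_inv d y"]) auto
        ultimately show ?thesis using i(1) by blast
      next
        case False
        let ?W = "snd d ` (fst d - chart_inv c ` ?K)"
        have oW: "open ?W" by (rule chart_image_open[OF d open_Diff[OF chart(1)[OF d] clK]]) auto
        have "chart_inv c ` ?K \<subseteq> fst c" using KV chart(6)[OF c(1)] by blast
        then have yW: "y \<in> ?W" using chart(6)[OF d y] False by (intro image_eqI[of _ _ "chart_inv d y"]) auto
        have "C1_on ?W (\<phi> \<circ> chart_inv d)"
        proof (rule C1_on_cong[OF C1_on_const[of _ 0] oW])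
          fix x assume "x \<in> ?W"
          then have "chart_inv d x \<notin> chart_inv c ` ?K" using chart(5)[OF d] by auto
          then show "0 = (\<phi> \<circ> chart_inv d) x" using z by simp
        qed
        then show ?thesis using oW yW by blast
      qed
    qed
  qed
  show ?thesis
  proof (intro exI[of _ \<phi>] exI[of _ ?K] conjI allI impI C1)
    show "0 \<le> \<phi> q" for q by (simp add: \<phi>_def b_def)
    show "0 < \<phi> p" using c(2) r(1) by (simp add: \<phi>_def b_def)
    show "compact ?K" "?K \<subseteq> ?V" using r(2) by auto
  qed (rule z)
qed

definition chart_laplacian :: "('a, 'n) chart \<Rightarrow> ('a \<Rightarrow> real) \<Rightarrow> 'a \<Rightarrow> real" where
  "chart_laplacian c f p = - chart_divergence M c (chart_gradient M c f) p"

lemma laplacian_chart_at: "laplacian M f p = chart_laplacian (chart_at M p) f p"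
  by (simp add: laplacian_def chart_laplacian_def Let_def)

lemma chart_gradient_eq:
  "chart_gradient M c f p = matrix_inv (gram M c p) *v partials c f (snd c p)"
  by (simp add: chart_gradient_def partials_def chart_partial_def[abs_def])

lemma weighted_gradient_C1:
  assumes f: "smooth_fun M f" and c: "c \<in> atlas M"
  shows "C1_on (snd c ` fst c) (\<lambda>y. density_at M c y * chart_gradient M c f (chart_inv c y) $ i)"
proof -
  have s: "smooth_on (snd c ` fst c) (f \<circ> chart_inv c)" using f c by (simp add: smooth_fun_def)
  have "C1_on (snd c ` fst c) (\<lambda>y. partials c f y $ j)" for j
    using smooth_on_C1[OF smooth_on_partial[OF s, of j]] by (simp add: partials_def)
  then have "C1_on (snd c ` fst c) (\<lambda>y. (matrix_inv (gram M c (chart_inv c y)) *v partials c f y) $ i)"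
    by (intro C1_on_posdef_inverse gram_C1 c chart(2) posdef_chart_inv)
  then have "C1_on (snd c ` fst c) (\<lambda>y. density_at M c y * (matrix_inv (gram M c (chart_inv c y)) *v partials c f y) $ i)"
    by (rule C1_on_mult[OF density_C1[OF c]])
  then show ?thesis
    by (rule C1_on_cong[OF _ chart(2)[OF c]]) (use chart(6)[OF c] in \<open>auto simp: chart_gradient_eq\<close>)
qed

lemma divergence_coordinates:
  assumes c: "c \<in> atlas M" and y: "y \<in> snd c ` fst c"
  shows "density_at M c y * chart_laplacian c f (chart_inv c y) =
    - (\<Sum>i\<in>UNIV. frechet_derivative (\<lambda>y. density_at M c y * chart_gradient M c f (chart_inv c y) $ i) (at y) (axis i 1))"
proof -
  have "0 < density_at M c y" by (rule density_pos[OF c y])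
  then show ?thesis using chart(6)[OF c y]
    by (simp add: chart_laplacian_def chart_divergence_def chart_partial_def density_at_def[abs_def] o_def sum_negf)
qed

lemma chart_laplacian_continuous:
  assumes f: "smooth_fun M f" and c: "c \<in> atlas M"
  shows "continuous_on (fst c) (chart_laplacian c f)"
proof -
  have "continuous_on (snd c ` fst c) (\<lambda>y. - (\<Sum>i\<in>UNIV. frechet_derivative (\<lambda>y. density_at M c y * chart_gradient M c f (chart_inv c y) $ i) (at y) (axis i 1)) / density_at M c y)"
    by (intro continuous_on_divide continuous_on_minus continuous_on_sum C1_on_partial_continuous weighted_gradient_C1[OF f c] C1_on_continuous density_C1 c)
       (use density_pos[OF c] in force)
  then have "continuous_on (fst c) (\<lambda>p. - (\<Sum>i\<in>UNIV. frechet_derivative (\<lambda>y. density_at M c y * chart_gradient M c f (chart_inv c y) $ i) (at (snd c p)) (axis i 1)) / density_at M c (snd c p))"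
    by (rule continuous_on_compose2[OF _ chart(3)[OF c]]) auto
  then show ?thesis
  proof (rule continuous_on_eq)
    fix p assume p: "p \<in> fst c"
    then have y: "snd c p \<in> snd c ` fst c" by blast
    show "- (\<Sum>i\<in>UNIV. frechet_derivative (\<lambda>y. density_at M c y * chart_gradient M c f (chart_inv c y) $ i) (at (snd c p)) (axis i 1)) / density_at M c (snd c p) = chart_laplacian c f p"
      using divergence_coordinates[OF c y, of f] density_pos[OF c y] chart(5)[OF c p] by (simp add: field_simps)
  qed
qed

lemma pairing_zero:
  assumes c: "open U" "p \<in> U" "\<And>q. q \<in> U \<Longrightarrow> \<phi> q = 0"
  shows "pairing \<phi> f p = 0"
proof -
  let ?c = "chart_at M p"
  let ?W = "snd ?c ` (fst ?c \<inter> U)"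
  have oW: "open ?W" by (rule chart_image_open[OF chart_at(1) open_Int[OF chart(1)[OF chart_at(1)] c(1)]]) auto
  have yW: "snd ?c p \<in> ?W" using chart_at(2) c(2) by blast
  have "frechet_derivative (\<phi> \<circ> chart_inv ?c) (at (snd ?c p)) = frechet_derivative (\<lambda>_. 0) (at (snd ?c p))"
    by (rule frechet_derivative_cong_open[OF oW yW]) (use c(3) chart(5)[OF chart_at(1)] in auto)
  then have "partials ?c \<phi> (snd ?c p) = 0" by (simp add: partials_def vec_eq_iff)
  then show ?thesis by (simp add: pairing_def grad_pairing_def)
qed

lemma partials_add:
  assumes "C1_fun f" "C1_fun g" "c \<in> atlas M" "p \<in> fst c"
  shows "partials c (\<lambda>q. f q + g q) (snd c p) = partials c f (snd c p) + partials c g (snd c p)"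
proof -
  have df: "((f \<circ> chart_inv c) has_derivative frechet_derivative (f \<circ> chart_inv c) (at (snd c p))) (at (snd c p))"
    using C1_funD(2)[OF assms(1,3,4)] by (simp add: frechet_derivative_works)
  have dg: "((g \<circ> chart_inv c) has_derivative frechet_derivative (g \<circ> chart_inv c) (at (snd c p))) (at (snd c p))"
    using C1_funD(2)[OF assms(2,3,4)] by (simp add: frechet_derivative_works)
  show ?thesis
    using frechet_derivative_at[OF has_derivative_add[OF df dg], symmetric]
    by (simp add: partials_def vec_eq_iff o_def)
qed

lemma pairing_sum:
  assumes "finite I" "\<And>i. i \<in> I \<Longrightarrow> C1_fun (f i)"
  shows "pairing (\<lambda>q. \<Sum>i\<in>I. f i q) g p = (\<Sum>i\<in>I. pairing (f i) g p)"
  using assms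
proof (induction I)
  case empty
  show ?case using pairing_zero[of UNIV p "\<lambda>_. 0" g] by simp
next
  case (insert j I)
  have "pairing (\<lambda>q. f j q + (\<Sum>i\<in>I. f i q)) g p = pairing (f j) g p + pairing (\<lambda>q. \<Sum>i\<in>I. f i q) g p"
    unfolding pairing_def grad_pairing_def
    by (subst partials_add) (use insert chart_at in \<open>auto intro!: C1_fun_sum simp: inner_add_left\<close>)
  then show ?case using insert by simp
qed

end

context compact_rmanifold
begin

text \<open>On the domain of a chart the Riemannian measure is the image of the weighted Lebesgue measure under
  the inverse of the chart.\<close>

lemma integral_vol_chart:
  fixes k :: "'a \<Rightarrow> real"
  assumes c: "c \<in> atlas M" and k: "k \<in> borel_measurable borel" "\<And>p. p \<notin> fst c \<Longrightarrow> k p = 0"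
  shows "integrable vol k \<longleftrightarrow> integrable lborel (\<lambda>y. indicat_real (snd c ` fst c) y * density_at M c y * k (chart_inv c y))"
    and "(LINT p|vol. k p) = (LINT y|lborel. indicat_real (snd c ` fst c) y * density_at M c y * k (chart_inv c y))"
proof -
  let ?V = "snd c ` fst c"
  \<comment> \<open>A measurable extension of the inverse of the chart to all of the coordinate space; the weight
    vanishes where the extension is arbitrary.\<close>
  define J where "J y = (if y \<in> ?V then chart_inv c y else undefined)" for y
  have Jm: "J \<in> borel_measurable borel"
  proof (rule borel_measurableI)
    fix S :: "'a set" assume S: "open S"
    have "?V \<inter> chart_inv c -` S \<in> sets borel" "- ?V \<in> sets borel"
      using borel_Int_vimage_open[OF chart(2,4)[OF c] borel_open[OF S]] chart(2)[OF c] by auto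
    moreover have "J -` S = (?V \<inter> chart_inv c -` S) \<union> (if undefined \<in> S then - ?V else {})"
      by (auto simp: J_def split: if_splits)
    ultimately show "J -` S \<inter> space borel \<in> sets borel" by simp
  qed
  have dens: "(\<lambda>y. ennreal (indicat_real ?V y * density_at M c y)) \<in> borel_measurable lborel"
    using density_measurable[OF c] by simp
  have d0: "0 \<le> indicat_real ?V y * density_at M c y" for y
    using density_pos[OF c, of y] by (auto simp: indicator_def)
  have eq: "distr (chart_lborel c) borel J = density vol (indicator (fst c))"
  proof (rule measure_eqI)
    fix E assume "E \<in> sets (distr (chart_lborel c) borel J)"
    then have E: "E \<in> sets borel" by simp
    have EU: "E \<inter> fst c \<in> sets borel" using E chart(1)[OF c] by auto
    have "emeasure (distr (chart_lborel c) borel J) E = emeasure (chart_lborel c) (J -` E)"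
      using Jm E by (subst emeasure_distr) (auto simp: chart_lborel_def)
    also have "\<dots> = emeasure (chart_lborel c) (snd c ` (E \<inter> fst c))"
    proof -
      have im: "snd c ` (E \<inter> fst c) \<in> sets borel" by (rule chart_image_borel[OF c EU]) auto
      have "y \<in> J -` E \<longleftrightarrow> y \<in> snd c ` (E \<inter> fst c)" if "y \<in> ?V" for y
        using that chart(5)[OF c] by (auto simp: J_def)
      then show ?thesis
        unfolding chart_lborel_def using dens im measurable_sets[OF Jm E]
        by (subst (1 2) emeasure_density) (auto intro!: nn_integral_cong simp: indicator_def)
    qed
    also have "\<dots> = emeasure vol (E \<inter> fst c)"
      using chart_measure_eq[OF c EU] emeasure_vol_chart[OF c EU] by simp
    also have "\<dots> = emeasure (density vol (indicator (fst c))) E"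
      using E borel_open[OF chart(1)[OF c]]
      by (subst emeasure_density) (auto simp: Int_commute simp flip: indicator_inter_arith intro!: borel_measurable_indicator)
    finally show "emeasure (distr (chart_lborel c) borel J) E = emeasure (density vol (indicator (fst c))) E" .
  qed simp
  have kv: "k \<in> borel_measurable vol" using k(1) by (simp add: measurable_cong_sets[OF sets_vol refl])
  have fm: "indicat_real (fst c) \<in> borel_measurable vol" using borel_open[OF chart(1)[OF c]] by (intro borel_measurable_indicator) simp
  have kk: "(\<lambda>p. indicat_real (fst c) p *\<^sub>R k p) = k"
  proof
    show "indicat_real (fst c) p *\<^sub>R k p = k p" for p using k(2) by (cases "p \<in> fst c") auto
  qed
  have JJ: "(\<lambda>y. (indicat_real ?V y * density_at M c y) *\<^sub>R k (J y)) = (\<lambda>y. indicat_real ?V y * density_at M c y * k (chart_inv c y))"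
    by (auto simp: indicator_def J_def)
  have den: "density vol (indicator (fst c)) = density vol (\<lambda>p. ennreal (indicat_real (fst c) p))"
    by (simp add: ennreal_indicator)
  have kJ: "(\<lambda>y. k (J y)) \<in> borel_measurable lborel" using measurable_compose[OF Jm k(1)] by simp
  have dm: "(\<lambda>y. indicat_real ?V y * density_at M c y) \<in> borel_measurable lborel" using density_measurable[OF c] by simp
  have Jm': "J \<in> measurable (chart_lborel c) borel" using Jm by (simp add: chart_lborel_def)
  have "integrable vol k \<longleftrightarrow> integrable (density vol (\<lambda>p. ennreal (indicat_real (fst c) p))) k"
    using integrable_density[OF kv fm] kk by simp
  also have "\<dots> \<longleftrightarrow> integrable (chart_lborel c) (\<lambda>y. k (J y))"
    unfolding den[symmetric] eq[symmetric] using integrable_distr_eq[OF Jm' k(1)] by simp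
  also have "\<dots> \<longleftrightarrow> integrable lborel (\<lambda>y. indicat_real ?V y * density_at M c y * k (chart_inv c y))"
    unfolding chart_lborel_def using integrable_density[OF kJ dm] d0 JJ by simp
  finally show "integrable vol k \<longleftrightarrow> integrable lborel (\<lambda>y. indicat_real ?V y * density_at M c y * k (chart_inv c y))" .
  have "(LINT p|vol. k p) = integral\<^sup>L (density vol (\<lambda>p. ennreal (indicat_real (fst c) p))) k"
    using integral_density[OF kv fm] kk by simp
  also have "\<dots> = (LINT y|chart_lborel c. k (J y))"
    unfolding den[symmetric] eq[symmetric] by (rule integral_distr[OF Jm' k(1)])
  also have "\<dots> = (LINT y|lborel. indicat_real ?V y * density_at M c y * k (chart_inv c y))"
    unfolding chart_lborel_def using integral_density[OF kJ dm] d0 JJ by simp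
  finally show "(LINT p|vol. k p) = (LINT y|lborel. indicat_real ?V y * density_at M c y * k (chart_inv c y))" .
qed

lemma pairing_weighted_gradient:
  assumes \<phi>: "C1_fun \<phi>" and f: "C1_fun f" and c: "c \<in> atlas M" "p \<in> fst c"
  shows "pairing \<phi> f p = (\<Sum>i\<in>UNIV. partials c \<phi> (snd c p) $ i * chart_gradient M c f p $ i)"
  unfolding pairing_eq[OF c \<phi> f] grad_pairing_def chart_gradient_eq by (simp add: inner_vec_def)

text \<open>The coordinate divergence of \<open>\<phi> (det g)\<^sup>1\<^sup>/\<^sup>2 \<nabla>f\<close> has integral \<open>0\<close>. By the product rule it is
  the difference of the two integrands.\<close>

lemma chart_Green:
  assumes f: "smooth_fun M f" and \<phi>: "C1_fun \<phi>" and c: "c \<in> atlas M"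
    and K: "compact K" "K \<subseteq> snd c ` fst c" "\<And>q. q \<notin> chart_inv c ` K \<Longrightarrow> \<phi> q = 0"
  shows "(LINT p|vol. pairing \<phi> f p) = (LINT p|vol. \<phi> p * chart_laplacian c f p)"
    and "continuous_on UNIV (\<lambda>p. \<phi> p * chart_laplacian c f p)"
proof -
  let ?V = "snd c ` fst c"
  have fC: "C1_fun f" by (rule smooth_fun_C1[OF f])
  have oV: "open ?V" by (rule chart(2)[OF c])
  have ccK: "compact (chart_inv c ` K)"
    by (rule compact_continuous_image[OF continuous_on_subset[OF chart(4)[OF c] K(2)] K(1)])
  then have clK: "closed (chart_inv c ` K)" by (rule compact_imp_closed)
  have KU: "chart_inv c ` K \<subseteq> fst c" using K(2) chart(6)[OF c] by blast
  show cont: "continuous_on UNIV (\<lambda>p. \<phi> p * chart_laplacian c f p)"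
  proof -
    have "continuous_on (fst c) (\<lambda>p. \<phi> p * chart_laplacian c f p)"
      by (intro continuous_on_mult continuous_on_subset[OF C1_fun_continuous[OF \<phi>]] chart_laplacian_continuous f c) simp
    moreover have "continuous_on (- (chart_inv c ` K)) (\<lambda>p. \<phi> p * chart_laplacian c f p)"
      by (rule continuous_on_eq[OF continuous_on_const[of _ 0]]) (use K(3) in auto)
    ultimately have "continuous_on (fst c \<union> - (chart_inv c ` K)) (\<lambda>p. \<phi> p * chart_laplacian c f p)"
      using continuous_on_open_Un[OF chart(1)[OF c]] clK by blast
    moreover have "fst c \<union> - (chart_inv c ` K) = UNIV" using KU by blast
    ultimately show ?thesis by simp
  qed
  define w where "w i y = density_at M c y * chart_gradient M c f (chart_inv c y) $ i" for i y
  define X where "X i y = (if y \<in> ?V then \<phi> (chart_inv c y) * w i y else 0)" for i y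
  have wC: "C1_on ?V (w i)" for i unfolding w_def[abs_def] by (rule weighted_gradient_C1[OF f c])
  have \<phi>z: "\<phi> (chart_inv c y) = 0" if "y \<in> ?V" "y \<notin> K" for y
  proof (rule K(3))
    show "chart_inv c y \<notin> chart_inv c ` K"
    proof
      assume "chart_inv c y \<in> chart_inv c ` K"
      then obtain z where z: "z \<in> K" "chart_inv c y = chart_inv c z" by blast
      then have "y = z" using chart(6)[OF c that(1)] chart(6)[OF c, of z] K(2) by (metis subsetD)
      then show False using z that by simp
    qed
  qed
  have Xz: "X i y = 0" if "y \<notin> K" for i y using that \<phi>z by (auto simp: X_def)
  have XV: "C1_on ?V (X i)" for i
  proof (rule C1_on_cong[OF C1_on_mult[OF C1_funD(1)[OF \<phi> c] wC[of i]] oV])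
    show "(\<phi> \<circ> chart_inv c) y * w i y = X i y" if "y \<in> ?V" for y using that by (simp add: X_def)
  qed
  have XC: "C1_on UNIV (X i)" for i
  proof (rule C1_on_local)
    fix y :: "real^'n"
    show "\<exists>W. open W \<and> y \<in> W \<and> C1_on W (X i)"
    proof (cases "y \<in> K")
      case True
      then show ?thesis using K(2) XV oV by blast
    next
      case False
      have oK: "open (- K)" using compact_imp_closed[OF K(1)] by blast
      have "C1_on (- K) (X i)" by (rule C1_on_cong[OF C1_on_const[of _ 0] oK]) (use Xz in auto)
      then show ?thesis using False oK by blast
    qed
  qed
  let ?D = "\<lambda>i y. frechet_derivative (X i) (at y) (axis i 1)"
  note div = integral_directional_derivative_zero[OF XC K(1) Xz]
  let ?P = "\<lambda>y. indicat_real ?V y * density_at M c y * pairing \<phi> f (chart_inv c y)"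
  let ?L = "\<lambda>y. indicat_real ?V y * density_at M c y * (\<phi> (chart_inv c y) * chart_laplacian c f (chart_inv c y))"
  have pt: "(\<Sum>i\<in>UNIV. ?D i y) = ?P y - ?L y" for y
  proof (cases "y \<in> ?V")
    case True
    have d: "?D i y = \<phi> (chart_inv c y) * frechet_derivative (w i) (at y) (axis i 1) + partials c \<phi> y $ i * w i y" for i
    proof -
      have "frechet_derivative (X i) (at y) = frechet_derivative (\<lambda>y. (\<phi> \<circ> chart_inv c) y * w i y) (at y)"
        by (rule frechet_derivative_cong_open[OF oV True]) (simp add: X_def)
      moreover have a: "((\<phi> \<circ> chart_inv c) has_derivative frechet_derivative (\<phi> \<circ> chart_inv c) (at y)) (at y)"
        using C1_on_differentiable[OF C1_funD(1)[OF \<phi> c] True] by (simp add: frechet_derivative_works)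
      moreover have b: "(w i has_derivative frechet_derivative (w i) (at y)) (at y)"
        using C1_on_differentiable[OF wC True] by (simp add: frechet_derivative_works)
      ultimately show ?thesis
        using frechet_derivative_at[OF has_derivative_mult[OF a b], symmetric]
        by (simp add: partials_def o_def)
    qed
    have "(\<Sum>i\<in>UNIV. ?D i y) = \<phi> (chart_inv c y) * (\<Sum>i\<in>UNIV. frechet_derivative (w i) (at y) (axis i 1)) + (\<Sum>i\<in>UNIV. partials c \<phi> y $ i * w i y)"
      unfolding d by (simp add: sum.distrib sum_distrib_left)
    also have "(\<Sum>i\<in>UNIV. frechet_derivative (w i) (at y) (axis i 1)) = - (density_at M c y * chart_laplacian c f (chart_inv c y))"
      unfolding divergence_coordinates[OF c True] w_def[abs_def] by simp
    also have "(\<Sum>i\<in>UNIV. partials c \<phi> y $ i * w i y) = density_at M c y * pairing \<phi> f (chart_inv c y)"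
      using pairing_weighted_gradient[OF \<phi> fC c, of "chart_inv c y"] chart(6)[OF c True]
      by (simp add: w_def sum_distrib_left mult_ac)
    finally show ?thesis using True by (simp add: algebra_simps)
  next
    case False
    have "frechet_derivative (X i) (at y) = frechet_derivative (\<lambda>_. 0) (at y)" for i
      by (rule frechet_derivative_cong_open[of "- K"]) (use False K(2) Xz compact_imp_closed[OF K(1)] in auto)
    then show ?thesis using False by simp
  qed
  have Pz: "pairing \<phi> f p = 0" if "p \<notin> fst c" for p
    by (rule pairing_zero[of "- (chart_inv c ` K)"]) (use that KU clK K(3) in auto)
  have Lz: "\<phi> p * chart_laplacian c f p = 0" if "p \<notin> fst c" for p
    using K(3)[of p] KU that by auto
  note Pc = pairing_continuous[OF \<phi> fC]
  note iP = integral_vol_chart[OF c borel_measurable_continuous_onI[OF Pc] Pz]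
  note iL = integral_vol_chart[OF c borel_measurable_continuous_onI[OF cont] Lz]
  have PI: "integrable lborel ?P" using iP(1) continuous_integrable[OF Pc] by blast
  have LI: "integrable lborel ?L" using iL(1) continuous_integrable[OF cont] by blast
  have "0 = (\<Sum>i\<in>UNIV. LINT y|lborel. ?D i y)" using div(2) by simp
  also have "\<dots> = (LINT y|lborel. (\<Sum>i\<in>UNIV. ?D i y))" using div(1) by (intro Bochner_Integration.integral_sum[symmetric]) auto
  also have "\<dots> = (LINT y|lborel. ?P y) - (LINT y|lborel. ?L y)" unfolding pt by (rule Bochner_Integration.integral_diff[OF PI LI])
  finally show "(LINT p|vol. pairing \<phi> f p) = (LINT p|vol. \<phi> p * chart_laplacian c f p)"
    using iP(2) iL(2) by linarith
qed

text \<open>Green's formula determines the Laplacian, and it does not refer to a chart: if two coordinate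
  expressions differed at \<open>p\<close>, a bump function near \<open>p\<close> would distinguish the integrals.\<close>

lemma chart_laplacian_le:
  assumes f: "smooth_fun M f" and c: "c \<in> atlas M" "p \<in> fst c" and d: "d \<in> atlas M" "p \<in> fst d"
  shows "chart_laplacian c f p \<le> chart_laplacian d f p"
proof (rule ccontr)
  assume "\<not> ?thesis"
  then have gt: "0 < chart_laplacian c f p - chart_laplacian d f p" by simp
  let ?g = "\<lambda>q. chart_laplacian c f q - chart_laplacian d f q"
  let ?O = "fst c \<inter> fst d"
  have "continuous_on ?O ?g"
    by (intro continuous_on_diff continuous_on_subset[OF chart_laplacian_continuous[OF f]] c d) auto
  from continuous_open_preimage[OF this _ open_greaterThan[of 0]]
  have oU: "open (?O \<inter> ?g -` {0<..})" using chart(1) c d by blast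
  have pU: "p \<in> ?O \<inter> ?g -` {0<..}" using c d gt by simp
  obtain \<phi> K where \<phi>: "C1_fun \<phi>" "\<forall>q. 0 \<le> \<phi> q" "0 < \<phi> p" and K: "compact K" "K \<subseteq> snd c ` (fst c \<inter> (?O \<inter> ?g -` {0<..}))"
    and Kz: "\<forall>q. q \<notin> chart_inv c ` K \<longrightarrow> \<phi> q = 0"
    using C1_fun_bump[OF c oU pU] by (elim exE conjE)
  have Kc: "K \<subseteq> snd c ` fst c" using K(2) by auto
  have Ks: "chart_inv c ` K \<subseteq> ?O \<inter> ?g -` {0<..}"
  proof
    fix q assume "q \<in> chart_inv c ` K"
    then obtain q' where "q' \<in> fst c \<inter> (?O \<inter> ?g -` {0<..})" "q = chart_inv c (snd c q')" using K(2) by blast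
    then show "q \<in> ?O \<inter> ?g -` {0<..}" using chart(5)[OF c(1), of q'] by simp
  qed
  have cK: "compact (chart_inv c ` K)"
    by (rule compact_continuous_image[OF continuous_on_subset[OF chart(4)[OF c(1)] Kc] K(1)])
  let ?Kd = "snd d ` chart_inv c ` K"
  have Kd: "compact ?Kd" "?Kd \<subseteq> snd d ` fst d"
    using Ks by (auto intro!: compact_continuous_image[OF continuous_on_subset[OF chart(3)[OF d(1)]] cK])
  have im: "chart_inv d ` ?Kd = chart_inv c ` K"
    unfolding image_image[of "chart_inv d"] using Ks chart(5)[OF d(1)] by (intro image_cong[where g = "\<lambda>x. x", simplified]) auto
  note gc = chart_Green[OF f \<phi>(1) c(1) K(1) Kc Kz[rule_format]]
  note gd = chart_Green[OF f \<phi>(1) d(1) Kd, unfolded im, OF Kz[rule_format]]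
  have eq: "\<phi> q * ?g q = \<phi> q * chart_laplacian c f q - \<phi> q * chart_laplacian d f q" for q by (simp add: right_diff_distrib)
  have "(LINT q|vol. \<phi> q * ?g q) = 0"
    unfolding eq using Bochner_Integration.integral_diff[OF continuous_integrable[OF gc(2)] continuous_integrable[OF gd(2)]] gc(1) gd(1)
    by simp
  moreover have "continuous_on UNIV (\<lambda>q. \<phi> q * ?g q)"
    unfolding eq by (intro continuous_on_diff gc(2) gd(2))
  moreover have "0 \<le> \<phi> q * ?g q" for q
  proof (cases "q \<in> chart_inv c ` K")
    case True
    then have "0 < ?g q" using Ks by auto
    then show ?thesis using \<phi>(2) by simp
  qed (simp add: Kz)
  ultimately have "\<phi> p * ?g p = 0" using continuous_integral_zero by blast
  then show False using \<phi>(3) gt by simp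
qed

lemma laplacian_eq_chart:
  assumes "smooth_fun M f" "c \<in> atlas M" "p \<in> fst c"
  shows "laplacian M f p = chart_laplacian c f p"
  unfolding laplacian_chart_at
  by (rule antisym) (intro chart_laplacian_le assms chart_at)+

text \<open>A partition of unity, obtained by normalising finitely many bump functions, reduces the formula to
  test functions supported in single charts.\<close>

lemma Green:
  assumes f: "smooth_fun M f" and \<phi>: "C1_fun \<phi>"
  shows "(LINT p|vol. pairing \<phi> f p) = (LINT p|vol. \<phi> p * laplacian M f p)"
proof -
  define P where "P p bK \<longleftrightarrow> C1_fun (fst bK) \<and> (\<forall>q. 0 \<le> fst bK q) \<and> 0 < fst bK p \<and> compact (snd bK) \<and>
     snd bK \<subseteq> snd (chart_at M p) ` (fst (chart_at M p) \<inter> UNIV) \<and>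
     (\<forall>q. q \<notin> chart_inv (chart_at M p) ` snd bK \<longrightarrow> fst bK q = 0)" for p and bK :: "('a \<Rightarrow> real) \<times> (real^'n) set"
  have "\<forall>p. \<exists>bK. P p bK"
    unfolding P_def split_paired_Ex fst_conv snd_conv
    by (intro allI C1_fun_bump chart_at open_UNIV UNIV_I)
  from choice[OF this] obtain bK where bK: "\<forall>p. P p (bK p)" by (elim exE)
  define b where "b p = fst (bK p)" for p
  define K where "K p = snd (bK p)" for p
  have b: "C1_fun (b p)" "0 \<le> b p q" "0 < b p p" "compact (K p)"
      "K p \<subseteq> snd (chart_at M p) ` fst (chart_at M p)" "q \<notin> chart_inv (chart_at M p) ` K p \<Longrightarrow> b p q = 0" for p q
    using spec[OF bK, of p] by (simp_all add: P_def b_def K_def)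
  define U where "U p = b p -` {0<..}" for p
  have oU: "open (U p)" for p
    unfolding U_def using C1_fun_continuous[OF b(1)] by (intro open_vimage) auto
  have "\<And>B. B \<in> range U \<Longrightarrow> open B" "UNIV \<subseteq> \<Union>(range U)" using oU b(3) by (auto simp: U_def)
  then obtain T' where T': "T' \<subseteq> range U" "finite T'" "UNIV \<subseteq> \<Union>T'" using compactE[OF compact_M] by metis
  obtain T where T: "finite T" "T' = U ` T" using finite_subset_image[OF T'(2,1)] by blast
  define s where "s q = (\<Sum>p\<in>T. b p q)" for q
  have s: "0 < s q" for q
  proof -
    obtain p where "p \<in> T" "0 < b p q" using T'(3) T by (auto simp: U_def)
    then show ?thesis unfolding s_def using b(2) T(1) by (intro sum_pos2[of T p]) auto
  qed
  define \<psi> where "\<psi> q = \<phi> q * inverse (s q)" for q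
  have C\<psi>: "C1_fun \<psi>"
    unfolding \<psi>_def[abs_def] s_def[abs_def]
    using s by (intro C1_fun_mult \<phi> C1_fun_inverse C1_fun_sum b(1)) (simp add: s_def)
  have C: "C1_fun (\<lambda>q. b p q * \<psi> q)" for p by (intro C1_fun_mult b C\<psi>)
  have sum: "\<phi> q = (\<Sum>p\<in>T. b p q * \<psi> q)" for q
    using s[of q] by (simp add: sum_distrib_right[symmetric] s_def[symmetric] \<psi>_def)
  have fC: "C1_fun f" by (rule smooth_fun_C1[OF f])
  have loc: "(LINT q|vol. pairing (\<lambda>q. b p q * \<psi> q) f q) = (LINT q|vol. (b p q * \<psi> q) * laplacian M f q)"
    "continuous_on UNIV (\<lambda>q. (b p q * \<psi> q) * laplacian M f q)" for p
  proof -
    have z: "b p q * \<psi> q = 0" if "q \<notin> chart_inv (chart_at M p) ` K p" for q using b(6)[OF that] by simp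
    note g = chart_Green[OF f C[of p] chart_at(1)[of p] b(4)[of p] b(5)[of p] z]
    have e: "(\<lambda>q. (b p q * \<psi> q) * chart_laplacian (chart_at M p) f q) = (\<lambda>q. (b p q * \<psi> q) * laplacian M f q)"
    proof
      fix q show "(b p q * \<psi> q) * chart_laplacian (chart_at M p) f q = (b p q * \<psi> q) * laplacian M f q"
      proof (cases "q \<in> fst (chart_at M p)")
        case True then show ?thesis using laplacian_eq_chart[OF f chart_at(1) True] by simp
      next
        case False
        have "chart_inv (chart_at M p) ` K p \<subseteq> fst (chart_at M p)" using b(5) chart(6)[OF chart_at(1)] by blast
        then show ?thesis using z[of q] False by (metis mult_zero_left subsetD)
      qed
    qed
    show "(LINT q|vol. pairing (\<lambda>q. b p q * \<psi> q) f q) = (LINT q|vol. (b p q * \<psi> q) * laplacian M f q)"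
      using g(1) unfolding e .
    show "continuous_on UNIV (\<lambda>q. (b p q * \<psi> q) * laplacian M f q)" using g(2) unfolding e .
  qed
  have "(LINT q|vol. pairing \<phi> f q) = (LINT q|vol. (\<Sum>p\<in>T. pairing (\<lambda>q. b p q * \<psi> q) f q))"
    unfolding pairing_sum[OF T(1) C, symmetric] sum[symmetric] ..
  also have "\<dots> = (\<Sum>p\<in>T. LINT q|vol. pairing (\<lambda>q. b p q * \<psi> q) f q)"
    by (intro Bochner_Integration.integral_sum continuous_integrable pairing_continuous C fC)
  also have "\<dots> = (\<Sum>p\<in>T. LINT q|vol. (b p q * \<psi> q) * laplacian M f q)" by (intro sum.cong refl loc(1))
  also have "\<dots> = (LINT q|vol. (\<Sum>p\<in>T. (b p q * \<psi> q) * laplacian M f q))"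
    by (intro Bochner_Integration.integral_sum[symmetric] continuous_integrable loc(2))
  also have "\<dots> = (LINT q|vol. \<phi> q * laplacian M f q)"
    by (simp only: sum sum_distrib_right)
  finally show ?thesis .
qed

end

section \<open>The Riemannian distance\<close>

lemma piecewise_C1_cong:
  assumes f: "f piecewise_C1_differentiable_on {u..v}" and eq: "\<And>x. x \<in> {u..v} \<Longrightarrow> f x = g x"
  shows "g piecewise_C1_differentiable_on {u..v :: real}"
proof -
  obtain S where S: "continuous_on {u..v} f" "finite S" "f C1_differentiable_on ({u..v} - S)"
    using f unfolding piecewise_C1_differentiable_on_def by blast
  obtain D where D: "\<forall>x\<in>{u..v} - S. (f has_vector_derivative D x) (at x)" "continuous_on ({u..v} - S) D"
    using S(3) unfolding C1_differentiable_on_def by blast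
  have "g C1_differentiable_on ({u..v} - (S \<union> {u, v}))"
    unfolding C1_differentiable_on_def
  proof (intro exI[of _ D] conjI ballI)
    fix x assume x: "x \<in> {u..v} - (S \<union> {u, v})"
    then have "(f has_vector_derivative D x) (at x)" using D(1) by auto
    then show "(g has_vector_derivative D x) (at x)"
    proof (rule has_vector_derivative_transform_within_open[where S = "{u<..<v}"])
      show "x \<in> {u<..<v}" using x by auto
      show "f t = g t" if "t \<in> {u<..<v}" for t using that by (intro eq) auto
    qed simp
  next
    show "continuous_on ({u..v} - (S \<union> {u, v})) D" by (rule continuous_on_subset[OF D(2)]) auto
  qed
  moreover have "continuous_on {u..v} g" by (rule continuous_on_eq[OF S(1) eq])
  moreover have "finite (S \<union> {u, v})" using S(2) by simp
  ultimately show ?thesis unfolding piecewise_C1_differentiable_on_def by (intro conjI exI)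
qed

definition regular_at :: "('a::topological_space, 'n::finite) riemannian \<Rightarrow> (real \<Rightarrow> 'a) \<Rightarrow> real \<Rightarrow> bool" where
  "regular_at M \<gamma> s \<longleftrightarrow> (\<exists>c\<in>atlas M. \<exists>I. open I \<and> s \<in> I \<and> I \<subseteq> {0<..<1} \<and> \<gamma> ` I \<subseteq> fst c \<and>
     (snd c \<circ> \<gamma>) C1_differentiable_on I)"

context rmanifold
begin

text \<open>The speed is defined with an arbitrary chart around the point. By the chain rule and the
  transformation rule of Gram matrices every chart gives the same value.\<close>

lemma speed_eq:
  assumes c: "c \<in> atlas M" "\<gamma> s \<in> fst c" and \<gamma>: "isCont \<gamma> s"
    and v: "((snd c \<circ> \<gamma>) has_vector_derivative v) (at s)"
  shows "speed M \<gamma> s = sqrt (v \<bullet> (gram M c (\<gamma> s) *v v))"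
proof -
  let ?d = "chart_at M (\<gamma> s)"
  let ?\<tau> = "snd ?d \<circ> id \<circ> chart_inv c" and ?W = "snd c ` (fst c \<inter> id -` fst ?d)"
  note i = isometry_coordinates[OF isometry_id c(1) chart_at(1)[of "\<gamma> s"]]
  let ?y = "snd c (\<gamma> s)"
  have y: "?y \<in> ?W" using c(2) chart_at(2) by auto
  let ?J = "frechet_derivative ?\<tau> (at ?y)"
  have d\<tau>: "?\<tau> differentiable (at ?y)" by (rule C1_on_differentiable[OF i(2) y])
  have "(?\<tau> has_derivative ?J) (at ((snd c \<circ> \<gamma>) s))" using d\<tau> by (simp add: frechet_derivative_works)
  from has_derivative_compose[OF v[unfolded has_vector_derivative_def] this]
  have "((\<lambda>t. ?\<tau> ((snd c \<circ> \<gamma>) t)) has_derivative (\<lambda>h. ?J (h *\<^sub>R v))) (at s)" .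
  moreover have "?J (h *\<^sub>R v) = h *\<^sub>R ?J v" for h by (rule linear_scale[OF linear_frechet_derivative[OF d\<tau>]])
  ultimately have 1: "((\<lambda>t. ?\<tau> ((snd c \<circ> \<gamma>) t)) has_vector_derivative ?J v) (at s)"
    by (simp only: has_vector_derivative_def)
  obtain S where S: "open S" "s \<in> S" "\<gamma> ` S \<subseteq> fst c"
  proof -
    have "\<exists>S. open S \<and> s \<in> S \<and> (\<forall>x\<in>S. \<gamma> x \<in> fst c)"
      using \<gamma> chart(1)[OF c(1)] c(2) unfolding continuous_at_open by blast
    then show ?thesis using that by blast
  qed
  have "((snd ?d \<circ> \<gamma>) has_vector_derivative ?J v) (at s)"
    by (rule has_vector_derivative_transform_within_open[OF 1 S(1,2)]) (use S(3) chart(5)[OF c(1)] in auto)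
  then have "vector_derivative (snd ?d \<circ> \<gamma>) (at s) = matrix ?J *v v"
    unfolding matrix_frechet_mult[OF d\<tau>] by (rule vector_derivative_at)
  moreover have "gram M c (\<gamma> s) = transpose (matrix ?J) ** gram M ?d (\<gamma> s) ** matrix ?J"
    using i(5)[OF y] chart(5)[OF c] by simp
  moreover have "(J *v v) \<bullet> (G *v (J *v v)) = v \<bullet> ((transpose J ** G ** J) *v v)" for J G :: "real^'n^'n"
    by (simp only: matrix_vector_mul_assoc[symmetric] transpose_matrix_vector inner_commute[of v] dot_lmul_matrix inner_commute[of "J *v v"])
  ultimately show ?thesis by (simp add: speed_def Let_def)
qed

lemma curve_continuous: "piecewise_C1_curve M \<gamma> \<Longrightarrow> continuous_on {0..1} \<gamma>"
  by (simp add: piecewise_C1_curve_def path_def)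

lemma curve_isCont: "piecewise_C1_curve M \<gamma> \<Longrightarrow> s \<in> {0<..<1} \<Longrightarrow> isCont \<gamma> s"
  using curve_continuous[of \<gamma>] continuous_on_interior[of "{0..1}" \<gamma> s] by simp

lemma curve_in_chart:
  assumes "piecewise_C1_curve M \<gamma>" "c \<in> atlas M" "0 \<le> u" "u < v" "v \<le> 1" "\<gamma> ` {u..v} \<subseteq> fst c"
  shows "(snd c \<circ> \<gamma>) piecewise_C1_differentiable_on {u..v}"
  using assms unfolding piecewise_C1_curve_def by blast

text \<open>Every parameter has a neighbourhood that is mapped into a single chart and therefore contains only
  finitely many exceptions; finitely many such neighbourhoods cover the unit interval.\<close>

lemma finite_irregular:
  assumes \<gamma>: "piecewise_C1_curve M \<gamma>" shows "finite {s \<in> {0..1}. \<not> regular_at M \<gamma> s}"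
proof -
  have c\<gamma>: "continuous_on {0..1} \<gamma>" by (rule curve_continuous[OF \<gamma>])
  have loc: "\<exists>e>0. finite {s \<in> {0..1} \<inter> ball t e. \<not> regular_at M \<gamma> s}" if t: "t \<in> {0..1}" for t
  proof -
    obtain c where c: "c \<in> atlas M" "\<gamma> t \<in> fst c" using chart_cover by blast
    obtain O' where O'': "open O'" "O' \<inter> {0..1} = \<gamma> -` fst c \<inter> {0..1}"
      using c\<gamma>[unfolded continuous_on_open_invariant] chart(1)[OF c(1)] by blast
    then have O': "open O'" "{0..1} \<inter> \<gamma> -` fst c = O' \<inter> {0..1}" by blast+
    then have "t \<in> O'" using t c(2) by blast
    then obtain e where e: "0 < e" "ball t e \<subseteq> O'" using O'(1) openE by blast
    define u where "u = max 0 (t - e / 2)"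
    define v where "v = min 1 (t + e / 2)"
    have uv: "0 \<le> u" "u < v" "v \<le> 1" using t e by (auto simp: u_def v_def)
    have "{u..v} \<subseteq> ball t e" using e by (auto simp: u_def v_def dist_real_def)
    then have "{u..v} \<subseteq> {0..1} \<inter> \<gamma> -` fst c" unfolding O'(2) using uv e(2) by auto
    then have sub: "\<gamma> ` {u..v} \<subseteq> fst c" by blast
    have "(snd c \<circ> \<gamma>) piecewise_C1_differentiable_on {u..v}"
      by (rule curve_in_chart[OF \<gamma> c(1) uv sub])
    then obtain S where S: "finite S" "(snd c \<circ> \<gamma>) C1_differentiable_on ({u..v} - S)"
      unfolding piecewise_C1_differentiable_on_def by blast
    have reg: "regular_at M \<gamma> s" if s: "s \<in> {u<..<v} - S" for s
      unfolding regular_at_def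
    proof (intro bexI[OF _ c(1)] exI[of _ "{u<..<v} - S"] conjI)
      show "open ({u<..<v} - S)" using S(1) by (intro open_Diff finite_imp_closed) auto
      show "(snd c \<circ> \<gamma>) C1_differentiable_on {u<..<v} - S"
        by (rule C1_differentiable_on_subset[OF S(2)]) auto
      show "{u<..<v} - S \<subseteq> {0<..<1}" "\<gamma> ` ({u<..<v} - S) \<subseteq> fst c" using uv sub by auto
    qed (rule s)
    have "{s \<in> {0..1} \<inter> ball t (e / 2). \<not> regular_at M \<gamma> s} \<subseteq> S \<union> {0, 1}"
    proof
      fix s assume s: "s \<in> {s \<in> {0..1} \<inter> ball t (e / 2). \<not> regular_at M \<gamma> s}"
      show "s \<in> S \<union> {0, 1}"
      proof (rule ccontr)
        assume n: "s \<notin> S \<union> {0, 1}"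
        then have "s \<in> {u<..<v} - S" using s by (auto simp: u_def v_def dist_real_def abs_if split: if_splits)
        then show False using reg s by blast
      qed
    qed
    then have "finite {s \<in> {0..1} \<inter> ball t (e / 2). \<not> regular_at M \<gamma> s}" using S(1) finite_subset by blast
    then show ?thesis using e(1) half_gt_zero by blast
  qed
  then obtain e where e: "\<And>t. t \<in> {0..1} \<Longrightarrow> 0 < e t \<and> finite {s \<in> {0..1} \<inter> ball t (e t). \<not> regular_at M \<gamma> s}"
    by metis
  have "compact {0..1::real}" by simp
  moreover have "\<And>t. t \<in> {0..1} \<Longrightarrow> open (ball t (e t))" "{0..1} \<subseteq> (\<Union>t\<in>{0..1}. ball t (e t))" using e by auto
  ultimately obtain T where T: "T \<subseteq> {0..1}" "finite T" "{0..1} \<subseteq> (\<Union>t\<in>T. ball t (e t))"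
    by (rule compactE_image)
  have "{s \<in> {0..1}. \<not> regular_at M \<gamma> s} \<subseteq> (\<Union>t\<in>T. {s \<in> {0..1} \<inter> ball t (e t). \<not> regular_at M \<gamma> s})"
    using T(3) by blast
  moreover have "finite (\<Union>t\<in>T. {s \<in> {0..1} \<inter> ball t (e t). \<not> regular_at M \<gamma> s})"
    using T(1,2) e by (intro finite_UN_I) auto
  ultimately show ?thesis by (rule finite_subset)
qed

lemma regular_open: "open {s. regular_at M \<gamma> s}"
proof (subst open_subopen, intro ballI)
  fix s assume "s \<in> {s. regular_at M \<gamma> s}"
  then obtain c I where "c \<in> atlas M" "open I" "s \<in> I" "I \<subseteq> {0<..<1}" "\<gamma> ` I \<subseteq> fst c" "(snd c \<circ> \<gamma>) C1_differentiable_on I"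
    unfolding regular_at_def by blast
  then show "\<exists>T. open T \<and> s \<in> T \<and> T \<subseteq> {s. regular_at M \<gamma> s}"
    unfolding regular_at_def by (intro exI[of _ I]) blast
qed

lemma regular_derivative:
  assumes \<gamma>: "piecewise_C1_curve M \<gamma>" and s: "regular_at M \<gamma> s"
  obtains c I D where "c \<in> atlas M" "open I" "s \<in> I" "I \<subseteq> {0<..<1}" "\<gamma> ` I \<subseteq> fst c" "continuous_on I D"
    "\<forall>t\<in>I. ((snd c \<circ> \<gamma>) has_vector_derivative D t) (at t) \<and> speed M \<gamma> t = sqrt (D t \<bullet> (gram M c (\<gamma> t) *v D t))"
proof -
  obtain c I where cI: "c \<in> atlas M" "open I" "s \<in> I" "I \<subseteq> {0<..<1}" "\<gamma> ` I \<subseteq> fst c" "(snd c \<circ> \<gamma>) C1_differentiable_on I"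
    using s unfolding regular_at_def by blast
  obtain D where D: "\<forall>t\<in>I. ((snd c \<circ> \<gamma>) has_vector_derivative D t) (at t)" "continuous_on I D"
    using cI(6) unfolding C1_differentiable_on_def by blast
  have "speed M \<gamma> t = sqrt (D t \<bullet> (gram M c (\<gamma> t) *v D t))" if t: "t \<in> I" for t
    by (rule speed_eq[OF cI(1)]) (use cI t D(1) curve_isCont[OF \<gamma>] in auto)
  then show ?thesis using that[OF cI(1-5) D(2)] D(1) by blast
qed

lemma gram_entry_continuous:
  "c \<in> atlas M \<Longrightarrow> continuous_on (snd c ` fst c) (\<lambda>y. gram M c (chart_inv c y) $ i $ j)"
  by (rule C1_on_continuous[OF gram_C1])

lemma quadratic_form_sum:
  "v \<bullet> (G *v w) = (\<Sum>i\<in>UNIV. \<Sum>j\<in>UNIV. v $ i * (G $ i $ j * w $ j))" for G :: "real^'n^'n"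
  by (simp add: inner_vec_def matrix_vector_mult_def sum_distrib_left)

lemma speed_continuous:
  assumes \<gamma>: "piecewise_C1_curve M \<gamma>" shows "continuous_on {s. regular_at M \<gamma> s} (speed M \<gamma>)"
proof (rule continuous_at_imp_continuous_on, rule ballI)
  fix s assume "s \<in> {s. regular_at M \<gamma> s}"
  then have s: "regular_at M \<gamma> s" by simp
  obtain c I D where c: "c \<in> atlas M" and I: "open I" "s \<in> I" "I \<subseteq> {0<..<1}" "\<gamma> ` I \<subseteq> fst c" and D: "continuous_on I D"
    and sp: "\<forall>t\<in>I. ((snd c \<circ> \<gamma>) has_vector_derivative D t) (at t) \<and> speed M \<gamma> t = sqrt (D t \<bullet> (gram M c (\<gamma> t) *v D t))"
    by (rule regular_derivative[OF \<gamma> s])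
  have c\<gamma>: "continuous_on I (snd c \<circ> \<gamma>)"
    using sp I(1) has_vector_derivative_continuous by (intro continuous_at_imp_continuous_on) blast
  have g: "continuous_on I (\<lambda>t. gram M c (\<gamma> t) $ i $ j)" for i j
  proof -
    have "continuous_on I (\<lambda>t. gram M c (chart_inv c ((snd c \<circ> \<gamma>) t)) $ i $ j)"
      by (rule continuous_on_compose2[OF gram_entry_continuous[OF c] c\<gamma>]) (use I(4) in auto)
    then show ?thesis by (rule continuous_on_eq) (use I(4) chart(5)[OF c] in auto)
  qed
  have "continuous_on I (\<lambda>t. sqrt (D t \<bullet> (gram M c (\<gamma> t) *v D t)))"
    unfolding quadratic_form_sum by (intro continuous_on_real_sqrt continuous_on_sum continuous_on_mult g continuous_on_component D)
  then have "continuous_on I (speed M \<gamma>)" by (rule continuous_on_eq) (use sp in auto)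
  then show "isCont (speed M \<gamma>) s" using I by (simp add: continuous_on_eq_continuous_at)
qed

text \<open>Off the regular parameters the speed may be an arbitrary value of the derivative operator. Setting it to
  \<open>0\<close> there changes no integral and makes the function measurable.\<close>

definition reg_speed :: "(real \<Rightarrow> 'a) \<Rightarrow> real \<Rightarrow> real" where
  "reg_speed \<gamma> s = indicat_real {s. regular_at M \<gamma> s} s * speed M \<gamma> s"

lemma reg_speed_measurable: "piecewise_C1_curve M \<gamma> \<Longrightarrow> reg_speed \<gamma> \<in> borel_measurable borel"
  using borel_measurable_continuous_on_indicator[OF borel_open[OF regular_open] speed_continuous]
  by (simp add: reg_speed_def[abs_def])

lemma speed_nonneg: "0 \<le> speed M \<gamma> s"
  by (simp add: speed_def Let_def posdef_nonneg[OF gram_posdef[OF chart_at]])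

lemma reg_speed_nonneg: "0 \<le> reg_speed \<gamma> s"
  by (simp add: reg_speed_def speed_nonneg)

lemma regular_in_unit: "regular_at M \<gamma> s \<Longrightarrow> s \<in> {0<..<1}"
  unfolding regular_at_def by blast

lemma AE_regular:
  assumes "piecewise_C1_curve M \<gamma>" shows "AE s in lborel. s \<in> {0..1} \<longrightarrow> regular_at M \<gamma> s"
  using AE_not_in[OF finite_imp_null_set_lborel[OF finite_irregular[OF assms]]] by (rule eventually_mono) auto

lemma curve_length_reg_speed:
  assumes "piecewise_C1_curve M \<gamma>" shows "curve_length M \<gamma> = (\<integral>\<^sup>+s. ennreal (reg_speed \<gamma> s) \<partial>lborel)"
  unfolding curve_length_def
proof (rule nn_integral_cong_AE, rule eventually_mono[OF AE_regular[OF assms]])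
  fix s assume "s \<in> {0..1} \<longrightarrow> regular_at M \<gamma> s"
  then show "ennreal (speed M \<gamma> s) * indicator {0..1} s = ennreal (reg_speed \<gamma> s)"
    using regular_in_unit[of \<gamma> s] by (auto simp: reg_speed_def indicator_def)
qed

lemma join_curve:
  assumes g: "piecewise_C1_curve M g" and h: "piecewise_C1_curve M h" and e: "pathfinish g = pathstart h"
  shows "piecewise_C1_curve M (g +++ h)" (is "piecewise_C1_curve M ?j")
  unfolding piecewise_C1_curve_def
proof (intro conjI ballI allI impI)
  show "path ?j" using g h e by (simp add: piecewise_C1_curve_def)
  fix c u v assume c: "c \<in> atlas M" and uv: "0 \<le> u \<and> u < v \<and> v \<le> 1 \<and> ?j ` {u..v} \<subseteq> fst c"
  have L: "(\<lambda>x. snd c (g (2 * x))) piecewise_C1_differentiable_on {x..y}" if xy: "u \<le> x" "x < y" "y \<le> v" "y \<le> 1/2" for x y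
  proof -
    have "?j t = g (2 * t)" if "t \<in> {x..y}" for t using that xy by (auto simp: joinpaths_def)
    then have "g ` {2*x..2*y} \<subseteq> fst c"
    proof -
      have "g w \<in> fst c" if "w \<in> {2*x..2*y}" for w
      proof -
        have "w / 2 \<in> {x..y}" using that by auto
        then have "?j (w / 2) \<in> fst c" using uv xy by auto
        then show ?thesis using \<open>w / 2 \<in> {x..y}\<close> xy by (simp add: joinpaths_def)
      qed
      then show ?thesis by blast
    qed
    then have "(snd c \<circ> g) piecewise_C1_differentiable_on {2*x..2*y}"
      by (intro curve_in_chart[OF g c]) (use xy uv in auto)
    moreover have "(\<lambda>t. 2 * t + 0) ` {x..y} = {2*x..2*y}" using xy by (simp add: image_affinity_atLeastAtMost)
    ultimately have "((snd c \<circ> g) \<circ> (\<lambda>t. 2 *\<^sub>R t + 0)) piecewise_C1_differentiable_on {x..y}"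
      by (intro piecewise_C1_differentiable_affine) simp
    then show ?thesis by (simp add: o_def)
  qed
  have jh: "?j t = h (2 * t - 1)" if t: "t \<ge> 1/2" for t
  proof (cases "t = 1/2")
    case True
    show ?thesis unfolding True using e by (simp add: joinpaths_def pathfinish_def pathstart_def)
  qed (use t in \<open>auto simp: joinpaths_def\<close>)
  have R: "(\<lambda>x. snd c (h (2 * x - 1))) piecewise_C1_differentiable_on {x..y}" if xy: "u \<le> x" "x < y" "y \<le> v" "1/2 \<le> x" for x y
  proof -
    have "h w \<in> fst c" if "w \<in> {2*x-1..2*y-1}" for w
    proof -
      have "(w + 1) / 2 \<in> {x..y}" using that by auto
      then have "?j ((w + 1) / 2) \<in> fst c" using uv xy by auto
      moreover have "2 * ((w + 1) / 2) - 1 = w" by (simp add: field_simps)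
      ultimately show ?thesis using jh[of "(w + 1) / 2"] that xy by auto
    qed
    then have "h ` {2*x-1..2*y-1} \<subseteq> fst c" by blast
    then have "(snd c \<circ> h) piecewise_C1_differentiable_on {2*x-1..2*y-1}"
      by (intro curve_in_chart[OF h c]) (use xy uv in auto)
    moreover have "(\<lambda>t. 2 * t + (-1)) ` {x..y} = {2*x-1..2*y-1}" using xy by (simp add: image_affinity_atLeastAtMost_diff)
    ultimately have "((snd c \<circ> h) \<circ> (\<lambda>t. 2 *\<^sub>R t + (-1))) piecewise_C1_differentiable_on {x..y}"
      by (intro piecewise_C1_differentiable_affine) simp
    then show ?thesis by (simp add: o_def)
  qed
  have eq: "(snd c \<circ> ?j) x = (if x \<le> 1/2 then snd c (g (2 * x)) else snd c (h (2 * x - 1)))" for x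
    by (simp add: joinpaths_def)
  consider "v \<le> 1/2" | "1/2 \<le> u" | "u < 1/2" "1/2 < v" by linarith
  then show "(snd c \<circ> ?j) piecewise_C1_differentiable_on {u..v}"
  proof cases
    case 1
    show ?thesis by (rule piecewise_C1_cong[OF L[of u v]]) (use 1 uv eq in auto)
  next
    case 2
    show ?thesis by (rule piecewise_C1_cong[OF R[of u v]]) (use 2 uv jh in auto)
  next
    case 3
    have "(\<lambda>x. if x \<le> 1/2 then snd c (g (2 * x)) else snd c (h (2 * x - 1))) piecewise_C1_differentiable_on {u..v}"
      by (rule piecewise_C1_differentiable_cases[OF L R])
         (use 3 e in \<open>auto simp: pathfinish_def pathstart_def\<close>)
    then show ?thesis by (rule piecewise_C1_cong) (rule eq[symmetric])
  qed
qed

lemma speed_affine: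
  assumes g: "piecewise_C1_curve M g" and r: "regular_at M g (k * s + l)" and k: "0 < k"
    and j: "isCont j s" and T: "open T" "s \<in> T" "\<And>t. t \<in> T \<Longrightarrow> j t = g (k * t + l)"
  shows "speed M j s = k * speed M g (k * s + l)"
proof -
  obtain c I D where c: "c \<in> atlas M" and I: "open I" "k * s + l \<in> I" "I \<subseteq> {0<..<1}" "g ` I \<subseteq> fst c" and "continuous_on I D"
    and sp: "\<forall>t\<in>I. ((snd c \<circ> g) has_vector_derivative D t) (at t) \<and> speed M g t = sqrt (D t \<bullet> (gram M c (g t) *v D t))"
    by (rule regular_derivative[OF g r])
  let ?D = "D (k * s + l)"
  have "((\<lambda>t. k * t + l) has_vector_derivative k) (at s)"
    by (auto intro!: derivative_eq_intros simp: has_real_derivative_iff_has_vector_derivative[symmetric])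
  moreover have "((snd c \<circ> g) has_vector_derivative ?D) (at (k * s + l))" using sp I(2) by blast
  ultimately have "((snd c \<circ> g) \<circ> (\<lambda>t. k * t + l) has_vector_derivative k *\<^sub>R ?D) (at s)"
    by (rule vector_diff_chain_at)
  then have "((snd c \<circ> j) has_vector_derivative k *\<^sub>R ?D) (at s)"
    by (rule has_vector_derivative_transform_within_open[OF _ T(1,2)]) (simp add: T(3))
  moreover have js: "j s = g (k * s + l)" by (rule T(3)[OF T(2)])
  ultimately have "speed M j s = sqrt ((k *\<^sub>R ?D) \<bullet> (gram M c (g (k * s + l)) *v (k *\<^sub>R ?D)))"
    using speed_eq[OF c, of j s "k *\<^sub>R ?D"] j I by auto
  also have "\<dots> = sqrt (k\<^sup>2 * (?D \<bullet> (gram M c (g (k * s + l)) *v ?D)))"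
    by (simp add: matrix_vector_mult_scaleR power2_eq_square)
  also have "\<dots> = k * speed M g (k * s + l)" using sp I(2) k by (simp add: real_sqrt_mult)
  finally show ?thesis .
qed

lemma join_length:
  assumes g: "piecewise_C1_curve M g" and h: "piecewise_C1_curve M h" and e: "pathfinish g = pathstart h"
  shows "curve_length M (g +++ h) \<le> curve_length M g + curve_length M h"
proof -
  let ?j = "g +++ h"
  have j: "piecewise_C1_curve M ?j" by (rule join_curve[OF g h e])
  let ?G = "\<lambda>s. ennreal (2 * reg_speed g (0 + 2 * s))" and ?H = "\<lambda>s. ennreal (2 * reg_speed h (-1 + 2 * s))"
  let ?B = "(\<lambda>w. w / 2) ` {s \<in> {0..1}. \<not> regular_at M g s} \<union> (\<lambda>w. (w + 1) / 2) ` {s \<in> {0..1}. \<not> regular_at M h s} \<union> {1/2}"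
  have fB: "finite ?B" using finite_irregular[OF g] finite_irregular[OF h] by simp
  have "curve_length M ?j \<le> (\<integral>\<^sup>+s. ?G s + ?H s \<partial>lborel)"
    unfolding curve_length_reg_speed[OF j]
  proof (rule nn_integral_mono_AE, rule eventually_mono[OF AE_not_in[OF finite_imp_null_set_lborel[OF fB]]])
    fix s assume s: "s \<notin> ?B"
    show "ennreal (reg_speed ?j s) \<le> ?G s + ?H s"
    proof (cases "regular_at M ?j s")
      case False
      then show ?thesis by (simp add: reg_speed_def)
    next
      case True
      then have s01: "s \<in> {0<..<1}" by (rule regular_in_unit)
      have jc: "isCont ?j s" by (rule curve_isCont[OF j s01])
      consider "s < 1/2" | "1/2 < s" using s by fastforce
      then show ?thesis
      proof cases
        case 1
        have r: "regular_at M g (2 * s)"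
        proof (rule ccontr)
          assume "\<not> regular_at M g (2 * s)"
          then have "2 * s / 2 \<in> (\<lambda>w. w / 2) ` {s \<in> {0..1}. \<not> regular_at M g s}" using 1 s01 by (intro imageI) auto
          then show False using s by simp
        qed
        have "speed M ?j s = 2 * speed M g (2 * s + 0)"
          by (rule speed_affine[OF g _ _ jc, where T = "{..<1/2}"]) (use r 1 in \<open>auto simp: joinpaths_def\<close>)
        then have "reg_speed ?j s = 2 * reg_speed g (0 + 2 * s)" using True r by (simp add: reg_speed_def)
        then show ?thesis by simp
      next
        case 2
        have r: "regular_at M h (2 * s - 1)"
        proof (rule ccontr)
          assume "\<not> regular_at M h (2 * s - 1)"
          then have "((2 * s - 1) + 1) / 2 \<in> (\<lambda>w. (w + 1) / 2) ` {s \<in> {0..1}. \<not> regular_at M h s}" using 2 s01 by (intro imageI) auto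
          then show False using s by simp
        qed
        have "speed M ?j s = 2 * speed M h (2 * s + (-1))"
          by (rule speed_affine[OF h _ _ jc, where T = "{1/2<..}"]) (use r 2 in \<open>auto simp: joinpaths_def\<close>)
        then have "reg_speed ?j s = 2 * reg_speed h (-1 + 2 * s)" using True r by (simp add: reg_speed_def)
        then show ?thesis by simp
      qed
    qed
  qed
  also have "\<dots> = (\<integral>\<^sup>+s. ?G s \<partial>lborel) + (\<integral>\<^sup>+s. ?H s \<partial>lborel)"
  proof (rule nn_integral_add)
    have "(\<lambda>s. reg_speed g (0 + 2 * s)) \<in> borel_measurable borel" "(\<lambda>s. reg_speed h (-1 + 2 * s)) \<in> borel_measurable borel"
      by (rule measurable_compose[OF _ reg_speed_measurable[OF g]], simp) (rule measurable_compose[OF _ reg_speed_measurable[OF h]], simp)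
    then show "?G \<in> borel_measurable lborel" "?H \<in> borel_measurable lborel" by simp_all
  qed
  also have "(\<integral>\<^sup>+s. ?G s \<partial>lborel) = curve_length M g"
  proof -
    have m: "(\<lambda>s. ennreal (reg_speed g s)) \<in> borel_measurable borel" using reg_speed_measurable[OF g] by simp
    have m': "(\<lambda>s. ennreal (reg_speed g (0 + 2 * s))) \<in> borel_measurable lborel"
      using measurable_compose[OF _ m, of "\<lambda>s. 0 + 2 * s" borel] by simp
    have "(\<integral>\<^sup>+s. ?G s \<partial>lborel) = (\<integral>\<^sup>+s. ennreal 2 * ennreal (reg_speed g (0 + 2 * s)) \<partial>lborel)"
      by (intro nn_integral_cong) (simp add: ennreal_mult reg_speed_nonneg)
    also have "\<dots> = ennreal 2 * (\<integral>\<^sup>+s. ennreal (reg_speed g (0 + 2 * s)) \<partial>lborel)" by (rule nn_integral_cmult[OF m'])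
    also have "\<dots> = curve_length M g" using nn_integral_real_affine[OF m, of 2 0] by (simp add: curve_length_reg_speed[OF g])
    finally show ?thesis .
  qed
  also have "(\<integral>\<^sup>+s. ?H s \<partial>lborel) = curve_length M h"
  proof -
    have m: "(\<lambda>s. ennreal (reg_speed h s)) \<in> borel_measurable borel" using reg_speed_measurable[OF h] by simp
    have m': "(\<lambda>s. ennreal (reg_speed h (-1 + 2 * s))) \<in> borel_measurable lborel"
      using measurable_compose[OF _ m, of "\<lambda>s. -1 + 2 * s" borel] by simp
    have "(\<integral>\<^sup>+s. ?H s \<partial>lborel) = (\<integral>\<^sup>+s. ennreal 2 * ennreal (reg_speed h (-1 + 2 * s)) \<partial>lborel)"
      by (intro nn_integral_cong) (simp add: ennreal_mult reg_speed_nonneg)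
    also have "\<dots> = ennreal 2 * (\<integral>\<^sup>+s. ennreal (reg_speed h (-1 + 2 * s)) \<partial>lborel)" by (rule nn_integral_cmult[OF m'])
    also have "\<dots> = curve_length M h" using nn_integral_real_affine[OF m, of 2 "-1"] by (simp add: curve_length_reg_speed[OF h])
    finally show ?thesis .
  qed
  finally show ?thesis .
qed

abbreviation edist :: "'a \<Rightarrow> 'a \<Rightarrow> ennreal" where "edist \<equiv> riemannian_edist M"

lemma edist_le: "piecewise_C1_curve M \<gamma> \<Longrightarrow> edist (pathstart \<gamma>) (pathfinish \<gamma>) \<le> curve_length M \<gamma>"
  unfolding riemannian_edist_def by (rule INF_lower) simp

lemma edist_triangle: "edist p r \<le> edist p q + edist q r"
proof (rule ennreal_le_epsilon)
  fix e :: real assume e: "0 < e" and fin: "edist p q + edist q r < top"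
  then have f: "edist p q < top" "edist q r < top" by (auto simp: less_top[symmetric])
  have "edist p q < edist p q + ennreal (e / 2)" "edist q r < edist q r + ennreal (e / 2)"
    using f e by (auto simp: ennreal_add_left_cancel_less[of _ 0, simplified] less_top)
  then obtain g h where g: "piecewise_C1_curve M g" "pathstart g = p" "pathfinish g = q" "curve_length M g < edist p q + ennreal (e / 2)"
    and h: "piecewise_C1_curve M h" "pathstart h = q" "pathfinish h = r" "curve_length M h < edist q r + ennreal (e / 2)"
    unfolding riemannian_edist_def[of M p q] riemannian_edist_def[of M q r] INF_less_iff by blast
  have e: "pathfinish g = pathstart h" using g h by simp
  have "edist p r \<le> curve_length M (g +++ h)" using edist_le[OF join_curve[OF g(1) h(1) e]] g h by simp
  also have "\<dots> \<le> curve_length M g + curve_length M h" by (rule join_length[OF g(1) h(1) e])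
  also have "\<dots> \<le> (edist p q + ennreal (e / 2)) + (edist q r + ennreal (e / 2))"
    using g(4) h(4) by (intro add_mono) auto
  also have "\<dots> = edist p q + edist q r + ennreal e"
    using \<open>0 < e\<close> by (simp add: add_ac ennreal_plus[symmetric] del: ennreal_plus)
  finally show "edist p r \<le> edist p q + edist q r + ennreal e" .
qed

text \<open>The segment between two coordinate vectors is an admissible curve with constant coordinate velocity.
  Upper bounds for distances come from such segments and the triangle
  inequality.\<close>

lemma edist_segment:
  assumes c: "c \<in> atlas M" and seg: "closed_segment y z \<subseteq> snd c ` fst c" and K: "0 \<le> K"
    and b: "\<And>x. x \<in> closed_segment y z \<Longrightarrow> (z - y) \<bullet> (gram M c (chart_inv c x) *v (z - y)) \<le> K\<^sup>2"
  shows "edist (chart_inv c y) (chart_inv c z) \<le> ennreal K"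
proof -
  define l where "l s = y + s *\<^sub>R (z - y)" for s :: real
  define \<gamma> where "\<gamma> = chart_inv c \<circ> l"
  have lseg: "l s \<in> closed_segment y z" if "s \<in> {0..1}" for s
    unfolding in_segment l_def using that by (intro exI[of _ s]) (auto simp: algebra_simps)
  have lV: "l s \<in> snd c ` fst c" if "s \<in> {0..1}" for s using lseg[OF that] seg by blast
  have ld: "(l has_vector_derivative (z - y)) (at s)" for s
    unfolding l_def[abs_def] by (auto intro!: derivative_eq_intros)
  have cl: "continuous_on UNIV l" unfolding l_def[abs_def] by (intro continuous_intros)
  have c\<gamma>: "isCont \<gamma> s" if "s \<in> {0..1}" for s
  proof -
    have "isCont (chart_inv c) (l s)"
      using chart(4)[OF c] lV[OF that] unfolding continuous_on_eq_continuous_at[OF chart(2)[OF c]] by blast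
    moreover have "isCont l s" using cl by (simp add: continuous_on_eq_continuous_at)
    ultimately show ?thesis unfolding \<gamma>_def by (intro continuous_at_compose)
  qed
  have curve: "piecewise_C1_curve M \<gamma>"
    unfolding piecewise_C1_curve_def
  proof (intro conjI ballI allI impI)
    show "path \<gamma>" unfolding path_def using c\<gamma> by (intro continuous_at_imp_continuous_on) blast
    fix d u v assume d: "d \<in> atlas M" and uv: "0 \<le> u \<and> u < v \<and> v \<le> 1 \<and> \<gamma> ` {u..v} \<subseteq> fst d"
    let ?\<tau> = "snd d \<circ> id \<circ> chart_inv c" and ?W = "snd c ` (fst c \<inter> id -` fst d)"
    note i = isometry_coordinates[OF isometry_id c d]
    have lW: "l s \<in> ?W" if s: "s \<in> {u..v}" for s
    proof -
      have "l s \<in> snd c ` fst c" using s uv by (intro lV) auto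
      moreover have "chart_inv c (l s) \<in> fst d" using s uv by (auto simp: \<gamma>_def)
      ultimately show ?thesis using chart(6)[OF c, of "l s"] by (intro image_eqI[of _ _ "chart_inv c (l s)"]) auto
    qed
    have "(snd d \<circ> \<gamma>) C1_differentiable_on {u..v}"
      unfolding C1_differentiable_on_def
    proof (intro exI[of _ "\<lambda>s. frechet_derivative ?\<tau> (at (l s)) (z - y)"] conjI ballI)
      fix s assume s: "s \<in> {u..v}"
      have dt: "?\<tau> differentiable (at (l s))" by (rule C1_on_differentiable[OF i(2) lW[OF s]])
      then have "(?\<tau> has_derivative frechet_derivative ?\<tau> (at (l s))) (at (l s))" by (simp add: frechet_derivative_works)
      from has_derivative_compose[OF ld[unfolded has_vector_derivative_def] this]
      have "((\<lambda>t. ?\<tau> (l t)) has_derivative (\<lambda>h. frechet_derivative ?\<tau> (at (l s)) (h *\<^sub>R (z - y)))) (at s)" .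
      moreover have "frechet_derivative ?\<tau> (at (l s)) (h *\<^sub>R (z - y)) = h *\<^sub>R frechet_derivative ?\<tau> (at (l s)) (z - y)" for h
        by (rule linear_scale[OF linear_frechet_derivative[OF dt]])
      ultimately have "((\<lambda>t. ?\<tau> (l t)) has_vector_derivative frechet_derivative ?\<tau> (at (l s)) (z - y)) (at s)"
        by (simp only: has_vector_derivative_def)
      moreover have "(\<lambda>t. ?\<tau> (l t)) = snd d \<circ> \<gamma>" by (simp add: \<gamma>_def fun_eq_iff)
      ultimately show "((snd d \<circ> \<gamma>) has_vector_derivative frechet_derivative ?\<tau> (at (l s)) (z - y)) (at s)" by (simp only:)
    next
      show "continuous_on {u..v} (\<lambda>s. frechet_derivative ?\<tau> (at (l s)) (z - y))"
        by (rule continuous_on_compose2[OF C1_on_partial_continuous[OF i(2)] continuous_on_subset[OF cl]]) (use lW in auto)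
    qed
    then show "(snd d \<circ> \<gamma>) piecewise_C1_differentiable_on {u..v}" by (rule C1_differentiable_imp_piecewise)
  qed
  have "curve_length M \<gamma> \<le> (\<integral>\<^sup>+s. ennreal K * indicator {0..1::real} s \<partial>lborel)"
    unfolding curve_length_def
  proof (rule nn_integral_mono)
    fix s :: real
    show "ennreal (speed M \<gamma> s) * indicator {0..1} s \<le> ennreal K * indicator {0..1} s"
    proof (cases "s \<in> {0..1}")
      case True
      have gs: "\<gamma> s \<in> fst c" using chart(6)[OF c lV[OF True]] by (simp add: \<gamma>_def)
      have o: "open (l -` (snd c ` fst c))" using cl chart(2)[OF c] by (rule open_vimage[rotated])
      have "((snd c \<circ> \<gamma>) has_vector_derivative (z - y)) (at s)"
        by (rule has_vector_derivative_transform_within_open[OF ld o]) (use lV[OF True] chart(6)[OF c] in \<open>auto simp: \<gamma>_def\<close>)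
      from speed_eq[OF c gs c\<gamma>[OF True] this]
      have "speed M \<gamma> s = sqrt ((z - y) \<bullet> (gram M c (chart_inv c (l s)) *v (z - y)))" by (simp add: \<gamma>_def)
      also have "\<dots> \<le> sqrt (K\<^sup>2)" by (rule real_sqrt_le_mono[OF b[OF lseg[OF True]]])
      finally have "speed M \<gamma> s \<le> K" using K by simp
      then show ?thesis using True by (simp add: ennreal_leI)
    qed simp
  qed
  also have "\<dots> = ennreal K" by (simp add: nn_integral_cmult_indicator)
  finally have "curve_length M \<gamma> \<le> ennreal K" .
  moreover have "edist (chart_inv c y) (chart_inv c z) \<le> curve_length M \<gamma>"
    using edist_le[OF curve] by (simp add: pathstart_def pathfinish_def \<gamma>_def l_def)
  ultimately show ?thesis by simp
qed

lemma edist_refl [simp]: "edist p p = 0"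
proof -
  obtain c where c: "c \<in> atlas M" "p \<in> fst c" using chart_cover by blast
  have "edist (chart_inv c (snd c p)) (chart_inv c (snd c p)) \<le> ennreal 0"
    by (rule edist_segment[OF c(1)]) (use c in auto)
  then show ?thesis using chart(5)[OF c] by simp
qed

text \<open>The Gram matrices are bounded near \<open>p\<close>.\<close>

lemma edist_local:
  assumes c: "c \<in> atlas M" "p \<in> fst c"
  shows "\<exists>r C. 0 < r \<and> 0 \<le> C \<and> ball (snd c p) r \<subseteq> snd c ` fst c \<and>
    (\<forall>y\<in>ball (snd c p) r. edist p (chart_inv c y) \<le> ennreal (C * dist (snd c p) y) \<and>
       edist (chart_inv c y) p \<le> ennreal (C * dist (snd c p) y))"
proof -
  let ?z = "snd c p"
  obtain r where r: "0 < r" "cball ?z r \<subseteq> snd c ` fst c"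
    using chart(2)[OF c(1)] c(2) open_contains_cball by blast
  define b where "b y = (\<Sum>i\<in>UNIV. \<Sum>j\<in>UNIV. \<bar>gram M c (chart_inv c y) $ i $ j\<bar>)" for y
  have cb: "continuous_on (cball ?z r) b"
    unfolding b_def[abs_def]
    by (intro continuous_on_sum continuous_on_rabs continuous_on_subset[OF gram_entry_continuous[OF c(1)] r(2)])
  then have "bounded (b ` cball ?z r)" by (intro compact_imp_bounded compact_continuous_image) auto
  then obtain B where B: "\<forall>y\<in>cball ?z r. \<bar>b y\<bar> \<le> B" by (auto simp: bounded_iff)
  have B0: "0 \<le> B"
  proof -
    have "?z \<in> cball ?z r" using r(1) by simp
    then have "\<bar>b ?z\<bar> \<le> B" using B by blast
    then show ?thesis using abs_ge_zero[of "b ?z"] by linarith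
  qed
  have q: "w \<bullet> (gram M c (chart_inv c x) *v w) \<le> (sqrt B * norm w)\<^sup>2" if x: "x \<in> cball ?z r" for x w
  proof -
    have "w \<bullet> (gram M c (chart_inv c x) *v w) \<le> (\<Sum>i\<in>UNIV. \<Sum>j\<in>UNIV. \<bar>gram M c (chart_inv c x) $ i $ j\<bar> * (norm w)\<^sup>2)"
      unfolding quadratic_form_sum
    proof (intro sum_mono)
      fix i j
      have "w $ i * (gram M c (chart_inv c x) $ i $ j * w $ j) \<le> \<bar>w $ i * (gram M c (chart_inv c x) $ i $ j * w $ j)\<bar>" by simp
      also have "\<dots> = \<bar>gram M c (chart_inv c x) $ i $ j\<bar> * (\<bar>w $ i\<bar> * \<bar>w $ j\<bar>)" by (simp add: abs_mult mult_ac)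
      also have "\<dots> \<le> \<bar>gram M c (chart_inv c x) $ i $ j\<bar> * (norm w * norm w)"
        using component_le_norm_cart[of w i] component_le_norm_cart[of w j] by (intro mult_left_mono mult_mono) auto
      finally show "w $ i * (gram M c (chart_inv c x) $ i $ j * w $ j) \<le> \<bar>gram M c (chart_inv c x) $ i $ j\<bar> * (norm w)\<^sup>2"
        by (simp add: power2_eq_square)
    qed
    also have "\<dots> = b x * (norm w)\<^sup>2" by (simp add: b_def sum_distrib_right)
    also have "\<dots> \<le> B * (norm w)\<^sup>2"
    proof -
      have "\<bar>b x\<bar> \<le> B" using B x by blast
      then show ?thesis by (intro mult_right_mono) auto
    qed
    also have "\<dots> = (sqrt B * norm w)\<^sup>2" using B0 by (simp add: power_mult_distrib)
    finally show ?thesis .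
  qed
  have "edist p (chart_inv c y) \<le> ennreal (sqrt B * dist ?z y) \<and> edist (chart_inv c y) p \<le> ennreal (sqrt B * dist ?z y)"
    if y: "y \<in> ball ?z r" for y
  proof -
    have s1: "closed_segment ?z y \<subseteq> cball ?z r" "closed_segment y ?z \<subseteq> cball ?z r"
    proof -
      have e: "?z \<in> cball ?z r" "y \<in> cball ?z r" using y r(1) by auto
      show "closed_segment ?z y \<subseteq> cball ?z r" by (rule closed_segment_subset[OF e convex_cball])
      show "closed_segment y ?z \<subseteq> cball ?z r" by (rule closed_segment_subset[OF e(2,1) convex_cball])
    qed
    have "edist (chart_inv c ?z) (chart_inv c y) \<le> ennreal (sqrt B * norm (y - ?z))"
    proof (rule edist_segment[OF c(1)])
      show "closed_segment ?z y \<subseteq> snd c ` fst c" using s1(1) r(2) by (rule subset_trans)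
      show "(y - ?z) \<bullet> (gram M c (chart_inv c x) *v (y - ?z)) \<le> (sqrt B * norm (y - ?z))\<^sup>2" if "x \<in> closed_segment ?z y" for x
        by (rule q) (use that s1(1) in blast)
    qed (use B0 in simp)
    moreover have "edist (chart_inv c y) (chart_inv c ?z) \<le> ennreal (sqrt B * norm (?z - y))"
    proof (rule edist_segment[OF c(1)])
      show "closed_segment y ?z \<subseteq> snd c ` fst c" using s1(2) r(2) by (rule subset_trans)
      show "(?z - y) \<bullet> (gram M c (chart_inv c x) *v (?z - y)) \<le> (sqrt B * norm (?z - y))\<^sup>2" if "x \<in> closed_segment y ?z" for x
        by (rule q) (use that s1(2) in blast)
    qed (use B0 in simp)
    ultimately show ?thesis using chart(5)[OF c] by (simp add: dist_norm norm_minus_commute)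
  qed
  moreover have "ball ?z r \<subseteq> snd c ` fst c" using r(2) ball_subset_cball by blast
  ultimately show ?thesis using r(1) B0 by (intro exI[of _ r] exI[of _ "sqrt B"]) auto
qed

lemma edist_near:
  assumes "0 < e" shows "\<exists>U. open U \<and> p \<in> U \<and> (\<forall>q\<in>U. edist p q < ennreal e \<and> edist q p < ennreal e)"
proof -
  obtain c where c: "c \<in> atlas M" "p \<in> fst c" using chart_cover by blast
  obtain r C where rC: "0 < r" "0 \<le> C" "ball (snd c p) r \<subseteq> snd c ` fst c"
    "\<forall>y\<in>ball (snd c p) r. edist p (chart_inv c y) \<le> ennreal (C * dist (snd c p) y) \<and>
       edist (chart_inv c y) p \<le> ennreal (C * dist (snd c p) y)"
    using edist_local[OF c] by blast
  define t where "t = min r (e / (C + 1))"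
  have t: "0 < t" "t \<le> r" using rC assms by (auto simp: t_def)
  let ?U = "chart_inv c ` ball (snd c p) t"
  have sub: "ball (snd c p) t \<subseteq> ball (snd c p) r" using t by auto
  have "open ?U" by (rule chart_inv_image_open[OF c(1) open_ball]) (use sub rC(3) in blast)
  moreover have "p \<in> ?U" using chart(5)[OF c] t(1) by (intro image_eqI[of _ _ "snd c p"]) auto
  moreover have "edist p q < ennreal e \<and> edist q p < ennreal e" if q: "q \<in> ?U" for q
  proof -
    obtain y where y: "y \<in> ball (snd c p) t" "q = chart_inv c y" using q by blast
    have "C * dist (snd c p) y \<le> C * t" using y(1) rC(2) by (intro mult_left_mono) auto
    also have "\<dots> \<le> C * (e / (C + 1))" using rC(2) by (intro mult_left_mono) (auto simp: t_def)
    also have "\<dots> < e" using rC(2) assms by (simp add: field_simps)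
    finally have "ennreal (C * dist (snd c p) y) < ennreal e" using assms by (simp add: ennreal_lessI)
    moreover have "y \<in> ball (snd c p) r" using y(1) sub by blast
    ultimately show ?thesis using rC(4) y(2) by (meson order_le_less_trans)
  qed
  ultimately show ?thesis by blast
qed

text \<open>The points at finite distance from \<open>p\<close> form an open and closed set.\<close>

lemma edist_finite:
  assumes "connected (UNIV :: 'a set)" shows "edist p q < top"
proof -
  let ?S = "{q. edist p q < top}"
  have o: "open ?S"
  proof (subst open_subopen, intro ballI)
    fix q assume q: "q \<in> ?S"
    obtain U where U: "open U" "q \<in> U" "\<forall>x\<in>U. edist q x < ennreal 1 \<and> edist x q < ennreal 1"
      using edist_near[of 1 q] by auto
    have "U \<subseteq> ?S"
    proof
      fix x assume "x \<in> U"
      then have "edist q x < ennreal 1" using U(3) by blast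
      then have "edist q x < top" by (rule less_trans) simp
      then have "edist p q + edist q x < top" using q by simp
      then show "x \<in> ?S" using order_le_less_trans[OF edist_triangle[of p x q]] by simp
    qed
    then show "\<exists>T. open T \<and> q \<in> T \<and> T \<subseteq> ?S" using U by blast
  qed
  have o': "open (- ?S)"
  proof (subst open_subopen, intro ballI)
    fix q assume q: "q \<in> - ?S"
    obtain U where U: "open U" "q \<in> U" "\<forall>x\<in>U. edist q x < ennreal 1 \<and> edist x q < ennreal 1"
      using edist_near[of 1 q] by auto
    have "U \<subseteq> - ?S"
    proof
      fix x assume "x \<in> U"
      then have "edist x q < ennreal 1" using U(3) by blast
      then have xq: "edist x q < top" by (rule less_trans) simp
      show "x \<in> - ?S"
      proof
        assume "x \<in> ?S"
        then have "edist p x + edist x q < top" using xq by simp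
        then have "edist p q < top" using order_le_less_trans[OF edist_triangle[of p q x]] by simp
        then show False using q by simp
      qed
    qed
    then show "\<exists>T. open T \<and> q \<in> T \<and> T \<subseteq> - ?S" using U by blast
  qed
  have "?S = {} \<or> ?S = UNIV"
  proof -
    have "openin (top_of_set UNIV) ?S" "closedin (top_of_set UNIV) ?S"
      using o o' by (simp_all add: closed_def)
    then show ?thesis using assms[unfolded connected_clopen] by blast
  qed
  moreover have "p \<in> ?S" by simp
  ultimately show ?thesis by blast
qed

text \<open>By the Cauchy-Schwarz inequality, a function whose gradient has norm at most one grows along a
  curve at most as fast as the arc length.\<close>

lemma curve_length_lower_bound:
  assumes f: "C1_fun f" "\<And>p. pairing f f p \<le> 1" and \<gamma>: "piecewise_C1_curve M \<gamma>"
  shows "ennreal (f (\<gamma> 1) - f (\<gamma> 0)) \<le> curve_length M \<gamma>"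
proof (cases "curve_length M \<gamma> = top")
  case False
  let ?S = "{s \<in> {0..1}. \<not> regular_at M \<gamma> s}"
  have fS: "finite ?S" by (rule finite_irregular[OF \<gamma>])
  obtain L where L: "0 \<le> L" "curve_length M \<gamma> = ennreal L" using False by (cases "curve_length M \<gamma>") auto
  have sp: "(reg_speed \<gamma> has_integral L) UNIV"
  proof (rule nn_integral_has_integral)
    show "reg_speed \<gamma> \<in> borel_measurable borel" by (rule reg_speed_measurable[OF \<gamma>])
    show "(\<integral>\<^sup>+s. ennreal (reg_speed \<gamma> s) \<partial>lborel) = ennreal L" using curve_length_reg_speed[OF \<gamma>] L by simp
  qed (use reg_speed_nonneg L in auto)
  have sp0: "(\<lambda>s. if s \<in> {0..1} then reg_speed \<gamma> s else 0) = reg_speed \<gamma>"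
  proof
    fix s show "(if s \<in> {0..1} then reg_speed \<gamma> s else 0) = reg_speed \<gamma> s"
      using regular_in_unit[of \<gamma> s] by (cases "regular_at M \<gamma> s") (auto simp: reg_speed_def)
  qed
  have sp1: "(reg_speed \<gamma> has_integral L) {0..1}"
    using has_integral_restrict_UNIV[of "{0..1}" "reg_speed \<gamma>" L] sp unfolding sp0 by simp
  have der: "\<exists>D. ((f \<circ> \<gamma>) has_vector_derivative D) (at s) \<and> D \<le> reg_speed \<gamma> s" if s: "regular_at M \<gamma> s" for s
  proof -
    obtain c I D where c: "c \<in> atlas M" and I: "open I" "s \<in> I" "I \<subseteq> {0<..<1}" "\<gamma> ` I \<subseteq> fst c" and "continuous_on I D"
      and sp: "\<forall>t\<in>I. ((snd c \<circ> \<gamma>) has_vector_derivative D t) (at t) \<and> speed M \<gamma> t = sqrt (D t \<bullet> (gram M c (\<gamma> t) *v D t))"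
      by (rule regular_derivative[OF \<gamma> s])
    have \<gamma>c: "\<gamma> s \<in> fst c" using I by blast
    let ?G = "gram M c (\<gamma> s)" and ?v = "D s" and ?y = "snd c (\<gamma> s)"
    have pd: "posdef ?G" by (rule gram_posdef[OF c \<gamma>c])
    have fd: "(f \<circ> chart_inv c) differentiable (at ?y)" by (rule C1_funD(2)[OF f(1) c \<gamma>c])
    then have fd': "((f \<circ> chart_inv c) has_derivative frechet_derivative (f \<circ> chart_inv c) (at ?y)) (at ((snd c \<circ> \<gamma>) s))"
      by (simp add: frechet_derivative_works)
    have vd: "((snd c \<circ> \<gamma>) has_derivative (\<lambda>h. h *\<^sub>R ?v)) (at s)" using sp I(2) by (simp add: has_vector_derivative_def)
    let ?a = "partials c f ?y \<bullet> ?v"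
    have "frechet_derivative (f \<circ> chart_inv c) (at ?y) w = partials c f ?y \<bullet> w" for w
      using frechet_derivative_axis_sum[OF fd, of w] by (simp add: partials_def inner_vec_def mult.commute)
    then have "frechet_derivative (f \<circ> chart_inv c) (at ?y) (h *\<^sub>R ?v) = h *\<^sub>R ?a" for h by simp
    with has_derivative_compose[OF vd fd']
    have "((\<lambda>t. (f \<circ> chart_inv c) ((snd c \<circ> \<gamma>) t)) has_vector_derivative ?a) (at s)"
      by (simp only: has_vector_derivative_def)
    then have "((f \<circ> \<gamma>) has_vector_derivative ?a) (at s)"
      by (rule has_vector_derivative_transform_within_open[OF _ I(1,2)]) (use I(4) chart(5)[OF c] in auto)
    moreover have "?a \<le> reg_speed \<gamma> s"
    proof -
      let ?w = "matrix_inv ?G *v partials c f ?y"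
      have a: "?a = ?v \<bullet> (?G *v ?w)" by (simp add: posdef_inverse(2)[OF pd] inner_commute)
      have w: "?w \<bullet> (?G *v ?w) \<le> 1"
        using f(2)[of "\<gamma> s"] pairing_eq[OF c \<gamma>c f(1) f(1)] by (simp add: grad_pairing_def posdef_inverse(2)[OF pd] inner_commute)
      have "?a\<^sup>2 \<le> (?v \<bullet> (?G *v ?v)) * (?w \<bullet> (?G *v ?w))" unfolding a by (rule posdef_Cauchy_Schwarz[OF pd])
      also have "\<dots> \<le> (?v \<bullet> (?G *v ?v)) * 1" by (rule mult_left_mono[OF w posdef_nonneg[OF pd]])
      finally have "sqrt (?a\<^sup>2) \<le> sqrt (?v \<bullet> (?G *v ?v))" by (intro real_sqrt_le_mono) simp
      then have "?a \<le> sqrt (?v \<bullet> (?G *v ?v))" by simp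
      then show ?thesis using sp I(2) s by (simp add: reg_speed_def)
    qed
    ultimately show ?thesis by blast
  qed
  define g' where "g' s = (if regular_at M \<gamma> s then vector_derivative (f \<circ> \<gamma>) (at s) else 0)" for s
  have g': "((f \<circ> \<gamma>) has_vector_derivative g' s) (at s)" "g' s \<le> reg_speed \<gamma> s" if "regular_at M \<gamma> s" for s
    using der[OF that] that vector_derivative_at unfolding g'_def by auto
  have "(g' has_integral ((f \<circ> \<gamma>) 1 - (f \<circ> \<gamma>) 0)) {0..1}"
  proof (rule fundamental_theorem_of_calculus_strong[OF fS])
    show "((f \<circ> \<gamma>) has_vector_derivative g' s) (at s)" if "s \<in> {0..1} - ?S" for s using that by (intro g'(1)) auto
    show "continuous_on {0..1} (f \<circ> \<gamma>)"
      by (rule continuous_on_compose[OF curve_continuous[OF \<gamma>] continuous_on_subset[OF C1_fun_continuous[OF f(1)]]]) simp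
  qed simp
  then have "(f \<circ> \<gamma>) 1 - (f \<circ> \<gamma>) 0 \<le> L"
  proof (rule has_integral_le[OF _ sp1])
    fix s :: real
    show "g' s \<le> reg_speed \<gamma> s"
      using g'(2)[of s] by (cases "regular_at M \<gamma> s") (auto simp: g'_def reg_speed_def)
  qed
  then show ?thesis using L by (simp add: ennreal_leI)
qed simp

lemma edist_lower_bound:
  assumes f: "C1_fun f" "\<And>p. pairing f f p \<le> 1"
  shows "ennreal (f q - f p) \<le> edist p q"
  unfolding riemannian_edist_def
proof (rule INF_greatest)
  fix \<gamma> assume "\<gamma> \<in> {\<gamma>. piecewise_C1_curve M \<gamma> \<and> pathstart \<gamma> = p \<and> pathfinish \<gamma> = q}"
  then show "ennreal (f q - f p) \<le> curve_length M \<gamma>"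
    using curve_length_lower_bound[OF f, of \<gamma>] by (auto simp: pathstart_def pathfinish_def)
qed

end

section \<open>The coefficients of an isoparametric function\<close>

lemma deriv_within_lower_bound:
  fixes f :: "real \<Rightarrow> real"
  assumes "(f has_real_derivative D) (at a within {a..b})" "m < D" "a < b"
  obtains d where "0 < d" "d \<le> b - a" "\<And>s. s \<in> {a..a+d} \<Longrightarrow> f a + m * (s - a) \<le> f s"
proof -
  have "((\<lambda>s. (f s - f a) / (s - a)) \<longlongrightarrow> D) (at a within {a..b})"
    using assms(1) by (simp add: has_field_derivative_iff)
  then have "eventually (\<lambda>s. m < (f s - f a) / (s - a)) (at a within {a..b})"
    using assms(2) by (rule order_tendstoD(1))
  then obtain d where d: "0 < d" "\<forall>s\<in>{a..b}. s \<noteq> a \<and> dist s a < d \<longrightarrow> m < (f s - f a) / (s - a)"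
    unfolding eventually_at by blast
  define e where "e = min (d / 2) (b - a)"
  have e: "0 < e" "e \<le> b - a" "e < d" using d assms(3) by (auto simp: e_def)
  have "f a + m * (s - a) \<le> f s" if s: "s \<in> {a..a+e}" for s
  proof (cases "s = a")
    case False
    then have "m < (f s - f a) / (s - a)" using s e d(2) by (auto simp: dist_real_def)
    moreover have "0 < s - a" using s False by auto
    ultimately have "m * (s - a) < f s - f a" by (simp add: pos_less_divide_eq)
    then show ?thesis by simp
  qed simp
  then show ?thesis using that e by blast
qed

text \<open>If \<open>B\<close> were nonnegative at \<open>a\<close>, then \<open>A \<psi>' - B \<psi>\<close> would be nonnegative and nonzero
  for a suitable \<open>\<psi>\<close> supported near \<open>a\<close>.\<close>

lemma endpoint_sign:
  fixes A B :: "real \<Rightarrow> real"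
  assumes ab: "a < b" and A: "A a = 0" "(A has_real_derivative \<alpha>) (at a within {a..b})" "0 < \<alpha>"
    and B: "(B has_real_derivative \<beta>) (at a within {a..b})" and pos: "\<And>s. s \<in> {a..b} \<Longrightarrow> 0 \<le> A s"
    and Z: "\<And>\<psi> \<psi>'. \<lbrakk>\<forall>s\<in>{a..b}. (\<psi> has_real_derivative \<psi>' s) (at s within {a..b}); continuous_on {a..b} \<psi>';
        \<forall>s\<in>{a..b}. 0 \<le> A s * \<psi>' s - B s * \<psi> s\<rbrakk> \<Longrightarrow> \<forall>s\<in>{a..b}. A s * \<psi>' s - B s * \<psi> s = 0"
  shows "B a < 0"
proof (rule ccontr)
  assume "\<not> B a < 0"
  then have Ba: "0 \<le> B a" by simp
  obtain d1 where d1: "0 < d1" "d1 \<le> b - a" "\<And>s. s \<in> {a..a+d1} \<Longrightarrow> A a + \<alpha> / 2 * (s - a) \<le> A s"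
    using deriv_within_lower_bound[OF A(2), of "\<alpha> / 2"] A(3) ab by auto
  have neg: "- (\<bar>\<beta>\<bar> + 1) < \<beta>" by linarith
  obtain d2 where d2: "0 < d2" "d2 \<le> b - a" "\<And>s. s \<in> {a..a+d2} \<Longrightarrow> B a + (- (\<bar>\<beta>\<bar> + 1)) * (s - a) \<le> B s"
    using deriv_within_lower_bound[OF B neg ab] by blast
  \<comment> \<open>Near \<open>a\<close> the function \<open>A\<close> grows at least with slope \<open>\<alpha> / 2\<close> and \<open>B\<close> decreases at most with slope
    \<open>\<bar>\<beta>\<bar> + 1\<close>, hence \<open>- C A \<le> B\<close>.\<close>
  define C where "C = 2 * (\<bar>\<beta>\<bar> + 1) / \<alpha>"
  have C: "0 < C" using A(3) by (simp add: C_def)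
  define d where "d = min (min d1 d2) (1 / C)"
  have d: "0 < d" "d \<le> d1" "d \<le> d2" "C * d \<le> 1" "d \<le> b - a"
  proof -
    have "C * d \<le> C * (1 / C)" using C by (intro mult_left_mono) (auto simp: d_def)
    then show "C * d \<le> 1" using C by simp
  qed (use d1 d2 C in \<open>auto simp: d_def\<close>)
  have BA: "- C * A s \<le> B s" if "s \<in> {a..a+d}" for s
  proof -
    have "\<alpha> / 2 * (s - a) \<le> A s" using d1(3)[of s] that d A(1) by auto
    then have "C * (\<alpha> / 2 * (s - a)) \<le> C * A s" using C by (intro mult_left_mono) auto
    moreover have "C * (\<alpha> / 2 * (s - a)) = (\<bar>\<beta>\<bar> + 1) * (s - a)" using A(3) by (simp add: C_def)
    moreover have "B a + (- (\<bar>\<beta>\<bar> + 1)) * (s - a) \<le> B s" by (rule d2(3)) (use that d in auto)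
    moreover have "(- (\<bar>\<beta>\<bar> + 1)) * (s - a) = - ((\<bar>\<beta>\<bar> + 1) * (s - a))" by (simp only: mult_minus_left)
    ultimately have "- (C * A s) \<le> B s" using Ba by linarith
    then show ?thesis by simp
  qed
  define \<psi> where "\<psi> s = - (max 0 (a + d - s))\<^sup>2" for s
  define \<psi>' where "\<psi>' s = 2 * max 0 (a + d - s)" for s
  have der: "(\<psi> has_real_derivative \<psi>' s) (at s within {a..b})" for s
  proof -
    have "((\<lambda>s. a + d - s) has_real_derivative - 1) (at s within {a..b})" by (auto intro!: derivative_eq_intros)
    from DERIV_image_chain[OF squared_hinge_deriv this, unfolded o_def]
    have "((\<lambda>s. (max 0 (a + d - s))\<^sup>2) has_real_derivative 2 * max 0 (a + d - s) * - 1) (at s within {a..b})" .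
    from DERIV_minus[OF this] show ?thesis by (simp add: \<psi>_def[abs_def] \<psi>'_def)
  qed
  have cont: "continuous_on {a..b} \<psi>'" unfolding \<psi>'_def[abs_def] by (intro continuous_intros)
  have low: "A s * max 0 (a + d - s) \<le> A s * \<psi>' s - B s * \<psi> s" if s: "s \<in> {a..b}" for s
  proof (cases "s \<le> a + d")
    case True
    define u where "u = a + d - s"
    have u: "0 \<le> u" "u \<le> d" using True s by (auto simp: u_def)
    have \<psi>u: "\<psi> s = - u\<^sup>2" "\<psi>' s = 2 * u" "max 0 (a + d - s) = u" using u by (auto simp: \<psi>_def \<psi>'_def u_def)
    have "- C * A s \<le> B s" by (rule BA) (use s True in auto)
    then have "- C * A s * u\<^sup>2 \<le> B s * u\<^sup>2" by (intro mult_right_mono) auto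
    moreover have "C * u \<le> C * d" using C by (intro mult_left_mono u) simp
    then have "C * u \<le> 1" using d(4) by linarith
    then have "(C * u) * (u * A s) \<le> 1 * (u * A s)" using u pos[OF s] by (intro mult_right_mono) auto
    ultimately show ?thesis unfolding \<psi>u by (simp add: power2_eq_square algebra_simps)
  qed (simp add: \<psi>_def \<psi>'_def)
  have nn: "0 \<le> A s * max 0 (a + d - s)" if "s \<in> {a..b}" for s using pos[OF that] by simp
  have "\<forall>s\<in>{a..b}. A s * \<psi>' s - B s * \<psi> s = 0"
  proof (rule Z)
    show "\<forall>s\<in>{a..b}. 0 \<le> A s * \<psi>' s - B s * \<psi> s" using low nn by (meson order_trans)
  qed (use der cont in auto)
  moreover have m: "a + d / 2 \<in> {a..b}" using d by auto
  ultimately have "A (a + d / 2) * max 0 (a + d - (a + d / 2)) \<le> 0" using low[OF m] by auto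
  moreover have "0 < A (a + d / 2)" using d1(3)[of "a + d / 2"] d A(1,3) by (auto intro: less_le_trans[of 0 "\<alpha> / 2 * (d / 2)"])
  moreover have "0 < max 0 (a + d - (a + d / 2))" using d(1) by simp
  ultimately show False using mult_pos_pos by (metis not_le)
qed

text \<open>At a double zero \<open>A \<le> (k (s - s0))\<^sup>2\<close>, so \<open>1 / sqrt (A + \<eta>\<^sup>2)\<close> is at least
  \<open>1 / (k |s - s0| + \<eta>)\<close>, whose integral grows like \<open>ln (1 / \<eta>) / k\<close>.\<close>

lemma double_zero_diverges:
  fixes A :: "real \<Rightarrow> real"
  assumes ab: "a < b" and A: "\<And>n. Ck n a b A" "\<And>s. s \<in> {a..b} \<Longrightarrow> 0 \<le> A s"
    and s0: "s0 \<in> {a..b}" "A s0 = 0" "(A has_real_derivative 0) (at s0 within {a..b})"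
  shows "\<exists>\<epsilon>>0. D < integral {a..b} (\<lambda>s. 1 / sqrt (A s + \<epsilon>))"
proof -
  obtain A1 where A1: "\<And>s. s \<in> {a..b} \<Longrightarrow> (A has_real_derivative A1 s) (at s within {a..b})" "Ck (Suc 0) a b A1"
    using A(1)[of "Suc (Suc 0)"] by (metis Ck_SucE)
  obtain A2 where A2: "\<And>s. s \<in> {a..b} \<Longrightarrow> (A1 has_real_derivative A2 s) (at s within {a..b})" "Ck 0 a b A2"
    using A1(2) by (metis Ck_SucE)
  have "bounded (A2 ` {a..b})" using A2(2) by (intro compact_imp_bounded compact_continuous_image) auto
  then obtain L where L: "\<forall>s\<in>{a..b}. \<bar>A2 s\<bar> \<le> L" by (auto simp: bounded_iff)
  have L0: "0 \<le> L" using L s0(1) abs_ge_zero order_trans by blast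
  have A10: "A1 s0 = 0" using deriv_within_unique[OF ab s0(1) A1(1)[OF s0(1)] s0(3)] .
  have b1: "\<bar>A1 s\<bar> \<le> L * \<bar>s - s0\<bar>" if "s \<in> {a..b}" for s
    using field_differentiable_bound[of "{a..b}" A1 A2 L s s0] A2(1) L that s0(1) A10 by simp
  have b2: "A s \<le> L * (s - s0)\<^sup>2" if s: "s \<in> {a..b}" for s
  proof -
    let ?S = "closed_segment s0 s"
    have sub: "?S \<subseteq> {a..b}" by (rule closed_segment_subset[OF s0(1) s]) simp
    have "norm (A s - A s0) \<le> (L * \<bar>s - s0\<bar>) * norm (s - s0)"
    proof (rule field_differentiable_bound[of ?S A A1])
      show "(A has_real_derivative A1 z) (at z within ?S)" if "z \<in> ?S" for z
        using A1(1) sub that has_field_derivative_subset by blast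
      show "norm (A1 z) \<le> L * \<bar>s - s0\<bar>" if "z \<in> ?S" for z
      proof -
        have "\<bar>z - s0\<bar> \<le> \<bar>s - s0\<bar>" using that by (auto simp: closed_segment_eq_real_ivl split: if_splits)
        then have "L * \<bar>z - s0\<bar> \<le> L * \<bar>s - s0\<bar>" using L0 by (rule mult_left_mono)
        then show ?thesis using b1[of z] sub that by auto
      qed
    qed auto
    then show ?thesis using s0(2) by (simp add: power2_eq_square abs_mult_self_eq mult.assoc)
  qed
  define k where "k = sqrt L + 1"
  have k: "0 < k" "L \<le> k\<^sup>2"
  proof -
    show "0 < k" using L0 by (simp add: k_def add_nonneg_pos)
    have "L = (sqrt L)\<^sup>2" using L0 by simp
    also have "\<dots> \<le> k\<^sup>2" unfolding k_def using L0 by (intro power_mono) auto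
    finally show "L \<le> k\<^sup>2" .
  qed
  define l where "l = (b - a) / 2"
  have l: "0 < l" using ab by (simp add: l_def)
  \<comment> \<open>This \<open>\<eta>\<close> makes \<open>ln (k l / \<eta>) / k\<close> equal to \<open>\<bar>D\<bar> + 1\<close>, where \<open>l\<close> is a length that the interval
    contains on at least one side of \<open>s0\<close>.\<close>
  define \<eta> where "\<eta> = k * l * exp (- (k * (\<bar>D\<bar> + 1)))"
  have \<eta>: "0 < \<eta>" using k l by (simp add: \<eta>_def)
  let ?f = "\<lambda>s. 1 / sqrt (A s + \<eta>\<^sup>2)"
  have cA: "continuous_on {a..b} A" by (rule Ck_imp_continuous_on[OF A(1)[of 0]])
  have pos: "0 < A s + \<eta>\<^sup>2" if "s \<in> {a..b}" for s using A(2)[OF that] \<eta> by (simp add: add_nonneg_pos)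
  have cf: "continuous_on {a..b} ?f"
    by (intro continuous_on_divide continuous_on_const continuous_on_real_sqrt continuous_on_add cA) (use pos in force)
  have low: "1 / (k * \<bar>s - s0\<bar> + \<eta>) \<le> ?f s" if s: "s \<in> {a..b}" for s
  proof -
    have "A s + \<eta>\<^sup>2 \<le> k\<^sup>2 * (s - s0)\<^sup>2 + \<eta>\<^sup>2"
      using b2[OF s] mult_right_mono[OF k(2), of "(s - s0)\<^sup>2"] by simp
    also have "\<dots> \<le> (k * \<bar>s - s0\<bar> + \<eta>)\<^sup>2"
      using k(1) \<eta> by (simp add: power2_sum power_mult_distrib)
    finally have "sqrt (A s + \<eta>\<^sup>2) \<le> k * \<bar>s - s0\<bar> + \<eta>" using k(1) \<eta> by (intro real_le_lsqrt) auto
    then show ?thesis using pos[OF s] by (intro divide_left_mono mult_pos_pos) (auto intro: less_le_trans[of 0 "sqrt (A s + \<eta>\<^sup>2)"])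
  qed
  have half: "D < integral {a..b} ?f" if xy: "a \<le> x" "y \<le> b" "y - x \<ge> l" "e = 1 \<and> s0 = x \<or> e = -1 \<and> s0 = y" for x y e :: real
  proof -
    have xley: "x \<le> y" using xy l by simp
    let ?g = "\<lambda>s. 1 / (k * (e * (s - s0)) + \<eta>)"
    have es: "e * (s - s0) = \<bar>s - s0\<bar>" if "s \<in> {x..y}" for s using xy(4) that by auto
    have "(?g has_integral (e * ln (k * (e * (y - s0)) + \<eta>) / k - e * ln (k * (e * (x - s0)) + \<eta>) / k)) {x..y}"
    proof (rule fundamental_theorem_of_calculus[OF xley])
      fix s assume s: "s \<in> {x..y}"
      have p: "0 < k * (e * (s - s0)) + \<eta>" unfolding es[OF s] using k \<eta> by (simp add: add_nonneg_pos)
      have "((\<lambda>s. e * ln (k * (e * (s - s0)) + \<eta>) / k) has_real_derivative e * ((k * e) / (k * (e * (s - s0)) + \<eta>)) / k) (at s within {x..y})"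
        using p by (auto intro!: derivative_eq_intros)
      moreover have "e * ((k * e) / (k * (e * (s - s0)) + \<eta>)) / k = ?g s" using k(1) xy(4) by auto
      ultimately show "((\<lambda>s. e * ln (k * (e * (s - s0)) + \<eta>) / k) has_vector_derivative ?g s) (at s within {x..y})"
        by (simp only: has_real_derivative_iff_has_vector_derivative)
    qed
    then have ig: "(?g has_integral (ln (k * (y - x) + \<eta>) - ln \<eta>) / k) {x..y}"
      using xy(4) by (auto simp: diff_divide_distrib)
    have sub: "{x..y} \<subseteq> {a..b}" using xy by auto
    have cfi: "?f integrable_on {a..b}" "?f integrable_on {x..y}"
      by (intro integrable_continuous_real cf) (intro integrable_continuous_real continuous_on_subset[OF cf sub])
    have "k * l / \<eta> = exp (k * (\<bar>D\<bar> + 1))"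
      unfolding \<eta>_def exp_minus using k(1) l by (simp add: inverse_eq_divide)
    then have "k * (\<bar>D\<bar> + 1) = ln (k * l / \<eta>)" by simp
    also have "\<dots> = ln (k * l) - ln \<eta>" using k l \<eta> by (subst ln_div) auto
    also have "\<dots> \<le> ln (k * (y - x) + \<eta>) - ln \<eta>"
    proof -
      have "k * l \<le> k * (y - x)" using k(1) xy(3) by (intro mult_left_mono) auto
      then have "k * l \<le> k * (y - x) + \<eta>" using \<eta> by linarith
      moreover have "0 < k * l" using k l by simp
      ultimately show ?thesis by simp
    qed
    finally have "\<bar>D\<bar> + 1 \<le> (ln (k * (y - x) + \<eta>) - ln \<eta>) / k" using k(1) by (simp add: pos_le_divide_eq mult.commute)
    also have "\<dots> = integral {x..y} ?g" using integral_unique[OF ig] by simp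
    also have "\<dots> \<le> integral {x..y} ?f"
    proof (rule integral_le)
      show "?g integrable_on {x..y}" using ig by blast
      show "?g s \<le> ?f s" if "s \<in> {x..y}" for s using low[of s] sub that es[OF that] by auto
    qed (rule cfi)
    also have "\<dots> \<le> integral {a..b} ?f"
      by (rule integral_subset_le[OF sub cfi(2,1)]) (use pos in \<open>auto intro!: divide_nonneg_nonneg simp: less_imp_le\<close>)
    finally show ?thesis by linarith
  qed
  have "D < integral {a..b} ?f"
  proof (cases "s0 \<le> (a + b) / 2")
    case True
    show ?thesis by (rule half[of s0 b 1]) (use True s0(1) in \<open>auto simp: l_def field_simps\<close>)
  next
    case False
    show ?thesis by (rule half[of a s0 "-1"]) (use False s0(1) in \<open>auto simp: l_def field_simps\<close>)
  qed
  then show ?thesis using \<eta> by (intro exI[of _ "\<eta>\<^sup>2"]) simp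
qed

text \<open>Monotone convergence: the bounded integrals increase as \<open>\<epsilon>\<close> decreases to \<open>0\<close>.\<close>

lemma inverse_sqrt_integral:
  fixes A :: "real \<Rightarrow> real"
  assumes cA: "continuous_on {a..b} A" and pos: "\<And>s. s \<in> {a..b} \<Longrightarrow> 0 \<le> A s" "\<And>s. s \<in> {a<..<b} \<Longrightarrow> 0 < A s"
    and D: "\<And>\<epsilon>. 0 < \<epsilon> \<Longrightarrow> integral {a..b} (\<lambda>s. 1 / sqrt (A s + \<epsilon>)) \<le> D" and t: "t \<in> {a..b}"
  shows "(\<lambda>s. 1 / sqrt (A s)) integrable_on {a..t}"
    and "(\<lambda>n. integral {a..t} (\<lambda>s. 1 / sqrt (A s + 1 / Suc n))) \<longlonglongrightarrow> integral {a..t} (\<lambda>s. 1 / sqrt (A s))"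
proof -
  let ?f = "\<lambda>n s. 1 / sqrt (A s + 1 / real (Suc n))"
  have p: "0 < A s + 1 / real (Suc n)" if "s \<in> {a..b}" for s n using pos(1)[OF that] by (simp add: add_nonneg_pos)
  have cf: "continuous_on {a..b} (?f n)" for n
    by (intro continuous_on_divide continuous_on_const continuous_on_real_sqrt continuous_on_add cA ballI)
      (metis p less_numeral_extra(3) real_sqrt_gt_0_iff)
  have fi: "?f n integrable_on {a..u}" if "u \<in> {a..b}" for n u
    by (rule integrable_continuous_real, rule continuous_on_subset[OF cf]) (use that in auto)
  have f0: "0 \<le> ?f n s" if "s \<in> {a..b}" for n s using p[OF that, of n] by simp
  have "(\<lambda>s. 1 / sqrt (A s)) integrable_on {a<..<t} \<and>
     (\<lambda>n. integral {a<..<t} (?f n)) \<longlonglongrightarrow> integral {a<..<t} (\<lambda>s. 1 / sqrt (A s))"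
  proof (rule monotone_convergence_increasing)
    show "?f n integrable_on {a<..<t}" for n using fi[OF t] by (simp add: integrable_on_open_interval_real)
    show "?f n s \<le> ?f (Suc n) s" if "s \<in> {a<..<t}" for n s
    proof -
      have s: "s \<in> {a..b}" using that t by auto
      have "1 / real (Suc (Suc n)) \<le> 1 / real (Suc n)" by (intro divide_left_mono) auto
      then have "sqrt (A s + 1 / real (Suc (Suc n))) \<le> sqrt (A s + 1 / real (Suc n))" by (intro real_sqrt_le_mono) simp
      then show ?thesis using p[OF s, of n] p[OF s, of "Suc n"] by (intro divide_left_mono) auto
    qed
    show "(\<lambda>n. ?f n s) \<longlonglongrightarrow> 1 / sqrt (A s)" if s: "s \<in> {a<..<t}" for s
    proof -
      have "0 < A s" using s t by (intro pos(2)) auto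
      moreover have "(\<lambda>n. A s + 1 / real (Suc n)) \<longlonglongrightarrow> A s + 0"
        by (intro tendsto_add tendsto_const LIMSEQ_inverse_real_of_nat[unfolded inverse_eq_divide])
      then have "(\<lambda>n. sqrt (A s + 1 / real (Suc n))) \<longlonglongrightarrow> sqrt (A s)" using tendsto_real_sqrt by fastforce
      ultimately show ?thesis by (intro tendsto_divide tendsto_const) auto
    qed
    show "bounded (range (\<lambda>n. integral {a<..<t} (?f n)))"
    proof (rule boundedI)
      fix x assume "x \<in> range (\<lambda>n. integral {a<..<t} (?f n))"
      then obtain n where x: "x = integral {a..t} (?f n)" by (auto simp: integral_open_interval_real)
      have "0 \<le> x" unfolding x by (rule integral_nonneg[OF fi[OF t]]) (use f0 t in auto)
      moreover have "x \<le> integral {a..b} (?f n)" unfolding x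
        by (rule integral_subset_le) (use fi[OF t] fi[of b] t f0 in auto)
      moreover have "\<dots> \<le> D" by (rule D) simp
      ultimately show "norm x \<le> D" by simp
    qed
  qed
  then show "(\<lambda>s. 1 / sqrt (A s)) integrable_on {a..t}"
    "(\<lambda>n. integral {a..t} (?f n)) \<longlonglongrightarrow> integral {a..t} (\<lambda>s. 1 / sqrt (A s))"
    by (simp_all add: integrable_on_open_interval_real integral_open_interval_real)
qed

lemma reflect_deriv:
  fixes f :: "real \<Rightarrow> real"
  assumes "(f has_real_derivative D) (at (- s) within {a..b})"
  shows "((\<lambda>x. f (- x)) has_real_derivative - D) (at s within {- b..- a})"
proof -
  have "((\<lambda>x. - x) has_real_derivative - 1) (at s within {- b..- a})" by (auto intro!: derivative_eq_intros)
  moreover have "(\<lambda>x. - x) ` {- b..- a} = {a..b}" by simp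
  ultimately show ?thesis
    using DERIV_image_chain[of f D "\<lambda>x. - x" s "{- b..- a}" "-1"] assms by (simp add: o_def)
qed

locale isoparametric_manifold = compact_rmanifold M
  for M :: "('a::{t2_space, second_countable_topology}, 'n::finite) riemannian" +
  fixes F :: "'a \<Rightarrow> real" and a b :: real and A B :: "real \<Rightarrow> real"
  assumes conn: "connected (UNIV :: 'a set)" and ab: "a < b" and smF: "smooth_fun M F"
    and rangeF: "range F = {a..b}" and smA: "smooth_on_interval a b A" and smB: "smooth_on_interval a b B"
    and gradF: "\<And>p. grad_norm_sq M F p = A (F p)" and lapF: "\<And>p. laplacian M F p = B (F p)"
begin

lemma F_C1: "C1_fun F" by (rule smooth_fun_C1[OF smF])

lemma F_mem: "F p \<in> {a..b}" using rangeF by blast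

lemma level_point: "s \<in> {a..b} \<Longrightarrow> \<exists>p. F p = s"
proof -
  assume "s \<in> {a..b}"
  then have "s \<in> range F" by (simp add: rangeF)
  then show ?thesis by blast
qed

lemma CkA: "Ck n a b A" by (rule smooth_on_interval_imp_Ck[OF smA])
lemma CkB: "Ck n a b B" by (rule smooth_on_interval_imp_Ck[OF smB])

lemma A_cont: "continuous_on {a..b} A" by (rule Ck_imp_continuous_on[OF CkA[of 0]])
lemma B_cont: "continuous_on {a..b} B" by (rule Ck_imp_continuous_on[OF CkB[of 0]])

lemma pairing_F: "pairing F F p = A (F p)"
  using gradF by (simp add: grad_norm_sq_pairing)

lemma A_nonneg: assumes "s \<in> {a..b}" shows "0 \<le> A s"
proof -
  obtain p where p: "F p = s" using level_point[OF assms] by blast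
  have "0 \<le> grad_norm_sq M F p" unfolding grad_norm_sq_def Let_def
    by (rule posdef_nonneg[OF gram_posdef[OF chart_at]])
  then show ?thesis using gradF p by simp
qed

text \<open>The gradient vanishes where \<open>F\<close> attains its minimum or its maximum.\<close>

lemma A_endpoints: "A a = 0" "A b = 0"
proof -
  have z: "A (F p) = 0" if "(\<forall>q. F q \<le> F p) \<or> (\<forall>q. F p \<le> F q)" for p
  proof -
    let ?c = "chart_at M p"
    have "((F \<circ> chart_inv ?c) has_derivative frechet_derivative (F \<circ> chart_inv ?c) (at (snd ?c p))) (at (snd ?c p))"
      using C1_funD(2)[OF F_C1 chart_at] by (simp add: frechet_derivative_works)
    then have "frechet_derivative (F \<circ> chart_inv ?c) (at (snd ?c p)) = (\<lambda>v. 0)"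
      by (rule differential_zero_maxmin[OF UNIV_I open_UNIV])
         (use that chart(5)[OF chart_at[of p]] in auto)
    then have "partials ?c F (snd ?c p) = 0" by (simp add: partials_def vec_eq_iff)
    then show ?thesis using pairing_F[of p] by (simp add: pairing_def grad_pairing_def)
  qed
  obtain p where "F p = a" using level_point[of a] ab by auto
  then show "A a = 0" using z[of p] F_mem by auto
  obtain q where "F q = b" using level_point[of b] ab by auto
  then show "A b = 0" using z[of q] F_mem by auto
qed

lemma pairing_compose:
  assumes h: "\<And>s. s \<in> {a..b} \<Longrightarrow> (h has_real_derivative h' s) (at s within {a..b})" and h': "continuous_on {a..b} h'"
  shows "C1_fun (\<lambda>q. h (F q))" "pairing (\<lambda>q. h (F q)) k p = h' (F p) * pairing F k p"
    and "pairing (\<lambda>q. h (F q)) (\<lambda>q. h (F q)) p = (h' (F p))\<^sup>2 * A (F p)"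
proof -
  note c = C1_fun_compose[where h = h and h' = h' and S = "{a..b}", OF F_C1 _ h h']
  show "C1_fun (\<lambda>q. h (F q))" by (rule c(1)) (use rangeF in auto)
  have *: "pairing (\<lambda>q. h (F q)) k p = h' (F p) * pairing F k p" for k by (rule c(2)) (use rangeF in auto)
  show "pairing (\<lambda>q. h (F q)) k p = h' (F p) * pairing F k p" by (rule *)
  show "pairing (\<lambda>q. h (F q)) (\<lambda>q. h (F q)) p = (h' (F p))\<^sup>2 * A (F p)"
    using *[of "\<lambda>q. h (F q)"] pairing_sym[of F "\<lambda>q. h (F q)" p] *[of F] pairing_F[of p]
    by (simp add: power2_eq_square)
qed

text \<open>Primitives of \<open>1 / sqrt (A + \<epsilon>)\<close> composed with \<open>F\<close> have gradients of norm at most one.\<close>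

lemma integral_le_edist:
  assumes e: "0 < \<epsilon>"
  shows "ennreal (integral {a..F p} (\<lambda>s. 1 / sqrt (A s + \<epsilon>)) - integral {a..F q} (\<lambda>s. 1 / sqrt (A s + \<epsilon>))) \<le> edist p q"
proof -
  let ?g = "\<lambda>s. 1 / sqrt (A s + \<epsilon>)"
  have pos: "0 < A s + \<epsilon>" if "s \<in> {a..b}" for s using A_nonneg[OF that] e by simp
  have cg: "continuous_on {a..b} ?g"
    by (intro continuous_on_divide continuous_on_const continuous_on_real_sqrt continuous_on_add A_cont ballI)
       (metis pos less_numeral_extra(3) real_sqrt_gt_0_iff)
  define h where "h s = - integral {a..s} ?g" for s
  have h: "(h has_real_derivative - ?g s) (at s within {a..b})" if "s \<in> {a..b}" for s
    unfolding h_def[abs_def] by (rule DERIV_minus[OF integral_has_real_derivative[OF cg that]])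
  have ch: "continuous_on {a..b} (\<lambda>s. - ?g s)" by (rule continuous_on_minus[OF cg])
  note c = pairing_compose[where h = h and h' = "\<lambda>s. - ?g s", OF h ch]
  have "pairing (\<lambda>q. h (F q)) (\<lambda>q. h (F q)) p \<le> 1" for p
  proof -
    have "0 < A (F p) + \<epsilon>" by (rule pos[OF F_mem])
    moreover have "pairing (\<lambda>q. h (F q)) (\<lambda>q. h (F q)) p = (- ?g (F p))\<^sup>2 * A (F p)" by (rule c(3))
    ultimately show ?thesis using e by (simp add: power_divide)
  qed
  from edist_lower_bound[OF c(1) this, of q p] show ?thesis by (simp add: h_def)
qed

text \<open>A bound is the distance between a point of \<open>F\<^sup>-\<^sup>1(a)\<close> and a point of \<open>F\<^sup>-\<^sup>1(b)\<close>.\<close>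

lemma length_integral_bounded:
  obtains D where "\<And>\<epsilon>. 0 < \<epsilon> \<Longrightarrow> integral {a..b} (\<lambda>s. 1 / sqrt (A s + \<epsilon>)) \<le> D"
proof -
  obtain p q where pq: "F p = b" "F q = a" using level_point[of a] level_point[of b] ab by auto
  obtain D where D: "0 \<le> D" "edist p q = ennreal D" using edist_finite[OF conn, of p q] by (cases "edist p q") auto
  have "integral {a..b} (\<lambda>s. 1 / sqrt (A s + \<epsilon>)) \<le> D" if "0 < \<epsilon>" for \<epsilon>
    using integral_le_edist[OF that, of p q] pq D by (auto simp: ennreal_le_iff2)
  then show thesis by (rule that)
qed

lemma no_double_zero:
  assumes "s \<in> {a..b}" "A s = 0" "(A has_real_derivative D) (at s within {a..b})" shows "D \<noteq> 0"
proof
  assume "D = 0"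
  obtain L where L: "\<And>\<epsilon>. 0 < \<epsilon> \<Longrightarrow> integral {a..b} (\<lambda>s. 1 / sqrt (A s + \<epsilon>)) \<le> L"
    using length_integral_bounded by blast
  have "\<exists>\<epsilon>>0. L < integral {a..b} (\<lambda>s. 1 / sqrt (A s + \<epsilon>))"
    by (rule double_zero_diverges[OF ab CkA A_nonneg assms(1,2)]) (use assms(3) \<open>D = 0\<close> in auto)
  then show False using L by (meson not_le)
qed

definition A' :: "real \<Rightarrow> real" where
  "A' = (SOME d. \<forall>s\<in>{a..b}. (A has_real_derivative d s) (at s within {a..b}))"

lemma A': assumes "s \<in> {a..b}" shows "(A has_real_derivative A' s) (at s within {a..b})"
proof -
  have "\<exists>d. \<forall>s\<in>{a..b}. (A has_real_derivative d s) (at s within {a..b})"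
    using CkA[of "Suc 0"] by (metis Ck_SucE)
  from someI_ex[OF this] show ?thesis using assms unfolding A'_def by blast
qed

text \<open>An interior zero would be a minimum of \<open>A\<close>, hence a double zero.\<close>

lemma A_pos: assumes s: "s \<in> {a<..<b}" shows "0 < A s"
proof (rule ccontr)
  assume "\<not> 0 < A s"
  then have z: "A s = 0" using A_nonneg[of s] s by auto
  have m: "s \<in> {a..b}" using s by auto
  have "(A has_real_derivative A' s) (at s)"
    using A'[OF m] s by (simp add: at_within_Icc_at)
  then have "A' s = 0"
  proof (rule DERIV_local_min[of A "A' s" s "min (s - a) (b - s)"])
    show "\<forall>y. \<bar>s - y\<bar> < min (s - a) (b - s) \<longrightarrow> A s \<le> A y"
    proof (intro allI impI)
      fix y assume "\<bar>s - y\<bar> < min (s - a) (b - s)"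
      then have "y \<in> {a..b}" by auto
      then show "A s \<le> A y" using A_nonneg z by simp
    qed
  qed (use s in auto)
  then show False using no_double_zero[OF m z A'[OF m]] by simp
qed

lemma A'_endpoints: "0 < A' a" "A' b < 0"
proof -
  have m: "a \<in> {a..b}" "b \<in> {a..b}" using ab by auto
  have nb: "at s within {a..b} \<noteq> bot" if "s \<in> {a..b}" for s
    using that ab by (simp add: trivial_limit_within islimpt_Icc)
  have "((\<lambda>s. (A s - A a) / (s - a)) \<longlongrightarrow> A' a) (at a within {a..b})"
    using A'[OF m(1)] by (simp add: has_field_derivative_iff)
  moreover have "\<forall>\<^sub>F s in at a within {a..b}. 0 \<le> (A s - A a) / (s - a)"
    unfolding eventually_at_filter using A_nonneg A_endpoints by (intro always_eventually) auto
  ultimately have "0 \<le> A' a" by (rule tendsto_lowerbound[OF _ _ nb[OF m(1)]])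
  then show "0 < A' a" using no_double_zero[OF m(1) A_endpoints(1) A'[OF m(1)]] by simp
  have "((\<lambda>s. (A s - A b) / (s - b)) \<longlongrightarrow> A' b) (at b within {a..b})"
    using A'[OF m(2)] by (simp add: has_field_derivative_iff)
  moreover have "\<forall>\<^sub>F s in at b within {a..b}. (A s - A b) / (s - b) \<le> 0"
    unfolding eventually_at_filter using A_nonneg A_endpoints
    by (intro always_eventually) (auto intro!: divide_nonneg_nonpos)
  ultimately have "A' b \<le> 0" by (rule tendsto_upperbound[OF _ _ nb[OF m(2)]])
  then show "A' b < 0" using no_double_zero[OF m(2) A_endpoints(2) A'[OF m(2)]] by simp
qed

text \<open>Green's formula for \<open>F\<close> and the test function \<open>h \<circ> F\<close>: the integral of \<open>(A h' - B h) \<circ> F\<close>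
  vanishes.\<close>

lemma Green_radial:
  assumes h: "\<And>s. s \<in> {a..b} \<Longrightarrow> (h has_real_derivative h' s) (at s within {a..b})" and h': "continuous_on {a..b} h'"
    and nn: "\<And>s. s \<in> {a..b} \<Longrightarrow> 0 \<le> A s * h' s - B s * h s" and s: "s \<in> {a..b}"
  shows "A s * h' s - B s * h s = 0"
proof -
  note c = pairing_compose[where h = h and h' = h', OF h h']
  have cF: "continuous_on UNIV F" by (rule C1_fun_continuous[OF F_C1])
  have ch: "continuous_on {a..b} h" by (rule DERIV_continuous_on[OF h])
  have comp: "continuous_on UNIV (\<lambda>p. g (F p))" if "continuous_on {a..b} g" for g :: "real \<Rightarrow> real"
    by (rule continuous_on_compose2[OF that cF]) (use F_mem in auto)
  have i: "integrable vol (\<lambda>p. A (F p) * h' (F p))" "integrable vol (\<lambda>p. B (F p) * h (F p))"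
    by (intro continuous_integrable comp[of "\<lambda>s. A s * h' s"] continuous_on_mult A_cont h',
        intro continuous_integrable comp[of "\<lambda>s. B s * h s"] continuous_on_mult B_cont ch)
  have e: "(LINT p|vol. pairing (\<lambda>q. h (F q)) F p) = (LINT p|vol. h (F p) * laplacian M F p)"
    by (rule Green[OF smF c(1)])
  have "(LINT p|vol. A (F p) * h' (F p)) = (LINT p|vol. B (F p) * h (F p))"
  proof -
    have "A (F p) * h' (F p) = pairing (\<lambda>q. h (F q)) F p" for p
    proof -
      have "pairing (\<lambda>q. h (F q)) F p = h' (F p) * pairing F F p" by (rule c(2))
      then show ?thesis by (simp add: pairing_F)
    qed
    then have "(LINT p|vol. A (F p) * h' (F p)) = (LINT p|vol. pairing (\<lambda>q. h (F q)) F p)"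
      by (intro Bochner_Integration.integral_cong) simp_all
    then show ?thesis using e by (simp add: lapF mult.commute)
  qed
  then have z: "(LINT p|vol. (A (F p) * h' (F p) - B (F p) * h (F p))) = 0" using i by simp
  obtain p where p: "F p = s" using level_point[OF s] by blast
  have cc: "continuous_on UNIV (\<lambda>p. A (F p) * h' (F p) - B (F p) * h (F p))"
    by (rule comp[of "\<lambda>s. A s * h' s - B s * h s"]) (intro continuous_on_diff continuous_on_mult A_cont B_cont h' ch)
  have "A (F p) * h' (F p) - B (F p) * h (F p) = 0"
    by (rule continuous_integral_zero[OF cc nn[OF F_mem] z])
  then show ?thesis using p by simp
qed

text \<open>The argument at the left end point also applies to the reflected coefficients
  \<open>A(- s)\<close> and \<open>- B(- s)\<close>, which belong to the isoparametric function \<open>- F\<close>.\<close>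

lemma B_endpoints: "B a < 0" "0 < B b"
proof -
  have m: "a \<in> {a..b}" "b \<in> {a..b}" using ab by auto
  obtain B1 where B1: "\<And>s. s \<in> {a..b} \<Longrightarrow> (B has_real_derivative B1 s) (at s within {a..b})"
    using CkB[of "Suc 0"] by (metis Ck_SucE)
  show "B a < 0"
  proof (rule endpoint_sign[OF ab A_endpoints(1) A'[OF m(1)] A'_endpoints(1) B1[OF m(1)] A_nonneg])
    show "\<forall>s\<in>{a..b}. A s * \<psi>' s - B s * \<psi> s = 0"
      if "\<forall>s\<in>{a..b}. (\<psi> has_real_derivative \<psi>' s) (at s within {a..b})" "continuous_on {a..b} \<psi>'"
        "\<forall>s\<in>{a..b}. 0 \<le> A s * \<psi>' s - B s * \<psi> s" for \<psi> \<psi>'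
      by (intro ballI Green_radial[where h = \<psi> and h' = \<psi>']) (use that in auto)
  qed
  let ?A = "\<lambda>s. A (- s)" and ?B = "\<lambda>s. - B (- s)"
  have "?B (- b) < 0"
  proof (rule endpoint_sign[of "- b" "- a" ?A])
    show "(?A has_real_derivative - A' b) (at (- b) within {- b..- a})"
      by (rule reflect_deriv) (simp add: A'[OF m(2)])
    show "(?B has_real_derivative - (- B1 b)) (at (- b) within {- b..- a})"
      by (intro DERIV_minus reflect_deriv) (simp add: B1[OF m(2)])
    show "\<forall>s\<in>{- b..- a}. ?A s * \<psi>' s - ?B s * \<psi> s = 0"
      if d: "\<forall>s\<in>{- b..- a}. (\<psi> has_real_derivative \<psi>' s) (at s within {- b..- a})" and c: "continuous_on {- b..- a} \<psi>'"
        and n: "\<forall>s\<in>{- b..- a}. 0 \<le> ?A s * \<psi>' s - ?B s * \<psi> s" for \<psi> \<psi>'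
    proof
      fix s assume s: "s \<in> {- b..- a}"
      let ?h = "\<lambda>s. - \<psi> (- s)" and ?h' = "\<lambda>s. \<psi>' (- s)"
      have "A (- s) * ?h' (- s) - B (- s) * ?h (- s) = 0"
      proof (rule Green_radial)
        fix t assume t: "t \<in> {a..b}"
        have "(\<psi> has_real_derivative \<psi>' (- t)) (at (- t) within {- b..- a})" using d t by auto
        then have "((\<lambda>x. \<psi> (- x)) has_real_derivative - \<psi>' (- t)) (at t within {- (- a)..- (- b)})" by (rule reflect_deriv)
        from DERIV_minus[OF this]
        show "(?h has_real_derivative ?h' t) (at t within {a..b})" by simp
        show "0 \<le> A t * ?h' t - B t * ?h t" using n[rule_format, of "- t"] t by simp
      next
        show "continuous_on {a..b} ?h'"
          by (rule continuous_on_compose2[OF c]) (auto intro!: continuous_intros)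
      qed (use s in auto)
      then show "?A s * \<psi>' s - ?B s * \<psi> s = 0" by simp
    qed
  qed (use ab A_endpoints A'_endpoints A_nonneg in auto)
  then show "0 < B b" by simp
qed

section \<open>The distance from the focal set\<close>

text \<open>The function for which \<open>R \<circ> F\<close> has a gradient of norm one off the focal sets.\<close>

definition R :: "real \<Rightarrow> real" where "R t = integral {a..t} (\<lambda>s. 1 / sqrt (A s))"

lemma R_limit:
  assumes t: "t \<in> {a..b}"
  shows "(\<lambda>s. 1 / sqrt (A s)) integrable_on {a..t}"
    and "(\<lambda>n. integral {a..t} (\<lambda>s. 1 / sqrt (A s + 1 / Suc n))) \<longlonglongrightarrow> R t"
proof -
  obtain D where D: "\<And>\<epsilon>. 0 < \<epsilon> \<Longrightarrow> integral {a..b} (\<lambda>s. 1 / sqrt (A s + \<epsilon>)) \<le> D"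
    using length_integral_bounded by blast
  show "(\<lambda>s. 1 / sqrt (A s)) integrable_on {a..t}"
    by (rule inverse_sqrt_integral(1)[OF A_cont A_nonneg A_pos D t])
  show "(\<lambda>n. integral {a..t} (\<lambda>s. 1 / sqrt (A s + 1 / Suc n))) \<longlonglongrightarrow> R t"
    unfolding R_def by (rule inverse_sqrt_integral(2)[OF A_cont A_nonneg A_pos D t])
qed

lemma R_a [simp]: "R a = 0" by (simp add: R_def)

lemma R_cont: "continuous_on {a..b} R"
  unfolding R_def[abs_def] by (rule indefinite_integral_continuous_1[OF R_limit(1)]) (use ab in simp)

lemma R_deriv: assumes s: "s \<in> {a<..<b}" shows "(R has_real_derivative 1 / sqrt (A s)) (at s)"
proof -
  have m: "s \<in> {a..b}" using s by auto
  have "continuous (at s within {a..b}) A" using A_cont m by (simp add: continuous_on_eq_continuous_within)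
  then have "continuous (at s within {a..b}) (\<lambda>s. 1 / sqrt (A s))"
    using A_pos[OF s] unfolding continuous_within by (intro tendsto_divide tendsto_const tendsto_real_sqrt) auto
  then have "((\<lambda>u. integral {a..u} (\<lambda>s. 1 / sqrt (A s))) has_vector_derivative 1 / sqrt (A s)) (at s within {a..b})"
    using integral_has_vector_derivative_continuous_at[OF R_limit(1)[of b], of s "{}"] m ab by auto
  then show ?thesis
    using s by (simp add: R_def[abs_def] has_real_derivative_iff_has_vector_derivative at_within_Icc_at)
qed

lemma R_strict: assumes "a \<le> s" "s < t" "t \<le> b" shows "R s < R t"
proof (rule DERIV_pos_imp_increasing_open[OF assms(2)])
  fix x assume "s < x" "x < t"
  then have x: "x \<in> {a<..<b}" using assms by auto
  show "\<exists>y. (R has_real_derivative y) (at x) \<and> 0 < y"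
    using R_deriv[OF x] A_pos[OF x] by (intro exI[of _ "1 / sqrt (A x)"]) simp
next
  show "continuous_on {s..t} R" by (rule continuous_on_subset[OF R_cont]) (use assms in auto)
qed

lemma R_mono: assumes "a \<le> s" "s \<le> t" "t \<le> b" shows "R s \<le> R t"
  using R_strict[of s t] assms by (cases "s = t") auto

lemma R_nonneg: "s \<in> {a..b} \<Longrightarrow> 0 \<le> R s"
  using R_mono[of a s] by simp

definition rdist :: "'a \<Rightarrow> 'a \<Rightarrow> real" where "rdist p q = enn2real (edist p q)"

lemma ennreal_rdist: "ennreal (rdist p q) = edist p q"
  unfolding rdist_def by (rule ennreal_enn2real[OF edist_finite[OF conn]])

lemma rdist_nonneg [simp]: "0 \<le> rdist p q" by (simp add: rdist_def)

lemma rdist_refl [simp]: "rdist p p = 0" by (simp add: rdist_def)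

lemma rdist_triangle: "rdist p r \<le> rdist p q + rdist q r"
proof -
  have "ennreal (rdist p r) \<le> ennreal (rdist p q + rdist q r)"
    using edist_triangle[of p r q] by (simp add: ennreal_rdist)
  then show ?thesis by (subst (asm) ennreal_le_iff) auto
qed

lemma rdist_near:
  assumes "0 < e" obtains U where "open U" "p \<in> U" "\<And>q. q \<in> U \<Longrightarrow> rdist p q < e \<and> rdist q p < e"
proof -
  obtain U where U: "open U" "p \<in> U" "\<forall>q\<in>U. edist p q < ennreal e \<and> edist q p < ennreal e"
    using edist_near[OF assms] by blast
  have "rdist p q < e \<and> rdist q p < e" if "q \<in> U" for q
    using U(3) that assms by (auto simp: ennreal_rdist[symmetric] ennreal_less_iff)
  then show thesis using that U by blast
qed

lemma rdist_continuous: "continuous_on UNIV (rdist x)"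
  unfolding continuous_on_eq_continuous_at[OF open_UNIV]
proof
  fix p
  show "isCont (rdist x) p"
    unfolding isCont_def
  proof (rule tendstoI)
    fix e :: real assume "0 < e"
    then obtain U where U: "open U" "p \<in> U" "\<And>q. q \<in> U \<Longrightarrow> rdist p q < e \<and> rdist q p < e"
      using rdist_near by blast
    show "\<forall>\<^sub>F q in at p. dist (rdist x q) (rdist x p) < e"
      unfolding eventually_at_topological
    proof (intro exI[of _ U] conjI ballI impI)
      fix q assume q: "q \<in> U"
      show "dist (rdist x q) (rdist x p) < e"
        using U(3)[OF q] rdist_triangle[of x q p] rdist_triangle[of x p q] by (auto simp: dist_real_def)
    qed (use U in auto)
  qed
qed

lemma R_le_rdist: "R (F p) - R (F q) \<le> rdist p q"
proof -
  let ?R = "\<lambda>n t. integral {a..t} (\<lambda>s. 1 / sqrt (A s + 1 / Suc n))"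
  have "?R n (F p) - ?R n (F q) \<le> rdist p q" for n
  proof -
    have "0 < 1 / real (Suc n)" by simp
    from integral_le_edist[OF this, of p q] have "ennreal (?R n (F p) - ?R n (F q)) \<le> ennreal (rdist p q)"
      by (simp only: ennreal_rdist)
    then show ?thesis by (subst (asm) ennreal_le_iff) auto
  qed
  then show ?thesis
    by (intro LIMSEQ_le_const2[OF tendsto_diff[OF R_limit(2)[OF F_mem] R_limit(2)[OF F_mem]]]) auto
qed

lemma focal_rho_le: assumes "F q = a" shows "focal_rho M a F x \<le> rdist x q"
proof -
  have "(INF q\<in>focal_plus a F. edist x q) \<le> ennreal (rdist x q)"
    unfolding ennreal_rdist by (rule INF_lower) (simp add: focal_plus_def assms)
  then show ?thesis by (simp add: focal_rho_def riemannian_setdist_def enn2real_leI)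
qed

lemma focal_rho_ge: assumes "\<And>q. F q = a \<Longrightarrow> r \<le> rdist x q" "0 \<le> r" shows "r \<le> focal_rho M a F x"
proof -
  obtain q where q: "F q = a" using level_point[of a] ab by auto
  have "ennreal r \<le> (INF q\<in>focal_plus a F. edist x q)"
    unfolding ennreal_rdist[symmetric] by (rule INF_greatest) (use assms in \<open>auto simp: focal_plus_def ennreal_leI\<close>)
  moreover have "(INF q\<in>focal_plus a F. edist x q) \<le> edist x q"
    by (rule INF_lower) (simp add: focal_plus_def q)
  then have "(INF q\<in>focal_plus a F. edist x q) < top" using edist_finite[OF conn, of x q] by (rule order_le_less_trans)
  ultimately have "enn2real (ennreal r) \<le> enn2real (INF q\<in>focal_plus a F. edist x q)" by (rule enn2real_mono)
  then show ?thesis using assms(2) by (simp add: focal_rho_def riemannian_setdist_def)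
qed

text \<open>The gradient of \<open>R \<circ> F\<close> has norm one, so a short step against it decreases \<open>R \<circ> F\<close> by almost the
  length of the step.\<close>

lemma descent:
  assumes y: "F y \<in> {a<..<b}" and c: "0 < c" "c < 1"
  obtains z where "R (F z) + c * rdist y z < R (F y)"
proof -
  let ?d = "chart_at M y"
  let ?Y = "snd ?d y" and ?G = "gram M ?d y"
  have pd: "posdef ?G" by (rule gram_posdef[OF chart_at])
  define g where "g = partials ?d F ?Y"
  define w where "w = matrix_inv ?G *v g"
  have Gw: "?G *v w = g" unfolding w_def by (rule posdef_inverse(2)[OF pd])
  have gw: "g \<bullet> w = A (F y)" using pairing_F[of y] by (simp add: pairing_def grad_pairing_def g_def w_def)
  define m where "m = sqrt (A (F y))"
  have m: "0 < m" "m\<^sup>2 = A (F y)" using A_pos[OF y] by (auto simp: m_def)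
  \<comment> \<open>Along the step \<open>- h w\<close> with \<open>w = \<nabla>F\<close> and \<open>m = |w|\<close> the derivative of \<open>R \<circ> F\<close> is \<open>- m\<close>, and the length is
    at most \<open>h K\<close> with \<open>K = m / e > m\<close>. The loss \<open>c h K = e m h\<close> is less than the gain, because \<open>e < 1\<close>.\<close>
  define e where "e = sqrt c"
  have e: "0 < e" "e < 1" "c = e * e" using c by (auto simp: e_def)
  define K where "K = m / e"
  have K: "0 < K" "m < K" "c * K = e * m" using m e by (auto simp: K_def field_simps)
  have open_image: "open (snd ?d ` fst ?d)" by (rule chart(2)[OF chart_at(1)])
  have Y: "?Y \<in> snd ?d ` fst ?d" using chart_at by blast
  define Q where "Q x = w \<bullet> (gram M ?d (chart_inv ?d x) *v w)" for x
  have "continuous_on (snd ?d ` fst ?d) Q"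
    unfolding Q_def[abs_def] quadratic_form_sum
    by (intro continuous_on_sum continuous_on_mult continuous_on_const gram_entry_continuous chart_at)
  then have "isCont Q ?Y" using continuous_on_eq_continuous_at[OF open_image] Y by blast
  moreover have "Q ?Y = m\<^sup>2" using Gw gw m chart(5)[OF chart_at] by (simp add: Q_def inner_commute)
  moreover have "m\<^sup>2 < K\<^sup>2" using m K by (intro power_strict_mono) auto
  ultimately have "\<forall>\<^sub>F x in nhds ?Y. Q x < K\<^sup>2"
    using order_tendstoD(2)[of Q "Q ?Y" "nhds ?Y" "K\<^sup>2"] unfolding isCont_def tendsto_at_iff_tendsto_nhds by simp
  then have "\<forall>\<^sub>F x in nhds ?Y. Q x < K\<^sup>2 \<and> x \<in> snd ?d ` fst ?d"
    using eventually_nhds_in_open[OF open_image Y] by (rule eventually_conj)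
  then obtain r where r: "0 < r" "\<And>x. dist x ?Y < r \<Longrightarrow> Q x < K\<^sup>2 \<and> x \<in> snd ?d ` fst ?d"
    unfolding eventually_nhds_metric by blast
  define l where "l h = ?Y - h *\<^sub>R w" for h :: real
  define \<phi> where "\<phi> h = R ((F \<circ> chart_inv ?d) (l h))" for h
  have "(\<phi> has_real_derivative - m) (at 0)"
  proof -
    have ld: "(l has_derivative (\<lambda>h. - (h *\<^sub>R w))) (at 0)"
      unfolding l_def[abs_def] by (auto intro!: derivative_eq_intros)
    let ?D = "frechet_derivative (F \<circ> chart_inv ?d) (at ?Y)"
    have fd: "(F \<circ> chart_inv ?d) differentiable (at ?Y)" by (rule C1_funD(2)[OF F_C1 chart_at])
    then have "((F \<circ> chart_inv ?d) has_derivative ?D) (at (l 0))" by (simp add: frechet_derivative_works l_def)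
    from has_derivative_compose[OF ld this]
    have "((\<lambda>h. (F \<circ> chart_inv ?d) (l h)) has_derivative (\<lambda>h. ?D (- (h *\<^sub>R w)))) (at 0)" .
    moreover have "?D v = g \<bullet> v" for v
      using frechet_derivative_axis_sum[OF fd, of v] by (simp add: g_def partials_def inner_vec_def mult.commute)
    then have "(\<lambda>h. ?D (- (h *\<^sub>R w))) = (*) (- m\<^sup>2)" using gw m by (simp add: fun_eq_iff)
    ultimately have Fd: "((\<lambda>h. (F \<circ> chart_inv ?d) (l h)) has_real_derivative - m\<^sup>2) (at 0)"
      by (simp only: has_field_derivative_def)
    have F0: "(F \<circ> chart_inv ?d) (l 0) = F y" using chart(5)[OF chart_at] by (simp add: l_def)
    have "(R has_real_derivative 1 / m) (at ((F \<circ> chart_inv ?d) (l 0)))"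
      unfolding F0 m_def by (rule R_deriv[OF y])
    from DERIV_chain2[OF this Fd]
    show ?thesis using m by (simp add: \<phi>_def[abs_def] power2_eq_square)
  qed
  then have "((\<lambda>h. (\<phi> h - \<phi> 0) / h) \<longlongrightarrow> - m) (at 0)" by (simp add: DERIV_def)
  moreover have "- m < - (e * m)" using e m by simp
  ultimately have "\<forall>\<^sub>F h in at 0. (\<phi> h - \<phi> 0) / h < - (e * m)" by (rule order_tendstoD(2))
  then obtain h0 where h0: "0 < h0" "\<And>h. h \<noteq> 0 \<Longrightarrow> dist h 0 < h0 \<Longrightarrow> (\<phi> h - \<phi> 0) / h < - (e * m)"
    unfolding eventually_at by blast
  define h where "h = min (h0 / 2) (r / (2 * (norm w + 1)))"
  have h: "0 < h" "h < h0" "h * norm w < r"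
  proof -
    have n: "0 < norm w + 1" by (simp add: add_nonneg_pos)
    show "0 < h" "h < h0" using h0(1) r(1) n by (auto simp: h_def)
    have "h * norm w \<le> h * (norm w + 1)" using \<open>0 < h\<close> by (intro mult_left_mono) auto
    also have "\<dots> \<le> r / (2 * (norm w + 1)) * (norm w + 1)" using n by (intro mult_right_mono) (auto simp: h_def)
    also have "\<dots> = r / 2" using n by (simp add: field_simps)
    finally show "h * norm w < r" using r(1) by simp
  qed
  let ?z = "chart_inv ?d (l h)"
  have seg: "dist x ?Y < r" if "x \<in> closed_segment ?Y (l h)" for x
  proof -
    have "closed_segment ?Y (l h) \<subseteq> ball ?Y r"
      by (rule closed_segment_subset) (use r(1) h in \<open>auto simp: l_def dist_norm\<close>)
    then show ?thesis using that by (auto simp: dist_commute)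
  qed
  have "edist (chart_inv ?d ?Y) ?z \<le> ennreal (h * K)"
  proof (rule edist_segment[OF chart_at(1)])
    show "closed_segment ?Y (l h) \<subseteq> snd ?d ` fst ?d" using seg r(2) by blast
    show "(l h - ?Y) \<bullet> (gram M ?d (chart_inv ?d x) *v (l h - ?Y)) \<le> (h * K)\<^sup>2" if x: "x \<in> closed_segment ?Y (l h)" for x
    proof -
      have "(l h - ?Y) \<bullet> (gram M ?d (chart_inv ?d x) *v (l h - ?Y)) = h\<^sup>2 * Q x"
      proof -
        have "gram M ?d (chart_inv ?d x) *v ((- h) *\<^sub>R w) = (- h) *\<^sub>R (gram M ?d (chart_inv ?d x) *v w)"
          by (rule linear_scale[OF matrix_vector_mul_linear])
        moreover have "l h - ?Y = (- h) *\<^sub>R w" by (simp add: l_def)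
        ultimately show ?thesis by (simp only: Q_def inner_scaleR_left inner_scaleR_right power2_eq_square)
      qed
      also have "\<dots> \<le> h\<^sup>2 * K\<^sup>2" using r(2)[OF seg[OF x]] by (intro mult_left_mono) auto
      finally show ?thesis by (simp add: power_mult_distrib)
    qed
  qed (use h K in simp)
  then have "rdist y ?z \<le> h * K"
    unfolding ennreal_rdist[symmetric] using h K chart(5)[OF chart_at] by (subst (asm) ennreal_le_iff) auto
  then have "c * rdist y ?z \<le> c * (h * K)" using c by (intro mult_left_mono) auto
  also have "\<dots> = h * (e * m)" using K(3) by (simp add: mult_ac)
  finally have 1: "c * rdist y ?z \<le> h * (e * m)" .
  have "(\<phi> h - \<phi> 0) / h < - (e * m)" using h h0(2)[of h] by simp
  then have "\<phi> h - \<phi> 0 < - (h * (e * m))" using h(1) by (simp add: pos_divide_less_eq mult.commute)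
  moreover have "\<phi> h = R (F ?z)" "\<phi> 0 = R (F y)" using chart(5)[OF chart_at] by (simp_all add: \<phi>_def l_def)
  ultimately show thesis using that[of ?z] 1 by linarith
qed

text \<open>A minimiser of \<open>R \<circ> F + c dist(x, -)\<close> lies on the focal set, since elsewhere \<open>R \<circ> F\<close>
  decreases faster than the distance term grows.\<close>

lemma near_focal_point:
  assumes x: "F x < b" and c: "0 < c" "c < 1"
  obtains q where "F q = a" "c * rdist x q \<le> R (F x)"
proof -
  let ?f = "\<lambda>y. c * rdist x y + R (F y)"
  have "continuous_on UNIV ?f"
    by (intro continuous_on_add continuous_on_mult continuous_on_const rdist_continuous
      continuous_on_compose2[OF R_cont C1_fun_continuous[OF F_C1]]) (use F_mem in auto)
  then obtain y where y: "\<And>z. ?f y \<le> ?f z"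
    using continuous_attains_inf[OF compact_M, of ?f] by auto
  have le: "?f y \<le> R (F x)" using y[of x] by simp
  have "F y \<noteq> b"
  proof
    assume "F y = b"
    moreover have "0 \<le> c * rdist x y" using c by simp
    ultimately have "R b \<le> R (F x)" using le by simp
    then show False using R_strict[of "F x" b] F_mem[of x] x by auto
  qed
  moreover have "F y \<notin> {a<..<b}"
  proof
    assume "F y \<in> {a<..<b}"
    then obtain z where z: "R (F z) + c * rdist y z < R (F y)" using c by (rule descent)
    have "c * rdist x z \<le> c * (rdist x y + rdist y z)" using c rdist_triangle by (intro mult_left_mono) auto
    then have "c * rdist x z \<le> c * rdist x y + c * rdist y z" by (simp add: distrib_left)
    then show False using z y[of z] by linarith
  qed
  ultimately have "F y = a" using F_mem[of y] by auto
  then show thesis using that[of y] le by simp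
qed

text \<open>If \<open>F\<close> were equal to \<open>b\<close> near \<open>x\<close>, its Laplacian there would be \<open>0\<close> instead of \<open>B b > 0\<close>.\<close>

lemma maximum_not_interior:
  assumes x: "F x = b" and U: "open U" "x \<in> U" shows "\<exists>z\<in>U. F z < b"
proof (rule ccontr)
  assume "\<not> (\<exists>z\<in>U. F z < b)"
  then have Fb: "F z = b" if "z \<in> U" for z using F_mem[of z] that by fastforce
  let ?d = "chart_at M x"
  let ?W = "snd ?d ` (fst ?d \<inter> U)"
  have oW: "open ?W" by (rule chart_image_open[OF chart_at(1) open_Int[OF chart(1)[OF chart_at(1)] U(1)]]) auto
  have inW: "snd ?d x \<in> ?W" using U chart_at by blast
  have cong0: "frechet_derivative k (at y) = (\<lambda>_. 0)" if "y \<in> ?W" "\<And>z. z \<in> ?W \<Longrightarrow> k z = k0" for k :: "real^'n \<Rightarrow> real" and y k0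
  proof -
    have "((\<lambda>_. k0) has_derivative (\<lambda>_. 0)) (at y)" by simp
    then have "(k has_derivative (\<lambda>_. 0)) (at y)"
      by (rule has_derivative_transform_within_open[OF _ oW that(1)]) (use that(2) in auto)
    then show ?thesis by (rule frechet_derivative_at[symmetric])
  qed
  have "partials ?d F y = 0" if y: "y \<in> ?W" for y
  proof -
    have "frechet_derivative (F \<circ> chart_inv ?d) (at y) = (\<lambda>_. 0)"
      by (rule cong0[OF y, of _ b]) (use Fb chart(5)[OF chart_at(1)] in auto)
    then show ?thesis by (simp add: partials_def vec_eq_iff)
  qed
  then have "density_at M ?d y * chart_gradient M ?d F (chart_inv ?d y) $ i = 0" if "y \<in> ?W" for y i
    using that chart(5)[OF chart_at(1)] by (auto simp: chart_gradient_eq)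
  then have "frechet_derivative (\<lambda>y. density_at M ?d y * chart_gradient M ?d F (chart_inv ?d y) $ i) (at (snd ?d x)) = (\<lambda>_. 0)" for i
    by (intro cong0[OF inW, of _ 0])
  then have "density_at M ?d (snd ?d x) * chart_laplacian ?d F (chart_inv ?d (snd ?d x)) = 0"
    using chart_at by (subst divergence_coordinates[OF chart_at(1)]) auto
  then have "laplacian M F x = 0"
    using density_pos[OF chart_at(1)[of x], of "snd ?d x"] chart(5)[OF chart_at[of x]] chart_at[of x]
    by (auto simp: laplacian_chart_at)
  then show False using lapF[of x] x B_endpoints by simp
qed

text \<open>The lower bound holds because \<open>R \<circ> F\<close> grows at most like the distance. For the upper bound let
  \<open>c\<close> tend to \<open>1\<close> in \<open>near_focal_point\<close>; a point of the other focal set is first approximated by points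
  where \<open>F < b\<close>.\<close>

theorem focal_rho_eq: "focal_rho M a F x = R (F x)"
proof (rule antisym)
  show "R (F x) \<le> focal_rho M a F x"
  proof (rule focal_rho_ge)
    show "R (F x) \<le> rdist x q" if "F q = a" for q using R_le_rdist[of x q] that by simp
  qed (rule R_nonneg[OF F_mem])
  have near: "c * focal_rho M a F x \<le> R (F x) + e" if c: "0 < c" "c < 1" and e: "0 < e" for c e
  proof -
    obtain z where z: "F z < b" "rdist x z < e" "F z \<le> F x"
    proof (cases "F x < b")
      case True
      then show thesis using that[of x] e by simp
    next
      case False
      then have x: "F x = b" using F_mem[of x] by auto
      obtain U where U: "open U" "x \<in> U" "\<And>q. q \<in> U \<Longrightarrow> rdist x q < e \<and> rdist q x < e" using rdist_near[OF e] by blast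
      then show thesis using maximum_not_interior[OF x U(1,2)] that x by fastforce
    qed
    obtain q where q: "F q = a" "c * rdist z q \<le> R (F z)" by (rule near_focal_point[OF z(1) c])
    have "focal_rho M a F x \<le> rdist x z + rdist z q"
      using focal_rho_le[OF q(1), of x] rdist_triangle[of x q z] by simp
    then have "c * focal_rho M a F x \<le> c * (rdist x z + rdist z q)" using c by (intro mult_left_mono) auto
    moreover have "c * rdist x z \<le> rdist x z" using c by (simp add: mult_left_le_one_le)
    moreover have "R (F z) \<le> R (F x)" using R_mono z(3) F_mem[of z] F_mem[of x] by auto
    ultimately show ?thesis using q(2) z(2) by (simp add: distrib_left)
  qed
  show "focal_rho M a F x \<le> R (F x)"
    by (rule field_le_mult_one_interval, rule field_le_epsilon, rule near)
qed

end

section \<open>Radial functions\<close>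

text \<open>The functions built from smooth functions and from \<open>D k \<circ> f\<close>, where \<open>D k\<close> is the
  \<open>k\<close>-th derivative of the outer function; this class is closed under partial derivatives.\<close>

inductive chain_algebra ::
  "(real^'n::finite) set \<Rightarrow> (nat \<Rightarrow> real \<Rightarrow> real) \<Rightarrow> (real^'n \<Rightarrow> real) \<Rightarrow> (real^'n \<Rightarrow> real) \<Rightarrow> bool"
  for U D f where
  smooth: "smooth_on U g \<Longrightarrow> chain_algebra U D f g"
| outer: "chain_algebra U D f (\<lambda>y. D k (f y))"
| add: "chain_algebra U D f g \<Longrightarrow> chain_algebra U D f h \<Longrightarrow> chain_algebra U D f (\<lambda>y. g y + h y)"
| mult: "chain_algebra U D f g \<Longrightarrow> chain_algebra U D f h \<Longrightarrow> chain_algebra U D f (\<lambda>y. g y * h y)"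
| cong: "chain_algebra U D f g \<Longrightarrow> (\<And>y. y \<in> U \<Longrightarrow> h y = g y) \<Longrightarrow> chain_algebra U D f h"

lemma chain_algebra_partial:
  assumes U: "open U" and f: "smooth_on U f" "f ` U \<subseteq> {a..b}"
    and D: "\<And>k s. s \<in> {a..b} \<Longrightarrow> (D k has_real_derivative D (Suc k) s) (at s within {a..b})"
    and g: "chain_algebra U D f g"
  shows "(\<forall>y\<in>U. g differentiable (at y)) \<and> chain_algebra U D f (\<lambda>y. frechet_derivative g (at y) (axis i 1))"
  using g
proof induction
  case (smooth g)
  then show ?case using smooth_on_differentiable smooth_on_partial chain_algebra.smooth by blast
next
  case (outer k)
  note c = C1_on_real_compose[OF smooth_on_C1[OF f(1)] f(2) U, of "D k" "D (Suc k)", OF D DERIV_continuous_on[OF D]]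
  have "chain_algebra U D f (\<lambda>y. D (Suc k) (f y) * frechet_derivative f (at y) (axis i 1))"
    by (intro chain_algebra.mult chain_algebra.outer chain_algebra.smooth smooth_on_partial f)
  then have "chain_algebra U D f (\<lambda>y. frechet_derivative (\<lambda>y. D k (f y)) (at y) (axis i 1))"
    by (rule chain_algebra.cong) (rule c(2))
  then show ?case using C1_on_differentiable[OF c(1)] by blast
next
  case (add g h)
  have e: "((\<lambda>y. g y + h y) has_derivative (\<lambda>v. frechet_derivative g (at y) v + frechet_derivative h (at y) v)) (at y)"
    if "y \<in> U" for y
    by (rule has_derivative_add) (use add.IH that in \<open>simp_all add: frechet_derivative_works\<close>)
  have "chain_algebra U D f (\<lambda>y. frechet_derivative (\<lambda>y. g y + h y) (at y) (axis i 1))"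
    by (rule chain_algebra.cong[OF chain_algebra.add[OF add.IH(1)[THEN conjunct2] add.IH(2)[THEN conjunct2]]])
       (simp add: frechet_derivative_at[OF e, symmetric])
  then show ?case using e differentiableI by blast
next
  case (mult g h)
  have e: "((\<lambda>y. g y * h y) has_derivative (\<lambda>v. g y * frechet_derivative h (at y) v + frechet_derivative g (at y) v * h y)) (at y)"
    if "y \<in> U" for y
    by (rule has_derivative_mult) (use mult.IH that in \<open>simp_all add: frechet_derivative_works\<close>)
  have "chain_algebra U D f (\<lambda>y. frechet_derivative (\<lambda>y. g y * h y) (at y) (axis i 1))"
    by (rule chain_algebra.cong[OF chain_algebra.add[OF chain_algebra.mult[OF mult.hyps(1) mult.IH(2)[THEN conjunct2]]
          chain_algebra.mult[OF mult.IH(1)[THEN conjunct2] mult.hyps(2)]]])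
       (simp add: frechet_derivative_at[OF e, symmetric])
  then show ?case using e differentiableI by blast
next
  case (cong g h)
  have "h differentiable (at y)" if y: "y \<in> U" for y
  proof -
    have "(g has_derivative frechet_derivative g (at y)) (at y)" using cong.IH y by (simp add: frechet_derivative_works)
    then have "(h has_derivative frechet_derivative g (at y)) (at y)"
      by (rule has_derivative_transform_within_open[OF _ U y]) (simp add: cong.hyps)
    then show ?thesis by (rule differentiableI)
  qed
  moreover have "chain_algebra U D f (\<lambda>y. frechet_derivative h (at y) (axis i 1))"
    by (rule chain_algebra.cong[OF cong.IH[THEN conjunct2]])
       (simp add: frechet_derivative_cong_open[OF U _ cong.hyps(2)])
  ultimately show ?case by blast
qed

text \<open>Near a point where \<open>f\<close> equals \<open>a\<close> or \<open>b\<close> the one-sided derivatives of \<open>u\<close> suffice, since \<open>f\<close> takes its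
  values in \<open>[a, b]\<close>.\<close>

lemma smooth_on_compose_interval:
  fixes f :: "real^'n::finite \<Rightarrow> real"
  assumes U: "open U" and f: "smooth_on U f" "f ` U \<subseteq> {a..b}" and u: "smooth_on_interval a b u"
  shows "smooth_on U (\<lambda>y. u (f y))"
proof -
  obtain D where D: "D 0 = u" "\<And>k s. s \<in> {a..b} \<Longrightarrow> (D k has_real_derivative D (Suc k) s) (at s within {a..b})"
    using u unfolding smooth_on_interval_def by blast
  note closed = chain_algebra_partial[where D = D, OF U f D(2)]
  have "chain_algebra U D f (iter_partial js (\<lambda>y. D 0 (f y)))" for js
  proof (induction js)
    case Nil
    show ?case unfolding iter_partial.simps by (rule chain_algebra.outer)
  next
    case (Cons i js)
    show ?case unfolding iter_partial.simps by (rule closed[THEN conjunct2, OF _ Cons]) assumption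
  qed
  then have "\<forall>y\<in>U. iter_partial js (\<lambda>y. D 0 (f y)) differentiable (at y)" for js
    by (rule closed[THEN conjunct1, rotated]) assumption
  then show ?thesis by (simp add: smooth_on_def D(1))
qed

context isoparametric_manifold
begin

lemma smooth_fun_compose:
  assumes "smooth_on_interval a b u" shows "smooth_fun M (\<lambda>q. u (F q))"
  unfolding smooth_fun_def
proof
  fix c assume c: "c \<in> atlas M"
  have "smooth_on (snd c ` fst c) (F \<circ> chart_inv c)" using smF c unfolding smooth_fun_def by blast
  then have "smooth_on (snd c ` fst c) (\<lambda>y. u ((F \<circ> chart_inv c) y))"
    by (rule smooth_on_compose_interval[OF chart(2)[OF c] _ _ assms]) (use F_mem in auto)
  then show "smooth_on (snd c ` fst c) ((\<lambda>q. u (F q)) \<circ> chart_inv c)" by (simp add: o_def)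
qed

text \<open>In coordinates the weighted gradient of \<open>u \<circ> F\<close> is \<open>p \<circ> F\<close> times that of \<open>F\<close>. Its divergence consists
  of \<open>p \<circ> F\<close> times the Laplacian of \<open>F\<close> and of the pairing of \<open>F\<close> with itself.\<close>

lemma laplacian_compose:
  assumes u: "\<And>s. s \<in> {a..b} \<Longrightarrow> (u has_real_derivative p s) (at s within {a..b})"
    and p: "\<And>s. s \<in> {a..b} \<Longrightarrow> (p has_real_derivative q s) (at s within {a..b})" and q: "continuous_on {a..b} q"
  shows "laplacian M (\<lambda>x. u (F x)) x = p (F x) * B (F x) - q (F x) * A (F x)"
proof -
  let ?c = "chart_at M x"
  let ?f = "F \<circ> chart_inv ?c" and ?Y = "snd ?c x" and ?W = "snd ?c ` fst ?c"
  note c = chart_at[of x]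
  have oW: "open ?W" by (rule chart(2)[OF c(1)])
  have Y: "?Y \<in> ?W" using c by blast
  have sub: "?f ` ?W \<subseteq> {a..b}" using F_mem by auto
  note fC = C1_funD(1)[OF F_C1 c(1)]
  have uf: "frechet_derivative (\<lambda>y. u (?f y)) (at y) v = p (?f y) * frechet_derivative ?f (at y) v" if "y \<in> ?W" for y v
    by (rule C1_on_real_compose(2)[OF fC sub oW u DERIV_continuous_on[OF p] that])
  have pf: "C1_on ?W (\<lambda>y. p (?f y))" by (rule C1_on_real_compose(1)[OF fC sub oW p q])
  have pf': "frechet_derivative (\<lambda>y. p (?f y)) (at ?Y) v = q (?f ?Y) * frechet_derivative ?f (at ?Y) v" for v
    by (rule C1_on_real_compose(2)[OF fC sub oW p q Y])
  define w where "w i y = density_at M ?c y * chart_gradient M ?c F (chart_inv ?c y) $ i" for i y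
  have wC: "C1_on ?W (w i)" for i unfolding w_def[abs_def] by (rule weighted_gradient_C1[OF smF c(1)])
  have pu: "partials ?c (\<lambda>x. u (F x)) y = p (?f y) *\<^sub>R partials ?c F y" if y: "y \<in> ?W" for y
    using uf[OF y] by (simp add: partials_def vec_eq_iff o_def)
  have wu: "density_at M ?c y * chart_gradient M ?c (\<lambda>x. u (F x)) (chart_inv ?c y) $ i = p (?f y) * w i y" if y: "y \<in> ?W" for y i
    using chart(6)[OF c(1) y]
    by (simp add: chart_gradient_eq pu[OF y] w_def linear_scale[OF matrix_vector_mul_linear])
  have d: "frechet_derivative (\<lambda>y. density_at M ?c y * chart_gradient M ?c (\<lambda>x. u (F x)) (chart_inv ?c y) $ i) (at ?Y) (axis i 1)
      = p (F x) * frechet_derivative (w i) (at ?Y) (axis i 1) + q (F x) * (partials ?c F ?Y $ i * w i ?Y)" for i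
  proof -
    have dp: "((\<lambda>y. p (?f y)) has_derivative frechet_derivative (\<lambda>y. p (?f y)) (at ?Y)) (at ?Y)"
      using C1_on_differentiable[OF pf Y] by (simp add: frechet_derivative_works)
    have dw: "(w i has_derivative frechet_derivative (w i) (at ?Y)) (at ?Y)"
      using C1_on_differentiable[OF wC Y] by (simp add: frechet_derivative_works)
    have "frechet_derivative (\<lambda>y. density_at M ?c y * chart_gradient M ?c (\<lambda>x. u (F x)) (chart_inv ?c y) $ i) (at ?Y)
        = frechet_derivative (\<lambda>y. p (?f y) * w i y) (at ?Y)"
      by (rule frechet_derivative_cong_open[OF oW Y wu])
    also have "\<dots> = (\<lambda>v. p (?f ?Y) * frechet_derivative (w i) (at ?Y) v + frechet_derivative (\<lambda>y. p (?f y)) (at ?Y) v * w i ?Y)"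
      by (rule frechet_derivative_at[OF has_derivative_mult[OF dp dw], symmetric])
    finally show ?thesis using pf'[of "axis i 1"] chart(5)[OF c] by (simp add: partials_def mult.assoc)
  qed
  have dw: "(\<Sum>i\<in>UNIV. frechet_derivative (w i) (at ?Y) (axis i 1)) = - (density_at M ?c ?Y * B (F x))"
    using divergence_coordinates[OF c(1) Y, of F] chart(5)[OF c] lapF[of x]
    by (simp add: w_def[abs_def] laplacian_chart_at)
  have pw: "(\<Sum>i\<in>UNIV. partials ?c F ?Y $ i * w i ?Y) = density_at M ?c ?Y * A (F x)"
    using pairing_F[of x] chart(5)[OF c]
    by (simp add: pairing_def grad_pairing_def w_def chart_gradient_eq inner_vec_def sum_distrib_left mult_ac flip: pairing_F)
  have "density_at M ?c ?Y * laplacian M (\<lambda>x. u (F x)) x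
      = - (\<Sum>i\<in>UNIV. p (F x) * frechet_derivative (w i) (at ?Y) (axis i 1) + q (F x) * (partials ?c F ?Y $ i * w i ?Y))"
    using divergence_coordinates[OF c(1) Y, of "\<lambda>x. u (F x)"] chart(5)[OF c] by (simp add: d laplacian_chart_at)
  also have "\<dots> = density_at M ?c ?Y * (p (F x) * B (F x) - q (F x) * A (F x))"
    unfolding sum.distrib sum_distrib_left[symmetric] dw pw by (simp add: algebra_simps)
  finally show ?thesis using density_pos[OF c(1) Y] by simp
qed

text \<open>A smooth solution \<open>u\<close> of the homogeneous equation gives the eigenfunction \<open>u \<circ> F\<close>. It is radial
  because \<open>R\<close> is injective, so that \<open>F\<close> is a function of the distance from the focal set.\<close>

lemma radial_eigenvalue:
  assumes u: "\<And>n. Ck n a b u" and s: "solves a b A B \<kappa> (\<lambda>_. 0) u p q" and nz: "s0 \<in> {a..b}" "u s0 \<noteq> 0"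
  shows "\<kappa> \<in> radial_spectrum M a F"
proof -
  have p: "Ck n a b p" for n by (rule Ck_derivD[OF u ab solvesD(1)[OF s]])
  have q: "continuous_on {a..b} q" using Ck_derivD[OF p ab solvesD(2)[OF s], of 0] by simp
  obtain x0 where "F x0 = s0" using level_point[OF nz(1)] by blast
  moreover have "laplacian M (\<lambda>x. u (F x)) x = \<kappa> * u (F x)" for x
    using laplacian_compose[OF solvesD(1)[OF s] solvesD(2)[OF s] q, of x] solvesD(3)[OF s F_mem[of x]]
    by (simp add: mult.commute algebra_simps)
  ultimately have e: "eigenfunction M \<kappa> (\<lambda>x. u (F x))"
    unfolding eigenfunction_def using smooth_fun_compose[OF smooth_on_intervalI[OF u ab]] nz(2) by auto
  have inj: "inj_on R {a..b}"
  proof (rule inj_onI)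
    fix s t assume "s \<in> {a..b}" "t \<in> {a..b}" "R s = R t"
    then show "s = t" using R_strict[of s t] R_strict[of t s] by (cases s t rule: linorder_cases) auto
  qed
  have "(\<lambda>x. u (F x)) = (\<lambda>r. u (inv_into {a..b} R r)) \<circ> focal_rho M a F"
    by (simp add: fun_eq_iff focal_rho_eq inv_into_f_f[OF inj F_mem])
  then have "radial_fun M a F (\<lambda>x. u (F x))" unfolding radial_fun_def by blast
  then show ?thesis using e unfolding radial_spectrum_def spectrum_def by blast
qed

end

section \<open>Eigenfunctions with a nonradial eigenvalue\<close>

lemma real_polynomial_Ck: "real_polynomial_function g \<Longrightarrow> Ck n a b g" for g :: "real \<Rightarrow> real"
proof (induction rule: real_polynomial_function.induct)
  case (linear g)
  then have eq: "x * g 1 = g x" for x using linear_scale[OF bounded_linear.linear, of g x 1] by simp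
  show ?case by (rule Ck_cong[OF eq Ck_mult[OF Ck_ident Ck_const]])
next
  case (const c) show ?case by (rule Ck_const)
next
  case (add f g) from add.IH show ?case by (rule Ck_add)
next
  case (mult f g) from mult.IH show ?case by (rule Ck_mult)
qed

context isoparametric_manifold
begin

context
  fixes \<kappa> f h
  assumes f: "eigenfunction M \<kappa> f" and nr: "\<kappa> \<notin> radial_spectrum M a F" and h: "riemannian_isometry M h"
begin

text \<open>The isoparametric function of the foliation that is moved by \<open>h\<close>; the moved tubes are its sublevel
  sets.\<close>

definition G where "G = F \<circ> inv h"

lemma f_smooth: "smooth_fun M f" and f_lap: "laplacian M f x = \<kappa> * f x"
  using f by (auto simp: eigenfunction_def)

lemma f_C1: "C1_fun f" by (rule smooth_fun_C1[OF f_smooth])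
lemma f_cont: "continuous_on UNIV f" by (rule C1_fun_continuous[OF f_C1])

lemma G_h: "G (h x) = F x" "G \<circ> h = F"
  using h by (auto simp: G_def riemannian_isometry_def bij_is_inj)

lemma G_C1: "C1_fun G"
  unfolding G_def by (rule C1_fun_smooth_map[OF _ F_C1]) (use h in \<open>simp add: riemannian_isometry_def\<close>)

lemma G_mem: "G x \<in> {a..b}" by (simp only: G_def o_def F_mem)

lemma pairing_G: "pairing G G x = A (G x)"
proof -
  have x: "h (inv h x) = x" using h by (simp add: riemannian_isometry_def bij_is_surj surj_f_inv_f)
  have "pairing G G (h (inv h x)) = pairing F F (inv h x)"
    using pairing_isometry[OF h G_C1 G_C1, of "inv h x"] G_h by simp
  then show ?thesis unfolding x pairing_F by (simp add: G_def)
qed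

lemma integral_isometry:
  assumes "continuous_on UNIV (g :: 'a \<Rightarrow> real)" shows "(LINT x|vol. g x) = (LINT x|vol. g (h x))"
proof -
  have hm: "h \<in> borel_measurable vol"
    using h by (simp add: riemannian_isometry_def smooth_map_def borel_measurable_continuous_onI cong: measurable_cong_sets)
  have gm: "g \<in> borel_measurable borel" using assms by (rule borel_measurable_continuous_onI)
  have "(LINT x|vol. g x) = (LINT x|distr vol borel h. g x)" by (simp only: distr_isometry[OF h])
  also have "\<dots> = (LINT x|vol. g (h x))" by (rule integral_distr[OF hm gm])
  finally show ?thesis .
qed

text \<open>The weak form of \<open>\<Delta> G = B \<circ> G\<close>. It is transported from \<open>F\<close> by the invariance of the measure and of
  the pairing of gradients; second derivatives do not occur.\<close>

lemma weak_laplacian_G: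
  assumes "C1_fun \<phi>" shows "(LINT x|vol. pairing \<phi> G x) = (LINT x|vol. \<phi> x * B (G x))"
proof -
  have hs: "smooth_map M h" using h by (simp add: riemannian_isometry_def)
  have BG: "continuous_on UNIV (\<lambda>x. B (G x))"
    by (rule continuous_on_compose2[OF B_cont C1_fun_continuous[OF G_C1]]) (use G_mem in auto)
  have "(LINT x|vol. pairing \<phi> G x) = (LINT x|vol. pairing \<phi> G (h x))"
    by (rule integral_isometry[OF pairing_continuous[OF assms G_C1]])
  also have "\<dots> = (LINT x|vol. pairing (\<phi> \<circ> h) F x)"
    using pairing_isometry[OF h assms G_C1] G_h by simp
  also have "\<dots> = (LINT x|vol. \<phi> (h x) * B (G (h x)))"
    using Green[OF smF C1_fun_smooth_map[OF hs assms]] by (simp add: lapF G_h)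
  also have "\<dots> = (LINT x|vol. \<phi> x * B (G x))"
    by (rule integral_isometry[symmetric]) (intro continuous_on_mult C1_fun_continuous[OF assms] BG)
  finally show ?thesis .
qed

text \<open>The identity \<open>\<integral> (\<kappa> - \<Delta>)(\<psi> \<circ> G) f = \<integral> (\<psi> \<circ> G) (\<kappa> - \<Delta>) f = 0\<close>, obtained by comparing two
  expressions for the integral of the pairing of \<open>\<psi> \<circ> G\<close> with \<open>f\<close>.\<close>

lemma integral_solvable_zero:
  assumes sol: "solves a b A B \<kappa> \<eta> \<psi> p q" and C: "\<And>n. Ck n a b \<psi>"
  shows "(LINT x|vol. \<eta> (G x) * f x) = 0"
proof -
  note D\<psi> = solvesD(1)[OF sol] and Dp = solvesD(2)[OF sol]
  have Cp: "Ck n a b p" for n by (rule Ck_derivD[OF C ab D\<psi>])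
  have cp: "continuous_on {a..b} p" using Cp[of 0] by simp
  have cq: "continuous_on {a..b} q" using Ck_derivD[OF Cp ab Dp, of 0] by simp
  have c\<psi>: "continuous_on {a..b} \<psi>" using C[of 0] by simp
  have comp: "continuous_on UNIV (\<lambda>x. k (G x))" if "continuous_on {a..b} k" for k :: "real \<Rightarrow> real"
    by (rule continuous_on_compose2[OF that C1_fun_continuous[OF G_C1]]) (use G_mem in auto)
  have rG: "range G \<subseteq> {a..b}" using G_mem by blast
  note \<psi>G = C1_fun_compose[where h = \<psi> and h' = p, OF G_C1 rG D\<psi> cp]
  note pG = C1_fun_compose[where h = p and h' = q, OF G_C1 rG Dp cq]
  have i: "integrable vol (\<lambda>x. \<psi> (G x) * f x)" "integrable vol (\<lambda>x. q (G x) * A (G x) * f x)"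
      "integrable vol (\<lambda>x. p (G x) * pairing G f x)" "integrable vol (\<lambda>x. p (G x) * B (G x) * f x)"
    by (intro continuous_integrable continuous_on_mult comp c\<psi> cp cq A_cont B_cont f_cont pairing_continuous G_C1 f_C1)+
  have 1: "\<kappa> * (LINT x|vol. \<psi> (G x) * f x) = (LINT x|vol. p (G x) * pairing G f x)"
  proof -
    have "(LINT x|vol. p (G x) * pairing G f x) = (LINT x|vol. pairing (\<lambda>x. \<psi> (G x)) f x)"
      by (rule Bochner_Integration.integral_cong[OF refl]) (rule \<psi>G(2)[symmetric])
    also have "\<dots> = (LINT x|vol. \<psi> (G x) * laplacian M f x)" by (rule Green[OF f_smooth \<psi>G(1)])
    also have "\<dots> = (LINT x|vol. \<kappa> * (\<psi> (G x) * f x))" by (simp add: f_lap mult_ac)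
    finally show ?thesis by simp
  qed
  have 2: "(LINT x|vol. q (G x) * A (G x) * f x) + (LINT x|vol. p (G x) * pairing G f x) = (LINT x|vol. p (G x) * B (G x) * f x)"
  proof -
    have e: "pairing (\<lambda>x. p (G x) * f x) G x = q (G x) * A (G x) * f x + p (G x) * pairing G f x" for x
    proof -
      have "pairing (\<lambda>x. p (G x)) G x = q (G x) * A (G x)" using pG(2)[of G x] pairing_G by simp
      then show ?thesis using pairing_mult[OF pG(1) f_C1, of G x] pairing_sym[of f G x] by (simp add: mult_ac)
    qed
    have "(LINT x|vol. pairing (\<lambda>x. p (G x) * f x) G x) = (LINT x|vol. p (G x) * f x * B (G x))"
      by (rule weak_laplacian_G[OF C1_fun_mult[OF pG(1) f_C1]])
    then have "(LINT x|vol. (q (G x) * A (G x) * f x + p (G x) * pairing G f x)) = (LINT x|vol. p (G x) * f x * B (G x))"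
      by (simp only: e)
    then show ?thesis using i by (simp add: mult_ac)
  qed
  have "\<eta> (G x) * f x = q (G x) * A (G x) * f x - p (G x) * B (G x) * f x + \<kappa> * (\<psi> (G x) * f x)" for x
  proof -
    have e: "\<eta> (G x) = A (G x) * q (G x) - B (G x) * p (G x) + \<kappa> * \<psi> (G x)" using solvesD(3)[OF sol G_mem[of x]] by simp
    show ?thesis unfolding e by (simp add: algebra_simps)
  qed
  then have "(LINT x|vol. \<eta> (G x) * f x)
      = (LINT x|vol. (q (G x) * A (G x) * f x - p (G x) * B (G x) * f x + \<kappa> * (\<psi> (G x) * f x)))" by simp
  also have "\<dots> = (LINT x|vol. q (G x) * A (G x) * f x) - (LINT x|vol. p (G x) * B (G x) * f x) + \<kappa> * (LINT x|vol. \<psi> (G x) * f x)"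
    using i by simp
  finally show ?thesis using 1 2 by simp
qed

text \<open>Since \<open>\<kappa>\<close> is not radial, the homogeneous equation has no nonzero smooth solution, so every smooth
  right-hand side is attained.\<close>

lemma integral_smooth_zero:
  assumes "\<And>n. Ck n a b \<eta>" shows "(LINT x|vol. \<eta> (G x) * f x) = 0"
proof -
  have m: "a \<in> {a..b}" "b \<in> {a..b}" using ab by auto
  show ?thesis
  proof (rule singular_boundary_problem[where A = A and B = B and \<kappa> = \<kappa> and \<eta> = \<eta>, OF ab CkA CkB assms A_endpoints A_pos
        A'[OF m(1)] A'_endpoints(1) A'[OF m(2)] A'_endpoints(2) B_endpoints])
    fix u p q assume u: "\<forall>n. Ck n a b u" "solves a b A B \<kappa> (\<lambda>_. 0) u p q"
    show "\<forall>x\<in>{a..b}. u x = 0"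
    proof (rule ccontr)
      assume "\<not> (\<forall>x\<in>{a..b}. u x = 0)"
      then obtain s where "s \<in> {a..b}" "u s \<noteq> 0" by blast
      then have "\<kappa> \<in> radial_spectrum M a F" by (rule radial_eigenvalue[OF u(1)[rule_format] u(2)])
      then show False using nr by simp
    qed
  next
    fix \<psi> p q assume "\<And>n. Ck n a b \<psi>" "solves a b A B \<kappa> \<eta> \<psi> p q"
    then show ?thesis by (intro integral_solvable_zero)
  qed
qed

text \<open>By Weierstrass' theorem \<open>\<eta>\<close> is a uniform limit of polynomials.\<close>

lemma integral_continuous_zero:
  assumes \<eta>: "continuous_on {a..b} \<eta>" shows "(LINT x|vol. \<eta> (G x) * f x) = 0"
proof -
  have comp: "continuous_on UNIV (\<lambda>x. k (G x) * f x)" if "continuous_on {a..b} k" for k :: "real \<Rightarrow> real"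
    by (intro continuous_on_mult f_cont continuous_on_compose2[OF that C1_fun_continuous[OF G_C1]]) (use G_mem in auto)
  define I where "I = (LINT x|vol. \<bar>f x\<bar>)"
  have I: "0 \<le> I" by (simp add: I_def)
  have fi: "integrable vol (\<lambda>x. \<bar>f x\<bar>)" by (intro integrable_abs continuous_integrable f_cont)
  have "\<bar>LINT x|vol. \<eta> (G x) * f x\<bar> \<le> 0 + e" if e: "0 < e" for e
  proof -
    define d where "d = e / (I + 1)"
    have d: "0 < d" using e I by (simp add: d_def)
    obtain g where g: "real_polynomial_function g" "\<And>s. s \<in> {a..b} \<Longrightarrow> \<bar>\<eta> s - g s\<bar> < d"
      using Stone_Weierstrass_real_polynomial_function[OF compact_Icc \<eta> d] by blast
    have gC: "Ck n a b g" for n by (rule real_polynomial_Ck[OF g(1)])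
    have gc: "continuous_on {a..b} g" using gC[of 0] by simp
    have ie: "integrable vol (\<lambda>x. \<eta> (G x) * f x)" "integrable vol (\<lambda>x. g (G x) * f x)"
      by (intro continuous_integrable comp \<eta> gc)+
    then have "(LINT x|vol. \<eta> (G x) * f x) = (LINT x|vol. (\<eta> (G x) * f x - g (G x) * f x))"
      using integral_smooth_zero[OF gC] by simp
    also have "\<bar>\<dots>\<bar> \<le> (LINT x|vol. \<bar>\<eta> (G x) * f x - g (G x) * f x\<bar>)" by (rule integral_abs_bound)
    also have "\<dots> \<le> (LINT x|vol. d * \<bar>f x\<bar>)"
    proof (rule integral_mono)
      fix x
      have "\<bar>\<eta> (G x) * f x - g (G x) * f x\<bar> = \<bar>\<eta> (G x) - g (G x)\<bar> * \<bar>f x\<bar>"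
        by (simp add: abs_mult[symmetric] left_diff_distrib)
      also have "\<dots> \<le> d * \<bar>f x\<bar>" using g(2)[OF G_mem[of x]] by (intro mult_right_mono) auto
      finally show "\<bar>\<eta> (G x) * f x - g (G x) * f x\<bar> \<le> d * \<bar>f x\<bar>" .
    qed (use ie fi in \<open>auto intro!: integrable_abs\<close>)
    also have "\<dots> = d * I" by (simp add: I_def)
    also have "\<dots> \<le> d * (I + 1)" using d by (intro mult_left_mono) auto
    also have "\<dots> = e" using I by (simp add: d_def)
    finally show ?thesis by simp
  qed
  then have "\<bar>LINT x|vol. \<eta> (G x) * f x\<bar> \<le> 0" by (rule field_le_epsilon)
  then show ?thesis by simp
qed

text \<open>The moved tube is the set where \<open>R \<circ> G < t\<close>; its indicator function is a bounded pointwise limit of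
  continuous functions of \<open>G\<close>.\<close>

lemma tube_integral_zero:
  "(LINT x:h ` isoparametric_tube M a F t|vol. f x) = 0"
proof -
  have bij: "bij h" using h by (simp add: riemannian_isometry_def)
  have tube: "x \<in> h ` isoparametric_tube M a F t \<longleftrightarrow> R (G x) < t" for x
  proof
    assume "x \<in> h ` isoparametric_tube M a F t"
    then obtain y where y: "x = h y" "R (F y) < t" by (auto simp: isoparametric_tube_def focal_rho_eq)
    then show "R (G x) < t" by (simp add: G_h)
  next
    assume *: "R (G x) < t"
    have x: "x = h (inv h x)" using bij by (simp add: bij_is_surj surj_f_inv_f)
    moreover have "inv h x \<in> isoparametric_tube M a F t" using * by (simp add: isoparametric_tube_def focal_rho_eq G_def)
    ultimately show "x \<in> h ` isoparametric_tube M a F t" by blast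
  qed
  define \<eta> where "\<eta> n s = min 1 (real n * max 0 (t - R s))" for n s
  have c\<eta>: "continuous_on {a..b} (\<eta> n)" for n
    unfolding \<eta>_def[abs_def] by (intro continuous_on_min continuous_on_mult continuous_on_max continuous_on_const continuous_on_diff R_cont)
  have lim: "(\<lambda>n. \<eta> n s) \<longlonglongrightarrow> (if R s < t then 1 else 0)" for s
  proof (cases "R s < t")
    case True
    obtain N where N: "1 / (t - R s) < real N" using reals_Archimedean2 by blast
    have "\<eta> n s = 1" if "N \<le> n" for n
    proof -
      have "1 / (t - R s) < real n" using N that by linarith
      then show ?thesis using True by (simp add: \<eta>_def field_simps)
    qed
    then have "eventually (\<lambda>n. \<eta> n s = 1) sequentially" by (auto simp: eventually_sequentially)
    then show ?thesis using True by (simp add: tendsto_eventually)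
  qed (simp add: \<eta>_def)
  have "(\<lambda>n. LINT x|vol. \<eta> n (G x) * f x) \<longlonglongrightarrow> (LINT x|vol. indicator (h ` isoparametric_tube M a F t) x *\<^sub>R f x)"
  proof (rule integral_dominated_convergence[where w = "\<lambda>x. \<bar>f x\<bar>"])
    have cG: "continuous_on UNIV G" by (rule C1_fun_continuous[OF G_C1])
    have cRG: "continuous_on UNIV (\<lambda>x. R (G x))" by (rule continuous_on_compose2[OF R_cont cG]) (use G_mem in auto)
    have fm: "f \<in> borel_measurable borel" by (rule borel_measurable_continuous_onI[OF f_cont])
    have "h ` isoparametric_tube M a F t = (\<lambda>x. R (G x)) -` {..<t}" using tube by auto
    then have "open (h ` isoparametric_tube M a F t)" using cRG by (simp add: open_vimage)
    then have "h ` isoparametric_tube M a F t \<in> sets borel" by simp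
    then show "(\<lambda>x. indicator (h ` isoparametric_tube M a F t) x *\<^sub>R f x) \<in> borel_measurable vol"
      using fm by (simp cong: measurable_cong_sets)
    show "(\<lambda>x. \<eta> n (G x) * f x) \<in> borel_measurable vol" for n
    proof -
      have "continuous_on UNIV (\<lambda>x. \<eta> n (G x))" by (rule continuous_on_compose2[OF c\<eta> cG]) (use G_mem in auto)
      then have "integrable vol (\<lambda>x. \<eta> n (G x) * f x)" by (intro continuous_integrable continuous_on_mult f_cont)
      then show ?thesis by (rule borel_measurable_integrable)
    qed
    show "integrable vol (\<lambda>x. \<bar>f x\<bar>)" by (intro integrable_abs continuous_integrable f_cont)
    show "AE x in vol. (\<lambda>n. \<eta> n (G x) * f x) \<longlonglongrightarrow> indicator (h ` isoparametric_tube M a F t) x *\<^sub>R f x"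
    proof (intro AE_I2)
      fix x
      have "indicator (h ` isoparametric_tube M a F t) x = (if R (G x) < t then 1 else 0 :: real)"
        using tube[of x] by (simp add: indicator_def)
      then show "(\<lambda>n. \<eta> n (G x) * f x) \<longlonglongrightarrow> indicator (h ` isoparametric_tube M a F t) x *\<^sub>R f x"
        using tendsto_mult[OF lim[of "G x"] tendsto_const[of "f x"]] by simp
    qed
    show "AE x in vol. norm (\<eta> n (G x) * f x) \<le> \<bar>f x\<bar>" for n
    proof (intro AE_I2)
      fix x
      have "0 \<le> \<eta> n (G x)" "\<eta> n (G x) \<le> 1" by (simp_all add: \<eta>_def)
      then show "norm (\<eta> n (G x) * f x) \<le> \<bar>f x\<bar>" by (simp add: abs_mult mult_left_le_one_le)
    qed
  qed
  moreover have "(LINT x|vol. \<eta> n (G x) * f x) = 0" for n by (rule integral_continuous_zero[OF c\<eta>])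
  ultimately show ?thesis unfolding set_lebesgue_integral_def by (simp add: LIMSEQ_const_iff)
qed

end

end

theorem theorem2:
  fixes M :: "('a::{t2_space, second_countable_topology}, 'n::finite) riemannian"
    and F :: "'a \<Rightarrow> real" and a b t :: real
  assumes "riemannian_manifold M"
    and "compact (UNIV :: 'a set)" and "connected (UNIV :: 'a set)"
    and "proper_isoparametric M a b F"
    and "radial_spectrum M a F \<subset> spectrum M"
    and "0 < t" and "t < focal_distance M a b F"
  shows "\<not> pompeiu M (isoparametric_tube M a F t)"
proof -
  obtain A B where AB: "a < b" "smooth_fun M F" "range F = {a..b}" "smooth_on_interval a b A" "smooth_on_interval a b B"
    "\<And>p. grad_norm_sq M F p = A (F p)" "\<And>p. laplacian M F p = B (F p)"
    using assms(4) unfolding proper_isoparametric_def isoparametric_def by blast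
  interpret isoparametric_manifold M F a b A B
    by unfold_locales (fact assms AB)+
  obtain \<kappa> f where f: "eigenfunction M \<kappa> f" and nr: "\<kappa> \<notin> radial_spectrum M a F"
    using assms(5) unfolding spectrum_def by blast
  have "\<forall>h. riemannian_isometry M h \<longrightarrow> (LINT x:h ` isoparametric_tube M a F t|vol. f x) = 0"
    using tube_integral_zero[OF f nr] by blast
  moreover have "continuous_on UNIV f"
    using f unfolding eigenfunction_def by (intro C1_fun_continuous smooth_fun_C1) blast
  moreover have "\<exists>x. f x \<noteq> 0" using f by (simp add: eigenfunction_def)
  ultimately show ?thesis unfolding pompeiu_def by blast
qed

end
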